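(* Let $d\geq 1$ be an integer and let $0<s<d$. For every integer $N\geq 1$, the supremum defining $\Lambda_N(s,d)$ is attained, i.e. there exists $\rho\in\mathcal A_N$ with $\mathcal G_N(\rho)/\mathcal L(\rho)=\Lambda_N(s,d)$. Moreover, $$0<\Lambda_1(s,d)<\Lambda_2(s,d)<\Lambda_3(s,d)<\cdots .$$ Consequently, for every $N\ge 1$, every fixed-$N$ optimizer (every $\rho\in\mathcal A_N$ with $\mathcal G_N(\rho)/\mathcal L(\rho)=\Lambda_N(s,d)$) is compactly supported.
   Context: Set $p:=1+s/d$. For $N\in\mathbb N$, $N\ge1$, let $$\mathcal A_N:=\Big\{\rho\in L^1(\mathbb R^d)\cap L^p(\mathbb R^d):\ \rho\ge 0,\ \int_{\mathbb R^d}\rho=N\Big\}.$$ For a symmetric probability measure $P$ on $(\mathbb R^d)^N$ (symmetric means invariant under permutations of the $N$ coordinates in $\mathbb R^d$), its one-body measure is $\rho_P:=\sum_{i=1}^N(\pi_i)_\#P$, where $\pi_i$ is the $i$-th coordinate projection; when it is absolutely continuous it is identified with its density. For $\rho\in\mathcal A_N$ define $$\mathcal W_N(\rho):=\min\Big\{\int_{(\mathbb R^d)^N}\sum_{1\le i<j\le N}\frac{1}{|x_i-x_j|^s}\,\mathrm dP:\ P \text{ a symmetric probability measure on }(\mathbb R^d)^N,\ \rho_P=\rho\Big\}$$ (so $\mathcal W_1=0$), and $$D(\rho):=\iint_{\mathbb R^d\times\mathbb R^d}\frac{\rho(x)\rho(y)}{|x-y|^s}\,\mathrm dx\,\mathrm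 dy,\qquad \mathcal G_N(\rho):=\tfrac12D(\rho)-\mathcal W_N(\rho),\qquad \mathcal L(\rho):=\int_{\mathbb R^d}\rho^p .$$ The sharp fixed-particle-number Lieb–Oxford constant is $$\Lambda_N(s,d):=\sup_{\rho\in\mathcal A_N}\frac{\mathcal G_N(\rho)}{\mathcal L(\rho)}.$$ *)

theory Defs
  imports "HOL-Probability.Probability" "HOL-Combinatorics.Permutations"
begin

text \<open>
  The space R^d is a type \<open>'a :: euclidean_space\<close> with \<open>d = DIM('a)\<close>. An L^1 function is given by a
  Borel representative, and two representatives that agree almost everywhere are never
  distinguished. Points of the product space (R^d)^N are functions in
  \<open>PiE {..<N} (\<lambda>_. UNIV)\<close>, so the particles are numbered from 0 to \<open>N - 1\<close>.
\<close>

definition LO_exponent :: "'a::euclidean_space itself \<Rightarrow> real \<Rightarrow> real" where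
  "LO_exponent _ s = 1 + s / real DIM('a)"

definition admissible :: "real \<Rightarrow> nat \<Rightarrow> ('a::euclidean_space \<Rightarrow> real) set" where
  "admissible s N = {\<rho>. integrable lborel \<rho>
      \<and> integrable lborel (\<lambda>x. \<bar>\<rho> x\<bar> powr LO_exponent TYPE('a) s)
      \<and> (AE x in lborel. 0 \<le> \<rho> x)
      \<and> (LINT x|lborel. \<rho> x) = real N}"

text \<open>
  The kernel is taken in \<open>ennreal\<close>, where \<open>1 / 0 = \<infinity>\<close>; in \<open>real\<close> two coinciding
  particles would interact with energy 0.
\<close>

definition riesz_kernel :: "real \<Rightarrow> 'a::euclidean_space \<Rightarrow> 'a \<Rightarrow> ennreal" where
  "riesz_kernel s x y = 1 / ennreal (norm (x - y) powr s)"

lemma riesz_kernel_same: "riesz_kernel s x x = \<infinity>"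
  by (simp add: riesz_kernel_def divide_ennreal_def)

lemma riesz_kernel_neq:
  "x \<noteq> y \<Longrightarrow> riesz_kernel s x y = ennreal (1 / norm (x - y) powr s)"
  by (simp add: riesz_kernel_def divide_ennreal flip: ennreal_1)

abbreviation config_space :: "nat \<Rightarrow> (nat \<Rightarrow> 'a::euclidean_space) measure" where
  "config_space N \<equiv> PiM {..<N} (\<lambda>_. borel)"

definition symmetric_prob :: "nat \<Rightarrow> (nat \<Rightarrow> 'a::euclidean_space) measure \<Rightarrow> bool" where
  "symmetric_prob N P \<longleftrightarrow> prob_space P \<and> sets P = sets (config_space N)
     \<and> (\<forall>\<sigma>. \<sigma> permutes {..<N} \<longrightarrow>
          distr P (config_space N) (\<lambda>x. \<lambda>i\<in>{..<N}. x (\<sigma> i)) = P)"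

definition one_body :: "nat \<Rightarrow> (nat \<Rightarrow> 'a::euclidean_space) measure \<Rightarrow> 'a measure" where
  "one_body N P = measure_of UNIV (sets borel)
     (\<lambda>A. \<Sum>i<N. emeasure (distr P borel (\<lambda>x. x i)) A)"

text \<open>The set function above is a measure, so \<open>measure_of\<close> does not collapse to 0.\<close>

lemma sets_one_body [simp]: "sets (one_body N P) = sets borel"
  using sets.sigma_sets_eq[of borel] by (simp add: one_body_def)

lemma emeasure_one_body:
  assumes "A \<in> sets borel"
  shows "emeasure (one_body N P) A = (\<Sum>i<N. emeasure (distr P borel (\<lambda>x. x i)) A)"
proof (rule emeasure_measure_of[OF one_body_def])
  show "countably_additive (sets (one_body N P))
      (\<lambda>A. \<Sum>i<N. emeasure (distr P borel (\<lambda>x. x i)) A)"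
  proof (rule countably_additiveI)
    fix A :: "nat \<Rightarrow> 'a set"
    assume "range A \<subseteq> sets (one_body N P)" "disjoint_family A"
    then have "(\<Sum>k. emeasure (distr P borel (\<lambda>x. x i)) (A k))
        = emeasure (distr P borel (\<lambda>x. x i)) (\<Union>k. A k)" for i
      by (intro suminf_emeasure) auto
    then show "(\<Sum>k. \<Sum>i<N. emeasure (distr P borel (\<lambda>x. x i)) (A k))
        = (\<Sum>i<N. emeasure (distr P borel (\<lambda>x. x i)) (\<Union>k. A k))"
      by (subst suminf_sum) auto
  qed
qed (use assms in \<open>auto simp: positive_def\<close>)

definition interaction_energy ::
    "real \<Rightarrow> nat \<Rightarrow> (nat \<Rightarrow> 'a::euclidean_space) measure \<Rightarrow> ennreal" where
  "interaction_energy s N P = (\<integral>\<^sup>+x. (\<Sum>j<N. \<Sum>i<j. riesz_kernel s (x i) (x j)) \<partial>P)"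

text \<open>
  An infimum in \<open>ennreal\<close>: it agrees with the minimum, which is attained (the couplings of a
  given one-body density are weakly compact and the energy is lower semicontinuous).
\<close>

definition W_fun :: "real \<Rightarrow> nat \<Rightarrow> ('a::euclidean_space \<Rightarrow> real) \<Rightarrow> ennreal" where
  "W_fun s N \<rho> =
     (INF P\<in>{P. symmetric_prob N P \<and> one_body N P = density lborel (\<lambda>x. ennreal (\<rho> x))}.
        interaction_energy s N P)"

definition D_fun :: "real \<Rightarrow> ('a::euclidean_space \<Rightarrow> real) \<Rightarrow> ennreal" where
  "D_fun s \<rho> =
     (\<integral>\<^sup>+x. \<integral>\<^sup>+y. ennreal (\<rho> x) * ennreal (\<rho> y) * riesz_kernel s x y \<partial>lborel \<partial>lborel)"

definition G_fun :: "real \<Rightarrow> nat \<Rightarrow> ('a::euclidean_space \<Rightarrow> real) \<Rightarrow> ereal" where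
  "G_fun s N \<rho> = enn2ereal (D_fun s \<rho>) / 2 - enn2ereal (W_fun s N \<rho>)"

definition L_fun :: "real \<Rightarrow> ('a::euclidean_space \<Rightarrow> real) \<Rightarrow> real" where
  "L_fun s \<rho> = (LINT x|lborel. \<rho> x powr LO_exponent TYPE('a) s)"

definition LO_constant :: "'a::euclidean_space itself \<Rightarrow> real \<Rightarrow> nat \<Rightarrow> ereal" where
  "LO_constant _ s N =
     (SUP \<rho>\<in>(admissible s N :: ('a \<Rightarrow> real) set). G_fun s N \<rho> / ereal (L_fun s \<rho>))"

definition LO_optimizer :: "real \<Rightarrow> nat \<Rightarrow> ('a::euclidean_space \<Rightarrow> real) \<Rightarrow> bool" where
  "LO_optimizer s N \<rho> \<longleftrightarrow> \<rho> \<in> admissible s N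
     \<and> G_fun s N \<rho> / ereal (L_fun s \<rho>) = LO_constant TYPE('a) s N"

definition compactly_supported :: "('a::euclidean_space \<Rightarrow> real) \<Rightarrow> bool" where
  "compactly_supported \<rho> \<longleftrightarrow> (\<exists>K. compact K \<and> (AE x in lborel. x \<notin> K \<longrightarrow> \<rho> x = 0))"

end

theory Submission
  imports Defs "HOL-Complex_Analysis.Great_Picard" "HOL-Library.Diagonal_Subsequence"
begin

text \<open>
  The constraint of exactly \<open>N\<close> particles is relaxed: densities of mass at most \<open>N\<close> are realised by random
  configurations of at most \<open>N\<close> particles. The relaxed energy is lower semicontinuous under local
  convergence, so mass may escape to infinity without harm.

  A maximizing sequence, normalised by scaling and translation, does not vanish. The quadratic energies of
  the differences of its members tend to \<open>0\<close> on compact sets (Arzela-Ascoli for truncated potentials), and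
  the uniform convexity of \<open>\<rho> \<mapsto> \<integral>\<rho>\<^sup>p\<close> turns this into local \<open>L\<^sup>1\<close> convergence; the limit is a maximizer.

  Let \<open>\<Lambda>\<close> increase strictly from \<open>N\<close> to \<open>N + 1\<close>. Then almost optimal configurations for \<open>N + 1\<close> are full with
  positive probability. If a maximizer had smaller mass, configurations that are not full would contain
  fewer particles than the mean, and inserting a particle spread over a huge ball into them would gain
  more attraction than repulsion; so the maximizer has full mass. Similarly, deleting its part outside a
  large ball and inserting a spread-out particle whenever one was removed would gain, so it has compact
  support.

  Conversely, given a compactly supported maximizer for \<open>N\<close>, a particle placed just beyond an extreme point of
  the support, and only when the potential of the configuration there is below its mean, gains to
  first order in its probability, while \<open>\<integral>\<rho>\<^sup>p\<close> changes to higher order. So \<open>\<Lambda>\<close> increases strictly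
  from \<open>N\<close> to \<open>N + 1\<close>, and induction on \<open>N\<close> closes the circle.
\<close>

subsection \<open>The Riesz kernel\<close>

text \<open>Exactly N particles is not a condition that survives weak limits, and the original
  energy means nothing for a limit of smaller mass. With at most N particles \<open>W\<close> is
  convex, superadditive under cutting the space, and lower semicontinuous, and every density below
  an admissible one is admissible. All improved competitors use one device: a particle of density u
  is inserted on an event G of probability t. The attraction \<open>B / 2\<close> grows by at least
  t times the mean potential of u, the repulsion by the mean of that potential restricted to G. The
  net gain is minus the covariance of the potential with the indicator of G. For u spread over a
  huge ball the potential is nearly U times the number of particles, so G consists of configurations
  with a free place; close to the support the potential itself fluctuates. The increase of
  \<open>L\<close> has a linear part, which vanishes off the support and is small against U for
  spread u, and a part of order t^(1 + q), absorbed by keeping t small. The lower bound on the gain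
  is fixed before the almost optimal state is chosen, so its error can be made smaller.\<close>

lemma riesz_kernel_measurable [measurable]:
  fixes f g :: "'b \<Rightarrow> 'a::euclidean_space"
  assumes [measurable]: "f \<in> borel_measurable M" "g \<in> borel_measurable M"
  shows "(\<lambda>x. riesz_kernel s (f x) (g x)) \<in> borel_measurable M"
  unfolding riesz_kernel_def by measurable

lemma riesz_kernel_measurable' [measurable]:
  "riesz_kernel s x \<in> borel_measurable borel"
proof -
  have "(\<lambda>y. riesz_kernel s x y) \<in> borel_measurable borel" by measurable
  then show ?thesis .
qed

lemma pred_ball [measurable]:
  fixes f :: "'b \<Rightarrow> 'a::euclidean_space"
  assumes [measurable]: "f \<in> borel_measurable M"
  shows "Measurable.pred M (\<lambda>y. f y \<in> ball x r)"
  by simp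

lemma pred_cball [measurable]:
  fixes f :: "'b \<Rightarrow> 'a::euclidean_space"
  assumes [measurable]: "f \<in> borel_measurable M"
  shows "Measurable.pred M (\<lambda>y. f y \<in> cball x r)"
  by simp

lemma riesz_kernel_commute: "riesz_kernel s x y = riesz_kernel s y x"
  by (simp add: riesz_kernel_def norm_minus_commute)

lemma riesz_kernel_add: "riesz_kernel s (x + v) (y + v) = riesz_kernel s x y"
  by (simp add: riesz_kernel_def)

locale riesz_exponent =
  fixes s :: real and ty :: "'a::euclidean_space itself"
  assumes s_pos: "0 < s" and s_less: "s < real DIM('a)"
begin

text \<open>Excess of the exponent over 1, equal to s / d and hence strictly between 0 and 1.
  Potentials of densities bounded by t are of order t powr q, which is why q rather than the
  exponent itself appears in the estimates.\<close>

definition q :: real where "q = LO_exponent ty s - 1"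

lemma q_eq: "q = s / real DIM('a)"
  unfolding q_def LO_exponent_def by simp

lemma q_pos: "0 < q" and q_less: "q < 1"
  using s_pos s_less by (auto simp: q_eq)

definition dimR :: real where "dimR = s / q"

lemma dimR_eq: "dimR = real DIM('a)"
  using s_pos by (simp add: dimR_def q_eq)

abbreviation k :: "'a \<Rightarrow> 'a \<Rightarrow> ennreal" where "k \<equiv> riesz_kernel s"

lemma k_le:
  assumes "0 < r" "r \<le> dist x y"
  shows "k x y \<le> ennreal (r powr - s)"
proof -
  have "1 / norm (x - y) powr s \<le> 1 / r powr s"
    using assms s_pos by (intro divide_left_mono powr_mono2 mult_pos_pos)
      (auto simp: dist_norm)
  moreover have "x \<noteq> y" using assms by auto
  ultimately show ?thesis
    by (auto simp: riesz_kernel_neq powr_minus_divide intro!: ennreal_leI)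
qed

lemma k_ge:
  assumes "dist x y \<le> r"
  shows "ennreal (r powr - s) \<le> k x y"
proof (cases "x = y")
  case True then show ?thesis by (simp add: riesz_kernel_same)
next
  case False
  have "1 / r powr s \<le> 1 / norm (x - y) powr s"
    using assms s_pos False by (intro divide_left_mono powr_mono2 mult_pos_pos)
      (auto simp: dist_norm intro: less_le_trans)
  then show ?thesis using False
    by (auto simp: riesz_kernel_neq powr_minus_divide intro!: ennreal_leI)
qed

text \<open>Sum of the dyadic series in \<open>nn_integral_k_ball\<close>; its ratio 2 powr (s - d)
  is below 1 because s < d. The factor 2 powr s comes from evaluating the kernel at the inner radius
  of each shell.\<close>

definition C0 :: real where
  "C0 = unit_ball_vol (dimR) * 2 powr s / (1 - 2 powr (s - dimR))"

lemma C0_nonneg: "0 \<le> C0"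
proof -
  have "2 powr (s - dimR) \<le> 2 powr 0"
    using s_less by (intro powr_mono) (auto simp: dimR_eq)
  then show ?thesis unfolding C0_def by (simp add: dimR_eq)
qed

text \<open>On the shell between r / 2^(n + 1) and r / 2^n the kernel is at most its value at the
  inner radius, and the volumes of the enclosing balls shrink geometrically faster than these values
  grow.\<close>

lemma nn_integral_k_ball:
  assumes r: "0 < r"
  shows "(\<integral>\<^sup>+y. k x y * indicator (ball x r) y \<partial>lborel) \<le> ennreal (C0 * r powr (dimR - s))"
proof -
  let ?V = "unit_ball_vol (dimR)"
  let ?c = "\<lambda>n. (r / 2 ^ Suc n) powr - s"
  have dyadic: "k x y * indicator (ball x r) y
      \<le> (\<Sum>n. ennreal (?c n) * indicator (ball x (r / 2 ^ n)) y)" if "y \<noteq> x" for y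
  proof (cases "dist x y < r")
    case True
    have "\<exists>n. r / 2 ^ n \<le> dist x y"
    proof -
      have "0 < dist x y / r" using that r by simp
      then obtain n where "(1/2) ^ n < dist x y / r"
        using real_arch_pow_inv[of "dist x y / r" "1/2"] by auto
      then show ?thesis using r by (intro exI[of _ n]) (auto simp: field_simps)
    qed
    \<comment> \<open>m is the first dyadic scale not exceeding the distance. It is not 0 since dist
      x y < r, and its predecessor n puts y into the n-th ball.\<close>
    define m where "m = (LEAST n. r / 2 ^ n \<le> dist x y)"
    have m: "r / 2 ^ m \<le> dist x y"
      unfolding m_def using \<open>\<exists>n. _\<close> by (rule LeastI_ex)
    have "m \<noteq> 0" using m True by (intro notI) auto
    then obtain n where n: "m = Suc n" by (cases m) auto
    have "\<not> r / 2 ^ n \<le> dist x y"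
      using not_less_Least[of n "\<lambda>n. r / 2 ^ n \<le> dist x y"] n m_def by auto
    then have "k x y * indicator (ball x r) y
        \<le> ennreal (?c n) * indicator (ball x (r / 2 ^ n)) y"
      using k_le[of "r / 2 ^ Suc n" x y] m n r by (auto simp: indicator_def)
    also have "\<dots> = (\<Sum>i\<in>{n}. ennreal (?c i) * indicator (ball x (r / 2 ^ i)) y)"
      by (simp del: sum_mult_indicator)
    also have "\<dots> \<le> (\<Sum>n. ennreal (?c n) * indicator (ball x (r / 2 ^ n)) y)"
      by (rule sum_le_suminf) auto
    finally show ?thesis .
  qed auto
  have "(\<integral>\<^sup>+y. k x y * indicator (ball x r) y \<partial>lborel)
      \<le> (\<integral>\<^sup>+y. (\<Sum>n. ennreal (?c n) * indicator (ball x (r / 2 ^ n)) y) \<partial>lborel)"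
  proof (rule nn_integral_mono_AE)
    have "AE y in lborel. y \<noteq> x" by (rule AE_lborel_singleton)
    then show "AE y in lborel. k x y * indicator (ball x r) y
        \<le> (\<Sum>n. ennreal (?c n) * indicator (ball x (r / 2 ^ n)) y)"
      by (rule eventually_mono) (rule dyadic)
  qed
  also have "\<dots> = (\<Sum>n. ennreal (?c n) * emeasure lborel (ball x (r / 2 ^ n)))"
    by (subst nn_integral_suminf) (auto simp: nn_integral_cmult)
  also have "\<dots> = (\<Sum>n. ennreal (?V * 2 powr s * r powr (dimR - s) * (2 powr (s - dimR)) ^ n))"
  proof (intro suminf_cong)
    fix n
    have "?c n * (?V * (r / 2 ^ n) ^ DIM('a))
       = ?V * 2 powr s * r powr (dimR - s) * (2 powr (s - dimR)) ^ n"
    proof -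
      have 1: "(r / 2 ^ n) ^ DIM('a) = r powr dimR * 2 powr (- real n * dimR)"
        using r by (simp add: dimR_eq power_divide powr_realpow powr_minus_divide powr_mult
            flip: power_mult of_nat_mult)
      have 2: "?c n = r powr - s * 2 powr (s * (real n + 1))"
      proof -
        have "(2::real) ^ Suc n = 2 powr (real n + 1)"
          by (subst powr_realpow[symmetric]) (auto simp: add.commute)
        then show ?thesis using r by (simp add: powr_divide powr_powr powr_minus_divide field_simps)
      qed
      have 3: "(2 powr (s - dimR)) ^ n = 2 powr (real n * (s - dimR))"
        by (simp add: powr_powr mult.commute flip: powr_realpow)
      have 4: "(2::real) powr (s * (real n + 1)) * 2 powr (- real n * dimR)
          = 2 powr s * 2 powr (real n * (s - dimR))"
        by (simp add: powr_add[symmetric] algebra_simps)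
      have 5: "r powr - s * r powr dimR = r powr (dimR - s)"
        by (simp add: powr_add[symmetric])
      have "?c n * (?V * (r / 2 ^ n) ^ DIM('a))
          = ?V * (r powr - s * r powr dimR) * (2 powr (s * (real n + 1)) * 2 powr (- real n * dimR))"
        unfolding 1 2 by (simp only: ac_simps)
      then show ?thesis unfolding 3 4 5 by (simp only: ac_simps)
    qed
    then show "ennreal (?c n) * emeasure lborel (ball x (r / 2 ^ n)) = ennreal (?V * 2 powr s * r powr (dimR - s) * (2 powr (s - dimR)) ^ n)"
      using r by (subst emeasure_ball) (auto simp: ennreal_mult[symmetric] dimR_eq)
  qed
  also have "\<dots> = ennreal (C0 * r powr (dimR - s))"
  proof -
    have lt: "2 powr (s - dimR) < 1"
      using s_less powr_less_mono[of "s - dimR" 0 2] by (simp add: dimR_eq)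
    have "(\<lambda>n. ?V * 2 powr s * r powr (dimR - s) * (2 powr (s - dimR)) ^ n)
       sums (?V * 2 powr s * r powr (dimR - s) * (1 / (1 - 2 powr (s - dimR))))"
      using lt by (intro sums_mult geometric_sums) simp
    then show ?thesis
      unfolding C0_def by (subst suminf_ennreal_eq) (auto simp: field_simps dimR_eq)
  qed
  finally show ?thesis .
qed

abbreviation a :: real where "a \<equiv> 1 - q"

text \<open>The added 1 pays for the far part in \<open>nn_integral_k_bounded\<close> and makes the
  constant strictly positive.\<close>

definition C1 :: real where "C1 = C0 + 1"

lemma C1_pos: "0 < C1"
  using C0_nonneg by (simp add: C1_def)

text \<open>Inside radius r the density is replaced by its bound t, outside the kernel is replaced
  by r powr (- s). With r chosen so that t * r^d = m both parts are multiples of t powr q * m powr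
  a.\<close>

lemma nn_integral_k_bounded:
  fixes g :: "'a \<Rightarrow> ennreal"
  assumes [measurable]: "g \<in> borel_measurable borel"
    and le: "\<And>y. g y \<le> ennreal t" and m: "(\<integral>\<^sup>+y. g y \<partial>lborel) \<le> ennreal m"
    and t: "0 \<le> t" and "0 \<le> m"
  shows "(\<integral>\<^sup>+y. g y * k x y \<partial>lborel) \<le> ennreal (C1 * t powr q * m powr a)"
proof (cases "t = 0 \<or> m = 0")
  case True
  have "AE y in lborel. g y = 0"
  proof (cases "t = 0")
    case True
    then show ?thesis using le by simp
  next
    case False
    then have "(\<integral>\<^sup>+y. g y \<partial>lborel) = 0" using True m by simp
    then show ?thesis by (subst (asm) nn_integral_0_iff_AE) auto
  qed
  then have "(\<integral>\<^sup>+y. g y * k x y \<partial>lborel) = (\<integral>\<^sup>+y. 0 \<partial>(lborel::'a measure))"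
    by (intro nn_integral_cong_AE) (auto elim!: eventually_mono)
  then show ?thesis by simp
next
  case False
  then have t: "0 < t" and m0: "0 < m" using assms by auto
  define r where "r = (m / t) powr (1 / dimR)"
  have r: "0 < r" using t m0 by (simp add: r_def)
  have dq: "dimR * q = s" using q_pos by (simp add: dimR_def)
  have dpos: "0 < dimR" by (simp add: dimR_eq)
  have far: "g y * (k x y * indicator (- ball x r) y) \<le> g y * ennreal (r powr - s)" for y
    using k_le[OF r, of x y] by (intro mult_left_mono) (auto simp: indicator_def)
  have "(\<integral>\<^sup>+y. g y * k x y \<partial>lborel)
      = (\<integral>\<^sup>+y. g y * (k x y * indicator (ball x r) y) + g y * (k x y * indicator (- ball x r) y) \<partial>lborel)"
    by (intro nn_integral_cong) (auto simp: indicator_def)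
  also have "\<dots> \<le> (\<integral>\<^sup>+y. ennreal t * (k x y * indicator (ball x r) y) + g y * ennreal (r powr - s) \<partial>lborel)"
    by (intro nn_integral_mono add_mono far mult_right_mono le) auto
  also have "\<dots> = ennreal t * (\<integral>\<^sup>+y. k x y * indicator (ball x r) y \<partial>lborel)
      + (\<integral>\<^sup>+y. g y \<partial>lborel) * ennreal (r powr - s)"
    by (simp add: nn_integral_add nn_integral_cmult nn_integral_multc)
  also have "\<dots> \<le> ennreal t * ennreal (C0 * r powr (dimR - s)) + ennreal m * ennreal (r powr - s)"
    by (intro add_mono mult_left_mono mult_right_mono nn_integral_k_ball r m) auto
  also have "\<dots> = ennreal (t * (C0 * r powr (dimR - s)) + m * r powr - s)"
    using t m0 C0_nonneg by (simp add: ennreal_mult)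
  also have "t * (C0 * r powr (dimR - s)) + m * r powr - s = C1 * t powr q * m powr a"
  proof -
    have e1: "(dimR - s) / dimR = a" "- s / dimR = - q"
      using dpos dq by (auto simp: field_simps)
    have "r powr (dimR - s) = (m / t) powr a"
      unfolding r_def using e1 by (simp add: powr_powr)
    also have "\<dots> = m powr a * t powr q / t"
      using t m0 by (simp add: powr_divide powr_diff)
    finally have r1: "r powr (dimR - s) = m powr a * t powr q / t" .
    have "r powr - s = (m / t) powr - q"
      unfolding r_def using e1 by (simp add: powr_powr)
    also have "\<dots> = m powr a * t powr q / m"
      using t m0 by (simp add: powr_divide powr_diff powr_minus_divide)
    finally have r2: "r powr - s = m powr a * t powr q / m" .
    show ?thesis unfolding r1 r2 C1_def using t m0 by (simp add: field_simps)
  qed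
  finally show ?thesis .
qed


subsection \<open>Densities and the quadratic form\<close>

text \<open>Representatives are nonnegative everywhere and not only almost everywhere, so that
  pointwise algebra is free of null sets. An admissible function is turned into such a
  representative by taking its positive part, in \<open>admissible_iff\<close>.\<close>

definition dens :: "('a \<Rightarrow> real) \<Rightarrow> bool" where
  "dens f \<longleftrightarrow> f \<in> borel_measurable borel \<and> (\<forall>x. 0 \<le> f x) \<and> integrable lborel f
     \<and> integrable lborel (\<lambda>x. f x powr (1 + q))"

abbreviation mass :: "('a \<Rightarrow> real) \<Rightarrow> real" where "mass f \<equiv> integral\<^sup>L lborel f"

definition L :: "('a \<Rightarrow> real) \<Rightarrow> real" where "L f = (LINT x|lborel. f x powr (1 + q))"

lemma dens_measurable: "dens f \<Longrightarrow> f \<in> borel_measurable borel"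
  and dens_nonneg: "dens f \<Longrightarrow> 0 \<le> f x"
  and dens_integrable: "dens f \<Longrightarrow> integrable lborel f"
  and dens_integrable_powr: "dens f \<Longrightarrow> integrable lborel (\<lambda>x. f x powr (1 + q))"
  by (auto simp: dens_def)

lemma mass_nonneg: "dens f \<Longrightarrow> 0 \<le> mass f"
  by (simp add: dens_nonneg)

lemma L_nonneg: "0 \<le> L f"
  by (simp add: L_def)

lemma nn_integral_dens: "dens f \<Longrightarrow> (\<integral>\<^sup>+x. ennreal (f x) \<partial>lborel) = ennreal (mass f)"
  by (simp add: nn_integral_eq_integral dens_nonneg dens_integrable)

lemma nn_integral_powr_dens:
  "dens f \<Longrightarrow> (\<integral>\<^sup>+x. ennreal (f x powr (1 + q)) \<partial>lborel) = ennreal (L f)"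
  by (simp add: nn_integral_eq_integral dens_integrable_powr L_def)

lemma dens_mono:
  assumes f: "dens f" and [measurable]: "g \<in> borel_measurable borel"
    and g: "\<And>x. 0 \<le> g x" "\<And>x. g x \<le> f x"
  shows "dens g"
proof -
  have "integrable lborel g"
    by (rule Bochner_Integration.integrable_bound[OF dens_integrable[OF f]])
      (use g in \<open>auto intro!: AE_I2 order_trans[OF g(2) abs_ge_self]\<close>)
  moreover have "integrable lborel (\<lambda>x. g x powr (1 + q))"
    using g q_pos
    by (intro Bochner_Integration.integrable_bound[OF dens_integrable_powr[OF f]])
       (auto intro!: AE_I2 powr_mono2)
  ultimately show ?thesis using g by (auto simp: dens_def)
qed

lemma dens_zero: "dens (\<lambda>_. 0)"
  by (simp add: dens_def)

lemma dens_scale: "dens f \<Longrightarrow> 0 \<le> c \<Longrightarrow> dens (\<lambda>x. c * f x)"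
  by (auto simp: dens_def powr_mult)

lemma dens_add:
  assumes f: "dens f" and g: "dens g" shows "dens (\<lambda>x. f x + g x)"
proof -
  note [measurable] = dens_measurable[OF f] dens_measurable[OF g]
  have "integrable lborel (\<lambda>x. 2 powr (1 + q) * (f x powr (1 + q) + g x powr (1 + q)))"
    using f g by (intro integrable_mult_right Bochner_Integration.integrable_add dens_integrable_powr)
  then have "integrable lborel (\<lambda>x. (f x + g x) powr (1 + q))"
  proof (rule Bochner_Integration.integrable_bound)
    show "AE x in lborel. norm ((f x + g x) powr (1 + q))
        \<le> norm (2 powr (1 + q) * (f x powr (1 + q) + g x powr (1 + q)))"
    proof (intro AE_I2)
      fix x
      have "(f x + g x) powr (1 + q) \<le> (2 * max (f x) (g x)) powr (1 + q)"
        using dens_nonneg[OF f, of x] dens_nonneg[OF g, of x] q_pos by (intro powr_mono2) auto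
      also have "\<dots> = 2 powr (1 + q) * max (f x) (g x) powr (1 + q)"
        using dens_nonneg[OF f, of x] by (simp add: powr_mult)
      also have "\<dots> \<le> 2 powr (1 + q) * (f x powr (1 + q) + g x powr (1 + q))"
        by (intro mult_left_mono) (auto simp: max_def)
      finally show "norm ((f x + g x) powr (1 + q))
        \<le> norm (2 powr (1 + q) * (f x powr (1 + q) + g x powr (1 + q)))" by simp
    qed
  qed simp
  then show ?thesis using f g by (auto simp: dens_def)
qed

lemma dens_restrict:
  assumes "dens f" "E \<in> sets borel" shows "dens (\<lambda>x. f x * indicator E x)"
proof (rule dens_mono[OF assms(1)])
  note [measurable] = dens_measurable[OF assms(1)] assms(2)
  show "(\<lambda>x. f x * indicator E x) \<in> borel_measurable borel" by measurable
qed (use dens_nonneg[OF assms(1)] in \<open>auto simp: indicator_def\<close>)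

lemma mass_mono: "dens f \<Longrightarrow> dens g \<Longrightarrow> (\<And>x. g x \<le> f x) \<Longrightarrow> mass g \<le> mass f"
  by (intro integral_mono dens_integrable) auto

lemma L_mono: "dens f \<Longrightarrow> dens g \<Longrightarrow> (\<And>x. g x \<le> f x) \<Longrightarrow> L g \<le> L f"
  unfolding L_def
  by (rule integral_mono) (use q_pos dens_nonneg in \<open>auto intro!: dens_integrable_powr powr_mono2\<close>)

lemma L_scale: "0 \<le> c \<Longrightarrow> dens f \<Longrightarrow> L (\<lambda>x. c * f x) = c powr (1 + q) * L f"
  by (simp add: L_def powr_mult dens_nonneg)

lemma mass_add: "dens f \<Longrightarrow> dens g \<Longrightarrow> mass (\<lambda>x. f x + g x) = mass f + mass g"
  by (intro Bochner_Integration.integral_add dens_integrable)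

lemma L_zero_iff: assumes "dens f" shows "L f = 0 \<longleftrightarrow> mass f = 0"
proof -
  have "L f = 0 \<longleftrightarrow> (AE x in lborel. f x powr (1 + q) = 0)"
    unfolding L_def using assms by (subst integral_nonneg_eq_0_iff_AE) (auto intro: dens_integrable_powr)
  also have "\<dots> \<longleftrightarrow> (AE x in lborel. f x = 0)" using q_pos by simp
  also have "\<dots> \<longleftrightarrow> mass f = 0"
    using assms by (subst integral_nonneg_eq_0_iff_AE) (auto intro: dens_integrable dens_nonneg)
  finally show ?thesis .
qed

lemma mass_zero_AE: "dens f \<Longrightarrow> mass f = 0 \<longleftrightarrow> (AE x in lborel. f x = 0)"
  by (subst integral_nonneg_eq_0_iff_AE) (auto intro: dens_integrable dens_nonneg)

text \<open>The double integral is split along \<open>f x \<ge> g y\<close>; on that part \<open>g\<close> may be replaced by its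
  truncation at height \<open>f x\<close>, whose potential is at most of order \<open>f x powr q\<close>.\<close>

lemma bilinear_local_bound:
  assumes f: "dens f" and g: "dens g"
    and [measurable]: "Measurable.pred (borel \<Otimes>\<^sub>M borel) (\<lambda>z. A (fst z) (snd z))"
    and Mg: "\<And>x. (\<integral>\<^sup>+y. ennreal (g y) * indicator {y. A x y} y \<partial>lborel) \<le> ennreal Mg"
    and Mf: "\<And>y. (\<integral>\<^sup>+x. ennreal (f x) * indicator {x. A x y} x \<partial>lborel) \<le> ennreal Mf"
    and "0 \<le> Mf" "0 \<le> Mg"
  shows "(\<integral>\<^sup>+x. \<integral>\<^sup>+y. ennreal (f x) * ennreal (g y) * k x y * indicator {z. A (fst z) (snd z)} (x, y) \<partial>lborel \<partial>lborel)
    \<le> ennreal (C1 * (Mg powr a * L f + Mf powr a * L g))"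
proof -
  note [measurable] = dens_measurable[OF f] dens_measurable[OF g]
  have [measurable]: "Measurable.pred borel (\<lambda>y. A x y)" for x
    using measurable_compose[OF _ assms(3), of "\<lambda>y. (x, y)" borel] by simp
  have [measurable]: "Measurable.pred borel (\<lambda>x. A x y)" for y
    using measurable_compose[OF _ assms(3), of "\<lambda>x. (x, y)" borel] by simp
  define I :: "'a \<Rightarrow> 'a \<Rightarrow> ennreal" where "I = (\<lambda>x y. indicator {z. A (fst z) (snd z)} (x, y))"
  have [measurable]: "(\<lambda>z. I (u z) (v z)) \<in> borel_measurable M"
    if [measurable]: "u \<in> borel_measurable M" "v \<in> borel_measurable M" for u v :: "'b \<Rightarrow> 'a" and M
  proof -
    have "Measurable.pred M (\<lambda>z. A (u z) (v z))"
      using measurable_compose[OF _ assms(3), of "\<lambda>z. (u z, v z)" M] by simp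
    then show ?thesis unfolding I_def by simp
  qed
  have I1: "I x y = indicator {y. A x y} y" "I x y = indicator {x. A x y} x" for x y
    by (auto simp: indicator_def I_def)
  \<comment> \<open>\<open>A'\<close> is abstract because the bound is used twice, once for each
    orientation of the relation. Truncation at f x bounds the inner potential by C1 * f x powr q *
    Mg powr a, and the outer factor f x completes the power 1 + q.\<close>
  have half: "(\<integral>\<^sup>+x. \<integral>\<^sup>+y. ennreal (f x) * (ennreal (min (g y) (f x)) * A' x y * k x y) \<partial>lborel \<partial>lborel)
      \<le> ennreal (C1 * (Mg powr a * L f))"
    if f: "dens f" and g: "dens g" and Mg: "\<And>x. (\<integral>\<^sup>+y. ennreal (g y) * A' x y \<partial>lborel) \<le> ennreal Mg"
      and "0 \<le> Mg" and le: "\<And>x y. A' x y \<le> 1" and meas: "\<And>x. A' x \<in> borel_measurable borel"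
    for f g :: "'a \<Rightarrow> real" and Mg and A' :: "'a \<Rightarrow> 'a \<Rightarrow> ennreal"
  proof -
    note [measurable] = dens_measurable[OF f] dens_measurable[OF g] meas
    have "(\<integral>\<^sup>+x. \<integral>\<^sup>+y. ennreal (f x) * (ennreal (min (g y) (f x)) * A' x y * k x y) \<partial>lborel \<partial>lborel)
       = (\<integral>\<^sup>+x. ennreal (f x) * (\<integral>\<^sup>+y. (ennreal (min (g y) (f x)) * A' x y) * k x y \<partial>lborel) \<partial>lborel)"
      by (intro nn_integral_cong nn_integral_cmult) measurable
    also have "\<dots> \<le> (\<integral>\<^sup>+x. ennreal (f x) * ennreal (C1 * f x powr q * Mg powr a) \<partial>lborel)"
    proof (intro nn_integral_mono mult_left_mono nn_integral_k_bounded)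
      fix x y
      have "ennreal (min (g y) (f x)) * A' x y \<le> ennreal (f x) * 1"
        using le by (intro mult_mono ennreal_leI) auto
      then show "ennreal (min (g y) (f x)) * A' x y \<le> ennreal (f x)" by simp
      have "(\<integral>\<^sup>+y. ennreal (min (g y) (f x)) * A' x y \<partial>lborel) \<le> (\<integral>\<^sup>+y. ennreal (g y) * A' x y \<partial>lborel)"
        by (intro nn_integral_mono mult_right_mono ennreal_leI) auto
      also note Mg
      finally show "(\<integral>\<^sup>+y. ennreal (min (g y) (f x)) * A' x y \<partial>lborel) \<le> ennreal Mg" .
    qed (use that dens_nonneg[OF f] in auto)
    also have "\<dots> = (\<integral>\<^sup>+x. ennreal (C1 * Mg powr a) * ennreal (f x powr (1 + q)) \<partial>lborel)"
      using C1_pos dens_nonneg[OF f]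
      by (intro nn_integral_cong) (auto simp: ennreal_mult[symmetric] powr_mult_base intro!: arg_cong[where f=ennreal])
    also have "\<dots> = ennreal (C1 * Mg powr a) * ennreal (L f)"
      by (simp add: nn_integral_cmult nn_integral_powr_dens f)
    finally show ?thesis using C1_pos L_nonneg by (simp add: ennreal_mult[symmetric] mult.assoc)
  qed
  have "(\<integral>\<^sup>+x. \<integral>\<^sup>+y. ennreal (f x) * ennreal (g y) * k x y * I x y \<partial>lborel \<partial>lborel)
    \<le> (\<integral>\<^sup>+x. \<integral>\<^sup>+y. ennreal (f x) * (ennreal (min (g y) (f x)) * I x y * k x y)
          + ennreal (g y) * (ennreal (min (f x) (g y)) * I x y * k x y) \<partial>lborel \<partial>lborel)"
  proof (intro nn_integral_mono)
    fix x y
    show "ennreal (f x) * ennreal (g y) * k x y * I x y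
       \<le> ennreal (f x) * (ennreal (min (g y) (f x)) * I x y * k x y)
          + ennreal (g y) * (ennreal (min (f x) (g y)) * I x y * k x y)"
      by (cases "g y \<le> f x") (auto simp: min_def ac_simps)
  qed
  also have "\<dots> = (\<integral>\<^sup>+x. \<integral>\<^sup>+y. ennreal (f x) * (ennreal (min (g y) (f x)) * I x y * k x y) \<partial>lborel \<partial>lborel)
      + (\<integral>\<^sup>+x. \<integral>\<^sup>+y. ennreal (g y) * (ennreal (min (f x) (g y)) * I x y * k x y) \<partial>lborel \<partial>lborel)"
  proof -
    have "(\<integral>\<^sup>+y. ennreal (f x) * (ennreal (min (g y) (f x)) * I x y * k x y)
          + ennreal (g y) * (ennreal (min (f x) (g y)) * I x y * k x y) \<partial>lborel)
      = (\<integral>\<^sup>+y. ennreal (f x) * (ennreal (min (g y) (f x)) * I x y * k x y) \<partial>lborel)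
        + (\<integral>\<^sup>+y. ennreal (g y) * (ennreal (min (f x) (g y)) * I x y * k x y) \<partial>lborel)" for x
      by (intro nn_integral_add) measurable
    then show ?thesis
      by (simp only:) (intro nn_integral_add; measurable)
  qed
  also have "(\<integral>\<^sup>+x. \<integral>\<^sup>+y. ennreal (g y) * (ennreal (min (f x) (g y)) * I x y * k x y) \<partial>lborel \<partial>lborel)
     = (\<integral>\<^sup>+y. \<integral>\<^sup>+x. ennreal (g y) * (ennreal (min (f x) (g y)) * I x y * k x y) \<partial>lborel \<partial>lborel)"
    by (rule lborel_pair.Fubini'[symmetric]) measurable
  also have "\<dots> = (\<integral>\<^sup>+y. \<integral>\<^sup>+x. ennreal (g y) * (ennreal (min (f x) (g y)) * I x y * k y x) \<partial>lborel \<partial>lborel)"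
    by (simp add: riesz_kernel_commute)
  also have "(\<integral>\<^sup>+x. \<integral>\<^sup>+y. ennreal (f x) * (ennreal (min (g y) (f x)) * I x y * k x y) \<partial>lborel \<partial>lborel)
      + (\<integral>\<^sup>+y. \<integral>\<^sup>+x. ennreal (g y) * (ennreal (min (f x) (g y)) * I x y * k y x) \<partial>lborel \<partial>lborel)
      \<le> ennreal (C1 * (Mg powr a * L f)) + ennreal (C1 * (Mf powr a * L g))"
  proof (intro add_mono half f g)
    show "(\<integral>\<^sup>+y. ennreal (g y) * I x y \<partial>lborel) \<le> ennreal Mg" for x
      using Mg[of x] unfolding I1(1) .
    show "(\<integral>\<^sup>+x. ennreal (f x) * I x y \<partial>lborel) \<le> ennreal Mf" for y
      using Mf[of y] unfolding I1(2) .
    show "(\<lambda>y. I x y) \<in> borel_measurable borel" for x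
      unfolding I1(1) by measurable
    show "(\<lambda>x. I x y) \<in> borel_measurable borel" for y
      unfolding I1(2) by measurable
  qed (use assms in \<open>auto simp: I_def indicator_def\<close>)
  also have "\<dots> = ennreal (C1 * (Mg powr a * L f + Mf powr a * L g))"
    using C1_pos L_nonneg by (simp add: ennreal_plus[symmetric] distrib_left del: ennreal_plus)
  finally show ?thesis unfolding I_def .
qed

section \<open>The bilinear form of the kernel\<close>

definition bform :: "('a \<Rightarrow> real) \<Rightarrow> ('a \<Rightarrow> real) \<Rightarrow> ennreal" where
  "bform f g = (\<integral>\<^sup>+x. \<integral>\<^sup>+y. ennreal (f x) * ennreal (g y) * k x y \<partial>lborel \<partial>lborel)"

text \<open>Real-valued version for algebra; \<open>bform_eq\<close> guarantees that on densities no
  infinite value is turned into 0.\<close>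

definition B :: "('a \<Rightarrow> real) \<Rightarrow> ('a \<Rightarrow> real) \<Rightarrow> real" where "B f g = enn2real (bform f g)"

lemma B_nonneg: "0 \<le> B f g"
  by (simp add: B_def)

lemma bform_bound:
  assumes f: "dens f" and g: "dens g"
  shows "bform f g \<le> ennreal (C1 * (mass g powr a * L f + mass f powr a * L g))"
proof -
  have "(\<integral>\<^sup>+x. \<integral>\<^sup>+y. ennreal (f x) * ennreal (g y) * k x y
        * indicator {z. (\<lambda>x y. True) (fst z) (snd z)} (x, y) \<partial>lborel \<partial>lborel)
      \<le> ennreal (C1 * (mass g powr a * L f + mass f powr a * L g))"
    by (rule bilinear_local_bound) (use f g in \<open>auto simp: nn_integral_dens mass_nonneg\<close>)
  then show ?thesis by (simp add: bform_def)
qed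

lemma bform_eq: "dens f \<Longrightarrow> dens g \<Longrightarrow> bform f g = ennreal (B f g)"
  unfolding B_def using bform_bound[of f g]
  by (subst ennreal_enn2real) (auto simp: less_top[symmetric] top_unique)

lemma B_le: "dens f \<Longrightarrow> dens g \<Longrightarrow> B f g \<le> C1 * (mass g powr a * L f + mass f powr a * L g)"
  using bform_bound[of f g] C1_pos
  by (auto simp: bform_eq L_nonneg intro!: add_nonneg_nonneg mult_nonneg_nonneg)

lemma bform_commute:
  assumes "dens f" "dens g" shows "bform f g = bform g f"
proof -
  note [measurable] = assms[THEN dens_measurable]
  have "bform f g = (\<integral>\<^sup>+y. \<integral>\<^sup>+x. ennreal (f x) * ennreal (g y) * k x y \<partial>lborel \<partial>lborel)"
    unfolding bform_def by (rule lborel_pair.Fubini'[symmetric]) measurable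
  also have "\<dots> = bform g f"
    unfolding bform_def by (simp add: ac_simps riesz_kernel_commute)
  finally show ?thesis .
qed

lemma B_commute: "dens f \<Longrightarrow> dens g \<Longrightarrow> B f g = B g f"
  by (simp add: B_def bform_commute)

lemma bform_potential:
  "dens f \<Longrightarrow> dens g \<Longrightarrow> bform f g = (\<integral>\<^sup>+x. ennreal (f x) * (\<integral>\<^sup>+y. ennreal (g y) * k x y \<partial>lborel) \<partial>lborel)"
  unfolding bform_def
  by (intro nn_integral_cong, subst nn_integral_cmult[symmetric])
    (auto simp: mult.assoc intro!: borel_measurable_times_ennreal measurable_compose[OF dens_measurable])

lemma B_add_left:
  assumes f: "dens f" and g: "dens g" and h: "dens h"
  shows "B (\<lambda>x. f x + g x) h = B f h + B g h"
proof -
  note [measurable] = dens_measurable[OF f] dens_measurable[OF g] dens_measurable[OF h]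
  have "bform (\<lambda>x. f x + g x) h = bform f h + bform g h"
    using assms
    by (simp add: bform_potential dens_add dens_nonneg distrib_right nn_integral_add)
  then show ?thesis
    using assms by (simp add: bform_eq dens_add B_nonneg flip: ennreal_plus)
qed

lemma B_add_right:
  assumes "dens f" "dens g" "dens h"
  shows "B h (\<lambda>x. f x + g x) = B h f + B h g"
  using assms B_add_left[of f g h] by (simp add: B_commute[of h] dens_add)

lemma B_scale_left:
  assumes f: "dens f" and h: "dens h" and c: "0 \<le> c"
  shows "B (\<lambda>x. c * f x) h = c * B f h"
proof -
  note [measurable] = dens_measurable[OF f] dens_measurable[OF h]
  have "bform (\<lambda>x. c * f x) h = ennreal c * bform f h"
    using assms
    by (simp add: bform_potential dens_scale dens_nonneg ennreal_mult mult.assoc nn_integral_cmult)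
  then show ?thesis
    using assms by (simp add: bform_eq dens_scale B_nonneg flip: ennreal_mult)
qed

lemma B_scale_right: "dens f \<Longrightarrow> dens h \<Longrightarrow> 0 \<le> c \<Longrightarrow> B h (\<lambda>x. c * f x) = c * B h f"
  by (simp add: B_commute[of h] dens_scale B_scale_left)

lemma B_mono:
  assumes "dens f" "dens g" "dens f'" "dens g'" "\<And>x. f x \<le> f' x" "\<And>x. g x \<le> g' x"
  shows "B f g \<le> B f' g'"
proof -
  have "bform f g \<le> bform f' g'"
    unfolding bform_def using assms by (intro nn_integral_mono mult_mono ennreal_leI) auto
  then show ?thesis using assms by (simp add: bform_eq B_nonneg)
qed

text \<open>Replacing f by t * f and g by g / t leaves \<open>B\<close> unchanged but not the bound
  of \<open>B_le\<close>; the best t turns the sum into a geometric mean. In this product form the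
  small mass of a single factor already makes \<open>B\<close> small.\<close>

lemma B_le_sqrt:
  assumes f: "dens f" and g: "dens g"
  shows "B f g \<le> 2 * C1 * sqrt (mass f powr a * L f) * sqrt (mass g powr a * L g)"
proof -
  define X where "X = mass g powr a * L f"
  define Y where "Y = mass f powr a * L g"
  have nn: "0 \<le> X" "0 \<le> Y" by (auto simp: X_def Y_def L_nonneg)
  have scaled: "B f g \<le> C1 * (t powr (2 * q) * X + t powr (- 2 * q) * Y)" if t: "0 < t" for t
  proof -
    have "B f g = B (\<lambda>x. t * f x) (\<lambda>x. (1 / t) * g x)"
      using t f g by (simp add: B_scale_left B_scale_right dens_scale del: times_divide_eq_left)
    also have "\<dots> \<le> C1 * (mass (\<lambda>x. (1 / t) * g x) powr a * L (\<lambda>x. t * f x)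
        + mass (\<lambda>x. t * f x) powr a * L (\<lambda>x. (1 / t) * g x))"
      using t f g by (intro B_le dens_scale) auto
    also have "mass (\<lambda>x. (1 / t) * g x) powr a * L (\<lambda>x. t * f x) = ((1 / t) powr a * t powr (1 + q)) * X"
      unfolding X_def using t by (subst L_scale[OF _ f]) (auto simp: powr_mult powr_divide mass_nonneg g)
    also have "(1 / t) powr a * t powr (1 + q) = t powr (2 * q)"
      
    proof -
      have "(1 / t) powr a = t powr - a" using t by (simp add: powr_divide flip: powr_minus_divide)
      then show ?thesis using t by (simp flip: powr_add)
    qed
    also have "mass (\<lambda>x. t * f x) powr a * L (\<lambda>x. (1 / t) * g x) = (t powr a * (1 / t) powr (1 + q)) * Y"
      unfolding Y_def using t by (subst L_scale[OF _ g]) (auto simp: powr_mult powr_divide mass_nonneg f)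
    also have "t powr a * (1 / t) powr (1 + q) = t powr (- 2 * q)"
    proof -
      have "(1 / t) powr (1 + q) = t powr - (1 + q)" using t by (simp add: powr_divide flip: powr_minus_divide)
      then show ?thesis using t by (simp flip: powr_add)
    qed
    finally show ?thesis .
  qed
  have "B f g \<le> 2 * C1 * sqrt (X * Y)"
  proof (cases "X = 0 \<or> Y = 0")
    case True
    then have "mass f = 0 \<or> mass g = 0"
      using f g q_less by (auto simp: X_def Y_def L_zero_iff)
    then have "X = 0 \<and> Y = 0" using f g by (auto simp: X_def Y_def L_zero_iff)
    then show ?thesis using scaled[of 1] by simp
  next
    case False
    then have pos: "0 < X" "0 < Y" using nn by auto
    define t where "t = (Y / X) powr (1 / (4 * q))"
    have t: "0 < t" using pos by (simp add: t_def)
    have "t powr (2 * q) = sqrt (Y / X)"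
      using q_pos pos by (simp add: t_def powr_powr powr_half_sqrt)
    moreover have "t powr (- 2 * q) = 1 / sqrt (Y / X)"
      using calculation t by (simp add: powr_minus_divide)
    ultimately have "B f g \<le> C1 * (sqrt (Y / X) * X + 1 / sqrt (Y / X) * Y)"
      using scaled[OF t] by simp
    also have "sqrt (Y / X) * X + 1 / sqrt (Y / X) * Y = 2 * sqrt (X * Y)"
      using pos by (simp add: real_sqrt_divide real_sqrt_mult field_simps)
    finally show ?thesis by simp
  qed
  also have "sqrt (X * Y) = sqrt (mass f powr a * L f) * sqrt (mass g powr a * L g)"
    by (simp add: X_def Y_def real_sqrt_mult mult_ac)
  finally show ?thesis by (simp add: mult.assoc)
qed

end

subsection \<open>Random configurations\<close>

text \<open>A configuration has countably many slots; a slot carries a position and a flag telling whether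
  the slot is occupied.\<close>

definition slots :: "(nat \<Rightarrow> 'a::euclidean_space \<times> bool) measure" where
  "slots = PiM UNIV (\<lambda>_. borel \<Otimes>\<^sub>M count_space UNIV)"

text \<open>Linear statistic of the point configuration. For the constant 1 it is the number of
  particles; for \<open>riesz_kernel s y\<close> it is the interaction of the configuration with an
  extra particle at y.\<close>

definition psum :: "('a \<Rightarrow> ennreal) \<Rightarrow> (nat \<Rightarrow> 'a::euclidean_space \<times> bool) \<Rightarrow> ennreal" where
  "psum f \<omega> = (\<Sum>i. if snd (\<omega> i) then f (fst (\<omega> i)) else 0)"

definition pcost :: "real \<Rightarrow> (nat \<Rightarrow> 'a::euclidean_space \<times> bool) \<Rightarrow> ennreal" where
  "pcost s \<omega> = (\<Sum>j. \<Sum>i<j. if snd (\<omega> i) \<and> snd (\<omega> j)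
      then riesz_kernel s (fst (\<omega> i)) (fst (\<omega> j)) else 0)"

lemma measurable_slot [measurable]:
  assumes [measurable]: "h \<in> measurable M slots"
  shows "(\<lambda>x. h x i) \<in> measurable M (borel \<Otimes>\<^sub>M count_space UNIV)"
proof -
  have "(\<lambda>\<omega>. \<omega> i) \<in> measurable slots (borel \<Otimes>\<^sub>M count_space UNIV)"
    unfolding slots_def by simp
  from measurable_compose[OF assms this] show ?thesis .
qed

lemma measurable_slots:
  "(\<And>i. (\<lambda>x. h x i) \<in> measurable M (borel \<Otimes>\<^sub>M count_space UNIV)) \<Longrightarrow> h \<in> measurable M slots"
  unfolding slots_def by (rule measurable_PiM_single') (auto dest: measurable_space)

lemma measurable_fst_slot [measurable]:
  "h \<in> measurable M slots \<Longrightarrow> (\<lambda>x. fst (h x i)) \<in> borel_measurable M"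
  by (rule measurable_compose[OF measurable_slot measurable_fst])

lemma measurable_snd_slot [measurable]:
  "h \<in> measurable M slots \<Longrightarrow> Measurable.pred M (\<lambda>x. snd (h x i))"
  by (rule measurable_compose[OF measurable_slot measurable_snd])

lemma measurable_psum [measurable]:
  assumes [measurable]: "h \<in> measurable M slots" "f \<in> borel_measurable borel"
  shows "(\<lambda>x. psum f (h x)) \<in> borel_measurable M"
  unfolding psum_def by measurable

lemma measurable_pcost [measurable]:
  assumes [measurable]: "h \<in> measurable M slots"
  shows "(\<lambda>x. pcost s (h x)) \<in> borel_measurable M"
  unfolding pcost_def by measurable

lemma measurable_psum' [measurable]: "f \<in> borel_measurable borel \<Longrightarrow> psum f \<in> borel_measurable slots"
  using measurable_psum[of "\<lambda>x. x" slots f] by simp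

lemma measurable_pcost' [measurable]: "pcost s \<in> borel_measurable slots"
  using measurable_pcost[of "\<lambda>x. x" slots s] by simp

lemma suminf_case_nat:
  fixes f :: "nat \<Rightarrow> ennreal"
  shows "(\<Sum>n. f n) = f 0 + (\<Sum>n. f (Suc n))"
  using sums_Suc[of f "\<Sum>n. f (Suc n)"] by (simp add: sums_iff add.commute)

text \<open>\<open>case_nat\<close> prepends a slot and shifts the others, so there is an empty
  place for a new particle whatever the occupation of the old slots.\<close>

lemma psum_case_nat:
  "psum f (case_nat (y, b) \<omega>) = (if b then f y else 0) + psum f \<omega>"
  unfolding psum_def by (subst suminf_case_nat) (simp cong: if_cong)

lemma pcost_case_nat:
  "pcost s (case_nat (y, b) \<omega>) = (if b then psum (riesz_kernel s y) \<omega> else 0) + pcost s \<omega>"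
proof -
  have "pcost s (case_nat (y, b) \<omega>) = (\<Sum>j. (if b then (if snd (\<omega> j) then riesz_kernel s y (fst (\<omega> j)) else 0) else 0)
      + (\<Sum>i<j. if snd (\<omega> i) \<and> snd (\<omega> j) then riesz_kernel s (fst (\<omega> i)) (fst (\<omega> j)) else 0))"
    unfolding pcost_def by (subst suminf_case_nat) (auto simp: sum.lessThan_Suc_shift simp del: sum.lessThan_Suc intro!: suminf_cong cong: if_cong)
  then show ?thesis
    unfolding pcost_def psum_def by (subst (asm) suminf_add[symmetric]) auto
qed

lemma psum_mono: "(\<And>x. f x \<le> g x) \<Longrightarrow> psum f \<omega> \<le> psum g \<omega>"
  unfolding psum_def by (intro suminf_le) auto

lemma psum_cmult: "psum (\<lambda>x. c * f x) \<omega> = c * psum f \<omega>"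
  using ennreal_suminf_cmult[of c "\<lambda>i. if snd (\<omega> i) then f (fst (\<omega> i)) else 0"]
  by (simp add: psum_def if_distrib[of "(*) c"] cong: if_cong)

lemma nn_integral_psum:
  assumes "\<And>x. (\<lambda>y. f y x) \<in> borel_measurable M"
  shows "(\<integral>\<^sup>+y. psum (f y) \<omega> \<partial>M) = psum (\<lambda>x. \<integral>\<^sup>+y. f y x \<partial>M) \<omega>"
  unfolding psum_def using assms by (subst nn_integral_suminf) (auto intro!: suminf_cong)

text \<open>The last clause is Campbell's formula: \<open>\<rho>\<close> is the intensity of the
  point process. Slots are labelled and no invariance under permutations is imposed; symmetry is
  restored only in \<open>symmetrize\<close>.\<close>

definition state :: "nat \<Rightarrow> (nat \<Rightarrow> 'a::euclidean_space \<times> bool) measure \<Rightarrow> ('a \<Rightarrow> real) \<Rightarrow> bool" where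
  "state N P \<rho> \<longleftrightarrow> prob_space P \<and> sets P = sets slots \<and> (AE \<omega> in P. psum (\<lambda>_. 1) \<omega> \<le> of_nat N)
     \<and> (\<forall>f\<in>borel_measurable borel. (\<integral>\<^sup>+\<omega>. psum f \<omega> \<partial>P) = (\<integral>\<^sup>+x. f x * ennreal (\<rho> x) \<partial>lborel))"

definition cost :: "real \<Rightarrow> (nat \<Rightarrow> 'a::euclidean_space \<times> bool) measure \<Rightarrow> ennreal" where
  "cost s P = (\<integral>\<^sup>+\<omega>. pcost s \<omega> \<partial>P)"

lemma state_prob: "state N P \<rho> \<Longrightarrow> prob_space P"
  and state_sets: "state N P \<rho> \<Longrightarrow> sets P = sets slots"
  and state_count: "state N P \<rho> \<Longrightarrow> AE \<omega> in P. psum (\<lambda>_. 1) \<omega> \<le> of_nat N"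
  and state_density: "state N P \<rho> \<Longrightarrow> f \<in> borel_measurable borel \<Longrightarrow>
    (\<integral>\<^sup>+\<omega>. psum f \<omega> \<partial>P) = (\<integral>\<^sup>+x. f x * ennreal (\<rho> x) \<partial>lborel)"
  by (auto simp: state_def)

lemma cost_distr: "h \<in> measurable M slots \<Longrightarrow> cost s (distr M slots h) = (\<integral>\<^sup>+x. pcost s (h x) \<partial>M)"
  unfolding cost_def by (subst nn_integral_distr) auto

lemma state_distr:
  assumes "prob_space M" and h[measurable]: "h \<in> measurable M slots"
    and "AE x in M. psum (\<lambda>_. 1) (h x) \<le> of_nat N"
    and "\<And>f. f \<in> borel_measurable borel \<Longrightarrow>
      (\<integral>\<^sup>+x. psum f (h x) \<partial>M) = (\<integral>\<^sup>+x. f x * ennreal (\<rho> x) \<partial>lborel)"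
  shows "state N (distr M slots h) \<rho>"
proof -
  interpret prob_space M by fact
  have "prob_space (distr M slots h)" by (rule prob_space_distr) fact
  moreover have "AE \<omega> in distr M slots h. psum (\<lambda>_. 1) \<omega> \<le> of_nat N"
    using assms(3) by (subst AE_distr_iff) auto
  ultimately show ?thesis
    using assms(4) by (auto simp: state_def nn_integral_distr)
qed

lemma state_le: "state N P \<rho> \<Longrightarrow> N \<le> N' \<Longrightarrow> state N' P \<rho>"
  unfolding state_def by (auto elim!: eventually_mono intro: order_trans)

lemma state_empty: "\<exists>P. state N P (\<lambda>_::'a::euclidean_space. 0) \<and> cost s P = 0"
proof -
  let ?h = "\<lambda>_::unit. \<lambda>_::nat. (0::'a, False)"
  let ?M = "return (count_space UNIV) ()"
  have [measurable]: "?h \<in> measurable ?M slots"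
    by (rule measurable_slots) (simp add: space_pair_measure)
  have 0: "psum f (?h x) = 0" "pcost s (?h x) = 0" for f x by (auto simp: psum_def pcost_def)
  have h: "?h \<in> measurable ?M slots" by measurable
  have "state N (distr ?M slots ?h) (\<lambda>_. 0)"
    by (rule state_distr[OF _ h]) (auto intro!: prob_space_return simp: 0)
  moreover have "cost s (distr ?M slots ?h) = 0"
    using cost_distr[OF h, of s] by (simp add: 0)
  ultimately show ?thesis by blast
qed

section \<open>Thinning, mixing and inserting particles\<close>

definition thin :: "'a set \<Rightarrow> (nat \<Rightarrow> 'a::euclidean_space \<times> bool) \<Rightarrow> (nat \<Rightarrow> 'a \<times> bool)" where
  "thin E \<omega> = (\<lambda>i. (fst (\<omega> i), snd (\<omega> i) \<and> fst (\<omega> i) \<in> E))"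

lemma measurable_thin [measurable]:
  assumes [measurable]: "E \<in> sets borel" shows "thin E \<in> measurable slots slots"
  unfolding thin_def by (rule measurable_slots) measurable

lemma psum_thin: "psum f (thin E \<omega>) = psum (\<lambda>x. f x * indicator E x) \<omega>"
  unfolding psum_def thin_def by (intro suminf_cong) (auto simp: indicator_def)

text \<open>A pair inside E and a pair inside the complement are different pairs; those with one
  particle on each side are dropped.\<close>

lemma pcost_thin: "pcost s (thin E \<omega>) + pcost s (thin (- E) \<omega>) \<le> pcost s \<omega>"
  unfolding pcost_def
  by (subst suminf_add) (auto simp: thin_def sum.distrib[symmetric] intro!: suminf_le sum_mono)

lemma state_thin:
  assumes P: "state N P \<rho>" and [measurable]: "E \<in> sets borel"
  shows "state N (distr P slots (thin E)) (\<lambda>x. \<rho> x * indicator E x)"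
proof (rule state_distr)
  note [measurable_cong] = state_sets[OF P]
  show "prob_space P" using state_prob[OF P] .
  show "thin E \<in> measurable P slots" by measurable
  have "psum (\<lambda>_. 1) (thin E \<omega>) \<le> psum (\<lambda>_. 1) \<omega>" for \<omega>
    unfolding psum_thin by (rule psum_mono) (auto simp: indicator_def)
  with state_count[OF P] show "AE \<omega> in P. psum (\<lambda>_. 1) (thin E \<omega>) \<le> of_nat N"
    by (auto elim!: eventually_mono intro: order_trans)
  show "(\<integral>\<^sup>+\<omega>. psum f (thin E \<omega>) \<partial>P) = (\<integral>\<^sup>+x. f x * ennreal (\<rho> x * indicator E x) \<partial>lborel)"
    if [measurable]: "f \<in> borel_measurable borel" for f
    unfolding psum_thin
    by (subst state_density[OF P]) (auto intro!: nn_integral_cong simp: indicator_def)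
qed

lemma cost_thin:
  assumes P: "state N P \<rho>" and [measurable]: "E \<in> sets borel"
  shows "cost s (distr P slots (thin E)) + cost s (distr P slots (thin (- E))) \<le> cost s P"
proof -
  note [measurable_cong] = state_sets[OF P]
  have "cost s (distr P slots (thin E)) + cost s (distr P slots (thin (- E)))
     = (\<integral>\<^sup>+\<omega>. pcost s (thin E \<omega>) + pcost s (thin (- E) \<omega>) \<partial>P)"
    by (simp add: cost_distr nn_integral_add)
  also have "\<dots> \<le> cost s P"
    unfolding cost_def by (intro nn_integral_mono pcost_thin)
  finally show ?thesis .
qed

text \<open>With probability \<open>1 - c\<close> draw from \<open>P\<close>, keeping the result only on the event \<open>G\<close>;
  otherwise draw from \<open>Q\<close>.\<close>

lemma state_mix:
  assumes P: "state N P \<rho>" and Q: "state N Q \<sigma>" and c: "0 \<le> c" "c \<le> 1"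
    and [measurable]: "G \<in> sets slots"
    and [measurable]: "\<rho>' \<in> borel_measurable borel" "\<sigma> \<in> borel_measurable borel"
    and nn: "\<And>x. 0 \<le> \<rho>' x" "\<And>x. 0 \<le> \<sigma> x"
    and \<rho>': "\<And>f. f \<in> borel_measurable borel \<Longrightarrow>
      (\<integral>\<^sup>+\<omega>. psum f \<omega> * indicator G \<omega> \<partial>P) = (\<integral>\<^sup>+x. f x * ennreal (\<rho>' x) \<partial>lborel)"
  defines "w \<equiv> 1 - (1 - c) * measure P G"
  shows "\<exists>R. state N R (\<lambda>x. (1 - c) * \<rho>' x + w * \<sigma> x)
    \<and> cost s R \<le> ennreal (1 - c) * cost s P + ennreal w * cost s Q"
proof -
  interpret P: prob_space P using state_prob[OF P] .
  interpret Q: prob_space Q using state_prob[OF Q] .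
  interpret PQ: pair_prob_space P Q ..
  let ?b = "measure_pmf (bernoulli_pmf (1 - c))"
  interpret b: prob_space ?b by (rule measure_pmf.prob_space_axioms)
  interpret all: pair_prob_space ?b "P \<Otimes>\<^sub>M Q" ..
  note [measurable_cong] = state_sets[OF P] state_sets[OF Q]
  \<comment> \<open>The sample from Q is used when the coin fails or the sample from P misses G,
    which has total probability \<open>w\<close>.\<close>
  let ?h = "\<lambda>z. if fst z \<and> fst (snd z) \<in> G then fst (snd z) else snd (snd z)"
  let ?M = "?b \<Otimes>\<^sub>M (P \<Otimes>\<^sub>M Q)"
  have h[measurable]: "?h \<in> measurable ?M slots" by measurable
  have le1: "(1 - c) * P.prob G \<le> 1"
    using c mult_mono[of "1 - c" 1 "P.prob G" 1] by auto
  have w: "0 \<le> w" using le1 by (simp add: w_def)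
  have integral_h: "(\<integral>\<^sup>+z. F (?h z) \<partial>?M)
      = ennreal (1 - c) * (\<integral>\<^sup>+\<omega>. F \<omega> * indicator G \<omega> \<partial>P) + ennreal w * (\<integral>\<^sup>+\<omega>. F \<omega> \<partial>Q)"
    if [measurable]: "F \<in> borel_measurable slots" for F
  proof -
    have "(\<integral>\<^sup>+z. F (?h z) \<partial>?M) = (\<integral>\<^sup>+b. \<integral>\<^sup>+y. F (?h (b, y)) \<partial>(P \<Otimes>\<^sub>M Q) \<partial>?b)"
      by (subst PQ.nn_integral_fst[symmetric]) simp_all
    also have "\<dots> = (\<integral>\<^sup>+y. F (?h (True, y)) \<partial>(P \<Otimes>\<^sub>M Q)) * ennreal (1 - c) + (\<integral>\<^sup>+y. F (?h (False, y)) \<partial>(P \<Otimes>\<^sub>M Q)) * ennreal c"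
      using c by (subst nn_integral_bernoulli_pmf) auto
    also have "(\<integral>\<^sup>+y. F (?h (False, y)) \<partial>(P \<Otimes>\<^sub>M Q)) = (\<integral>\<^sup>+\<omega>. \<integral>\<^sup>+\<omega>'. F \<omega>' \<partial>Q \<partial>P)"
      by (subst Q.nn_integral_fst[symmetric]) auto
    also have "\<dots> = (\<integral>\<^sup>+\<omega>. F \<omega> \<partial>Q)" by (simp add: P.emeasure_space_1)
    also have "(\<integral>\<^sup>+y. F (?h (True, y)) \<partial>(P \<Otimes>\<^sub>M Q))
        = (\<integral>\<^sup>+\<omega>. \<integral>\<^sup>+\<omega>'. F (if \<omega> \<in> G then \<omega> else \<omega>') \<partial>Q \<partial>P)"
      by (simp, subst Q.nn_integral_fst[symmetric]) (simp_all cong: if_cong)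
    also have "\<dots> = (\<integral>\<^sup>+\<omega>. F \<omega> * indicator G \<omega> + (\<integral>\<^sup>+\<omega>'. F \<omega>' \<partial>Q) * indicator (space P - G) \<omega> \<partial>P)"
      by (intro nn_integral_cong) (auto simp: indicator_def Q.emeasure_space_1)
    also have "\<dots> = (\<integral>\<^sup>+\<omega>. F \<omega> * indicator G \<omega> \<partial>P) + (\<integral>\<^sup>+\<omega>. F \<omega> \<partial>Q) * emeasure P (space P - G)"
      by (subst nn_integral_add) (auto simp: nn_integral_cmult_indicator)
    also have "emeasure P (space P - G) = ennreal (1 - P.prob G)"
      using P.prob_compl[of G] state_sets[OF P] by (simp add: P.emeasure_eq_measure)
    also have "((\<integral>\<^sup>+\<omega>. F \<omega> * indicator G \<omega> \<partial>P) + (\<integral>\<^sup>+\<omega>. F \<omega> \<partial>Q) * ennreal (1 - P.prob G)) * ennreal (1 - c) + (\<integral>\<^sup>+\<omega>. F \<omega> \<partial>Q) * ennreal c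
       = ennreal (1 - c) * (\<integral>\<^sup>+\<omega>. F \<omega> * indicator G \<omega> \<partial>P) + (ennreal (1 - P.prob G) * ennreal (1 - c) + ennreal c) * (\<integral>\<^sup>+\<omega>. F \<omega> \<partial>Q)"
      by (simp add: algebra_simps)
    also have "ennreal (1 - P.prob G) * ennreal (1 - c) + ennreal c = ennreal w"
    proof -
      have "0 \<le> (1 - P.prob G) * (1 - c)" using c by simp
      then have "ennreal ((1 - P.prob G) * (1 - c)) + ennreal c = ennreal ((1 - P.prob G) * (1 - c) + c)"
        using c by simp
      then show ?thesis using c by (simp add: ennreal_mult[symmetric] w_def algebra_simps)
    qed
    finally show ?thesis .
  qed
  have "state N (distr ?M slots ?h) (\<lambda>x. (1 - c) * \<rho>' x + w * \<sigma> x)"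
  proof (rule state_distr)
    show "prob_space ?M" by unfold_locales
    have "AE z in ?M. psum (\<lambda>_. 1) (fst (snd z)) \<le> of_nat N"
    proof -
      have "AE y in P \<Otimes>\<^sub>M Q. psum (\<lambda>_. 1) (fst y) \<le> of_nat N"
        using state_count[OF P]
        by (subst PQ.AE_pair_iff[of "\<lambda>\<omega> \<omega>'. psum (\<lambda>_. 1) \<omega> \<le> of_nat N", symmetric]) auto
      then show ?thesis
        by (subst all.AE_pair_iff[of "\<lambda>b y. psum (\<lambda>_. 1) (fst y) \<le> of_nat N", symmetric]) auto
    qed
    moreover have "AE z in ?M. psum (\<lambda>_. 1) (snd (snd z)) \<le> of_nat N"
    proof -
      have "AE y in P \<Otimes>\<^sub>M Q. psum (\<lambda>_. 1) (snd y) \<le> of_nat N"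
        using state_count[OF Q]
        by (subst PQ.AE_pair_iff[of "\<lambda>\<omega> \<omega>'. psum (\<lambda>_. 1) \<omega>' \<le> of_nat N", symmetric]) auto
      then show ?thesis
        by (subst all.AE_pair_iff[of "\<lambda>b y. psum (\<lambda>_. 1) (snd y) \<le> of_nat N", symmetric]) auto
    qed
    ultimately show "AE z in ?M. psum (\<lambda>_. 1) (?h z) \<le> of_nat N"
      by eventually_elim auto
    fix f :: "'a \<Rightarrow> ennreal" assume [measurable]: "f \<in> borel_measurable borel"
    have "(\<integral>\<^sup>+z. psum f (?h z) \<partial>?M) = ennreal (1 - c) * (\<integral>\<^sup>+x. f x * ennreal (\<rho>' x) \<partial>lborel)
        + ennreal w * (\<integral>\<^sup>+x. f x * ennreal (\<sigma> x) \<partial>lborel)"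
      by (simp add: integral_h \<rho>' state_density[OF Q])
    also have "\<dots> = (\<integral>\<^sup>+x. f x * ennreal ((1 - c) * \<rho>' x + w * \<sigma> x) \<partial>lborel)"
    proof -
      have "f x * ennreal ((1 - c) * \<rho>' x + w * \<sigma> x)
          = ennreal (1 - c) * (f x * ennreal (\<rho>' x)) + ennreal w * (f x * ennreal (\<sigma> x))" for x
        using c w nn by (simp add: ennreal_mult distrib_left mult_ac)
      then show ?thesis by (simp add: nn_integral_cmult[symmetric] nn_integral_add[symmetric])
    qed
    finally show "(\<integral>\<^sup>+z. psum f (?h z) \<partial>?M) = (\<integral>\<^sup>+x. f x * ennreal ((1 - c) * \<rho>' x + w * \<sigma> x) \<partial>lborel)" .
  qed fact
  moreover have "cost s (distr ?M slots ?h) \<le> ennreal (1 - c) * cost s P + ennreal w * cost s Q"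
  proof -
    have "(\<integral>\<^sup>+\<omega>. pcost s \<omega> * indicator G \<omega> \<partial>P) \<le> cost s P"
      unfolding cost_def by (intro nn_integral_mono) (auto simp: indicator_def)
    then show ?thesis
      using cost_distr[OF h, of s] integral_h[OF measurable_pcost', of s]
      by (auto simp: cost_def intro!: add_mono mult_left_mono)
  qed
  ultimately show ?thesis by blast
qed

text \<open>The new particle is drawn from u independently of the configuration and switched on only
  when the configuration lies in G. Its mean repulsion is therefore the potential of u summed over
  the configuration, restricted to G. The bound on the count covers both filling a free place
  (\<open>N'\<close> = N) and adding a place (\<open>N'\<close> = N + 1).\<close>

lemma state_insert:
  fixes u :: "'a::euclidean_space \<Rightarrow> real"
  assumes P: "state N P \<rho>"
    and [measurable]: "u \<in> borel_measurable borel" "\<rho> \<in> borel_measurable borel" "G \<in> sets slots"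
    and nn: "\<And>x. 0 \<le> u x" "\<And>x. 0 \<le> \<rho> x" and u: "(\<integral>\<^sup>+x. ennreal (u x) \<partial>lborel) = 1"
    and count: "AE \<omega> in P. psum (\<lambda>_. 1) \<omega> + indicator G \<omega> \<le> of_nat N'"
  shows "\<exists>R. state N' R (\<lambda>x. \<rho> x + measure P G * u x)
    \<and> cost s R = cost s P + (\<integral>\<^sup>+\<omega>. psum (\<lambda>x. \<integral>\<^sup>+y. ennreal (u y) * riesz_kernel s x y \<partial>lborel) \<omega> * indicator G \<omega> \<partial>P)"
proof -
  interpret P: prob_space P using state_prob[OF P] .
  let ?U = "density lborel (\<lambda>x. ennreal (u x))"
  interpret U: prob_space ?U using u by (auto intro!: prob_spaceI simp: emeasure_density)
  have U_UNIV: "emeasure ?U UNIV = 1" using U.emeasure_space_1 by simp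
  interpret PU: pair_prob_space P ?U ..
  note [measurable_cong] = state_sets[OF P]
  let ?M = "P \<Otimes>\<^sub>M ?U"
  let ?h = "\<lambda>z. case_nat (snd z, fst z \<in> G) (fst z)"
  have h[measurable]: "?h \<in> measurable ?M slots"
  proof (rule measurable_slots)
    fix i show "(\<lambda>z. ?h z i) \<in> measurable ?M (borel \<Otimes>\<^sub>M count_space UNIV)"
      by (cases i) auto
  qed
  have integral_h: "(\<integral>\<^sup>+z. F (fst z) + (if fst z \<in> G then H (fst z) (snd z) else 0) \<partial>?M)
    = (\<integral>\<^sup>+\<omega>. F \<omega> \<partial>P) + (\<integral>\<^sup>+\<omega>. (\<integral>\<^sup>+y. ennreal (u y) * H \<omega> y \<partial>lborel) * indicator G \<omega> \<partial>P)"
    if [measurable]: "F \<in> borel_measurable slots" "(\<lambda>z. H (fst z) (snd z)) \<in> borel_measurable (slots \<Otimes>\<^sub>M borel)" for F H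
  proof -
    have [measurable]: "H \<omega> \<in> borel_measurable borel" if "\<omega> \<in> space P" for \<omega>
      using measurable_compose[OF measurable_Pair1' \<open>(\<lambda>z. H (fst z) (snd z)) \<in> _\<close>, of \<omega>] that
      by (simp add: sets_eq_imp_space_eq[OF state_sets[OF P]])
    have "(\<integral>\<^sup>+z. F (fst z) + (if fst z \<in> G then H (fst z) (snd z) else 0) \<partial>?M)
      = (\<integral>\<^sup>+\<omega>. \<integral>\<^sup>+y. F \<omega> + (if \<omega> \<in> G then H \<omega> y else 0) \<partial>?U \<partial>P)"
      by (subst U.nn_integral_fst[symmetric]) (auto cong: if_cong)
    also have "\<dots> = (\<integral>\<^sup>+\<omega>. F \<omega> + (\<integral>\<^sup>+y. ennreal (u y) * H \<omega> y \<partial>lborel) * indicator G \<omega> \<partial>P)"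
    proof (intro nn_integral_cong)
      fix \<omega> assume [measurable]: "\<omega> \<in> space P"
      show "(\<integral>\<^sup>+y. F \<omega> + (if \<omega> \<in> G then H \<omega> y else 0) \<partial>?U) = F \<omega> + (\<integral>\<^sup>+y. ennreal (u y) * H \<omega> y \<partial>lborel) * indicator G \<omega>"
        by (cases "\<omega> \<in> G") (auto simp: nn_integral_add nn_integral_density U_UNIV)
    qed
    also have "\<dots> = (\<integral>\<^sup>+\<omega>. F \<omega> \<partial>P) + (\<integral>\<^sup>+\<omega>. (\<integral>\<^sup>+y. ennreal (u y) * H \<omega> y \<partial>lborel) * indicator G \<omega> \<partial>P)"
      by (intro nn_integral_add) measurable
    finally show ?thesis .
  qed
  have PG: "(\<integral>\<^sup>+\<omega>. c * indicator G \<omega> \<partial>P) = c * ennreal (P.prob G)" for c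
    using state_sets[OF P] by (simp add: nn_integral_cmult_indicator P.emeasure_eq_measure)
  have "state N' (distr ?M slots ?h) (\<lambda>x. \<rho> x + measure P G * u x)"
  proof (rule state_distr)
    show "prob_space ?M" by unfold_locales
    have "AE z in ?M. psum (\<lambda>_. 1) (fst z) + indicator G (fst z) \<le> of_nat N'"
    proof -
      have "{z \<in> space ?M. psum (\<lambda>_. 1) (fst z) + indicator G (fst z) \<le> (of_nat N' :: ennreal)} \<in> sets ?M"
        by measurable
      from PU.AE_pair_iff[of "\<lambda>\<omega> y. psum (\<lambda>_. 1) \<omega> + indicator G \<omega> \<le> of_nat N'", OF this] count
      show ?thesis by simp
    qed
    then show "AE z in ?M. psum (\<lambda>_. 1) (?h z) \<le> of_nat N'"
      by eventually_elim (auto simp: psum_case_nat add.commute indicator_def split: if_splits)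
    fix f :: "'a \<Rightarrow> ennreal" assume [measurable]: "f \<in> borel_measurable borel"
    have "(\<integral>\<^sup>+z. psum f (?h z) \<partial>?M) = (\<integral>\<^sup>+z. psum f (fst z) + (if fst z \<in> G then f (snd z) else 0) \<partial>?M)"
      by (simp add: psum_case_nat add.commute)
    also have "\<dots> = (\<integral>\<^sup>+x. f x * ennreal (\<rho> x) \<partial>lborel) + (\<integral>\<^sup>+x. ennreal (u x) * f x \<partial>lborel) * ennreal (P.prob G)"
      by (subst integral_h) (auto simp: state_density[OF P] PG)
    also have "\<dots> = (\<integral>\<^sup>+x. f x * ennreal (\<rho> x + P.prob G * u x) \<partial>lborel)"
    proof -
      have "f x * ennreal (\<rho> x + P.prob G * u x)
          = f x * ennreal (\<rho> x) + ennreal (u x) * f x * ennreal (P.prob G)" for x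
        using nn by (simp add: ennreal_mult distrib_left mult_ac)
      then show ?thesis by (simp add: nn_integral_multc[symmetric] nn_integral_add[symmetric])
    qed
    finally show "(\<integral>\<^sup>+z. psum f (?h z) \<partial>?M) = (\<integral>\<^sup>+x. f x * ennreal (\<rho> x + P.prob G * u x) \<partial>lborel)" .
  qed fact
  moreover have "cost s (distr ?M slots ?h) = cost s P + (\<integral>\<^sup>+\<omega>. psum (\<lambda>x. \<integral>\<^sup>+y. ennreal (u y) * riesz_kernel s x y \<partial>lborel) \<omega> * indicator G \<omega> \<partial>P)"
  proof -
    have m: "(\<lambda>z. psum (riesz_kernel s (snd z)) (fst z)) \<in> borel_measurable (slots \<Otimes>\<^sub>M borel)"
      unfolding psum_def by measurable
    have "cost s (distr ?M slots ?h) = (\<integral>\<^sup>+z. pcost s (fst z) + (if fst z \<in> G then psum (riesz_kernel s (snd z)) (fst z) else 0) \<partial>?M)"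
      by (subst cost_distr[OF h]) (simp add: pcost_case_nat add.commute)
    also have "\<dots> = cost s P + (\<integral>\<^sup>+\<omega>. (\<integral>\<^sup>+y. ennreal (u y) * psum (riesz_kernel s y) \<omega> \<partial>lborel) * indicator G \<omega> \<partial>P)"
      by (subst integral_h) (auto simp: cost_def m)
    also have "(\<lambda>\<omega>. \<integral>\<^sup>+y. ennreal (u y) * psum (riesz_kernel s y) \<omega> \<partial>lborel)
       = psum (\<lambda>x. \<integral>\<^sup>+y. ennreal (u y) * riesz_kernel s x y \<partial>lborel)"
      by (auto simp: psum_cmult[symmetric] nn_integral_psum riesz_kernel_commute)
    finally show ?thesis .
  qed
  ultimately show ?thesis by blast
qed

text \<open>The particles present on G form a measure dominated by \<rho> times Lebesgue measure,
  and Radon-Nikodym gives its density.\<close>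

lemma state_restrict_density:
  fixes \<rho> :: "'a::euclidean_space \<Rightarrow> real"
  assumes P: "state N P \<rho>" and [measurable]: "\<rho> \<in> borel_measurable borel" "G \<in> sets slots"
    and nn: "\<And>x. 0 \<le> \<rho> x" and int: "integrable lborel \<rho>"
  obtains \<rho>' where "\<rho>' \<in> borel_measurable borel" "\<And>x. 0 \<le> \<rho>' x" "\<And>x. \<rho>' x \<le> \<rho> x"
    "\<And>f. f \<in> borel_measurable borel \<Longrightarrow>
      (\<integral>\<^sup>+\<omega>. psum f \<omega> * indicator G \<omega> \<partial>P) = (\<integral>\<^sup>+x. f x * ennreal (\<rho>' x) \<partial>lborel)"
proof -
  interpret P: prob_space P using state_prob[OF P] .
  note [measurable_cong] = state_sets[OF P]
  let ?C = "count_space (UNIV :: nat set)"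
  interpret C: sigma_finite_measure ?C by (rule sigma_finite_measure_count_space)
  let ?w = "\<lambda>z. (if snd (fst z (snd z)) \<and> fst z \<in> G then 1 else 0) :: ennreal"
  have [measurable]: "(\<lambda>z. fst z (snd z)) \<in> measurable (P \<Otimes>\<^sub>M ?C) (borel \<Otimes>\<^sub>M count_space UNIV)"
    by (rule measurable_compose_countable[of "\<lambda>i z. fst z i"]) measurable
  have [measurable]: "(\<lambda>z. fst (fst z (snd z))) \<in> borel_measurable (P \<Otimes>\<^sub>M ?C)"
    by (rule measurable_compose[OF _ measurable_fst]) measurable
  have [measurable]: "Measurable.pred (P \<Otimes>\<^sub>M ?C) (\<lambda>z. snd (fst z (snd z)))"
    by (rule measurable_compose[OF _ measurable_snd]) measurable
  \<comment> \<open>Pairs of a sample in G and an occupied slot, counted with weight 1 and pushed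
    forward to the position of the slot.\<close>
  define \<nu> where "\<nu> = distr (density (P \<Otimes>\<^sub>M ?C) ?w) borel (\<lambda>z. fst (fst z (snd z)))"
  have nu: "(\<integral>\<^sup>+x. f x \<partial>\<nu>) = (\<integral>\<^sup>+\<omega>. psum f \<omega> * indicator G \<omega> \<partial>P)"
    if [measurable]: "f \<in> borel_measurable borel" for f
  proof -
    have "(\<integral>\<^sup>+x. f x \<partial>\<nu>) = (\<integral>\<^sup>+z. ?w z * f (fst (fst z (snd z))) \<partial>(P \<Otimes>\<^sub>M ?C))"
      unfolding \<nu>_def by (subst nn_integral_distr) (auto simp: nn_integral_density)
    also have "\<dots> = (\<integral>\<^sup>+\<omega>. \<integral>\<^sup>+i. ?w (\<omega>, i) * f (fst (\<omega> i)) \<partial>?C \<partial>P)"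
      by (subst C.nn_integral_fst[symmetric]) auto
    also have "\<dots> = (\<integral>\<^sup>+\<omega>. psum f \<omega> * indicator G \<omega> \<partial>P)"
      unfolding psum_def nn_integral_count_space_nat
      by (intro nn_integral_cong) (auto simp: indicator_def intro!: suminf_cong)
    finally show ?thesis .
  qed
  have nu_le: "(\<integral>\<^sup>+x. f x \<partial>\<nu>) \<le> (\<integral>\<^sup>+x. f x * ennreal (\<rho> x) \<partial>lborel)"
    if [measurable]: "f \<in> borel_measurable borel" for f
    unfolding nu[OF that] state_density[OF P that, symmetric]
    by (intro nn_integral_mono) (auto simp: indicator_def)
  have sets_nu [simp, measurable_cong]: "sets \<nu> = sets borel" by (simp add: \<nu>_def)
  have "absolutely_continuous lborel \<nu>"
    unfolding absolutely_continuous_def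
  proof
    fix A :: "'a set" assume A: "A \<in> null_sets lborel"
    then have [measurable]: "A \<in> sets borel" by auto
    have "emeasure \<nu> A = (\<integral>\<^sup>+x. indicator A x \<partial>\<nu>)" by simp
    also have "\<dots> \<le> (\<integral>\<^sup>+x. indicator A x * ennreal (\<rho> x) \<partial>lborel)" by (rule nu_le) measurable
    also have "\<dots> = 0"
      using AE_not_in[OF A] by (subst nn_integral_0_iff_AE) (auto elim!: eventually_mono)
    finally show "A \<in> null_sets \<nu>" by auto
  qed
  then obtain f where f [measurable]: "f \<in> borel_measurable lborel" and dens: "density lborel f = \<nu>"
    using sigma_finite_measure.Radon_Nikodym[OF sigma_finite_lborel, of \<nu>] by auto
  let ?A = "{x. ennreal (\<rho> x) < f x}"
  have fin: "(\<integral>\<^sup>+x. ennreal (\<rho> x) * indicator ?A x \<partial>lborel) < \<infinity>"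
  proof -
    have "(\<integral>\<^sup>+x. ennreal (\<rho> x) * indicator ?A x \<partial>lborel) \<le> (\<integral>\<^sup>+x. ennreal (\<rho> x) \<partial>lborel)"
      by (intro nn_integral_mono) (auto simp: indicator_def)
    also have "\<dots> < \<infinity>" using int nn by (simp add: nn_integral_eq_integral)
    finally show ?thesis .
  qed
  have "(\<integral>\<^sup>+x. (f x - ennreal (\<rho> x)) * indicator ?A x \<partial>lborel)
      = (\<integral>\<^sup>+x. f x * indicator ?A x - ennreal (\<rho> x) * indicator ?A x \<partial>lborel)"
    by (intro nn_integral_cong) (auto simp: indicator_def)
  also have "\<dots> = (\<integral>\<^sup>+x. f x * indicator ?A x \<partial>lborel) - (\<integral>\<^sup>+x. ennreal (\<rho> x) * indicator ?A x \<partial>lborel)"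
    using fin by (intro nn_integral_diff) (auto simp: indicator_def)
  also have "\<dots> = 0"
  proof -
    have "(\<integral>\<^sup>+x. f x * indicator ?A x \<partial>lborel) = (\<integral>\<^sup>+x. indicator ?A x \<partial>\<nu>)"
      unfolding dens[symmetric] by (subst nn_integral_density) auto
    also have "\<dots> \<le> (\<integral>\<^sup>+x. indicator ?A x * ennreal (\<rho> x) \<partial>lborel)" by (rule nu_le) measurable
    finally show ?thesis using fin
      by (auto simp: mult.commute diff_eq_0_iff_ennreal intro: le_less_trans)
  qed
  finally have "AE x in lborel. (f x - ennreal (\<rho> x)) * indicator ?A x = 0"
    by (subst (asm) nn_integral_0_iff_AE) auto
  then have le: "AE x in lborel. f x \<le> ennreal (\<rho> x)"
    by (rule eventually_mono) (auto simp: indicator_def not_less diff_eq_0_iff_ennreal split: if_splits)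
  \<comment> \<open>The minimum changes f only on a null set and makes the bound by \<rho> hold
    everywhere.\<close>
  define \<rho>' where "\<rho>' = (\<lambda>x. enn2real (min (f x) (ennreal (\<rho> x))))"
  have "\<rho>' \<in> borel_measurable borel" "\<And>x. 0 \<le> \<rho>' x" by (auto simp: \<rho>'_def)
  moreover have "\<rho>' x \<le> \<rho> x" for x
    unfolding \<rho>'_def by (rule order_trans[OF enn2real_mono[of _ "ennreal (\<rho> x)"]]) (auto simp: nn)
  moreover have "(\<integral>\<^sup>+\<omega>. psum F \<omega> * indicator G \<omega> \<partial>P) = (\<integral>\<^sup>+x. F x * ennreal (\<rho>' x) \<partial>lborel)"
    if [measurable]: "F \<in> borel_measurable borel" for F
  proof -
    have "AE x in lborel. ennreal (\<rho>' x) = f x"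
      using le by (rule eventually_mono) (auto simp: \<rho>'_def min_def ennreal_enn2real_if top_unique)
    then have "(\<integral>\<^sup>+x. F x * ennreal (\<rho>' x) \<partial>lborel) = (\<integral>\<^sup>+x. f x * F x \<partial>lborel)"
      by (intro nn_integral_cong_AE) (auto simp: mult.commute elim!: eventually_mono)
    also have "\<dots> = (\<integral>\<^sup>+x. F x \<partial>\<nu>)"
      unfolding dens[symmetric] by (subst nn_integral_density) auto
    finally show ?thesis by (simp add: nu)
  qed
  ultimately show thesis by (rule that)
qed

lemma psum_one: "psum (\<lambda>_. 1) \<omega> = emeasure (count_space UNIV) {i. snd (\<omega> i)}"
proof -
  have "psum (\<lambda>_. 1) \<omega> = (\<Sum>i. indicator {i. snd (\<omega> i)} i)"
    unfolding psum_def by (intro suminf_cong) (auto simp: indicator_def)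
  also have "\<dots> = (\<integral>\<^sup>+i. indicator {i. snd (\<omega> i)} i \<partial>count_space UNIV)"
    by (rule nn_integral_count_space_nat[symmetric])
  finally show ?thesis by simp
qed

lemma psum_one_cases:
  obtains n where "psum (\<lambda>_. 1) \<omega> = of_nat n" | "psum (\<lambda>_. 1) \<omega> = \<infinity>"
  unfolding psum_one by (cases "finite {i. snd (\<omega> i)}") (auto simp: emeasure_count_space)

text \<open>Counts are natural numbers or infinite, so a strict inequality leaves a whole place
  free.\<close>

lemma psum_one_less: "psum (\<lambda>_. 1) \<omega> < of_nat N \<Longrightarrow> psum (\<lambda>_. 1) \<omega> + 1 \<le> of_nat N"
proof (rule psum_one_cases[of \<omega>])
  fix n assume n: "psum (\<lambda>_. 1) \<omega> = of_nat n" and "psum (\<lambda>_. 1) \<omega> < of_nat N"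
  then have "Suc n \<le> N" by simp
  then have "of_nat (Suc n) \<le> (of_nat N :: ennreal)" by (rule of_nat_mono)
  then show "psum (\<lambda>_. 1) \<omega> + 1 \<le> of_nat N" by (simp add: n add.commute)
qed simp

lemma state_cong_AE:
  assumes "state N P \<rho>" "AE x in lborel. \<rho> x = \<rho>' x"
  shows "state N P \<rho>'"
proof -
  have "(\<integral>\<^sup>+x. f x * ennreal (\<rho> x) \<partial>lborel) = (\<integral>\<^sup>+x. f x * ennreal (\<rho>' x) \<partial>lborel)" for f
    using assms(2) by (intro nn_integral_cong_AE) (auto elim!: eventually_mono)
  then show ?thesis using assms(1) by (simp add: state_def)
qed

subsection \<open>The relaxed energy\<close>

context riesz_exponent begin

definition adm :: "nat \<Rightarrow> ('a \<Rightarrow> real) \<Rightarrow> bool" where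
  "adm N \<rho> \<longleftrightarrow> dens \<rho> \<and> mass \<rho> \<le> real N"

lemma adm_dens: "adm N \<rho> \<Longrightarrow> dens \<rho>" and adm_mass: "adm N \<rho> \<Longrightarrow> mass \<rho> \<le> real N"
  by (auto simp: adm_def)

text \<open>The real number c is only an upper bound for the cost of some state. Estimates can thus
  be done in \<open>real\<close>, and the infimum \<open>W\<close> is approximated without being
  attained.\<close>

definition ach :: "nat \<Rightarrow> ('a \<Rightarrow> real) \<Rightarrow> real \<Rightarrow> bool" where
  "ach N \<rho> c \<longleftrightarrow> 0 \<le> c \<and> (\<exists>P. state N P \<rho> \<and> cost s P \<le> ennreal c)"

lemma ach_mono: "ach N \<rho> c \<Longrightarrow> c \<le> c' \<Longrightarrow> N \<le> N' \<Longrightarrow> ach N' \<rho> c'"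
  unfolding ach_def by (meson ennreal_leI order_trans state_le)

lemma ach_empty: "ach N (\<lambda>_. 0) 0"
  using state_empty[where 'a='a, of N s] by (auto simp: ach_def)

text \<open>\<open>state_mix\<close> with the whole space as event: the second state is then drawn
  with probability exactly t.\<close>

lemma ach_mix:
  assumes "ach N \<rho> c" "ach N \<sigma> d" "0 \<le> t" "t \<le> 1" "dens \<rho>" "dens \<sigma>"
  shows "ach N (\<lambda>x. (1 - t) * \<rho> x + t * \<sigma> x) ((1 - t) * c + t * d)"
proof -
  obtain P Q where P: "state N P \<rho>" "cost s P \<le> ennreal c" and Q: "state N Q \<sigma>" "cost s Q \<le> ennreal d"
    using assms by (auto simp: ach_def)
  interpret P: prob_space P using state_prob[OF P(1)] .
  have sp: "space P = space slots" using state_sets[OF P(1)] by (rule sets_eq_imp_space_eq)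
  have "\<exists>R. state N R (\<lambda>x. (1 - t) * \<rho> x + (1 - (1 - t) * P.prob (space slots)) * \<sigma> x)
    \<and> cost s R \<le> ennreal (1 - t) * cost s P + ennreal (1 - (1 - t) * P.prob (space slots)) * cost s Q"
  proof (rule state_mix[OF P(1) Q(1)])
    fix f :: "'a \<Rightarrow> ennreal" assume "f \<in> borel_measurable borel"
    from state_density[OF P(1) this]
    show "(\<integral>\<^sup>+\<omega>. psum f \<omega> * indicator (space slots) \<omega> \<partial>P) = (\<integral>\<^sup>+x. f x * ennreal (\<rho> x) \<partial>lborel)"
      by (simp add: sp[symmetric] cong: nn_integral_cong)
  qed (use assms in \<open>auto simp: dens_measurable dens_nonneg\<close>)
  then obtain R where R: "state N R (\<lambda>x. (1 - t) * \<rho> x + t * \<sigma> x)"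
      "cost s R \<le> ennreal (1 - t) * cost s P + ennreal t * cost s Q"
    by (auto simp: sp[symmetric] P.prob_space)
  note R(2)
  also have "ennreal (1 - t) * cost s P + ennreal t * cost s Q \<le> ennreal (1 - t) * ennreal c + ennreal t * ennreal d"
    by (intro add_mono mult_left_mono P Q) auto
  also have "\<dots> = ennreal ((1 - t) * c + t * d)"
    using assms by (simp add: ennreal_mult ach_def)
  finally show ?thesis using R(1) assms by (auto simp: ach_def)
qed

text \<open>An independent particle inserted with probability 1 repels the others by
  \<open>B \<rho> u\<close> on average, by Campbell's formula.\<close>

lemma ach_insert:
  assumes "ach N \<rho> c" and \<rho>: "dens \<rho>" and u: "dens u" "mass u = 1"
  shows "ach (Suc N) (\<lambda>x. \<rho> x + u x) (c + B \<rho> u)"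
proof -
  obtain P where P: "state N P \<rho>" "cost s P \<le> ennreal c" using assms by (auto simp: ach_def)
  interpret P: prob_space P using state_prob[OF P(1)] .
  note [measurable] = dens_measurable[OF \<rho>] dens_measurable[OF u(1)]
  have sp: "space P = space slots" using state_sets[OF P(1)] by (rule sets_eq_imp_space_eq)
  let ?U = "\<lambda>x. \<integral>\<^sup>+y. ennreal (u y) * k x y \<partial>lborel"
  have "\<exists>R. state (Suc N) R (\<lambda>x. \<rho> x + P.prob (space slots) * u x)
    \<and> cost s R = cost s P + (\<integral>\<^sup>+\<omega>. psum ?U \<omega> * indicator (space slots) \<omega> \<partial>P)"
  proof (rule state_insert[OF P(1)])
    show "AE \<omega> in P. psum (\<lambda>_. 1) \<omega> + indicator (space slots) \<omega> \<le> of_nat (Suc N)"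
      using state_count[OF P(1)] by (rule eventually_mono)
        (auto simp: indicator_def add.commute intro: add_left_mono order_trans)
  qed (use \<rho> u in \<open>auto simp: nn_integral_dens dens_nonneg\<close>)
  then obtain R where R: "state (Suc N) R (\<lambda>x. \<rho> x + u x)" "cost s R = cost s P + (\<integral>\<^sup>+\<omega>. psum ?U \<omega> \<partial>P)"
    by (auto simp: sp[symmetric] P.prob_space cong: nn_integral_cong)
  have "(\<integral>\<^sup>+\<omega>. psum ?U \<omega> \<partial>P) = bform \<rho> u"
    by (subst state_density[OF P(1)]) (auto simp: bform_potential \<rho> u mult.commute)
  then have "cost s R \<le> ennreal c + ennreal (B \<rho> u)"
    using R(2) P(2) by (simp add: bform_eq \<rho> u)
  then show ?thesis using R(1) assms(1) B_nonneg by (auto simp: ach_def)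
qed

lemma ach_cong_AE: "ach N \<rho> c \<Longrightarrow> AE x in lborel. \<rho> x = \<rho>' x \<Longrightarrow> ach N \<rho>' c"
  unfolding ach_def using state_cong_AE by blast

text \<open>N places, each filled independently with probability t = mass / N by a particle of
  density u = \<rho> / mass, cost N * (N - 1) / 2 * t^2 * \<open>B u u\<close>, which is at most
  half of the form. This competitor makes \<open>W\<close> well defined and finite.\<close>

lemma ach_half_form:
  assumes "adm N \<rho>" shows "ach N \<rho> (B \<rho> \<rho> / 2)"
proof (cases "mass \<rho> = 0")
  case True
  then have "AE x in lborel. 0 = \<rho> x" using mass_zero_AE[OF adm_dens[OF assms]]
    by (auto elim!: eventually_mono)
  then have "ach N \<rho> 0" using ach_cong_AE[OF ach_empty] by blast
  then show ?thesis by (rule ach_mono) (auto simp: B_nonneg)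
next
  case False
  note \<rho> = adm_dens[OF assms]
  have m: "0 < mass \<rho>" using False mass_nonneg[OF \<rho>] by simp
  then have N: "0 < real N" using adm_mass[OF assms] by linarith
  define u where "u = (\<lambda>x. (1 / mass \<rho>) * \<rho> x)"
  define t where "t = mass \<rho> / real N"
  have t: "0 \<le> t" "t \<le> 1" using m N adm_mass[OF assms] by (auto simp: t_def)
  have u: "dens u" "mass u = 1" unfolding u_def using m dens_scale[OF \<rho>, of "1 / mass \<rho>"] by auto
  \<comment> \<open>The places are filled one at a time: the state with n places is mixed, with
    weight t, with its own enlargement by an independent particle.\<close>
  have step: "ach n (\<lambda>x. real n * t * u x) (real n * (real n - 1) / 2 * t\<^sup>2 * B u u)" for n
  proof (induction n)
    case 0 then show ?case using ach_empty[of 0] by simp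
  next
    case (Suc n)
    let ?\<rho> = "\<lambda>x. real n * t * u x" and ?c = "real n * (real n - 1) / 2 * t\<^sup>2 * B u u"
    have d: "dens ?\<rho>" using t u by (intro dens_scale) auto
    have "ach (Suc n) (\<lambda>x. (1 - t) * ?\<rho> x + t * (?\<rho> x + u x)) ((1 - t) * ?c + t * (?c + B ?\<rho> u))"
      using Suc t d u by (intro ach_mix ach_insert dens_add ach_mono[OF Suc order_refl]) auto
    moreover have "(\<lambda>x. (1 - t) * ?\<rho> x + t * (?\<rho> x + u x)) = (\<lambda>x. real (Suc n) * t * u x)"
      by (auto simp: algebra_simps)
    moreover have "B ?\<rho> u = real n * t * B u u" using t u by (intro B_scale_left) auto
    then have "(1 - t) * ?c + t * (?c + B ?\<rho> u) = real (Suc n) * (real (Suc n) - 1) / 2 * t\<^sup>2 * B u u"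
    proof -
      assume "B ?\<rho> u = real n * t * B u u"
      moreover have "(1 - t) * c + t * (c + b) = c + t * b" for c b
        by (simp add: algebra_simps)
      ultimately have "(1 - t) * ?c + t * (?c + B ?\<rho> u) = ?c + t * (real n * t * B u u)"
        by (simp only:)
      also have "t * (real n * t * B u u) = real n * t\<^sup>2 * B u u"
        by (simp add: power2_eq_square)
      finally have "(1 - t) * ?c + t * (?c + B ?\<rho> u) = ?c + real n * t\<^sup>2 * B u u" .
      also have "\<dots> = (real n * (real n - 1) / 2 + real n) * (t\<^sup>2 * B u u)"
        by (simp only: distrib_right mult.assoc)
      also have "real n * (real n - 1) / 2 + real n = real (Suc n) * (real (Suc n) - 1) / 2"
        by (simp add: field_simps)
      finally show ?thesis by (simp only: mult.assoc)
    qed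
    ultimately show ?case by (simp only:)
  qed
  have eq: "(\<lambda>x. real N * t * u x) = \<rho>" using N m by (auto simp: u_def t_def)
  have "B \<rho> \<rho> = (real N * t) * ((real N * t) * B u u)"
    by (subst (1 2) eq[symmetric]) (use t u in \<open>simp add: B_scale_left B_scale_right dens_scale\<close>)
  moreover have "real N * (real N - 1) / 2 * t\<^sup>2 * B u u \<le> real N * real N / 2 * t\<^sup>2 * B u u"
    by (intro mult_right_mono divide_right_mono mult_left_mono) (auto simp: B_nonneg)
  ultimately have "real N * (real N - 1) / 2 * t\<^sup>2 * B u u \<le> B \<rho> \<rho> / 2"
    by (simp add: power2_eq_square mult_ac)
  then show ?thesis using ach_mono[OF step[of N] _ order_refl] eq by simp
qed

section \<open>The least relaxed cost and its convexity\<close>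

definition W :: "nat \<Rightarrow> ('a \<Rightarrow> real) \<Rightarrow> real" where "W N \<rho> = Inf {c. ach N \<rho> c}"

lemma W_le: "ach N \<rho> c \<Longrightarrow> W N \<rho> \<le> c"
  unfolding W_def by (rule cInf_lower) (auto simp: ach_def intro!: bdd_belowI[of _ 0])

lemma W_nonneg: "adm N \<rho> \<Longrightarrow> 0 \<le> W N \<rho>"
  unfolding W_def using ach_half_form[of N \<rho>] by (intro cInf_greatest) (blast, simp add: ach_def)

lemma W_approx: assumes "adm N \<rho>" "W N \<rho> < c" shows "ach N \<rho> c"
proof -
  have "{c. ach N \<rho> c} \<noteq> {}" "bdd_below {c. ach N \<rho> c}"
    using ach_half_form[OF assms(1)] by (blast, auto simp: ach_def intro!: bdd_belowI[of _ 0])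
  then obtain c' where "ach N \<rho> c'" "c' < c"
    using assms(2) unfolding W_def by (auto simp: cInf_less_iff)
  then show ?thesis by (intro ach_mono[of N \<rho> c' c N]) auto
qed

lemma W_approx_state:
  assumes "adm N \<rho>" "0 < \<xi>"
  obtains P where "state N P \<rho>" "cost s P \<le> ennreal (W N \<rho> + \<xi>)"
  using W_approx[OF assms(1), of "W N \<rho> + \<xi>"] assms(2) by (auto simp: ach_def)

lemma W_antimono: "adm N \<rho> \<Longrightarrow> N \<le> N' \<Longrightarrow> W N' \<rho> \<le> W N \<rho>"
  by (rule dense_ge) (rule W_le[OF ach_mono[OF W_approx order_refl]])

lemma adm_mix:
  assumes "adm N \<rho>" "adm N \<sigma>" "0 \<le> t" "t \<le> 1"
  shows "adm N (\<lambda>x. (1 - t) * \<rho> x + t * \<sigma> x)"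
proof -
  note d = assms(1,2)[THEN adm_dens]
  have "mass (\<lambda>x. (1 - t) * \<rho> x + t * \<sigma> x) = (1 - t) * mass \<rho> + t * mass \<sigma>"
    using assms d by (subst mass_add) (auto intro: dens_scale)
  also have "\<dots> \<le> (1 - t) * real N + t * real N"
    using assms by (intro add_mono mult_left_mono) (auto simp: adm_mass)
  also have "\<dots> = real N" by (simp add: algebra_simps)
  finally show ?thesis using assms d unfolding adm_def by (auto intro!: dens_add dens_scale)
qed

lemma adm_mono:
  assumes "adm N \<rho>" "\<sigma> \<in> borel_measurable borel" "\<And>x. 0 \<le> \<sigma> x" "\<And>x. \<sigma> x \<le> \<rho> x"
  shows "adm N \<sigma>"
  using dens_mono[OF adm_dens[OF assms(1)], of \<sigma>] assms mass_mono[of \<rho> \<sigma>]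
  by (auto simp: adm_def)

lemma adm_restrict: "adm N \<rho> \<Longrightarrow> E \<in> sets borel \<Longrightarrow> adm N (\<lambda>x. \<rho> x * indicator E x)"
  by (rule adm_mono[OF _ dens_measurable[OF dens_restrict[OF adm_dens]]])
    (auto simp: indicator_def dens_nonneg adm_dens)

text \<open>A coin decides between almost optimal states; density and cost both average.\<close>

lemma W_mix:
  assumes "adm N \<rho>" "adm N \<sigma>" "0 \<le> t" "t \<le> 1"
  shows "W N (\<lambda>x. (1 - t) * \<rho> x + t * \<sigma> x) \<le> (1 - t) * W N \<rho> + t * W N \<sigma>"
proof (rule field_le_epsilon)
  fix e :: real assume "0 < e"
  then have "ach N (\<lambda>x. (1 - t) * \<rho> x + t * \<sigma> x) ((1 - t) * (W N \<rho> + e) + t * (W N \<sigma> + e))"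
    using assms by (intro ach_mix W_approx) (auto intro: adm_dens)
  from W_le[OF this] show "W N (\<lambda>x. (1 - t) * \<rho> x + t * \<sigma> x) \<le> (1 - t) * W N \<rho> + t * W N \<sigma> + e"
    by (simp add: algebra_simps)
qed

lemma W_zero: "W N (\<lambda>_. 0) = 0"
  by (intro antisym W_le ach_empty W_nonneg) (simp add: adm_def dens_zero)

text \<open>Mixing with the empty configuration, which is allowed because a state may hold fewer
  than N particles.\<close>

lemma W_scale_le:
  assumes "adm N \<rho>" "0 \<le> t" "t \<le> 1" shows "W N (\<lambda>x. t * \<rho> x) \<le> t * W N \<rho>"
proof -
  have "adm N (\<lambda>_. 0)" by (simp add: adm_def dens_zero)
  from W_mix[OF this assms(1-3)] show ?thesis by (simp add: W_zero)
qed

text \<open>One almost optimal state, thinned to E and to its complement, is a competitor for both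
  pieces; the energy between the pieces is discarded.\<close>

lemma W_split:
  assumes "adm N \<rho>" "E \<in> sets borel"
  shows "W N (\<lambda>x. \<rho> x * indicator E x) + W N (\<lambda>x. \<rho> x * indicator (- E) x) \<le> W N \<rho>"
proof (rule field_le_epsilon)
  fix e :: real assume e: "0 < e"
  obtain P where P: "state N P \<rho>" "cost s P \<le> ennreal (W N \<rho> + e)"
    using W_approx_state[OF assms(1) e] .
  let ?A = "cost s (distr P slots (thin E))" and ?B = "cost s (distr P slots (thin (- E)))"
  have le: "?A + ?B \<le> ennreal (W N \<rho> + e)" using cost_thin[OF P(1) assms(2)] P(2) order_trans by blast
  then obtain x y where xy: "?A = ennreal x" "?B = ennreal y" "0 \<le> x" "0 \<le> y"
    by (cases ?A; cases ?B) (auto simp: top_unique)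
  have "x + y \<le> W N \<rho> + e"
    using le xy W_nonneg[OF assms(1)] e by (simp flip: ennreal_plus)
  moreover have "W N (\<lambda>x. \<rho> x * indicator E x) \<le> x"
    using state_thin[OF P(1) assms(2)] xy
    by (intro W_le) (auto simp: ach_def intro!: exI[of _ "distr P slots (thin E)"])
  moreover have "W N (\<lambda>x. \<rho> x * indicator (- E) x) \<le> y"
    using state_thin[OF P(1), of "- E"] assms(2) xy
    by (intro W_le) (auto simp: ach_def intro!: exI[of _ "distr P slots (thin (- E))"])
  ultimately show "W N (\<lambda>x. \<rho> x * indicator E x) + W N (\<lambda>x. \<rho> x * indicator (- E) x) \<le> W N \<rho> + e"
    by linarith
qed

lemma W_restrict_le: "adm N \<rho> \<Longrightarrow> E \<in> sets borel \<Longrightarrow> W N (\<lambda>x. \<rho> x * indicator E x) \<le> W N \<rho>"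
  using W_split[of N \<rho> E] W_nonneg[OF adm_restrict[of N \<rho> "- E"]] by auto

text \<open>Whatever is missing from the kept part of \<open>P\<close> is supplied by an independent state, which is
  drawn with probability at least \<open>\<kappa>\<close>.\<close>

lemma W_fill:
  assumes P: "state N P \<rho>'" "cost s P \<le> ennreal c" and G: "G \<in> sets slots"
    and \<rho>: "adm N \<rho>" and \<rho>2: "dens \<rho>2" "\<And>x. \<rho>2 x \<le> \<rho> x"
    and rest: "\<And>f. f \<in> borel_measurable borel \<Longrightarrow>
      (\<integral>\<^sup>+\<omega>. psum f \<omega> * indicator G \<omega> \<partial>P) = (\<integral>\<^sup>+x. f x * ennreal (\<rho>2 x) \<partial>lborel)"
    and \<kappa>: "0 < \<kappa>" "\<kappa> \<le> 1" and "0 \<le> c"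
    and le: "mass \<rho> - (1 - \<kappa>) * mass \<rho>2 \<le> real N * (1 - (1 - \<kappa>) * measure P G)"
  defines "h \<equiv> \<lambda>x. \<rho> x - (1 - \<kappa>) * \<rho>2 x"
  shows "W N \<rho> \<le> c + B h h / (2 * \<kappa>)"
proof -
  interpret P: prob_space P using state_prob[OF P(1)] .
  note d = adm_dens[OF \<rho>]
  note [measurable] = dens_measurable[OF d] dens_measurable[OF \<rho>2(1)]
  define w where "w = 1 - (1 - \<kappa>) * P.prob G"
  have w: "\<kappa> \<le> w" "0 < w" "w \<le> 1"
    using \<kappa> mult_left_mono[of "P.prob G" 1 "1 - \<kappa>"] by (auto simp: w_def)
  have h: "dens h"
  proof (rule dens_mono[OF d])
    fix x
    have "(1 - \<kappa>) * \<rho>2 x \<le> 1 * \<rho>2 x" using \<kappa> dens_nonneg[OF \<rho>2(1)] by (intro mult_right_mono) auto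
    then show "0 \<le> h x" "h x \<le> \<rho> x"
      using \<rho>2(2)[of x] \<kappa> dens_nonneg[OF \<rho>2(1), of x] by (auto simp: h_def)
  qed (simp add: h_def)
  have mh: "mass h = mass \<rho> - (1 - \<kappa>) * mass \<rho>2"
    unfolding h_def using d \<rho>2 by (subst Bochner_Integration.integral_diff) (auto intro: dens_integrable)
  \<comment> \<open>The missing density h is rescaled because it is supplied by draws of probability
    w; the mass hypothesis says exactly that \<sigma> fits N particles.\<close>
  define \<sigma> where "\<sigma> = (\<lambda>x. (1 / w) * h x)"
  have \<sigma>: "adm N \<sigma>"
  proof -
    have "mass h \<le> real N * w" using le unfolding mh w_def .
    then have "mass \<sigma> \<le> real N" using w by (simp add: \<sigma>_def field_simps)
    then show ?thesis using w dens_scale[OF h, of "1 / w"] by (simp add: adm_def \<sigma>_def)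
  qed
  obtain Q where Q: "state N Q \<sigma>" "cost s Q \<le> ennreal (B \<sigma> \<sigma> / 2)"
    using ach_half_form[OF \<sigma>] by (auto simp: ach_def)
  have "\<exists>R. state N R (\<lambda>x. (1 - \<kappa>) * \<rho>2 x + w * \<sigma> x)
    \<and> cost s R \<le> ennreal (1 - \<kappa>) * cost s P + ennreal w * cost s Q"
    unfolding w_def using \<kappa> dens_nonneg[OF \<rho>2(1)] dens_nonneg[OF adm_dens[OF \<sigma>]]
      dens_measurable[OF adm_dens[OF \<sigma>]]
    by (intro state_mix[OF P(1) Q(1)] rest G) auto
  moreover have "(\<lambda>x. (1 - \<kappa>) * \<rho>2 x + w * \<sigma> x) = \<rho>"
    using w by (auto simp: \<sigma>_def h_def)
  ultimately obtain R where R: "state N R \<rho>" "cost s R \<le> ennreal (1 - \<kappa>) * cost s P + ennreal w * cost s Q"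
    by auto
  note R(2)
  also have "ennreal (1 - \<kappa>) * cost s P + ennreal w * cost s Q
      \<le> 1 * ennreal c + ennreal w * ennreal (B \<sigma> \<sigma> / 2)"
    using \<kappa> by (intro add_mono mult_mono P Q) auto
  also have "\<dots> = ennreal (c + w * (B \<sigma> \<sigma> / 2))"
    using w \<open>0 \<le> c\<close> B_nonneg[of \<sigma> \<sigma>] ennreal_mult[of w "B \<sigma> \<sigma> / 2"] by simp
  \<comment> \<open>Two factors 1 / w from the form against one factor w from the probability of the
    draw.\<close>
  also have "w * (B \<sigma> \<sigma> / 2) = B h h / (2 * w)"
  proof -
    have "B \<sigma> \<sigma> = (1 / w) * ((1 / w) * B h h)"
      unfolding \<sigma>_def using w h dens_scale[OF h, of "1 / w"]
      by (subst B_scale_left) (simp_all add: B_scale_right del: times_divide_eq_left)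
    then show ?thesis using w by (simp add: field_simps)
  qed
  finally have "W N \<rho> \<le> c + B h h / (2 * w)"
    using R(1) w \<open>0 \<le> c\<close> B_nonneg[of h h] by (intro W_le) (auto simp: ach_def)
  also have "B h h / (2 * w) \<le> B h h / (2 * \<kappa>)"
    using w \<kappa> B_nonneg by (intro divide_left_mono) auto
  finally show ?thesis by simp
qed

end

text \<open>As a default rule it would match every binary function.\<close>

declare measurable_slot [measurable del]

subsection \<open>Semicontinuity and scaling\<close>

lemma nn_integral_affine:
  fixes v :: "'a::euclidean_space"
  assumes "0 < r" and [measurable]: "g \<in> borel_measurable borel"
  shows "(\<integral>\<^sup>+x. g x \<partial>lborel) = (\<integral>\<^sup>+x. ennreal (r ^ DIM('a)) * g (v + r *\<^sub>R x) \<partial>lborel)"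
  using assms(1) by (subst lborel_affine[of r v]) (simp_all add: nn_integral_density nn_integral_distr)

lemma riesz_kernel_affine:
  fixes v :: "'a::euclidean_space"
  assumes "0 < r"
  shows "riesz_kernel s (v + r *\<^sub>R x) (v + r *\<^sub>R y) = ennreal (r powr - s) * riesz_kernel s x y"
proof (cases "x = y")
  case True
  then show ?thesis using assms by (simp add: riesz_kernel_same ennreal_mult_top)
next
  case False
  have "norm (v + r *\<^sub>R x - (v + r *\<^sub>R y)) = r * norm (x - y)"
    using assms by (simp flip: scaleR_diff_right)
  then show ?thesis using assms False
    by (simp add: riesz_kernel_neq powr_mult powr_minus_divide flip: ennreal_mult)
qed

context riesz_exponent begin

text \<open>Modulus for the factor \<open>mass e powr a\<close> in \<open>B_le_mass\<close>, by
  which a piece of small mass has small interaction.\<close>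

lemma small_sqrt_powr:
  assumes "0 < \<delta>"
  obtains \<eta> where "0 < \<eta>" "\<And>x. 0 \<le> x \<Longrightarrow> x \<le> \<eta> \<Longrightarrow> sqrt (x powr a) \<le> \<delta>"
proof
  define \<eta> where "\<eta> = (\<delta>\<^sup>2) powr (1 / a)"
  show "0 < \<eta>" using assms by (simp add: \<eta>_def)
  fix x assume "0 \<le> x" "x \<le> \<eta>"
  then have "x powr a \<le> \<eta> powr a" using q_less by (intro powr_mono2) auto
  also have "\<eta> powr a = \<delta>\<^sup>2" using q_less assms by (simp add: \<eta>_def powr_powr)
  finally have "sqrt (x powr a) \<le> sqrt (\<delta>\<^sup>2)" by (rule real_sqrt_le_mono)
  then show "sqrt (x powr a) \<le> \<delta>" using assms by simp
qed

lemma B_le_mass: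
  assumes "dens f" "dens e" "L e \<le> l"
  shows "B f e \<le> 2 * C1 * sqrt (mass f powr a * L f) * sqrt l * sqrt (mass e powr a)"
proof -
  have "B f e \<le> 2 * C1 * sqrt (mass f powr a * L f) * sqrt (mass e powr a * L e)"
    by (rule B_le_sqrt) fact+
  also have "\<dots> \<le> 2 * C1 * sqrt (mass f powr a * L f) * sqrt (mass e powr a * l)"
    using assms(3) C1_pos by (intro mult_left_mono real_sqrt_le_mono) (auto simp: L_nonneg)
  finally show ?thesis by (simp add: real_sqrt_mult mult_ac)
qed

text \<open>An almost optimal state of \<rho>' is kept with weight 1 - \<kappa>, and the missing h
  \<le> \<kappa> * \<rho> + e is supplied independently as in \<open>W_fill\<close>. The price
  \<open>B h h\<close> / (2 * \<kappa>) is at most \<kappa> * D / 2 plus c times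
  \<open>B \<rho> e\<close>: \<kappa> is made small at the outset, and the mass of e is then made
  small for this \<kappa>.\<close>

lemma W_continuous_below:
  assumes \<rho>: "adm N \<rho>" and \<xi>: "0 < \<xi>"
  obtains \<epsilon> where "0 < \<epsilon>" "\<And>\<rho>'. dens \<rho>' \<Longrightarrow> (\<And>x. \<rho>' x \<le> \<rho> x) \<Longrightarrow> mass \<rho> - mass \<rho>' \<le> \<epsilon>
    \<Longrightarrow> W N \<rho> \<le> W N \<rho>' + \<xi>"
proof -
  note d = adm_dens[OF \<rho>]
  note [measurable] = dens_measurable[OF d]
  define D where "D = B \<rho> \<rho>"
  define K where "K = 2 * C1 * sqrt (mass \<rho> powr a * L \<rho>) * sqrt (L \<rho>)"
  define \<kappa> where "\<kappa> = min 1 (\<xi> / (2 * (D + 1)))"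
  define c where "c = 1 + 1 / (2 * \<kappa>)"
  define \<delta> where "\<delta> = \<xi> / (4 * c * (K + 1))"
  have D: "0 \<le> D" by (simp add: D_def B_nonneg)
  have K: "0 \<le> K" using C1_pos by (simp add: K_def L_nonneg)
  have \<kappa>: "0 < \<kappa>" "\<kappa> \<le> 1" using \<xi> D by (auto simp: \<kappa>_def)
  have "\<kappa> * (D + 1) \<le> \<xi> / 2"
  proof -
    have "\<kappa> * (D + 1) \<le> \<xi> / (2 * (D + 1)) * (D + 1)"
      using D by (intro mult_right_mono) (auto simp: \<kappa>_def)
    also have "\<dots> = \<xi> / 2" using D by (simp add: field_simps)
    finally show ?thesis .
  qed
  then have \<kappa>D: "\<kappa> * D / 2 \<le> \<xi> / 4" using \<kappa> by (simp add: algebra_simps)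
  have c: "0 < c" using \<kappa> by (simp add: c_def add_pos_pos)
  have \<delta>: "0 < \<delta>" using \<xi> c K by (simp add: \<delta>_def)
  have cK: "c * (K * \<delta>) \<le> \<xi> / 4"
  proof -
    have "c * (K * \<delta>) \<le> c * ((K + 1) * \<delta>)" using c \<delta> by (intro mult_left_mono mult_right_mono) auto
    also have "\<dots> = \<xi> / 4" using c K by (simp add: \<delta>_def)
    finally show ?thesis .
  qed
  obtain \<eta> where \<eta>: "0 < \<eta>" "\<And>x. 0 \<le> x \<Longrightarrow> x \<le> \<eta> \<Longrightarrow> sqrt (x powr a) \<le> \<delta>"
    using small_sqrt_powr[OF \<delta>] by blast
  \<comment> \<open>The first bound keeps the removed mass below \<eta> even after the
    configurations that are not full are discarded; the second makes the missing mass fit when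
    \<rho> has room below N.\<close>
  define \<epsilon> where "\<epsilon> = min (\<eta> / (real N + 1)) (if mass \<rho> < real N then \<kappa> * (real N - mass \<rho>) else 1)"
  have \<epsilon>: "0 < \<epsilon>" using \<eta> \<kappa> by (auto simp: \<epsilon>_def)
  have \<epsilon>N: "\<epsilon> * (real N + 1) \<le> \<eta>"
  proof -
    have "\<epsilon> \<le> \<eta> / (real N + 1)" by (simp add: \<epsilon>_def)
    then show ?thesis by (subst (asm) pos_le_divide_eq) auto
  qed
  have core: "W N \<rho> \<le> W N \<rho>' + \<xi>"
    if P: "state N P \<rho>'" "cost s P \<le> ennreal (W N \<rho>' + \<xi> / 2)" and "0 \<le> W N \<rho>'"
      and \<rho>2: "dens \<rho>2" "\<And>x. \<rho>2 x \<le> \<rho> x" and G: "G \<in> sets slots"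
      and rest: "\<And>f. f \<in> borel_measurable borel \<Longrightarrow>
      (\<integral>\<^sup>+\<omega>. psum f \<omega> * indicator G \<omega> \<partial>P) = (\<integral>\<^sup>+x. f x * ennreal (\<rho>2 x) \<partial>lborel)"
      and le: "mass \<rho> - (1 - \<kappa>) * mass \<rho>2 \<le> real N * (1 - (1 - \<kappa>) * measure P G)"
      and small: "mass \<rho> - mass \<rho>2 \<le> \<eta>"
    for P \<rho>' \<rho>2 and G :: "(nat \<Rightarrow> 'a \<times> bool) set"
  proof -
    define h where "h = (\<lambda>x. \<rho> x - (1 - \<kappa>) * \<rho>2 x)"
    define e where "e = (\<lambda>x. \<rho> x - \<rho>2 x)"
    note [measurable] = dens_measurable[OF \<rho>2(1)]
    have e: "dens e" "e x \<le> \<rho> x" for x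
      using \<rho>2 dens_nonneg[OF \<rho>2(1)] by (auto simp: e_def intro!: dens_mono[OF d])
    have he: "h x \<le> \<kappa> * \<rho> x + e x" "0 \<le> h x" "h x \<le> \<rho> x" for x
    proof -
      have 1: "\<kappa> * \<rho>2 x \<le> \<kappa> * \<rho> x" using \<kappa> \<rho>2(2) by (intro mult_left_mono) auto
      have 2: "\<kappa> * \<rho>2 x \<le> 1 * \<rho>2 x" using \<kappa> dens_nonneg[OF \<rho>2(1)] by (intro mult_right_mono) auto
      have 3: "0 \<le> \<kappa> * \<rho>2 x" using \<kappa> dens_nonneg[OF \<rho>2(1)] by simp
      show "h x \<le> \<kappa> * \<rho> x + e x" "0 \<le> h x" "h x \<le> \<rho> x"
        using 1 2 3 \<rho>2(2)[of x] unfolding h_def e_def by (auto simp: algebra_simps)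
    qed
    have h: "dens h" using he by (intro dens_mono[OF d]) (auto simp: h_def)
    have me: "mass e = mass \<rho> - mass \<rho>2"
      unfolding e_def using d \<rho>2 by (intro Bochner_Integration.integral_diff dens_integrable)
    have Be: "B \<rho> e \<le> K * \<delta>"
    proof -
      have "B \<rho> e \<le> K * sqrt (mass e powr a)"
        unfolding K_def using e d by (intro B_le_mass L_mono) auto
      also have "\<dots> \<le> K * \<delta>"
        using K small e mass_nonneg[OF e(1)] by (intro mult_left_mono \<eta>) (auto simp: me)
      finally show ?thesis .
    qed
    have \<kappa>\<rho>: "dens (\<lambda>x. \<kappa> * \<rho> x)" using \<kappa> d by (intro dens_scale) auto
    have "B h h \<le> B (\<lambda>x. \<kappa> * \<rho> x + e x) (\<lambda>x. \<kappa> * \<rho> x + e x)"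
      using h he e \<kappa>\<rho> by (intro B_mono dens_add) auto
    also have "\<dots> = \<kappa> * (\<kappa> * D) + \<kappa> * B \<rho> e + (\<kappa> * B \<rho> e + B e e)"
      using \<kappa> \<kappa>\<rho> d e
      by (simp add: B_add_left B_add_right dens_add B_scale_left B_scale_right D_def B_commute[of e \<rho>])
    also have "B e e \<le> B \<rho> e" using d e by (intro B_mono) auto
    finally have "B h h \<le> \<kappa> * (\<kappa> * D) + (2 * \<kappa> + 1) * B \<rho> e" by (simp add: algebra_simps)
    also have "\<dots> \<le> \<kappa> * (\<kappa> * D) + (2 * \<kappa> + 1) * (K * \<delta>)"
      using \<kappa> by (intro add_left_mono mult_left_mono Be) auto
    also have "\<dots> = (\<kappa> * D / 2 + c * (K * \<delta>)) * (2 * \<kappa>)"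
      using \<kappa> by (simp add: c_def field_simps)
    also have "\<dots> \<le> (\<xi> / 2) * (2 * \<kappa>)"
    proof (rule mult_right_mono)
      show "\<kappa> * D / 2 + c * (K * \<delta>) \<le> \<xi> / 2" using \<kappa>D cK by linarith
    qed (use \<kappa> in simp)
    finally have "B h h / (2 * \<kappa>) \<le> \<xi> / 2" using \<kappa> by (simp add: field_simps)
    moreover have "W N \<rho> \<le> (W N \<rho>' + \<xi> / 2) + B h h / (2 * \<kappa>)"
      unfolding h_def using that(3) \<xi>
      by (intro W_fill[OF P G \<rho> \<rho>2 rest \<kappa> _ le]) auto
    ultimately show ?thesis by simp
  qed
  show thesis
  proof (rule that[OF \<epsilon>])
    fix \<rho>' assume \<rho>': "dens \<rho>'" "\<And>x. \<rho>' x \<le> \<rho> x" and small: "mass \<rho> - mass \<rho>' \<le> \<epsilon>"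
    note [measurable] = dens_measurable[OF \<rho>'(1)]
    have adm': "adm N \<rho>'"
      using \<rho>' dens_nonneg[OF \<rho>'(1)] by (intro adm_mono[OF \<rho>]) auto
    obtain P where P: "state N P \<rho>'" "cost s P \<le> ennreal (W N \<rho>' + \<xi> / 2)"
      using W_approx_state[OF adm', of "\<xi> / 2"] \<xi> by auto
    interpret P: prob_space P using state_prob[OF P(1)] .
    have sp: "space P = space slots" using state_sets[OF P(1)] by (rule sets_eq_imp_space_eq)
    \<comment> \<open>With room below N the whole state is kept. At full mass only full
      configurations are kept: then mass \<rho>2 = N * \<open>P.prob G\<close>, and the mass
      condition of \<open>W_fill\<close> becomes an equality.\<close>
    show "W N \<rho> \<le> W N \<rho>' + \<xi>"
    proof (cases "mass \<rho> < real N")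
      case True
      have "\<epsilon> \<le> \<kappa> * (real N - mass \<rho>)" using True by (simp add: \<epsilon>_def)
      then have 1: "mass \<rho> - mass \<rho>' \<le> \<kappa> * (real N - mass \<rho>)" using small by linarith
      have "\<kappa> * mass \<rho>' \<le> \<kappa> * mass \<rho>" using \<kappa> \<rho>' d by (intro mult_left_mono mass_mono) auto
      then have le: "mass \<rho> - (1 - \<kappa>) * mass \<rho>' \<le> real N * (1 - (1 - \<kappa>) * P.prob (space slots))"
        using 1 by (simp add: sp[symmetric] P.prob_space algebra_simps)
      have "\<epsilon> * 1 \<le> \<epsilon> * (real N + 1)" using \<epsilon> by (intro mult_left_mono) auto
      then have "mass \<rho> - mass \<rho>' \<le> \<eta>" using small \<epsilon>N by linarith
      with le show ?thesis
        using \<rho>' W_nonneg[OF adm'] state_density[OF P(1)] sets.top[of P, unfolded state_sets[OF P(1)]]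
        by (intro core[OF P]) (auto simp: sp[symmetric] cong: nn_integral_cong)
    next
      case False
      then have m: "mass \<rho> = real N" using adm_mass[OF \<rho>] by simp
      define G :: "(nat \<Rightarrow> 'a \<times> bool) set" where "G = {\<omega> \<in> space slots. of_nat N \<le> (psum (\<lambda>_. 1) \<omega> :: ennreal)}"
      have G [measurable]: "G \<in> sets slots" unfolding G_def by measurable
      have GP [measurable]: "G \<in> sets P" using G state_sets[OF P(1)] by simp
      note [measurable_cong] = state_sets[OF P(1)]
      obtain \<rho>2 where \<rho>2m: "\<rho>2 \<in> borel_measurable borel" and \<rho>2: "\<And>x. 0 \<le> \<rho>2 x" "\<And>x. \<rho>2 x \<le> \<rho>' x"
        and rest: "\<And>f. f \<in> borel_measurable borel \<Longrightarrow>
      (\<integral>\<^sup>+\<omega>. psum f \<omega> * indicator G \<omega> \<partial>P) = (\<integral>\<^sup>+x. f x * ennreal (\<rho>2 x) \<partial>lborel)"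
        using state_restrict_density[OF P(1) dens_measurable[OF \<rho>'(1)] G _ dens_integrable[OF \<rho>'(1)]]
          dens_nonneg[OF \<rho>'(1)] by blast
      have d2: "dens \<rho>2" using \<rho>2 by (intro dens_mono[OF \<rho>'(1) \<rho>2m]) auto
      have le2: "\<rho>2 x \<le> \<rho> x" for x using \<rho>2(2)[of x] \<rho>'(2)[of x] by linarith
      have "ennreal (mass \<rho>2) = (\<integral>\<^sup>+\<omega>. psum (\<lambda>_. 1) \<omega> * indicator G \<omega> \<partial>P)"
        by (subst rest) (auto simp: nn_integral_dens[OF d2])
      also have "\<dots> = (\<integral>\<^sup>+\<omega>. of_nat N * indicator G \<omega> \<partial>P)"
        using state_count[OF P(1)]
        by (intro nn_integral_cong_AE) (auto elim!: eventually_mono simp: G_def indicator_def)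
      also have "\<dots> = ennreal (real N * P.prob G)"
        by (simp add: nn_integral_cmult_indicator P.emeasure_eq_measure ennreal_mult ennreal_of_nat_eq_real_of_nat)
      finally have m2: "mass \<rho>2 = real N * P.prob G" by (simp add: mass_nonneg[OF d2])
      \<comment> \<open>A configuration that is not full misses at least one particle, so the
        probability of such configurations is at most the missing mass.\<close>
      have "ennreal (mass \<rho>') + ennreal (1 - P.prob G) = (\<integral>\<^sup>+\<omega>. psum (\<lambda>_. 1) \<omega> + indicator (space P - G) \<omega> \<partial>P)"
        by (subst nn_integral_add)
          (auto simp: state_density[OF P(1)] nn_integral_dens[OF \<rho>'(1)] P.prob_compl[OF GP] P.emeasure_eq_measure)
      also have "\<dots> \<le> (\<integral>\<^sup>+\<omega>. of_nat N \<partial>P)"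
        using state_count[OF P(1)]
        by (intro nn_integral_mono_AE) (auto elim!: eventually_mono intro: psum_one_less simp: G_def sp indicator_def not_le)
      also have "\<dots> = ennreal (real N)" by (simp add: P.emeasure_space_1 ennreal_of_nat_eq_real_of_nat)
      finally have "mass \<rho>' + (1 - P.prob G) \<le> real N"
        using mass_nonneg[OF \<rho>'(1)] by (simp flip: ennreal_plus)
      then have "1 - P.prob G \<le> \<epsilon>" using small m by linarith
      then have "real N * (1 - P.prob G) \<le> \<epsilon> * (real N + 1)"
        using \<epsilon> mult_left_mono[of "1 - P.prob G" \<epsilon> "real N"] by (simp add: algebra_simps)
      then have "mass \<rho> - mass \<rho>2 \<le> \<eta>" using \<epsilon>N by (simp add: m m2 algebra_simps)
      moreover have "mass \<rho> - (1 - \<kappa>) * mass \<rho>2 \<le> real N * (1 - (1 - \<kappa>) * P.prob G)"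
        by (simp add: m m2 algebra_simps)
      ultimately show ?thesis
        using W_nonneg[OF adm'] by (intro core[OF P _ d2 le2 G rest]) auto
    qed
  qed
qed

text \<open>Where f n exceeds (1 + \<delta>) * \<rho> it is deleted, and the rest is divided by 1 +
  \<delta>. Neither operation increases \<open>W\<close>, the result lies below \<rho>, and its mass
  tends to mass \<rho> / (1 + \<delta>), so \<open>W_continuous_below\<close> applies. Mass that
  escapes to infinity or concentrates is simply cut away.\<close>

lemma W_lower_semicontinuous:
  assumes \<rho>: "adm N \<rho>" and f: "\<And>n. adm N (f n)"
    and lim: "AE x in lborel. (\<lambda>n. f n x) \<longlonglongrightarrow> \<rho> x" and \<xi>: "0 < \<xi>"
  shows "\<forall>\<^sub>F n in sequentially. W N \<rho> \<le> W N (f n) + \<xi>"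
proof -
  note d = adm_dens[OF \<rho>]
  note [measurable] = dens_measurable[OF d] dens_measurable[OF adm_dens[OF f]]
  obtain \<epsilon> where \<epsilon>: "0 < \<epsilon>" "\<And>\<rho>'. dens \<rho>' \<Longrightarrow> (\<And>x. \<rho>' x \<le> \<rho> x) \<Longrightarrow> mass \<rho> - mass \<rho>' \<le> \<epsilon>
    \<Longrightarrow> W N \<rho> \<le> W N \<rho>' + \<xi>"
    using W_continuous_below[OF \<rho> \<xi>] by blast
  \<comment> \<open>Makes mass \<rho> / (1 + \<delta>) larger than mass \<rho> - \<epsilon>; the
    summand 1 covers the case of mass 0.\<close>
  define \<delta> where "\<delta> = \<epsilon> / (mass \<rho> + 1)"
  have m0: "0 \<le> mass \<rho>" by (rule mass_nonneg[OF d])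
  have \<delta>: "0 < \<delta>" using \<epsilon> m0 by (simp add: \<delta>_def)
  define g where "g n x = (1 / (1 + \<delta>)) * (f n x * indicator {x. f n x \<le> (1 + \<delta>) * \<rho> x} x)" for n x
  have [measurable]: "g n \<in> borel_measurable borel" for n unfolding g_def by measurable
  have g: "0 \<le> g n x" "g n x \<le> \<rho> x" for n x
    using \<delta> dens_nonneg[OF adm_dens[OF f], of n x] dens_nonneg[OF d, of x]
    by (auto simp: g_def indicator_def field_simps)
  have dg: "dens (g n)" for n using g by (intro dens_mono[OF d]) auto
  have Wg: "W N (g n) \<le> W N (f n)" for n
  proof -
    let ?e = "\<lambda>x. f n x * indicator {x. f n x \<le> (1 + \<delta>) * \<rho> x} x"
    have e: "adm N ?e" by (rule adm_restrict[OF f]) measurable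
    have "W N (g n) \<le> (1 / (1 + \<delta>)) * W N ?e"
      unfolding g_def using \<delta> by (intro W_scale_le e) auto
    also have "\<dots> \<le> 1 * W N ?e" using \<delta> W_nonneg[OF e] by (intro mult_right_mono) auto
    also have "W N ?e \<le> W N (f n)" by (rule W_restrict_le[OF f]) measurable
    finally show ?thesis by simp
  qed
  have "(\<lambda>n. mass (g n)) \<longlonglongrightarrow> (LINT x|lborel. (1 / (1 + \<delta>)) * \<rho> x)"
  proof (rule integral_dominated_convergence[where w = \<rho>])
    show "AE x in lborel. (\<lambda>n. g n x) \<longlonglongrightarrow> (1 / (1 + \<delta>)) * \<rho> x"
      using lim
    proof eventually_elim
      fix x assume x: "(\<lambda>n. f n x) \<longlonglongrightarrow> \<rho> x"
      show "(\<lambda>n. g n x) \<longlonglongrightarrow> (1 / (1 + \<delta>)) * \<rho> x"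
      proof (cases "\<rho> x = 0")
        case True
        then have "g n x = 0" for n using g[of n x] by simp
        then show ?thesis using True by simp
      next
        case False
        then have pos: "0 < \<rho> x" using dens_nonneg[OF d, of x] by simp
        have "\<rho> x < (1 + \<delta>) * \<rho> x" using pos \<delta> by (simp add: algebra_simps)
        then have "\<forall>\<^sub>F n in sequentially. f n x < (1 + \<delta>) * \<rho> x"
          using order_tendstoD(2)[OF x] by blast
        then have "\<forall>\<^sub>F n in sequentially. (1 / (1 + \<delta>)) * f n x = g n x"
          by eventually_elim (auto simp: g_def)
        moreover have "(\<lambda>n. (1 / (1 + \<delta>)) * f n x) \<longlonglongrightarrow> (1 / (1 + \<delta>)) * \<rho> x"
          by (intro tendsto_mult x tendsto_const)
        ultimately show ?thesis by (rule Lim_transform_eventually[rotated])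
      qed
    qed
    show "AE x in lborel. norm (g n x) \<le> \<rho> x" for n using g by auto
  qed (use dens_integrable[OF d] in auto)
  moreover have "mass \<rho> - \<epsilon> < (LINT x|lborel. (1 / (1 + \<delta>)) * \<rho> x)"
  proof -
    have e: "\<epsilon> = \<delta> * (mass \<rho> + 1)" using m0 by (simp add: \<delta>_def)
    have "(mass \<rho> - \<epsilon>) * (1 + \<delta>) = mass \<rho> - \<delta> - \<delta> * \<epsilon>" unfolding e by (simp add: algebra_simps)
    also have "\<dots> < mass \<rho>" using \<delta> mult_pos_pos[OF \<delta> \<epsilon>(1)] by linarith
    finally show ?thesis using \<delta> by (simp add: field_simps)
  qed
  ultimately have "\<forall>\<^sub>F n in sequentially. mass \<rho> - \<epsilon> < mass (g n)"
    by (rule order_tendstoD(1))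
  then show ?thesis
  proof eventually_elim
    case (elim n)
    then have "W N \<rho> \<le> W N (g n) + \<xi>" using g dg by (intro \<epsilon>) auto
    then show ?case using Wg[of n] by simp
  qed
qed

section \<open>Affine changes of variables\<close>

definition aff :: "real \<Rightarrow> 'a \<Rightarrow> ('a \<Rightarrow> real) \<Rightarrow> 'a \<Rightarrow> real" where
  "aff r v f x = r ^ DIM('a) * f (v + r *\<^sub>R x)"

text \<open>The Jacobian factor in \<open>aff\<close> preserves mass. \<open>L\<close> acquires the
  factor (r^d) powr q = r powr s, the same that \<open>B\<close> has by homogeneity of the kernel.
  This invariance of the quotient is what singles out the exponent 1 + s / d.\<close>

lemma
  assumes f: "dens f" and r: "0 < r"
  shows dens_aff: "dens (aff r v f)" and mass_aff: "mass (aff r v f) = mass f"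
    and L_aff: "L (aff r v f) = r powr s * L f"
    and B_aff: "B (aff r v f) (aff r v f) = r powr s * B f f"
proof -
  note [measurable] = dens_measurable[OF f]
  have meas [measurable]: "aff r v f \<in> borel_measurable borel" unfolding aff_def by measurable
  have nn: "0 \<le> aff r v f x" for x using r dens_nonneg[OF f] by (simp add: aff_def)
  have m: "(\<integral>\<^sup>+x. ennreal (aff r v f x) \<partial>lborel) = ennreal (mass f)"
    using nn_integral_affine[OF r, of "\<lambda>x. ennreal (f x)" v] r nn_integral_dens[OF f]
    by (simp add: aff_def ennreal_mult dens_nonneg[OF f])
  have pw: "aff r v f x powr (1 + q) = r powr s * (r ^ DIM('a) * f (v + r *\<^sub>R x) powr (1 + q))" for x
  proof -
    have "(r ^ DIM('a)) powr (1 + q) = r powr (real DIM('a) * (1 + q))"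
      using r by (simp add: powr_powr flip: powr_realpow)
    also have "real DIM('a) * (1 + q) = s + real DIM('a)" by (simp add: q_eq field_simps)
    finally show ?thesis using r by (simp add: aff_def powr_mult powr_add powr_realpow abs_mult)
  qed
  have l: "(\<integral>\<^sup>+x. ennreal (aff r v f x powr (1 + q)) \<partial>lborel) = ennreal (r powr s * L f)"
  proof -
    have "(\<integral>\<^sup>+x. ennreal (aff r v f x powr (1 + q)) \<partial>lborel)
        = (\<integral>\<^sup>+x. ennreal (r powr s) * (ennreal (r ^ DIM('a)) * ennreal (f (v + r *\<^sub>R x) powr (1 + q))) \<partial>lborel)"
      using r by (simp add: pw ennreal_mult)
    also have "\<dots> = ennreal (r powr s) * (\<integral>\<^sup>+x. ennreal (r ^ DIM('a)) * ennreal (f (v + r *\<^sub>R x) powr (1 + q)) \<partial>lborel)"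
      by (rule nn_integral_cmult) measurable
    also have "(\<integral>\<^sup>+x. ennreal (r ^ DIM('a)) * ennreal (f (v + r *\<^sub>R x) powr (1 + q)) \<partial>lborel) = ennreal (L f)"
      by (subst nn_integral_affine[OF r, symmetric, of "\<lambda>x. ennreal (f x powr (1 + q))"]) (auto simp: nn_integral_powr_dens[OF f])
    finally show ?thesis by (simp add: ennreal_mult L_nonneg)
  qed
  show d: "dens (aff r v f)"
    unfolding dens_def using meas nn m l
    by (auto intro!: integrableI_nonneg)
  show "mass (aff r v f) = mass f"
    using nn_integral_dens[OF d] m mass_nonneg[OF f] mass_nonneg[OF d] by simp
  show "L (aff r v f) = r powr s * L f"
    using nn_integral_powr_dens[OF d] l by (simp add: L_nonneg)
  have "bform f f = (\<integral>\<^sup>+x. ennreal (r ^ DIM('a)) * (\<integral>\<^sup>+y. ennreal (f (v + r *\<^sub>R x)) * ennreal (f y) * k (v + r *\<^sub>R x) y \<partial>lborel) \<partial>lborel)"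
    unfolding bform_def by (rule nn_integral_affine[OF r]) measurable
  also have "\<dots> = (\<integral>\<^sup>+x. ennreal (r ^ DIM('a)) * (\<integral>\<^sup>+y. ennreal (r ^ DIM('a)) * (ennreal (f (v + r *\<^sub>R x)) * ennreal (f (v + r *\<^sub>R y)) * k (v + r *\<^sub>R x) (v + r *\<^sub>R y)) \<partial>lborel) \<partial>lborel)"
    by (intro nn_integral_cong arg_cong2[where f = "(*)"] refl nn_integral_affine[OF r]) measurable
  also have "\<dots> = (\<integral>\<^sup>+x. (\<integral>\<^sup>+y. ennreal (r powr - s) * (ennreal (aff r v f x) * ennreal (aff r v f y) * k x y) \<partial>lborel) \<partial>lborel)"
    using r dens_nonneg[OF f]
    by (intro nn_integral_cong, subst nn_integral_cmult[symmetric])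
      (auto simp: aff_def riesz_kernel_affine ennreal_mult mult_ac intro!: nn_integral_cong)
  also have "\<dots> = ennreal (r powr - s) * bform (aff r v f) (aff r v f)"
    unfolding bform_def by (simp add: nn_integral_cmult)
  finally have "ennreal (B f f) = ennreal (r powr - s) * ennreal (B (aff r v f) (aff r v f))"
    by (simp add: bform_eq f d)
  then have "B f f = r powr - s * B (aff r v f) (aff r v f)"
    using B_nonneg by (simp flip: ennreal_mult)
  then show "B (aff r v f) (aff r v f) = r powr s * B f f"
    using r by (simp add: powr_minus_divide)
qed

lemma adm_aff: "adm N f \<Longrightarrow> 0 < r \<Longrightarrow> adm N (aff r v f)"
  by (simp add: adm_def dens_aff mass_aff)

text \<open>States are transported by the inverse map, which multiplies every pair energy by r powr
  s.\<close>

lemma W_aff: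
  assumes f: "adm N f" and r: "0 < r"
  shows "W N (aff r v f) \<le> r powr s * W N f"
proof (rule field_le_epsilon)
  fix e :: real assume e: "0 < e"
  note [measurable] = dens_measurable[OF adm_dens[OF f]]
  define \<xi> where "\<xi> = e / r powr s"
  have \<xi>: "0 < \<xi>" using e r by (simp add: \<xi>_def)
  obtain P where P: "state N P f" "cost s P \<le> ennreal (W N f + \<xi>)"
    using W_approx_state[OF f \<xi>] .
  note [measurable_cong] = state_sets[OF P(1)]
  let ?T = "\<lambda>x. (1 / r) *\<^sub>R (x - v)"
  have T: "v + r *\<^sub>R ?T x = x" for x using r by simp
  have T': "?T (v + r *\<^sub>R x) = x" for x using r by simp
  let ?h = "\<lambda>\<omega> i. (?T (fst (\<omega> i)), snd (\<omega> i))"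
  have h: "?h \<in> measurable P slots" by (rule measurable_slots) measurable
  have psum_h: "psum F (?h \<omega>) = psum (\<lambda>x. F (?T x)) \<omega>" for F \<omega>
    by (simp add: psum_def cong: if_cong)
  have "k (?T x) (?T y) = ennreal (r powr s) * k x y" for x y
  proof -
    have "k x y = k (v + r *\<^sub>R ?T x) (v + r *\<^sub>R ?T y)" by (simp only: T)
    then have "ennreal (r powr s) * k x y = ennreal (r powr s) * (ennreal (r powr - s) * k (?T x) (?T y))"
      by (simp only: riesz_kernel_affine[OF r])
    also have "\<dots> = k (?T x) (?T y)"
      using r by (simp add: mult.assoc[symmetric] ennreal_mult[symmetric] powr_minus_divide)
    finally show ?thesis by simp
  qed
  then have pcost_h: "pcost s (?h \<omega>) = ennreal (r powr s) * pcost s \<omega>" for \<omega>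
    unfolding pcost_def by (simp add: ennreal_suminf_cmult[symmetric] sum_distrib_left if_distrib[of "(*) _"] cong: if_cong)
  have "state N (distr P slots ?h) (aff r v f)"
  proof (rule state_distr[OF state_prob[OF P(1)] h])
    show "AE \<omega> in P. psum (\<lambda>_. 1) (?h \<omega>) \<le> of_nat N"
      using state_count[OF P(1)] by (simp add: psum_h)
    fix F :: "'a \<Rightarrow> ennreal" assume [measurable]: "F \<in> borel_measurable borel"
    have "(\<integral>\<^sup>+\<omega>. psum F (?h \<omega>) \<partial>P) = (\<integral>\<^sup>+x. F (?T x) * ennreal (f x) \<partial>lborel)"
      unfolding psum_h by (rule state_density[OF P(1)]) measurable
    also have "\<dots> = (\<integral>\<^sup>+x. ennreal (r ^ DIM('a)) * (F (?T (v + r *\<^sub>R x)) * ennreal (f (v + r *\<^sub>R x))) \<partial>lborel)"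
      by (rule nn_integral_affine[OF r]) measurable
    also have "\<dots> = (\<integral>\<^sup>+x. F x * ennreal (aff r v f x) \<partial>lborel)"
      unfolding T' using r by (simp add: aff_def ennreal_mult dens_nonneg[OF adm_dens[OF f]] mult_ac)
    finally show "(\<integral>\<^sup>+\<omega>. psum F (?h \<omega>) \<partial>P) = (\<integral>\<^sup>+x. F x * ennreal (aff r v f x) \<partial>lborel)" .
  qed
  moreover have "cost s (distr P slots ?h) = ennreal (r powr s) * cost s P"
    by (simp only: cost_distr[OF h] pcost_h) (simp only: cost_def, rule nn_integral_cmult, measurable)
  moreover have "ennreal (r powr s) * cost s P \<le> ennreal (r powr s) * ennreal (W N f + \<xi>)"
    by (intro mult_left_mono P) auto
  moreover have "\<dots> = ennreal (r powr s * W N f + e)"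
    using r W_nonneg[OF f] e by (simp add: ennreal_mult[symmetric] distrib_left \<xi>_def)
  ultimately show "W N (aff r v f) \<le> r powr s * W N f + e"
    using W_nonneg[OF f] e by (intro W_le) (auto simp: ach_def)
qed

end

subsection \<open>The relaxed constant and its almost maximizers\<close>

text \<open>Up to S = x + y the second derivative of t powr (1 + q) is at least M, its value at S,
  because q < 1. Subtracting M / 2 * t^2 leaves a convex function, whose midpoint inequality is the
  claim.\<close>

lemma powr_midpoint_gap_pos:
  fixes x y q :: real
  assumes "0 < q" "q < 1" "0 < x" "0 < y"
  shows "(1 + q) * q / 8 * ((x - y)\<^sup>2 * (x + y) powr (q - 1))
    \<le> x powr (1 + q) / 2 + y powr (1 + q) / 2 - ((x + y) / 2) powr (1 + q)"
proof -
  define S where "S = x + y"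
  define M where "M = (1 + q) * q * S powr (q - 1)"
  have S: "0 < S" using assms by (simp add: S_def)
  let ?\<psi> = "\<lambda>t. t powr (1 + q) - M / 2 * t\<^sup>2"
  have "convex_on {0<..S} ?\<psi>"
  proof (rule convex_on_realI)
    show "connected {0<..S}" by simp
    show "(?\<psi> has_real_derivative (1 + q) * t powr q - M * t) (at t)" if "t \<in> {0<..S}" for t
      using that by (auto intro!: derivative_eq_intros)
    fix t u assume tu: "t \<in> {0<..S}" "u \<in> {0<..S}" "t \<le> u"
    show "(1 + q) * t powr q - M * t \<le> (1 + q) * u powr q - M * u"
    proof (rule DERIV_nonneg_imp_nondecreasing[OF tu(3)])
      fix z assume z: "t \<le> z" "z \<le> u"
      then have zp: "0 < z" "z \<le> S" using tu by auto
      have "((\<lambda>z. (1 + q) * z powr q - M * z) has_real_derivative (1 + q) * (q * z powr (q - 1)) - M) (at z)"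
        using zp by (auto intro!: derivative_eq_intros)
      moreover have "S powr (q - 1) \<le> z powr (q - 1)"
        using zp assms by (intro powr_mono2') auto
      then have "(1 + q) * q * S powr (q - 1) \<le> (1 + q) * q * z powr (q - 1)"
        using assms by (intro mult_left_mono) auto
      then have "0 \<le> (1 + q) * (q * z powr (q - 1)) - M"
        by (simp add: M_def mult.assoc)
      ultimately show "\<exists>D. ((\<lambda>z. (1 + q) * z powr q - M * z) has_real_derivative D) (at z) \<and> 0 \<le> D"
        by blast
    qed
  qed
  from convex_onD[OF this, of "1/2" x y] assms
  have *: "((x + y) / 2) powr (1 + q) - M / 2 * ((x + y) / 2)\<^sup>2
      \<le> (x powr (1 + q) - M / 2 * x\<^sup>2) / 2 + (y powr (1 + q) - M / 2 * y\<^sup>2) / 2"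
    by (simp add: S_def add_divide_distrib)
  have "M / 2 * (x\<^sup>2 / 2 + y\<^sup>2 / 2 - ((x + y) / 2)\<^sup>2)
      \<le> x powr (1 + q) / 2 + y powr (1 + q) / 2 - ((x + y) / 2) powr (1 + q)"
  proof -
    have "M / 2 * (X / 2 + Y / 2 - Z) = (M / 2 * X) / 2 + (M / 2 * Y) / 2 - M / 2 * Z" for X Y Z
      by (simp add: field_simps)
    note eq = this[of "x\<^sup>2" "y\<^sup>2" "((x + y) / 2)\<^sup>2"]
    define X Y Z where "X = M / 2 * x\<^sup>2" "Y = M / 2 * y\<^sup>2" "Z = M / 2 * ((x + y) / 2)\<^sup>2"
    show ?thesis using * unfolding eq unfolding X_Y_Z_def[symmetric] by argo
  qed
  moreover have "x\<^sup>2 / 2 + y\<^sup>2 / 2 - ((x + y) / 2)\<^sup>2 = (x - y)\<^sup>2 / 4"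
    by (simp add: power2_eq_square field_simps)
  ultimately show ?thesis by (simp add: M_def S_def mult_ac)
qed

text \<open>Limit of the positive case after shifting both arguments by a null sequence; the
  derivative argument breaks down at 0, where the power q - 1 is singular.\<close>

lemma powr_midpoint_gap:
  fixes x y q :: real
  assumes "0 < q" "q < 1" "0 \<le> x" "0 \<le> y"
  shows "(1 + q) * q / 8 * ((x - y)\<^sup>2 * (x + y) powr (q - 1))
    \<le> x powr (1 + q) / 2 + y powr (1 + q) / 2 - ((x + y) / 2) powr (1 + q)"
proof (cases "x = 0 \<and> y = 0")
  case False
  then have pos: "x + y \<noteq> 0" using assms by auto
  let ?e = "\<lambda>n. 1 / real (Suc n)"
  have e: "?e \<longlonglongrightarrow> 0" by (rule LIMSEQ_Suc[OF lim_1_over_n])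
  have xe: "(\<lambda>n. x + ?e n) \<longlonglongrightarrow> x" "(\<lambda>n. y + ?e n) \<longlonglongrightarrow> y"
    using tendsto_add[OF tendsto_const e, of x] tendsto_add[OF tendsto_const e, of y] by simp_all
  have pow: "(\<lambda>n. (u n) powr (1 + q)) \<longlonglongrightarrow> z powr (1 + q)" if "u \<longlonglongrightarrow> z" "\<And>n. 0 \<le> u n" for u z
    using assms that by (intro tendsto_powr2[OF _ tendsto_const]) auto
  show ?thesis
  proof (rule LIMSEQ_le)
    show "(\<lambda>n. (1 + q) * q / 8 * (((x + ?e n) - (y + ?e n))\<^sup>2 * ((x + ?e n) + (y + ?e n)) powr (q - 1)))
      \<longlonglongrightarrow> (1 + q) * q / 8 * ((x - y)\<^sup>2 * (x + y) powr (q - 1))"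
      using pos by (intro tendsto_intros xe) auto
    show "(\<lambda>n. (x + ?e n) powr (1 + q) / 2 + (y + ?e n) powr (1 + q) / 2 - (((x + ?e n) + (y + ?e n)) / 2) powr (1 + q))
      \<longlonglongrightarrow> x powr (1 + q) / 2 + y powr (1 + q) / 2 - ((x + y) / 2) powr (1 + q)"
      using assms by (intro tendsto_intros pow xe) auto
    show "\<exists>N. \<forall>n\<ge>N. (1 + q) * q / 8 * (((x + ?e n) - (y + ?e n))\<^sup>2 * ((x + ?e n) + (y + ?e n)) powr (q - 1))
      \<le> (x + ?e n) powr (1 + q) / 2 + (y + ?e n) powr (1 + q) / 2 - (((x + ?e n) + (y + ?e n)) / 2) powr (1 + q)"
      using assms by (intro exI[of _ 0] allI impI powr_midpoint_gap_pos) (auto intro: add_nonneg_pos)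
  qed
qed (use assms in auto)

context riesz_exponent begin

definition G :: "nat \<Rightarrow> ('a \<Rightarrow> real) \<Rightarrow> real" where "G N f = B f f / 2 - W N f"

text \<open>The zero function contributes \<open>0 / 0 = 0\<close>.\<close>

definition lam :: "nat \<Rightarrow> real" where "lam N = Sup {G N f / L f | f. adm N f}"

text \<open>Dropping \<open>W\<close> leaves \<open>B_le\<close> with mass at most N; this makes the
  supremum \<open>lam\<close> finite.\<close>

lemma G_le:
  assumes "adm N f" shows "G N f \<le> C1 * real N powr a * L f"
proof -
  have "B f f / 2 \<le> C1 * (mass f powr a * L f)"
    using B_le[OF adm_dens[OF assms] adm_dens[OF assms]] by (simp only: mult_2[symmetric] mult_ac)
  also have "\<dots> \<le> C1 * (real N powr a * L f)"
    using C1_pos q_less mass_nonneg[OF adm_dens[OF assms]] adm_mass[OF assms]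
    by (intro mult_left_mono mult_right_mono powr_mono2) (auto simp: L_nonneg)
  finally show ?thesis using W_nonneg[OF assms] by (simp add: G_def mult.assoc)
qed

lemma adm_zero: "adm N (\<lambda>_. 0)" by (simp add: adm_def dens_zero)

lemma lam_bdd: "bdd_above {G N f / L f | f. adm N f}"
proof (rule bdd_aboveI)
  fix r assume "r \<in> {G N f / L f | f. adm N f}"
  then obtain f where f: "adm N f" "r = G N f / L f" by auto
  show "r \<le> C1 * real N powr a"
  proof (cases "L f = 0")
    case False
    then have "0 < L f" using L_nonneg[of f] by simp
    then show ?thesis using G_le[OF f(1)] f by (simp add: pos_divide_le_eq)
  qed (use f C1_pos in simp)
qed

lemma G_le_lam: assumes "adm N f" shows "G N f \<le> lam N * L f"
proof (cases "L f = 0")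
  case True
  then show ?thesis using G_le[OF assms] by simp
next
  case False
  then have "0 < L f" using L_nonneg[of f] by simp
  moreover have "G N f / L f \<le> lam N"
    unfolding lam_def using assms by (intro cSup_upper lam_bdd) auto
  ultimately show ?thesis by (simp add: field_simps)
qed

lemma lam_nonneg: "0 \<le> lam N"
proof -
  have "G N (\<lambda>_. 0) / L (\<lambda>_. 0) \<le> lam N"
    unfolding lam_def using adm_zero by (intro cSup_upper lam_bdd) auto
  then show ?thesis by (simp add: L_def)
qed

lemma lam_approx:
  assumes "c < lam N"
  obtains f where "adm N f" "c < G N f / L f"
proof -
  have "{G N f / L f | f. adm N f} \<noteq> {}" using adm_zero by blast
  with assms obtain r where "r \<in> {G N f / L f | f. adm N f}" "c < r"
    unfolding lam_def by (subst (asm) less_cSup_iff) (auto intro: lam_bdd)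
  then show thesis using that by auto
qed

lemma adm_le: "adm N f \<Longrightarrow> N \<le> N' \<Longrightarrow> adm N' f"
  by (auto simp: adm_def)

lemma lam_mono: assumes "N \<le> N'" shows "lam N \<le> lam N'"
proof (rule dense_le)
  fix c assume "c < lam N"
  then obtain f where f: "adm N f" "c < G N f / L f" by (rule lam_approx)
  note f(2)
  also have "G N f / L f \<le> G N' f / L f"
    using W_antimono[OF f(1) assms] by (intro divide_right_mono) (auto simp: G_def L_nonneg)
  also have "\<dots> \<le> lam N'"
    unfolding lam_def using adm_le[OF f(1) assms] by (intro cSup_upper lam_bdd) auto
  finally show "c \<le> lam N'" by simp
qed

text \<open>Distance from optimality in additive form. Unlike the quotient it makes sense for
  \<open>L f\<close> = 0 and can be estimated under restriction and at midpoints.\<close>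

definition defect :: "nat \<Rightarrow> ('a \<Rightarrow> real) \<Rightarrow> real" where "defect N f = lam N * L f - G N f"

lemma defect_nonneg: "adm N f \<Longrightarrow> 0 \<le> defect N f"
  using G_le_lam by (simp add: defect_def)

text \<open>The weight is written as \<open>1 - 1/2\<close> so that the midpoint is literally the
  mixture of \<open>W_mix\<close> and \<open>adm_mix\<close>.\<close>

definition Lgap :: "('a \<Rightarrow> real) \<Rightarrow> ('a \<Rightarrow> real) \<Rightarrow> real" where
  "Lgap f g = L f / 2 + L g / 2 - L (\<lambda>x. (1 - 1/2) * f x + 1/2 * g x)"

text \<open>At the midpoint \<open>W\<close> is at most its average, while \<open>B / 2\<close>
  falls short of its average by one eighth of the energy of f - g; the midpoint itself has
  nonnegative defect.\<close>

lemma Lgap_le: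
  assumes f: "adm N f" and g: "adm N g"
  shows "lam N * Lgap f g \<le> defect N f / 2 + defect N g / 2 + (B f f + B g g - 2 * B f g) / 8"
proof -
  let ?m = "\<lambda>x. (1 - 1/2) * f x + 1/2 * g x"
  note df = adm_dens[OF f] and dg = adm_dens[OF g]
  have m: "adm N ?m" using f g by (rule adm_mix) auto
  define Wm Bm Lm where m_defs: "Wm = W N ?m" "Bm = B ?m ?m" "Lm = L ?m"
  have "Wm \<le> W N f / 2 + W N g / 2"
    unfolding m_defs using W_mix[OF f g, of "1/2"] by simp
  moreover have "Bm = B f g / 2 + (B f f / 4 + B g g / 4)"
    using df dg dens_scale[OF df, of "1/2"] dens_scale[OF dg, of "1/2"] unfolding m_defs
    by (simp add: B_add_left B_add_right dens_add B_scale_left B_scale_right B_commute[of g f] del: times_divide_eq_left)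
  moreover have "lam N * Lgap f g = lam N * L f / 2 + lam N * L g / 2 - lam N * Lm"
    unfolding m_defs by (simp add: Lgap_def algebra_simps)
  ultimately show ?thesis using defect_nonneg[OF m]
    unfolding defect_def G_def m_defs[symmetric] by argo
qed

text \<open>Young's inequality bounds |f - g| by Y / (2 * \<eta>) + \<eta> / 2 * (f + g) powr (1 -
  q), with Y = (f - g)^2 * (f + g) powr (q - 1). Y is controlled by the pointwise convexity gap, and
  the other power is at most 1 + f + g, which is integrable over a set of finite measure.\<close>

lemma L1_le_Lgap:
  assumes f: "dens f" and g: "dens g" and \<eta>: "0 < \<eta>" and E[measurable]: "E \<in> sets borel" and fin: "emeasure lborel E < \<infinity>"
  shows "(LINT x|lborel. \<bar>f x - g x\<bar> * indicator E x)
    \<le> 1 / (2 * \<eta>) * (8 / ((1 + q) * q)) * Lgap f g + \<eta> / 2 * (measure lborel E + mass f + mass g)"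
proof -
  note [measurable] = dens_measurable[OF f] dens_measurable[OF g]
  define c where "c = 8 / ((1 + q) * q)"
  have c: "0 < c" using q_pos by (simp add: c_def)
  let ?m = "\<lambda>x. (1 - 1/2) * f x + 1/2 * g x"
  have dm: "dens ?m" using f g by (intro dens_add dens_scale) auto
  let ?\<Gamma> = "\<lambda>x. f x powr (1 + q) / 2 + g x powr (1 + q) / 2 - (?m x) powr (1 + q)"
  have int\<Gamma>: "integrable lborel ?\<Gamma>"
    using f g dm by (intro Bochner_Integration.integrable_diff Bochner_Integration.integrable_add integrable_divide dens_integrable_powr)
  have I\<Gamma>: "(LINT x|lborel. ?\<Gamma> x) = Lgap f g"
    using f g dm by (simp add: Lgap_def L_def dens_integrable_powr)
  have intE: "integrable lborel (indicator E :: 'a \<Rightarrow> real)" using fin by (simp add: integrable_indicator_iff)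
  have pw: "\<bar>f x - g x\<bar> * indicator E x \<le> 1 / (2 * \<eta>) * c * ?\<Gamma> x + \<eta> / 2 * (indicator E x + f x + g x)" for x
  proof -
    have nn: "0 \<le> f x" "0 \<le> g x" using dens_nonneg[OF f] dens_nonneg[OF g] by auto
    define Y where "Y = (f x - g x)\<^sup>2 * (f x + g x) powr (q - 1)"
    have Y: "Y \<le> c * ?\<Gamma> x"
    proof -
      have m: "(f x + g x) / 2 = ?m x" by (simp add: add_divide_distrib)
      have "(1 + q) * q / 8 * Y \<le> ?\<Gamma> x"
        using powr_midpoint_gap[OF q_pos q_less nn] unfolding Y_def m by simp
      then have "c * ((1 + q) * q / 8 * Y) \<le> c * ?\<Gamma> x" using c by (intro mult_left_mono) auto
      moreover have "c * ((1 + q) * q / 8) = 1" using q_pos by (simp add: c_def)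
      then have "c * ((1 + q) * q / 8 * Y) = Y" by (simp only: mult.assoc[symmetric])
      ultimately show ?thesis by (simp only:)
    qed
    have "0 \<le> Y" by (simp add: Y_def)
    then have \<Gamma>0: "0 \<le> c * ?\<Gamma> x" using Y by linarith
    show ?thesis
    proof (cases "f x + g x = 0 \<or> x \<notin> E")
      case True
      then have "\<bar>f x - g x\<bar> * indicator E x = 0" using nn by auto
      moreover have "0 \<le> 1 / (2 * \<eta>) * (c * ?\<Gamma> x)" by (rule mult_nonneg_nonneg[OF _ \<Gamma>0]) (use \<eta> in simp)
      moreover have "0 \<le> \<eta> / 2 * (indicator E x + f x + g x)" using \<eta> nn by auto
      ultimately show ?thesis by (simp only: mult.assoc)
    next
      case False
      then have t: "0 < f x + g x" and xE: "x \<in> E" using nn by auto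
      define t where "t = f x + g x"
      have "t powr (1 - q) \<le> 1 + t"
      proof (cases "t \<le> 1")
        case True
        then have "t powr (1 - q) \<le> 1 powr (1 - q)" using t q_less by (intro powr_mono2) (auto simp: t_def)
        then show ?thesis using t by (simp add: t_def)
      next
        case False
        then have "t powr (1 - q) \<le> t powr 1" using q_pos by (intro powr_mono) auto
        then show ?thesis using False by simp
      qed
      moreover have "\<bar>f x - g x\<bar> \<le> 1 / (2 * \<eta>) * Y + \<eta> / 2 * t powr (1 - q)"
      proof -
        define A where "A = \<bar>f x - g x\<bar>"
        define Z where "Z = t powr (1 - q)"
        have Z: "0 < Z" using t by (simp add: Z_def t_def)
        have YZ: "Y = A\<^sup>2 / Z" using t powr_minus_divide[of t "1 - q"]
          by (simp add: Y_def A_def Z_def t_def[symmetric])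
        \<comment> \<open>Completed square with Z = (f + g) powr (1 - q), the reciprocal of the
          weight in Y.\<close>
        have "0 \<le> (A - \<eta> * Z)\<^sup>2" by simp
        then have "2 * \<eta> * Z * A \<le> A\<^sup>2 + \<eta>\<^sup>2 * Z\<^sup>2" by (simp add: power2_eq_square algebra_simps)
        then have "A \<le> (A\<^sup>2 + \<eta>\<^sup>2 * Z\<^sup>2) / (2 * \<eta> * Z)" using \<eta> Z by (simp add: field_simps)
        also have "\<dots> = 1 / (2 * \<eta>) * (A\<^sup>2 / Z) + \<eta> / 2 * Z"
          using \<eta> Z by (simp add: field_simps power2_eq_square)
        finally show ?thesis by (simp add: A_def[symmetric] Z_def[symmetric] YZ)
      qed
      moreover have "1 / (2 * \<eta>) * Y \<le> 1 / (2 * \<eta>) * (c * ?\<Gamma> x)" using Y \<eta> by (intro mult_left_mono) auto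
      moreover have "\<eta> / 2 * t powr (1 - q) \<le> \<eta> / 2 * (1 + t)"
        using calculation(1) \<eta> by (intro mult_left_mono) auto
      ultimately show ?thesis using xE by (simp add: t_def add.assoc mult.assoc)
    qed
  qed
  have "(LINT x|lborel. \<bar>f x - g x\<bar> * indicator E x)
      \<le> (LINT x|lborel. 1 / (2 * \<eta>) * c * ?\<Gamma> x + \<eta> / 2 * (indicator E x + f x + g x))"
  proof (rule integral_mono)
    show "integrable lborel (\<lambda>x. \<bar>f x - g x\<bar> * indicator E x)"
      using f g by (intro integrable_mult_indicator[where 'b=real, simplified, unfolded mult.commute[of "indicator _ _"]] E
        integrable_abs Bochner_Integration.integrable_diff dens_integrable) auto
    show "integrable lborel (\<lambda>x. 1 / (2 * \<eta>) * c * ?\<Gamma> x + \<eta> / 2 * (indicator E x + f x + g x))"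
      by (intro Bochner_Integration.integrable_add integrable_mult_right int\<Gamma> intE
        dens_integrable[OF f] dens_integrable[OF g])
  qed (rule pw)
  also have "\<dots> = 1 / (2 * \<eta>) * c * Lgap f g + \<eta> / 2 * (measure lborel E + mass f + mass g)"
  proof -
    have int3: "integrable lborel (\<lambda>x. indicator E x + f x + g x)"
      by (intro Bochner_Integration.integrable_add intE dens_integrable[OF f] dens_integrable[OF g])
    have "(LINT x|lborel. indicator E x + f x + g x) = measure lborel E + mass f + mass g"
      using intE f g by (simp add: dens_integrable)
    then show ?thesis
      using Bochner_Integration.integral_add[OF integrable_mult_right[OF int\<Gamma>] integrable_mult_right[OF int3]]
      by (simp only: integral_mult_right_zero I\<Gamma>)
  qed
  finally show ?thesis unfolding c_def .
qed

section \<open>Local mass and nonvanishing\<close>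

lemma local_mass_small:
  assumes "0 < \<epsilon>"
  obtains \<tau> where "0 < \<tau>" "\<And>g x. dens g \<Longrightarrow> L g \<le> 1 \<Longrightarrow>
    (\<integral>\<^sup>+y. ennreal (g y) * indicator (ball x \<tau>) y \<partial>lborel) \<le> ennreal \<epsilon>"
proof -
  \<comment> \<open>g is split at height T: g \<le> T + T powr (- q) * g powr (1 + q). The last term
    contributes at most \<epsilon> / 2 to the integral, and the radius \<tau> takes care of the
    other one.\<close>
  define T where "T = (2 / \<epsilon>) powr (1 / q)"
  have T: "0 < T" using assms by (simp add: T_def)
  have Tq: "T powr - q = \<epsilon> / 2"
    using assms q_pos by (simp add: T_def powr_powr powr_minus_divide)
  define V where "V = unit_ball_vol (real DIM('a)) + 1"
  have V: "0 < V" by (simp add: V_def add_nonneg_pos)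
  define \<tau> where "\<tau> = min 1 (\<epsilon> / (2 * T * V))"
  have \<tau>: "0 < \<tau>" "\<tau> \<le> 1" using assms T V by (auto simp: \<tau>_def)
  show thesis
  proof (rule that[OF \<tau>(1)])
    fix g :: "'a \<Rightarrow> real" and x assume g: "dens g" "L g \<le> 1"
    note [measurable] = dens_measurable[OF g(1)]
    have pw: "g y \<le> T + T powr - q * g y powr (1 + q)" for y
    proof (cases "g y \<le> T")
      case False
      then have "1 \<le> (g y / T) powr q" using T q_pos by (intro ge_one_powr_ge_zero) auto
      then have "g y \<le> g y * (g y / T) powr q" using False T by simp
      also have "\<dots> = T powr - q * g y powr (1 + q)"
        using False T by (simp add: powr_divide powr_minus_divide powr_add)
      finally show ?thesis using T by simp
    qed (simp add: add_increasing2)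
    have "(\<integral>\<^sup>+y. ennreal (g y) * indicator (ball x \<tau>) y \<partial>lborel)
        \<le> (\<integral>\<^sup>+y. ennreal T * indicator (ball x \<tau>) y + ennreal (T powr - q) * ennreal (g y powr (1 + q)) \<partial>lborel)"
    proof (intro nn_integral_mono)
      fix y
      show "ennreal (g y) * indicator (ball x \<tau>) y
        \<le> ennreal T * indicator (ball x \<tau>) y + ennreal (T powr - q) * ennreal (g y powr (1 + q))"
        using pw[of y] T by (auto simp: indicator_def ennreal_mult[symmetric] ennreal_plus[symmetric] simp del: ennreal_plus intro: ennreal_leI)
    qed
    also have "\<dots> = ennreal T * emeasure lborel (ball x \<tau>) + ennreal (T powr - q) * ennreal (L g)"
      by (simp add: nn_integral_add nn_integral_cmult nn_integral_powr_dens[OF g(1)])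
    also have "\<dots> \<le> ennreal (T * (V * \<tau>)) + ennreal (T powr - q * 1)"
    proof (intro add_mono)
      have "\<tau> ^ DIM('a) \<le> \<tau> ^ 1" using \<tau> by (intro power_decreasing) (auto simp: Suc_leI)
      then have "unit_ball_vol (real DIM('a)) * \<tau> ^ DIM('a) \<le> V * \<tau>"
        using \<tau> by (intro mult_mono) (auto simp: V_def)
      then show "ennreal T * emeasure lborel (ball x \<tau>) \<le> ennreal (T * (V * \<tau>))"
        using \<tau> T by (subst emeasure_ball) (auto simp: ennreal_mult[symmetric] intro!: ennreal_leI)
      show "ennreal (T powr - q) * ennreal (L g) \<le> ennreal (T powr - q * 1)"
        using g by (auto simp: ennreal_mult[symmetric] L_nonneg intro!: ennreal_leI mult_left_le)
    qed
    also have "\<dots> = ennreal (T * (V * \<tau>) + \<epsilon> / 2)"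
      using T V \<tau> assms by (simp add: Tq ennreal_plus[symmetric] del: ennreal_plus)
    also have "T * (V * \<tau>) + \<epsilon> / 2 \<le> \<epsilon>"
    proof -
      have "(T * V) * \<tau> \<le> (T * V) * (\<epsilon> / (2 * T * V))" using T V by (intro mult_left_mono) (auto simp: \<tau>_def)
      then show ?thesis using T V by simp
    qed
    finally show "(\<integral>\<^sup>+y. ennreal (g y) * indicator (ball x \<tau>) y \<partial>lborel) \<le> ennreal \<epsilon>"
      by (simp add: ennreal_leI)
  qed
qed

definition near :: "real \<Rightarrow> ('a \<Rightarrow> real) \<Rightarrow> ('a \<Rightarrow> real) \<Rightarrow> ennreal" where
  "near \<tau> f g = (\<integral>\<^sup>+x. \<integral>\<^sup>+y. ennreal (f x) * ennreal (g y) * k x y * indicator {z. dist (fst z) (snd z) < \<tau>} (x, y) \<partial>lborel \<partial>lborel)"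

lemma near_le:
  assumes "dens f" "dens g" "L f \<le> 1" "L g \<le> 1" "0 \<le> M"
    and "\<And>x. (\<integral>\<^sup>+y. ennreal (f y) * indicator (ball x \<tau>) y \<partial>lborel) \<le> ennreal M"
    and "\<And>x. (\<integral>\<^sup>+y. ennreal (g y) * indicator (ball x \<tau>) y \<partial>lborel) \<le> ennreal M"
  shows "near \<tau> f g \<le> ennreal (2 * C1 * M powr a)"
proof -
  have 1: "indicator {y. dist x y < \<tau>} = indicator (ball x \<tau>)" "indicator {y. dist y x < \<tau>} = indicator (ball x \<tau>)" for x :: 'a
    by (auto simp: fun_eq_iff indicator_def dist_commute)
  have "near \<tau> f g \<le> ennreal (C1 * (M powr a * L f + M powr a * L g))"
    unfolding near_def using assms
    by (intro bilinear_local_bound[where A = "\<lambda>x y. dist x y < \<tau>"]) (auto simp: 1)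
  also have "C1 * (M powr a * L f + M powr a * L g) \<le> C1 * (M powr a * 1 + M powr a * 1)"
    using assms C1_pos by (intro mult_left_mono add_mono) auto
  finally show ?thesis by (simp add: mult_ac ennreal_leI)
qed

text \<open>Balls of radius \<tau> carry uniformly little mass, so the local bound applies.
  Uniformity over all densities with \<open>L\<close> at most 1 lets one truncation scale of the
  kernel serve a whole sequence.\<close>

lemma near_small:
  assumes "0 < \<epsilon>"
  obtains \<tau> where "0 < \<tau>" "\<And>f g. dens f \<Longrightarrow> dens g \<Longrightarrow> L f \<le> 1 \<Longrightarrow> L g \<le> 1 \<Longrightarrow> near \<tau> f g \<le> ennreal \<epsilon>"
proof -
  define M where "M = (\<epsilon> / (2 * C1)) powr (1 / a)"
  have M: "0 < M" "2 * C1 * M powr a = \<epsilon>"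
    using assms C1_pos q_less by (auto simp: M_def powr_powr)
  obtain \<tau> where \<tau>: "0 < \<tau>" "\<And>g x. dens g \<Longrightarrow> L g \<le> 1 \<Longrightarrow>
    (\<integral>\<^sup>+y. ennreal (g y) * indicator (ball x \<tau>) y \<partial>lborel) \<le> ennreal M"
    using local_mass_small[OF M(1)] by blast
  show thesis
    by (rule that[OF \<tau>(1)]) (use near_le[where M = M and \<tau> = \<tau>] \<tau> M in auto)
qed

text \<open>If every ball of radius A carried less than c, the pairs closer than A would contribute
  at most b / 4 by the local bound, and the remaining ones at most A powr (- s) * N^2, again at most
  b / 4; the form would be smaller than b.\<close>

lemma nonvanishing:
  assumes "0 < b"
  obtains A c where "0 < A" "0 < c" "\<And>f. adm N f \<Longrightarrow> L f \<le> 1 \<Longrightarrow> b \<le> B f f \<Longrightarrow>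
    \<exists>x. ennreal c \<le> (\<integral>\<^sup>+y. ennreal (f y) * indicator (ball x A) y \<partial>lborel)"
proof -
  define M where "M = (b / (8 * C1)) powr (1 / a)"
  have M: "0 < M" "2 * C1 * M powr a = b / 4"
    using assms C1_pos q_less by (auto simp: M_def powr_powr)
  \<comment> \<open>The summand 1 keeps A positive for N = 0.\<close>
  define A where "A = (4 * ((real N)\<^sup>2 + 1) / b) powr (1 / s)"
  have A: "0 < A"
    using assms s_pos by (simp add: A_def add_nonneg_pos add_pos_nonneg zero_less_mult_iff) (smt (verit) zero_le_power2)
  have As: "A powr - s * ((real N)\<^sup>2 + 1) = b / 4"
  proof -
    have pos: "0 < (real N)\<^sup>2 + 1" by (simp add: add_nonneg_pos)
    have "A powr - s = 1 / (4 * ((real N)\<^sup>2 + 1) / b)"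
      using assms s_pos pos by (simp add: A_def powr_powr powr_minus_divide)
    then show ?thesis using pos assms by (simp add: field_simps)
  qed
  show thesis
  proof (rule that[OF A M(1)])
    fix f assume f: "adm N f" "L f \<le> 1" "b \<le> B f f"
    note d = adm_dens[OF f(1)]
    note [measurable] = dens_measurable[OF d]
    show "\<exists>x. ennreal M \<le> (\<integral>\<^sup>+y. ennreal (f y) * indicator (ball x A) y \<partial>lborel)"
    proof (rule ccontr)
      assume "\<not> ?thesis"
      then have small: "(\<integral>\<^sup>+y. ennreal (f y) * indicator (ball x A) y \<partial>lborel) \<le> ennreal M" for x
        by (auto simp: not_le intro: less_imp_le)
      have [measurable]: "Measurable.pred (borel \<Otimes>\<^sub>M borel) (\<lambda>z::'a\<times>'a. dist (fst z) (snd z) < A)" by measurable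
      have I[measurable]: "(\<lambda>x. indicator {z::'a\<times>'a. dist (fst z) (snd z) < A} (u x, v x) :: ennreal) \<in> borel_measurable M'"
        if [measurable]: "u \<in> borel_measurable M'" "v \<in> borel_measurable M'" for u v and M' :: "'b measure"
      proof -
        have "(\<lambda>x. if dist (u x) (v x) < A then 1 else (0::ennreal)) \<in> borel_measurable M'" by measurable
        also have "(\<lambda>x. if dist (u x) (v x) < A then 1 else (0::ennreal)) = (\<lambda>x. indicator {z::'a\<times>'a. dist (fst z) (snd z) < A} (u x, v x))"
          by (auto simp: indicator_def)
        finally show ?thesis .
      qed
      have "bform f f \<le> (\<integral>\<^sup>+x. \<integral>\<^sup>+y. ennreal (f x) * ennreal (f y) * k x y * indicator {z. dist (fst z) (snd z) < A} (x, y)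
          + ennreal (f x) * ennreal (f y) * ennreal (A powr - s) \<partial>lborel \<partial>lborel)"
        unfolding bform_def
      proof (intro nn_integral_mono)
        fix x y
        show "ennreal (f x) * ennreal (f y) * k x y \<le> ennreal (f x) * ennreal (f y) * k x y * indicator {z. dist (fst z) (snd z) < A} (x, y)
          + ennreal (f x) * ennreal (f y) * ennreal (A powr - s)"
          using k_le[OF A, of x y] by (cases "dist x y < A") (auto intro: mult_left_mono)
      qed
      also have "\<dots> = near A f f + (\<integral>\<^sup>+x. \<integral>\<^sup>+y. ennreal (f x) * ennreal (f y) * ennreal (A powr - s) \<partial>lborel \<partial>lborel)"
        unfolding near_def by (simp add: nn_integral_add)
      also have "(\<integral>\<^sup>+x. \<integral>\<^sup>+y. ennreal (f x) * ennreal (f y) * ennreal (A powr - s) \<partial>lborel \<partial>lborel)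
          = ennreal (mass f * mass f * A powr - s)"
        using mass_nonneg[OF d]
        by (simp add: nn_integral_cmult nn_integral_multc nn_integral_dens[OF d] ennreal_mult)
      also have "near A f f + ennreal (mass f * mass f * A powr - s) \<le> ennreal (b / 4) + ennreal (b / 4)"
      proof (intro add_mono ennreal_leI)
        show "near A f f \<le> ennreal (b / 4)"
          using near_le[OF d d f(2) f(2) less_imp_le[OF M(1)] small small] M(2) by simp
        have "mass f * mass f \<le> real N * real N"
          using adm_mass[OF f(1)] mass_nonneg[OF d] by (intro mult_mono) auto
        then have "mass f * mass f \<le> (real N)\<^sup>2 + 1" by (simp add: power2_eq_square)
        then have "mass f * mass f * A powr - s \<le> ((real N)\<^sup>2 + 1) * A powr - s"
          by (intro mult_right_mono) auto
        then show "mass f * mass f * A powr - s \<le> b / 4" using As by (simp add: mult.commute)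
      qed
      also have "\<dots> = ennreal (b / 2)" using assms by (simp add: ennreal_plus[symmetric] del: ennreal_plus)
      finally have "B f f \<le> b / 2" using assms by (simp add: bform_eq[OF d d])
      then show False using f(3) assms by simp
    qed
  qed
qed

section \<open>Cutting densities in space\<close>

lemma B_far:
  assumes f: "dens f" and g: "dens g" and r: "0 < r"
    and far: "\<And>x y. f x \<noteq> 0 \<Longrightarrow> g y \<noteq> 0 \<Longrightarrow> r \<le> dist x y"
  shows "B f g \<le> r powr - s * mass f * mass g"
proof -
  note [measurable] = dens_measurable[OF f] dens_measurable[OF g]
  have "bform f g \<le> (\<integral>\<^sup>+x. \<integral>\<^sup>+y. ennreal (f x) * ennreal (g y) * ennreal (r powr - s) \<partial>lborel \<partial>lborel)"
    unfolding bform_def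
  proof (intro nn_integral_mono)
    fix x y
    show "ennreal (f x) * ennreal (g y) * k x y \<le> ennreal (f x) * ennreal (g y) * ennreal (r powr - s)"
      using k_le[OF r far, of x y] by (cases "f x = 0 \<or> g y = 0") (auto intro: mult_left_mono)
  qed
  also have "\<dots> = ennreal (r powr - s * mass f * mass g)"
    using mass_nonneg[OF f] mass_nonneg[OF g]
    by (simp add: nn_integral_cmult nn_integral_multc nn_integral_dens f g ennreal_mult mult_ac)
  finally show ?thesis using mass_nonneg[OF f] mass_nonneg[OF g] by (simp add: bform_eq f g)
qed

lemma restrict_split:
  assumes f: "dens f" and E: "E \<in> sets borel"
  defines "f1 \<equiv> \<lambda>x. f x * indicator E x" and "f2 \<equiv> \<lambda>x. f x * indicator (- E) x"
  shows mass_split: "mass f = mass f1 + mass f2" and L_split: "L f = L f1 + L f2"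
    and B_split: "dens g \<Longrightarrow> B f g = B f1 g + B f2 g"
    and BB_split: "B f f = B f1 f1 + 2 * B f1 f2 + B f2 f2"
proof -
  have d: "dens f1" "dens f2" unfolding f1_def f2_def using f E by (auto intro: dens_restrict)
  have f12: "f = (\<lambda>x. f1 x + f2 x)" by (auto simp: f1_def f2_def indicator_def)
  show "mass f = mass f1 + mass f2" by (subst f12) (rule mass_add[OF d])
  have "f x powr (1 + q) = f1 x powr (1 + q) + f2 x powr (1 + q)" for x
    by (auto simp: f1_def f2_def indicator_def)
  then show "L f = L f1 + L f2"
    unfolding L_def using d by (simp add: dens_integrable_powr)
  show "dens g \<Longrightarrow> B f g = B f1 g + B f2 g" by (subst f12) (rule B_add_left[OF d])
  show "B f f = B f1 f1 + 2 * B f1 f2 + B f2 f2"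
    by (subst (1 2) f12) (use d in \<open>simp add: B_add_left B_add_right dens_add B_commute[of f2 f1]\<close>)
qed

text \<open>\<open>W\<close> is superadditive and \<open>L\<close> additive under cutting, and the
  discarded piece has nonnegative defect, so only the interaction of the two pieces is lost.\<close>

lemma defect_restrict:
  assumes f: "adm N f" and E: "E \<in> sets borel"
  defines "f1 \<equiv> \<lambda>x. f x * indicator E x" and "f2 \<equiv> \<lambda>x. f x * indicator (- E) x"
  shows "defect N f1 \<le> defect N f + B f1 f2"
proof -
  have a2: "adm N f2" unfolding f2_def using E by (intro adm_restrict[OF f]) auto
  note s = restrict_split[OF adm_dens[OF f] E, folded f1_def f2_def]
  have "W N f1 + W N f2 \<le> W N f" unfolding f1_def f2_def by (rule W_split[OF f E])
  moreover have "lam N * L f = lam N * L f1 + lam N * L f2" by (simp add: s(2) distrib_left)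
  ultimately show ?thesis
    using defect_nonneg[OF a2] s(4) unfolding defect_def G_def by argo
qed

text \<open>The mass beyond radius 2 * R has distance at least R from the kept part and interacts
  weakly with it; the shell between R and 2 * R has mass at most \<epsilon>, which bounds its
  interaction by \<open>B_le_sqrt\<close>.\<close>

lemma defect_cutoff:
  assumes f: "adm N f" "L f \<le> 1" and R: "0 < R"
    and shell: "mass (\<lambda>x. f x * indicator (cball 0 (2 * R) - cball 0 R) x) \<le> \<epsilon>" and "0 \<le> \<epsilon>"
  shows "defect N (\<lambda>x. f x * indicator (cball 0 R) x)
    \<le> defect N f + (2 * C1 * sqrt (real N powr a) * sqrt (\<epsilon> powr a) + R powr - s * real N * real N)"
proof -
  note d = adm_dens[OF f(1)]
  define f1 where "f1 = (\<lambda>x. f x * indicator (cball 0 R) x)"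
  define f2 where "f2 = (\<lambda>x. f x * indicator (- cball 0 R) x)"
  define g1 where "g1 = (\<lambda>x. f2 x * indicator (cball 0 (2 * R)) x)"
  define g2 where "g2 = (\<lambda>x. f2 x * indicator (- cball 0 (2 * R)) x)"
  have ad: "adm N f1" "adm N f2" unfolding f1_def f2_def by (auto intro: adm_restrict f)
  then have ad': "adm N g1" "adm N g2" unfolding g1_def g2_def by (auto intro: adm_restrict)
  note dd = ad[THEN adm_dens] ad'[THEN adm_dens]
  have le: "f1 x \<le> f x" "g1 x \<le> f x" for x
    using dens_nonneg[OF d, of x] by (auto simp: f1_def g1_def f2_def indicator_def)
  have "B f1 f2 = B f1 g1 + B f1 g2"
    using B_split[OF dd(2), of "cball 0 (2 * R)" f1] dd
    by (simp add: g1_def[symmetric] g2_def[symmetric] B_commute[of f1])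
  moreover have "B f1 g2 \<le> R powr - s * real N * real N"
  proof -
    have "B f1 g2 \<le> R powr - s * mass f1 * mass g2"
    proof (rule B_far[OF dd(1,4) R])
      fix x y assume "f1 x \<noteq> 0" "g2 y \<noteq> 0"
      then have "norm x \<le> R" "2 * R < norm y"
        by (auto simp: f1_def g2_def indicator_def split: if_splits)
      then show "R \<le> dist x y" using norm_triangle_ineq2[of y x] by (simp add: dist_norm norm_minus_commute)
    qed
    also have "\<dots> \<le> R powr - s * real N * real N"
      using ad ad' dd by (intro mult_mono) (auto simp: adm_mass mass_nonneg)
    finally show ?thesis .
  qed
  moreover have "B f1 g1 \<le> 2 * C1 * sqrt (real N powr a) * sqrt (\<epsilon> powr a)"
  proof -
    have L1: "L f1 \<le> 1" "L g1 \<le> 1" using L_mono[OF d dd(1)] L_mono[OF d dd(3)] le f(2) by (meson order_trans)+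
    have g1m: "mass g1 \<le> \<epsilon>"
    proof -
      have "g1 = (\<lambda>x. f x * indicator (cball 0 (2 * R) - cball 0 R) x)"
        by (auto simp: g1_def f2_def indicator_def)
      then show ?thesis using shell by simp
    qed
    have "B f1 g1 \<le> 2 * C1 * sqrt (mass f1 powr a * L f1) * sqrt (mass g1 powr a * L g1)"
      by (rule B_le_sqrt[OF dd(1,3)])
    also have "\<dots> \<le> 2 * C1 * sqrt (real N powr a * 1) * sqrt (\<epsilon> powr a * 1)"
      using L1 g1m ad dd q_less C1_pos
      by (intro mult_mono real_sqrt_le_mono powr_mono2) (auto simp: adm_mass mass_nonneg L_nonneg)
    finally show ?thesis by simp
  qed
  moreover have "defect N f1 \<le> defect N f + B f1 f2"
    unfolding f1_def f2_def by (rule defect_restrict[OF f(1)]) simp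
  ultimately show ?thesis unfolding f1_def by linarith
qed


subsection \<open>Existence of maximizers\<close>

text \<open>Kernel capped at distance \<tau>. It is bounded and Lipschitz, so that its potentials
  are equicontinuous, and it differs from the kernel only for pairs closer than \<tau>, which
  \<open>near_small\<close> controls.\<close>

definition kt :: "real \<Rightarrow> 'a \<Rightarrow> 'a \<Rightarrow> real" where "kt \<tau> x y = (max \<tau> (dist x y)) powr - s"

definition pot :: "real \<Rightarrow> ('a \<Rightarrow> real) \<Rightarrow> 'a \<Rightarrow> real" where
  "pot \<tau> g x = (LINT y|lborel. g y * kt \<tau> x y)"

lemma measurable_kt [measurable]:
  assumes [measurable]: "u \<in> borel_measurable M" "v \<in> borel_measurable M"
  shows "(\<lambda>z. kt \<tau> (u z) (v z)) \<in> borel_measurable M"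
  unfolding kt_def by measurable

lemma kt_nonneg: "0 \<le> kt \<tau> x y"
  by (simp add: kt_def)

lemma kt_le: "0 < \<tau> \<Longrightarrow> kt \<tau> x y \<le> \<tau> powr - s"
  unfolding kt_def using s_pos by (intro powr_mono2') auto

lemma kt_le_k: assumes "0 < \<tau>" shows "ennreal (kt \<tau> x y) \<le> k x y"
proof (cases "x = y")
  case False
  have "kt \<tau> x y \<le> dist x y powr - s"
    unfolding kt_def using s_pos False by (intro powr_mono2') auto
  then show ?thesis
    by (rule order_trans[OF ennreal_leI k_ge]) simp
qed (simp add: riesz_kernel_same)

lemma k_le_kt: "\<tau> \<le> dist x y \<Longrightarrow> 0 < \<tau> \<Longrightarrow> k x y \<le> ennreal (kt \<tau> x y)"
  using k_le[of "dist x y" x y] by (cases "x = y") (auto simp: kt_def max_def)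

lemma kt_lipschitz:
  assumes "0 < \<tau>"
  shows "\<bar>kt \<tau> x y - kt \<tau> x' y\<bar> \<le> s * \<tau> powr (- s - 1) * dist x x'"
proof -
  have "norm ((max \<tau> (dist x y)) powr - s - (max \<tau> (dist x' y)) powr - s)
      \<le> (s * \<tau> powr (- s - 1)) * norm (max \<tau> (dist x y) - max \<tau> (dist x' y))"
  proof (rule field_differentiable_bound[where S = "{\<tau>..}" and f' = "\<lambda>z. - s * z powr (- s - 1)"])
    fix z assume "z \<in> {\<tau>..}"
    then have z: "\<tau> \<le> z" "0 < z" using assms by auto
    show "((\<lambda>z. z powr - s) has_field_derivative - s * z powr (- s - 1)) (at z within {\<tau>..})"
      using z by (auto intro!: derivative_eq_intros)
    show "norm (- s * z powr (- s - 1)) \<le> s * \<tau> powr (- s - 1)"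
      using z s_pos assms by (auto simp: abs_mult intro!: mult_left_mono powr_mono2')
  qed auto
  also have "\<dots> \<le> (s * \<tau> powr (- s - 1)) * dist x x'"
  proof (rule mult_left_mono)
    have "\<bar>max \<tau> (dist x y) - max \<tau> (dist x' y)\<bar> \<le> \<bar>dist x y - dist x' y\<bar>" by (auto simp: max_def)
    also have "\<dots> \<le> dist x x'" using dist_triangle[of x y x'] dist_triangle[of x' y x] by (auto simp: dist_commute)
    finally show "norm (max \<tau> (dist x y) - max \<tau> (dist x' y)) \<le> dist x x'" by simp
  qed (use s_pos in auto)
  finally show ?thesis by (simp add: kt_def)
qed

lemma integrable_kt:
  assumes g: "dens g" and "0 < \<tau>" shows "integrable lborel (\<lambda>y. g y * kt \<tau> x y)"
proof -
  note [measurable] = dens_measurable[OF g]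
  have "integrable lborel (\<lambda>y. \<tau> powr - s * g y)" using dens_integrable[OF g] by simp
  then show ?thesis
  proof (rule Bochner_Integration.integrable_bound)
    show "AE y in lborel. norm (g y * kt \<tau> x y) \<le> norm (\<tau> powr - s * g y)"
      using dens_nonneg[OF g] kt_nonneg kt_le[OF assms(2)]
      by (auto intro!: AE_I2 mult_left_mono simp: abs_mult mult.commute)
  qed simp
qed

lemma pot_eq: "dens g \<Longrightarrow> 0 < \<tau> \<Longrightarrow> ennreal (pot \<tau> g x) = (\<integral>\<^sup>+y. ennreal (g y) * ennreal (kt \<tau> x y) \<partial>lborel)"
  unfolding pot_def
  by (subst nn_integral_eq_integral[symmetric])
    (auto simp: integrable_kt dens_nonneg kt_nonneg ennreal_mult[symmetric])

lemma pot_nonneg: "dens g \<Longrightarrow> 0 \<le> pot \<tau> g x"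
  by (auto simp: pot_def dens_nonneg kt_nonneg)

lemma pot_le: assumes "dens g" "0 < \<tau>" shows "pot \<tau> g x \<le> \<tau> powr - s * mass g"
proof -
  have "pot \<tau> g x \<le> (LINT y|lborel. g y * \<tau> powr - s)"
    unfolding pot_def using assms
    by (intro integral_mono integrable_kt integrable_mult_left dens_integrable mult_left_mono kt_le dens_nonneg)
  then show ?thesis by (simp add: mult.commute)
qed

lemma pot_lipschitz:
  assumes "dens g" "0 < \<tau>"
  shows "\<bar>pot \<tau> g x - pot \<tau> g x'\<bar> \<le> s * \<tau> powr (- s - 1) * mass g * dist x x'"
proof -
  have "\<bar>pot \<tau> g x - pot \<tau> g x'\<bar> = \<bar>LINT y|lborel. g y * kt \<tau> x y - g y * kt \<tau> x' y\<bar>"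
    unfolding pot_def using assms by (subst Bochner_Integration.integral_diff) (auto intro: integrable_kt)
  also have "\<dots> \<le> (LINT y|lborel. \<bar>g y * kt \<tau> x y - g y * kt \<tau> x' y\<bar>)" by (rule integral_abs_bound)
  also have "\<dots> \<le> (LINT y|lborel. g y * (s * \<tau> powr (- s - 1) * dist x x'))"
  proof (rule integral_mono)
    show "integrable lborel (\<lambda>y. \<bar>g y * kt \<tau> x y - g y * kt \<tau> x' y\<bar>)"
      using assms by (intro integrable_abs Bochner_Integration.integrable_diff integrable_kt)
    show "integrable lborel (\<lambda>y. g y * (s * \<tau> powr (- s - 1) * dist x x'))"
      using assms by (intro integrable_mult_left dens_integrable)
    show "\<bar>g y * kt \<tau> x y - g y * kt \<tau> x' y\<bar> \<le> g y * (s * \<tau> powr (- s - 1) * dist x x')" for y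
      using kt_lipschitz[OF assms(2)] dens_nonneg[OF assms(1), of y]
      by (auto simp: right_diff_distrib[symmetric] abs_mult intro!: mult_left_mono)
  qed
  also have "\<dots> = s * \<tau> powr (- s - 1) * mass g * dist x x'" by (simp add: mult_ac)
  finally show ?thesis .
qed

lemma measurable_near [measurable]:
  assumes [measurable]: "u \<in> borel_measurable M" "v \<in> borel_measurable M"
  shows "(\<lambda>x. indicator {z::'a\<times>'a. dist (fst z) (snd z) < A} (u x, v x) :: ennreal) \<in> borel_measurable M"
proof -
  have "(\<lambda>x. if dist (u x) (v x) < A then 1 else (0::ennreal)) \<in> borel_measurable M" by measurable
  also have "(\<lambda>x. if dist (u x) (v x) < A then 1 else (0::ennreal)) = (\<lambda>x. indicator {z::'a\<times>'a. dist (fst z) (snd z) < A} (u x, v x))"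
    by (auto simp: indicator_def)
  finally show ?thesis .
qed

lemma measurable_pot [measurable]:
  assumes g: "dens g" and "0 < \<tau>" shows "(\<lambda>x. ennreal (pot \<tau> g x)) \<in> borel_measurable borel"
proof -
  note [measurable] = dens_measurable[OF g]
  show ?thesis unfolding pot_eq[OF assms] by measurable
qed

lemma bform_le_pot:
  assumes f: "dens f" and g: "dens g" and \<tau>: "0 < \<tau>"
  shows "bform f g \<le> (\<integral>\<^sup>+x. ennreal (f x) * ennreal (pot \<tau> g x) \<partial>lborel) + near \<tau> f g"
proof -
  note [measurable] = dens_measurable[OF f] dens_measurable[OF g]
  have "bform f g \<le> (\<integral>\<^sup>+x. \<integral>\<^sup>+y. ennreal (f x) * (ennreal (g y) * ennreal (kt \<tau> x y))
      + ennreal (f x) * ennreal (g y) * k x y * indicator {z. dist (fst z) (snd z) < \<tau>} (x, y) \<partial>lborel \<partial>lborel)"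
    unfolding bform_def
  proof (intro nn_integral_mono)
    fix x y
    show "ennreal (f x) * ennreal (g y) * k x y \<le> ennreal (f x) * (ennreal (g y) * ennreal (kt \<tau> x y))
      + ennreal (f x) * ennreal (g y) * k x y * indicator {z. dist (fst z) (snd z) < \<tau>} (x, y)"
      using k_le_kt[of \<tau> x y] \<tau> by (cases "dist x y < \<tau>") (auto simp: mult.assoc intro!: mult_left_mono)
  qed
  also have "\<dots> = (\<integral>\<^sup>+x. ennreal (f x) * ennreal (pot \<tau> g x) \<partial>lborel) + near \<tau> f g"
    unfolding near_def pot_eq[OF g \<tau>] by (simp add: nn_integral_add nn_integral_cmult)
  finally show ?thesis .
qed

lemma pot_le_bform:
  assumes f: "dens f" and g: "dens g" and \<tau>: "0 < \<tau>"
  shows "(\<integral>\<^sup>+x. ennreal (f x) * ennreal (pot \<tau> g x) \<partial>lborel) \<le> bform f g"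
  unfolding bform_potential[OF f g] pot_eq[OF g \<tau>]
  by (intro nn_integral_mono mult_left_mono kt_le_k \<tau>) auto

text \<open>The form lies between the capped form and the capped form plus its near part. Closeness
  of the capped potentials on the set where f is nonzero then bounds \<open>B f f - B f g\<close>;
  adding the same bound with f and g exchanged gives the energy of f - g.\<close>

lemma B_diff_le:
  assumes f: "dens f" and g: "dens g" and \<tau>: "0 < \<tau>" and near: "near \<tau> f f \<le> ennreal \<epsilon>" and "0 \<le> \<epsilon>"
    and S: "\<And>x. f x \<noteq> 0 \<Longrightarrow> pot \<tau> f x \<le> pot \<tau> g x + \<eta>" and "0 \<le> \<eta>"
  shows "B f f - B f g \<le> \<eta> * mass f + \<epsilon>"
proof -
  note [measurable] = dens_measurable[OF f] measurable_pot[OF g \<tau>]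
  have "bform f f \<le> (\<integral>\<^sup>+x. ennreal (f x) * ennreal (pot \<tau> f x) \<partial>lborel) + near \<tau> f f"
    by (rule bform_le_pot[OF f f \<tau>])
  also have "(\<integral>\<^sup>+x. ennreal (f x) * ennreal (pot \<tau> f x) \<partial>lborel)
      \<le> (\<integral>\<^sup>+x. ennreal (f x) * ennreal (pot \<tau> g x) + ennreal \<eta> * ennreal (f x) \<partial>lborel)"
  proof (intro nn_integral_mono)
    fix x
    show "ennreal (f x) * ennreal (pot \<tau> f x) \<le> ennreal (f x) * ennreal (pot \<tau> g x) + ennreal \<eta> * ennreal (f x)"
    proof (cases "f x = 0")
      case False
      have "f x * pot \<tau> f x \<le> f x * (pot \<tau> g x + \<eta>)"
        using S[OF False] dens_nonneg[OF f] by (intro mult_left_mono) auto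
      then have "ennreal (f x * pot \<tau> f x) \<le> ennreal (f x * pot \<tau> g x + \<eta> * f x)"
        by (intro ennreal_leI) (simp add: algebra_simps)
      then show ?thesis
        using dens_nonneg[OF f] pot_nonneg[OF f] pot_nonneg[OF g] \<open>0 \<le> \<eta>\<close> by (simp add: ennreal_mult)
    qed simp
  qed
  also have "\<dots> = (\<integral>\<^sup>+x. ennreal (f x) * ennreal (pot \<tau> g x) \<partial>lborel) + ennreal (\<eta> * mass f)"
    using \<open>0 \<le> \<eta>\<close> by (simp add: nn_integral_add nn_integral_cmult nn_integral_dens[OF f] ennreal_mult mass_nonneg[OF f])
  also have "(\<integral>\<^sup>+x. ennreal (f x) * ennreal (pot \<tau> g x) \<partial>lborel) \<le> bform f g" by (rule pot_le_bform[OF f g \<tau>])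
  also note near
  finally have "ennreal (B f f) \<le> ennreal (B f g) + ennreal (\<eta> * mass f) + ennreal \<epsilon>"
    by (simp add: bform_eq f g)
  also have "\<dots> = ennreal (B f g + \<eta> * mass f + \<epsilon>)"
    using B_nonneg mass_nonneg[OF f] assms by simp
  finally show ?thesis
    using B_nonneg[of f g] mass_nonneg[OF f] assms by (subst (asm) ennreal_le_iff) auto
qed

section \<open>Extraction of subsequences\<close>

definition trunc :: "nat \<Rightarrow> ('a \<Rightarrow> real) \<Rightarrow> 'a \<Rightarrow> real" where
  "trunc j f x = f x * indicator (cball 0 (real j)) x"

lemma adm_trunc: "adm N f \<Longrightarrow> adm N (trunc j f)"
  unfolding trunc_def by (rule adm_restrict) auto

lemma dens_trunc: "dens f \<Longrightarrow> dens (trunc j f)"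
  unfolding trunc_def by (rule dens_restrict) auto

lemma trunc_le: "dens f \<Longrightarrow> trunc j f x \<le> f x"
  using dens_nonneg[of f x] by (auto simp: trunc_def indicator_def)

text \<open>The index j governs both the radius of the cut-off and the cap 1 / (j + 1), so one
  diagonal extraction covers all scales. Stated as a Cauchy property it passes to subsequences
  without mentioning limits.\<close>

definition cauchy_trunc :: "nat \<Rightarrow> (nat \<Rightarrow> 'a \<Rightarrow> real) \<Rightarrow> bool" where
  "cauchy_trunc j f \<longleftrightarrow> (\<forall>e>0. \<exists>n0. \<forall>m\<ge>n0. \<forall>n\<ge>n0.
     (\<forall>x\<in>cball 0 (real j). \<bar>pot (1 / real (Suc j)) (trunc j (f m)) x - pot (1 / real (Suc j)) (trunc j (f n)) x\<bar> < e)
     \<and> \<bar>mass (trunc j (f m)) - mass (trunc j (f n))\<bar> < e)"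

lemma cauchy_trunc_subseq: "cauchy_trunc j f \<Longrightarrow> strict_mono r \<Longrightarrow> cauchy_trunc j (f \<circ> r)"
  unfolding cauchy_trunc_def comp_def by (meson le_trans seq_suble)

text \<open>Masses are at most N, so the capped potentials share a bound and a Lipschitz constant.
  After their uniform limit on the ball has been extracted, a second extraction makes the truncated
  masses converge.\<close>

lemma exists_cauchy_trunc:
  fixes f :: "nat \<Rightarrow> 'a \<Rightarrow> real"
  assumes f: "\<And>n. adm N (f n)"
  shows "\<exists>r. strict_mono r \<and> cauchy_trunc j (f \<circ> r)"
proof -
  define \<tau> where "\<tau> = 1 / real (Suc j)"
  have \<tau>: "0 < \<tau>" by (simp add: \<tau>_def)
  note a = adm_trunc[OF f, of j] and d = adm_dens[OF adm_trunc[OF f, of j]]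
  let ?V = "\<lambda>n. pot \<tau> (trunc j (f n))"
  define Lc where "Lc = s * \<tau> powr (- s - 1) * real N"
  have Lc: "0 \<le> Lc" using s_pos by (simp add: Lc_def)
  have lip: "\<bar>?V n x - ?V n y\<bar> \<le> Lc * dist x y" for n x y
  proof -
    have "s * \<tau> powr (- s - 1) * mass (trunc j (f n)) * dist x y \<le> Lc * dist x y"
      unfolding Lc_def using s_pos adm_mass[OF a, of n] by (intro mult_right_mono mult_left_mono) auto
    then show ?thesis using pot_lipschitz[OF d \<tau>, of n x y] by linarith
  qed
  obtain l r1 where r1: "strict_mono (r1 :: nat \<Rightarrow> nat)"
    and l: "\<And>e. 0 < e \<Longrightarrow> \<exists>n0. \<forall>n x. n0 \<le> n \<and> x \<in> cball 0 (real j) \<longrightarrow> norm (?V (r1 n) x - l x) < e"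
  proof (rule Arzela_Ascoli[of "cball 0 (real j)" ?V "\<tau> powr - s * real N"])
    show "norm (?V n x) \<le> \<tau> powr - s * real N" for n x
    proof -
      have "\<tau> powr - s * mass (trunc j (f n)) \<le> \<tau> powr - s * real N"
        using adm_mass[OF a, of n] by (intro mult_left_mono) auto
      then show ?thesis using pot_le[OF d \<tau>, of n x] pot_nonneg[OF d, of \<tau> n x] by simp
    qed
    fix x :: 'a and e :: real assume e: "0 < e"
    show "\<exists>d>0. \<forall>n y. y \<in> cball 0 (real j) \<and> norm (x - y) < d \<longrightarrow> norm (?V n x - ?V n y) < e"
    proof (intro exI[of _ "e / (Lc + 1)"] conjI allI impI)
      show "0 < e / (Lc + 1)" using e Lc by simp
      fix n y assume "y \<in> cball 0 (real j) \<and> norm (x - y) < e / (Lc + 1)"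
      then have "(Lc + 1) * dist x y < e" using Lc by (simp add: dist_norm field_simps)
      moreover have "Lc * dist x y \<le> (Lc + 1) * dist x y" by (intro mult_right_mono) auto
      ultimately show "norm (?V n x - ?V n y) < e" using lip[of n x y] by simp
    qed
  qed auto
  have "bounded (range (\<lambda>n. mass (trunc j (f (r1 n)))))"
    using adm_mass[OF a] mass_nonneg[OF d] by (intro boundedI[of _ "real N"]) auto
  then obtain c r2 where r2: "strict_mono (r2 :: nat \<Rightarrow> nat)" and c: "((\<lambda>n. mass (trunc j (f (r1 n)))) \<circ> r2) \<longlonglongrightarrow> c"
    using bounded_imp_convergent_subsequence by blast
  have "cauchy_trunc j (f \<circ> (r1 \<circ> r2))"
    unfolding cauchy_trunc_def
  proof (intro allI impI)
    fix e :: real assume e: "0 < e"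
    obtain n1 where n1: "\<And>n x. n1 \<le> n \<Longrightarrow> x \<in> cball 0 (real j) \<Longrightarrow> norm (?V (r1 n) x - l x) < e / 2"
      using l[of "e / 2"] e by auto
    have "Cauchy ((\<lambda>n. mass (trunc j (f (r1 n)))) \<circ> r2)" using c by (intro LIMSEQ_imp_Cauchy)
    then obtain n2 where n2: "\<And>m n. n2 \<le> m \<Longrightarrow> n2 \<le> n \<Longrightarrow> \<bar>mass (trunc j (f (r1 (r2 m)))) - mass (trunc j (f (r1 (r2 n))))\<bar> < e"
      using e by (force simp: Cauchy_def dist_real_def)
    show "\<exists>n0. \<forall>m\<ge>n0. \<forall>n\<ge>n0.
     (\<forall>x\<in>cball 0 (real j). \<bar>pot (1 / real (Suc j)) (trunc j ((f \<circ> (r1 \<circ> r2)) m)) x - pot (1 / real (Suc j)) (trunc j ((f \<circ> (r1 \<circ> r2)) n)) x\<bar> < e)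
     \<and> \<bar>mass (trunc j ((f \<circ> (r1 \<circ> r2)) m)) - mass (trunc j ((f \<circ> (r1 \<circ> r2)) n))\<bar> < e"
    proof (intro exI[of _ "max n1 n2"] allI impI conjI ballI)
      fix m n x assume mn: "max n1 n2 \<le> m" "max n1 n2 \<le> n" and x: "x \<in> cball (0::'a) (real j)"
      have "n1 \<le> r2 m" "n1 \<le> r2 n" using mn seq_suble[OF r2, of m] seq_suble[OF r2, of n] by linarith+
      from n1[OF this(1) x] n1[OF this(2) x]
      show "\<bar>pot (1 / real (Suc j)) (trunc j ((f \<circ> (r1 \<circ> r2)) m)) x - pot (1 / real (Suc j)) (trunc j ((f \<circ> (r1 \<circ> r2)) n)) x\<bar> < e"
        unfolding comp_def \<tau>_def[symmetric] real_norm_def by linarith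
    next
      fix m n assume "max n1 n2 \<le> m" "max n1 n2 \<le> n"
      then show "\<bar>mass (trunc j ((f \<circ> (r1 \<circ> r2)) m)) - mass (trunc j ((f \<circ> (r1 \<circ> r2)) n))\<bar> < e"
        using n2[of m n] by simp
    qed
  qed
  then show ?thesis using strict_mono_o[OF r1 r2] by blast
qed

text \<open>The diagonal sequence has the j-th property after its first j + 1 terms are dropped;
  finitely many terms do not affect a Cauchy property.\<close>

lemma exists_cauchy_trunc_all:
  fixes f :: "nat \<Rightarrow> 'a \<Rightarrow> real"
  assumes f: "\<And>n. adm N (f n)"
  obtains r where "strict_mono r" "\<And>j. cauchy_trunc j (f \<circ> r)"
proof -
  interpret subseqs "\<lambda>j r. cauchy_trunc j (f \<circ> r)"
  proof
    fix j and t :: "nat \<Rightarrow> nat" assume "strict_mono t"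
    show "\<exists>r'. strict_mono r' \<and> cauchy_trunc j (f \<circ> (t \<circ> r'))"
      using exists_cauchy_trunc[of N "f \<circ> t" j] f by (simp add: comp_assoc)
  qed
  define \<delta> where "\<delta> = diagseq"
  have *: "cauchy_trunc j (f \<circ> (\<delta> \<circ> ((+) (Suc j))))" for j
    unfolding \<delta>_def by (rule diagseq_holds) (metis cauchy_trunc_subseq comp_assoc)
  have "cauchy_trunc j (f \<circ> \<delta>)" for j
    unfolding cauchy_trunc_def
    proof (intro allI impI)
      fix e :: real assume "0 < e"
      with *[of j] obtain n0 where n0: "\<And>m n. n0 \<le> m \<Longrightarrow> n0 \<le> n \<Longrightarrow>
     (\<forall>x\<in>cball 0 (real j). \<bar>pot (1 / real (Suc j)) (trunc j (f (\<delta> (Suc j + m)))) x - pot (1 / real (Suc j)) (trunc j (f (\<delta> (Suc j + n)))) x\<bar> < e)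
     \<and> \<bar>mass (trunc j (f (\<delta> (Suc j + m)))) - mass (trunc j (f (\<delta> (Suc j + n))))\<bar> < e"
        unfolding cauchy_trunc_def o_apply by blast
      have shift: "(\<And>m n. n0 \<le> m \<Longrightarrow> n0 \<le> n \<Longrightarrow> Q (Suc j + m) (Suc j + n)) \<Longrightarrow>
        \<exists>n0. \<forall>m\<ge>n0. \<forall>n\<ge>n0. Q m n" for Q :: "nat \<Rightarrow> nat \<Rightarrow> bool"
        by (rule exI[of _ "Suc j + n0"]) (metis add_le_cancel_left le_Suc_ex le_add1 le_trans)
      show "\<exists>n0. \<forall>m\<ge>n0. \<forall>n\<ge>n0.
     (\<forall>x\<in>cball 0 (real j). \<bar>pot (1 / real (Suc j)) (trunc j ((f \<circ> \<delta>) m)) x - pot (1 / real (Suc j)) (trunc j ((f \<circ> \<delta>) n)) x\<bar> < e)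
     \<and> \<bar>mass (trunc j ((f \<circ> \<delta>) m)) - mass (trunc j ((f \<circ> \<delta>) n))\<bar> < e"
        unfolding o_apply by (rule shift) (rule n0)
    qed
  with subseq_diagseq show thesis unfolding \<delta>_def by (rule that)
qed

text \<open>f \<le> g + h with h = |f - g|, and \<open>B\<close> is monotone. The three terms with h
  in the expansion are each at most 4 * C1 * K * M because \<open>L h\<close> is at most 2, whence
  the factor 12.\<close>

lemma B_continuous_L1:
  assumes f: "adm N f" "L f \<le> 1" and g: "adm N g" "L g \<le> 1"
  shows "B f f \<le> B g g + 12 * C1 * sqrt ((2 * real N) powr a) * sqrt (mass (\<lambda>x. \<bar>f x - g x\<bar>) powr a)"
proof -
  note d = adm_dens[OF f(1)] adm_dens[OF g(1)]
  note [measurable] = d[THEN dens_measurable]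
  define h where "h = (\<lambda>x. \<bar>f x - g x\<bar>)"
  have nn: "0 \<le> f x" "0 \<le> g x" for x using d by (auto intro: dens_nonneg)
  have hfg: "h x \<le> f x + g x" "f x \<le> g x + h x" "0 \<le> h x" for x using nn[of x] by (auto simp: h_def)
  have dh: "dens h" using hfg by (intro dens_mono[OF dens_add[OF d]]) (auto simp: h_def)
  have Lh: "L h \<le> 2"
  proof -
    have "L h \<le> (LINT x|lborel. f x powr (1 + q) + g x powr (1 + q))"
      unfolding L_def
    proof (rule integral_mono)
      fix x
      have "h x powr (1 + q) \<le> max (f x) (g x) powr (1 + q)"
        using nn[of x] q_pos by (intro powr_mono2) (auto simp: h_def)
      also have "\<dots> \<le> f x powr (1 + q) + g x powr (1 + q)" by (auto simp: max_def)
      finally show "h x powr (1 + q) \<le> f x powr (1 + q) + g x powr (1 + q)" .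
    qed (use d dh in \<open>auto intro: dens_integrable_powr\<close>)
    also have "\<dots> = L f + L g" unfolding L_def using d by (simp add: dens_integrable_powr)
    finally show ?thesis using f g by simp
  qed
  define M where "M = sqrt (mass h powr a)"
  define K where "K = sqrt ((2 * real N) powr a)"
  have MK: "0 \<le> M" "0 \<le> K" by (auto simp: M_def K_def)
  have mh: "mass h \<le> 2 * real N"
    using mass_mono[OF dens_add[OF d] dh hfg(1)] mass_add[OF d] adm_mass[OF f(1)] adm_mass[OF g(1)] by simp
  have bnd: "B u h \<le> 4 * C1 * K * M" if u: "dens u" "L u \<le> 2" "mass u \<le> 2 * real N" for u
  proof -
    have "B u h \<le> 2 * C1 * sqrt (mass u powr a * L u) * sqrt 2 * sqrt (mass h powr a)"
      using Lh by (rule B_le_mass[OF u(1) dh])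
    also have "\<dots> \<le> 2 * C1 * sqrt ((2 * real N) powr a * 2) * sqrt 2 * sqrt (mass h powr a)"
      using u q_less C1_pos by (intro mult_right_mono mult_left_mono real_sqrt_le_mono mult_mono powr_mono2)
        (auto simp: mass_nonneg L_nonneg)
    also have "\<dots> = 4 * C1 * K * M" by (simp add: real_sqrt_mult K_def M_def)
    finally show ?thesis .
  qed
  have "B f f \<le> B (\<lambda>x. g x + h x) (\<lambda>x. g x + h x)"
    using d dh hfg by (intro B_mono dens_add) auto
  also have "\<dots> = B g g + 2 * B g h + B h h"
    using d dh by (simp add: B_add_left B_add_right dens_add B_commute[of h g])
  also have "\<dots> \<le> B g g + 2 * (4 * C1 * K * M) + 4 * C1 * K * M"
    using d dh Lh mh g adm_mass[OF g(1)] by (intro add_mono mult_left_mono bnd) auto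
  finally show ?thesis
    unfolding h_def[symmetric] M_def[symmetric] K_def[symmetric] by (simp add: algebra_simps)
qed

lemma mass_shell:
  assumes "dens f"
  shows "mass (\<lambda>x. f x * indicator (cball 0 (2 * real j) - cball 0 (real j)) x)
    = mass (trunc (2 * j) f) - mass (trunc j f)"
proof -
  have "(\<lambda>x. f x * indicator (cball 0 (2 * real j) - cball 0 (real j)) x) = (\<lambda>x. trunc (2 * j) f x - trunc j f x)"
    by (auto simp: trunc_def indicator_def)
  then show ?thesis
    using assms by (simp add: dens_integrable dens_trunc)
qed

lemma trunc_mono: "dens f \<Longrightarrow> i \<le> j \<Longrightarrow> trunc i f x \<le> trunc j f x"
  using dens_nonneg[of f x] by (auto simp: trunc_def indicator_def)

text \<open>The limits b j of the truncated masses increase and are bounded by N, so b (2 * j) - b j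
  tends to 0. Shells become thin even if mass of the sequence escapes further out.\<close>

lemma exists_small_shell:
  fixes f :: "nat \<Rightarrow> 'a \<Rightarrow> real"
  assumes f: "\<And>n. adm N (f n)" and c: "\<And>j. cauchy_trunc j f" and \<epsilon>: "0 < \<epsilon>"
  shows "\<forall>\<^sub>F j in sequentially. \<forall>\<^sub>F n in sequentially. mass (trunc (2 * j) (f n)) - mass (trunc j (f n)) < \<epsilon>"
proof -
  have "Cauchy (\<lambda>n. mass (trunc j (f n)))" for j
    unfolding Cauchy_def dist_real_def
  proof (intro allI impI)
    fix e :: real assume "0 < e"
    then show "\<exists>M. \<forall>m\<ge>M. \<forall>n\<ge>M. \<bar>mass (trunc j (f m)) - mass (trunc j (f n))\<bar> < e"
      using c[of j] unfolding cauchy_trunc_def by meson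
  qed
  then have "\<exists>l. (\<lambda>n. mass (trunc j (f n))) \<longlonglongrightarrow> l" for j
    by (simp add: Cauchy_convergent_iff convergent_def)
  then obtain b where b: "\<And>j. (\<lambda>n. mass (trunc j (f n))) \<longlonglongrightarrow> b j" by metis
  have d: "dens (f n)" for n using adm_dens[OF f] .
  have "incseq b"
  proof (rule incseq_SucI)
    fix j show "b j \<le> b (Suc j)"
      by (rule LIMSEQ_le[OF b b]) (auto intro!: mass_mono dens_trunc d trunc_mono)
  qed
  moreover have "b j \<le> real N" for j
    by (rule LIMSEQ_le_const2[OF b]) (use adm_mass[OF adm_trunc[OF f]] in auto)
  ultimately obtain l where l: "b \<longlonglongrightarrow> l" using incseq_convergent[of b "real N"] by blast
  have "(\<lambda>j. b (2 * j) - b j) \<longlonglongrightarrow> l - l"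
    by (intro tendsto_diff l filterlim_compose[OF l]) (auto intro!: filterlim_subseq simp: strict_mono_def)
  then have "\<forall>\<^sub>F j in sequentially. b (2 * j) - b j < \<epsilon>" using \<epsilon> by (intro order_tendstoD(2)) auto
  then show ?thesis
    by eventually_elim (rule order_tendstoD(2)[OF tendsto_diff[OF b b]])
qed

text \<open>At large radii the shell is thin and \<open>defect_cutoff\<close> loses little. The
  truncated sequence is thus again almost maximizing, with all members supported in one
  ball.\<close>

lemma defect_trunc_small:
  fixes f :: "nat \<Rightarrow> 'a \<Rightarrow> real"
  assumes f: "\<And>n. adm N (f n)" and Lf: "\<And>n. L (f n) \<le> 1" and defect: "(\<lambda>n. defect N (f n)) \<longlonglongrightarrow> 0"
    and c: "\<And>j. cauchy_trunc j f" and \<kappa>: "0 < \<kappa>"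
  shows "\<forall>\<^sub>F J in sequentially. \<forall>\<^sub>F n in sequentially. defect N (trunc J (f n)) \<le> \<kappa>"
proof -
  define K where "K = 2 * C1 * sqrt (real N powr a)"
  have K: "0 \<le> K" using C1_pos by (simp add: K_def)
  obtain \<epsilon> where \<epsilon>: "0 < \<epsilon>" "\<And>x. 0 \<le> x \<Longrightarrow> x \<le> \<epsilon> \<Longrightarrow> sqrt (x powr a) \<le> \<kappa> / (4 * (K + 1))"
    using small_sqrt_powr[of "\<kappa> / (4 * (K + 1))"] \<kappa> K by auto
  have K\<epsilon>: "K * sqrt (\<epsilon> powr a) \<le> \<kappa> / 4"
  proof -
    have "K * sqrt (\<epsilon> powr a) \<le> (K + 1) * (\<kappa> / (4 * (K + 1)))"
      using K \<kappa> \<epsilon> by (intro mult_mono) auto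
    also have "\<dots> = \<kappa> / 4" using K by (simp add: field_simps)
    finally show ?thesis .
  qed
  note df = adm_dens[OF f]
  have d: "\<forall>\<^sub>F n in sequentially. defect N (f n) < \<kappa> / 4"
    using \<kappa> by (intro order_tendstoD(2)[OF defect]) auto
  have "\<forall>\<^sub>F J in sequentially. real J powr - s * (real N * real N) < \<kappa> / 4"
  proof (rule order_tendstoD(2))
    show "(\<lambda>J. real J powr - s * (real N * real N)) \<longlonglongrightarrow> 0 * (real N * real N)"
      using s_pos by (intro tendsto_mult tendsto_const tendsto_neg_powr filterlim_real_sequentially) auto
  qed (use \<kappa> in simp)
  moreover have "\<forall>\<^sub>F J in sequentially. 1 \<le> J" by (rule eventually_ge_at_top)
  moreover note exists_small_shell[OF f c \<epsilon>(1)]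
  ultimately show ?thesis
  proof eventually_elim
    case (elim J)
    from elim(3) d show ?case
    proof eventually_elim
      case (elim n)
      have "defect N (\<lambda>x. f n x * indicator (cball 0 (real J)) x)
        \<le> defect N (f n) + (K * sqrt (\<epsilon> powr a) + real J powr - s * real N * real N)"
        unfolding K_def
      proof (rule defect_cutoff[OF f Lf])
        show "mass (\<lambda>x. f n x * indicator (cball 0 (2 * real J) - cball 0 (real J)) x) \<le> \<epsilon>"
          using elim by (simp add: mass_shell[OF df])
      qed (use \<open>1 \<le> J\<close> \<epsilon> in auto)
      then show ?case
        using elim \<open>real J powr - s * (real N * real N) < \<kappa> / 4\<close> K\<epsilon> \<kappa>
        unfolding trunc_def by (simp add: mult.assoc)
    qed
  qed
qed

text \<open>The convexity gap of \<open>L\<close> controls the distance of two almost maximizers, because the quadratic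
  energy of their difference tends to \<open>0\<close> along the subsequence.\<close>

lemma L1_cauchy:
  fixes f :: "nat \<Rightarrow> 'a \<Rightarrow> real"
  assumes f: "\<And>n. adm N (f n)" and Lf: "\<And>n. L (f n) \<le> 1" and defect: "(\<lambda>n. defect N (f n)) \<longlonglongrightarrow> 0"
    and c: "\<And>j. cauchy_trunc j f" and lam: "0 < lam N" and e: "0 < e"
  shows "\<exists>n0. \<forall>m\<ge>n0. \<forall>n\<ge>n0. (LINT x|lborel. \<bar>f m x - f n x\<bar> * indicator (cball 0 (real i)) x) \<le> e"
proof -
  define V where "V = measure lborel (cball (0::'a) (real i))"
  define \<eta> where "\<eta> = e / (V + 2 * real N + 1)"
  define cq where "cq = 8 / ((1 + q) * q)"
  \<comment> \<open>A convexity gap \<gamma> makes the first term of \<open>L1_le_Lgap\<close> equal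
    to e / 2, and the choice of \<eta> does the same for the second. The errors in
    \<open>Lgap_le\<close> will be at most 2 * \<kappa> = lam N * \<gamma>.\<close>
  define \<gamma> where "\<gamma> = e * \<eta> / cq"
  define \<kappa> where "\<kappa> = lam N * \<gamma> / 2"
  have V: "0 \<le> V" by (simp add: V_def)
  have \<eta>: "0 < \<eta>" using e V by (simp add: \<eta>_def)
  have cq: "0 < cq" using q_pos by (simp add: cq_def)
  have \<gamma>: "0 < \<gamma>" using e \<eta> cq by (simp add: \<gamma>_def)
  have \<kappa>: "0 < \<kappa>" using lam \<gamma> by (simp add: \<kappa>_def)
  obtain \<tau> where \<tau>: "0 < \<tau>" "\<And>f g. dens f \<Longrightarrow> dens g \<Longrightarrow> L f \<le> 1 \<Longrightarrow> L g \<le> 1 \<Longrightarrow> near \<tau> f g \<le> ennreal \<kappa>"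
    using near_small[OF \<kappa>] by blast
  have "\<forall>\<^sub>F J in sequentially. 1 / real (Suc J) < \<tau>"
    using \<tau> by (intro order_tendstoD(2)[OF LIMSEQ_Suc[OF lim_1_over_n]])
  moreover have "\<forall>\<^sub>F J in sequentially. i \<le> J" by (rule eventually_ge_at_top)
  moreover note defect_trunc_small[OF f Lf defect c \<kappa>]
  ultimately have "\<forall>\<^sub>F J in sequentially. 1 / real (Suc J) < \<tau> \<and> i \<le> J
    \<and> (\<forall>\<^sub>F n in sequentially. defect N (trunc J (f n)) \<le> \<kappa>)"
    by eventually_elim auto
  \<comment> \<open>J serves three purposes: the cap lies below the scale \<tau>, the ball contains
    the one of radius i, and the truncations eventually have small defect.\<close>
  then obtain J where J: "1 / real (Suc J) < \<tau>" "i \<le> J"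
    and small: "\<forall>\<^sub>F n in sequentially. defect N (trunc J (f n)) \<le> \<kappa>"
    using eventually_happens'[OF sequentially_bot] by blast
  define g where "g n = trunc J (f n)" for n
  have g: "adm N (g n)" for n unfolding g_def by (rule adm_trunc[OF f])
  note dg = adm_dens[OF g] and df = adm_dens[OF f]
  have Lg: "L (g n) \<le> 1" for n
    using L_mono[OF df dg, of n n] trunc_le[OF df, of J n] Lf[of n] by (simp add: g_def)
  have near: "near (1 / real (Suc J)) (g n) (g n) \<le> ennreal \<kappa>" for n
  proof -
    have "near (1 / real (Suc J)) (g n) (g n) \<le> near \<tau> (g n) (g n)"
      unfolding near_def using J(1) by (intro nn_integral_mono mult_left_mono) (auto simp: indicator_def)
    also have "\<dots> \<le> ennreal \<kappa>" using dg Lg by (intro \<tau>)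
    finally show ?thesis .
  qed
  obtain n1 where n1: "\<And>n. n1 \<le> n \<Longrightarrow> defect N (g n) \<le> \<kappa>"
    using small unfolding g_def eventually_sequentially by blast
  have "0 < \<kappa> / (real N + 1)" using \<kappa> by simp
  then obtain n2 where n2: "\<And>m n x. n2 \<le> m \<Longrightarrow> n2 \<le> n \<Longrightarrow> x \<in> cball 0 (real J) \<Longrightarrow>
     \<bar>pot (1 / real (Suc J)) (g m) x - pot (1 / real (Suc J)) (g n) x\<bar> < \<kappa> / (real N + 1)"
    using c[of J] unfolding cauchy_trunc_def g_def by meson
  have diff: "B (g m) (g m) - B (g m) (g n) \<le> 2 * \<kappa>" if "n2 \<le> m" "n2 \<le> n" for m n
  proof -
    have "B (g m) (g m) - B (g m) (g n) \<le> \<kappa> / (real N + 1) * mass (g m) + \<kappa>"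
    proof (rule B_diff_le[OF dg dg _ near])
      fix x assume "g m x \<noteq> 0"
      then have "x \<in> cball 0 (real J)" by (auto simp: g_def trunc_def indicator_def split: if_splits)
      from n2[OF that this] show "pot (1 / real (Suc J)) (g m) x \<le> pot (1 / real (Suc J)) (g n) x + \<kappa> / (real N + 1)"
        by linarith
    qed (use \<kappa> in auto)
    also have "\<kappa> / (real N + 1) * mass (g m) \<le> \<kappa> / (real N + 1) * (real N + 1)"
      using \<kappa> adm_mass[OF g, of m] by (intro mult_left_mono) auto
    finally show ?thesis by simp
  qed
  show ?thesis
  proof (intro exI[of _ "max n1 n2"] allI impI)
    fix m n assume mn: "max n1 n2 \<le> m" "max n1 n2 \<le> n"
    have "lam N * Lgap (g m) (g n) \<le> defect N (g m) / 2 + defect N (g n) / 2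
        + (B (g m) (g m) + B (g n) (g n) - 2 * B (g m) (g n)) / 8"
      by (rule Lgap_le[OF g g])
    also have "\<dots> \<le> \<kappa> / 2 + \<kappa> / 2 + (4 * \<kappa>) / 8"
    proof -
      have "defect N (g m) \<le> \<kappa>" "defect N (g n) \<le> \<kappa>" using n1 mn by auto
      moreover have "B (g m) (g m) - B (g m) (g n) \<le> 2 * \<kappa>" "B (g n) (g n) - B (g m) (g n) \<le> 2 * \<kappa>"
        using diff[of m n] diff[of n m] mn B_commute[OF dg dg, of m n] by auto
      ultimately show ?thesis by argo
    qed
    also have "\<dots> \<le> 2 * \<kappa>" using \<kappa> by simp
    also have "2 * \<kappa> = lam N * \<gamma>" by (simp add: \<kappa>_def)
    finally have gap: "Lgap (g m) (g n) \<le> \<gamma>" using lam by simp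
    have "(LINT x|lborel. \<bar>f m x - f n x\<bar> * indicator (cball 0 (real i)) x)
        = (LINT x|lborel. \<bar>g m x - g n x\<bar> * indicator (cball 0 (real i)) x)"
      using J(2) by (intro Bochner_Integration.integral_cong) (auto simp: g_def trunc_def indicator_def)
    also have "\<dots> \<le> 1 / (2 * \<eta>) * cq * Lgap (g m) (g n) + \<eta> / 2 * (V + mass (g m) + mass (g n))"
      unfolding cq_def V_def using L1_le_Lgap[OF dg dg \<eta>, of "cball 0 (real i)"] emeasure_bounded_finite[of "cball (0::'a) (real i)"] by auto
    also have "\<dots> \<le> 1 / (2 * \<eta>) * cq * \<gamma> + \<eta> / 2 * (V + 2 * real N + 1)"
    proof (rule add_mono)
      show "1 / (2 * \<eta>) * cq * Lgap (g m) (g n) \<le> 1 / (2 * \<eta>) * cq * \<gamma>"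
        using \<eta> cq gap by (intro mult_left_mono) auto
      have "V + mass (g m) + mass (g n) \<le> V + 2 * real N + 1"
        using adm_mass[OF g, of m] adm_mass[OF g, of n] by simp
      then show "\<eta> / 2 * (V + mass (g m) + mass (g n)) \<le> \<eta> / 2 * (V + 2 * real N + 1)"
        using \<eta> by (intro mult_left_mono) auto
    qed
    also have "1 / (2 * \<eta>) * cq * \<gamma> = e / 2" using \<eta> cq by (simp add: \<gamma>_def)
    also have "\<eta> / 2 * (V + 2 * real N + 1) = e / 2" using V by (simp add: \<eta>_def field_simps)
    finally show "(LINT x|lborel. \<bar>f m x - f n x\<bar> * indicator (cball 0 (real i)) x) \<le> e" by simp
  qed
qed

section \<open>Passage to the limit\<close>

lemma integrable_abs_diff_indicator:
  assumes "dens f" "dens g" "E \<in> sets borel"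
  shows "integrable lborel (\<lambda>x. \<bar>f x - g x\<bar> * indicator E x)"
proof -
  note [measurable] = assms(1,2)[THEN dens_measurable] assms(3)
  have "integrable lborel (\<lambda>x. \<bar>f x - g x\<bar>)"
    using assms by (intro integrable_abs Bochner_Integration.integrable_diff dens_integrable)
  then show ?thesis
    by (rule Bochner_Integration.integrable_bound) (auto simp: indicator_def)
qed

text \<open>Since the masses are bounded, the weight 1 / (1 + norm x) turns a sequence that is
  Cauchy in L^1 of every ball into one that is Cauchy in L^1 of the whole space; this yields an
  almost everywhere convergent subsequence. Fatou's lemma bounds mass and \<open>L\<close> of the
  limit from above, and mass may be lost.\<close>

lemma exists_limit:
  fixes f :: "nat \<Rightarrow> 'a \<Rightarrow> real"
  assumes f: "\<And>n. adm N (f n)" and Lf: "\<And>n. L (f n) \<le> 1"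
    and cauchy: "\<And>e i. 0 < e \<Longrightarrow> \<exists>n0. \<forall>m\<ge>n0. \<forall>n\<ge>n0. (LINT x|lborel. \<bar>f m x - f n x\<bar> * indicator (cball 0 (real i)) x) \<le> e"
  obtains \<rho> r where "strict_mono r" "adm N \<rho>" "L \<rho> \<le> 1" "AE x in lborel. (\<lambda>n. f (r n) x) \<longlonglongrightarrow> \<rho> x"
proof -
  note d = adm_dens[OF f]
  note [measurable] = dens_measurable[OF d]
  let ?w = "\<lambda>x::'a. 1 / (1 + norm x)"
  have w: "0 < ?w x" "?w x \<le> 1" for x by (auto simp: add_pos_nonneg field_simps)
  have int: "integrable lborel (\<lambda>x. f n x * ?w x)" for n
  proof (rule Bochner_Integration.integrable_bound[OF dens_integrable[OF d, of n]])
    show "AE x in lborel. norm (f n x * ?w x) \<le> norm (f n x)"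
    proof (rule AE_I2)
      fix x
      have "f n x * ?w x \<le> f n x" using w(2) dens_nonneg[OF d] by (rule mult_left_le)
      then show "norm (f n x * ?w x) \<le> norm (f n x)"
        using dens_nonneg[OF d, of n x] w(1)[of x] by simp
    qed
  qed simp
  have weighted: "\<exists>M. \<forall>m\<ge>M. \<forall>n\<ge>M. (LINT x|lborel. norm (f m x * ?w x - f n x * ?w x)) < e" if e: "0 < e" for e
  proof -
    \<comment> \<open>Outside radius i the weight is below 1 / (1 + i), so the tail costs at most 2
      * N / (1 + i).\<close>
    obtain i where i: "2 * real N / (1 + real i) < e / 2"
    proof -
      obtain i :: nat where "4 * real N / e < real i" using reals_Archimedean2 by blast
      then have "2 * real N / (1 + real i) < e / 2" using e by (simp add: field_simps)
      then show thesis by (rule that)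
    qed
    obtain n0 where n0: "\<And>m n. n0 \<le> m \<Longrightarrow> n0 \<le> n \<Longrightarrow> (LINT x|lborel. \<bar>f m x - f n x\<bar> * indicator (cball 0 (real i)) x) \<le> e / 2"
      using cauchy[of "e / 2" i] e by auto
    show ?thesis
    proof (intro exI[of _ n0] allI impI)
      fix m n assume mn: "n0 \<le> m" "n0 \<le> n"
      have "(LINT x|lborel. norm (f m x * ?w x - f n x * ?w x))
          \<le> (LINT x|lborel. \<bar>f m x - f n x\<bar> * indicator (cball 0 (real i)) x + (f m x + f n x) * (1 / (1 + real i)))"
      proof (rule integral_mono)
        show "integrable lborel (\<lambda>x. norm (f m x * ?w x - f n x * ?w x))"
          using int by (intro integrable_norm Bochner_Integration.integrable_diff)
        show "integrable lborel (\<lambda>x. \<bar>f m x - f n x\<bar> * indicator (cball 0 (real i)) x + (f m x + f n x) * (1 / (1 + real i)))"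
          by (intro Bochner_Integration.integrable_add integrable_mult_left integrable_abs_diff_indicator dens_integrable[OF d] d) auto
        fix x
        have e: "norm (f m x * ?w x - f n x * ?w x) = \<bar>f m x - f n x\<bar> * ?w x"
          using w(1)[of x] by (simp only: left_diff_distrib[symmetric] real_norm_def abs_mult abs_of_pos)
        show "norm (f m x * ?w x - f n x * ?w x) \<le> \<bar>f m x - f n x\<bar> * indicator (cball 0 (real i)) x + (f m x + f n x) * (1 / (1 + real i))"
        proof (cases "norm x \<le> real i")
          case True
          have "\<bar>f m x - f n x\<bar> * ?w x \<le> \<bar>f m x - f n x\<bar>" using w[of x] by (intro mult_left_le) auto
          moreover have "0 \<le> (f m x + f n x) * (1 / (1 + real i))" by (simp add: dens_nonneg[OF d])
          ultimately show ?thesis unfolding e using True by simp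
        next
          case False
          have "\<bar>f m x - f n x\<bar> * ?w x \<le> (f m x + f n x) * (1 / (1 + real i))"
            using False dens_nonneg[OF d, of m x] dens_nonneg[OF d, of n x] w(1)[of x]
            by (intro mult_mono) (auto intro!: divide_left_mono mult_pos_pos simp: add_pos_nonneg)
          then show ?thesis unfolding e using False by simp
        qed
      qed
      also have "\<dots> = (LINT x|lborel. \<bar>f m x - f n x\<bar> * indicator (cball 0 (real i)) x) + (mass (f m) + mass (f n)) * (1 / (1 + real i))"
      proof -
        have 1: "integrable lborel (\<lambda>x. \<bar>f m x - f n x\<bar> * indicator (cball 0 (real i)) x)"
          by (rule integrable_abs_diff_indicator[OF d d]) simp
        have 2: "integrable lborel (\<lambda>x. f m x + f n x)"
          by (intro Bochner_Integration.integrable_add dens_integrable[OF d])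
        show ?thesis
          using Bochner_Integration.integral_add[OF 1 integrable_mult_left[OF 2]] mass_add[OF d d, of m n]
          by (simp only: integral_mult_left_zero)
      qed
      also have "\<dots> \<le> e / 2 + (real N + real N) * (1 / (1 + real i))"
        using n0[OF mn] adm_mass[OF f, of m] adm_mass[OF f, of n] by (intro add_mono mult_right_mono) auto
      also have "\<dots> < e" using i by simp
      finally show "(LINT x|lborel. norm (f m x * ?w x - f n x * ?w x)) < e" .
    qed
  qed
  obtain r where r: "strict_mono r" and ae: "AE x in lborel. Cauchy (\<lambda>i. f (r i) x * ?w x)"
    using cauchy_L1_AE_cauchy_subseq[of lborel "\<lambda>n x. f n x * ?w x", OF int weighted] by blast
  \<comment> \<open>The maximum with 0 makes the function nonnegative also at the points where the
    sequence diverges.\<close>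
  define \<rho> where "\<rho> = (\<lambda>x. max 0 (lim (\<lambda>i. f (r i) x)))"
  have [measurable]: "\<rho> \<in> borel_measurable borel" unfolding \<rho>_def by measurable
  have conv: "AE x in lborel. (\<lambda>i. f (r i) x) \<longlonglongrightarrow> \<rho> x"
    using ae
  proof eventually_elim
    fix x assume "Cauchy (\<lambda>i. f (r i) x * ?w x)"
    then obtain l where "(\<lambda>i. f (r i) x * ?w x) \<longlonglongrightarrow> l" by (auto simp: Cauchy_convergent_iff convergent_def)
    then have "(\<lambda>i. (f (r i) x * ?w x) * (1 + norm x)) \<longlonglongrightarrow> l * (1 + norm x)" by (intro tendsto_mult tendsto_const)
    moreover have "(f (r i) x * ?w x) * (1 + norm x) = f (r i) x" for i
      using add_pos_nonneg[of 1 "norm x"] by simp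
    ultimately have l: "(\<lambda>i. f (r i) x) \<longlonglongrightarrow> l * (1 + norm x)" by simp
    moreover have "0 \<le> l * (1 + norm x)"
      using l by (rule LIMSEQ_le_const) (auto simp: dens_nonneg[OF d])
    ultimately show "(\<lambda>i. f (r i) x) \<longlonglongrightarrow> \<rho> x" by (simp add: \<rho>_def limI)
  qed
  have nn: "0 \<le> \<rho> x" for x by (simp add: \<rho>_def)
  have fatou: "(\<integral>\<^sup>+x. ennreal (\<rho> x powr p) \<partial>lborel) \<le> ennreal c"
    if p: "0 < p" and bound: "\<And>n. (\<integral>\<^sup>+x. ennreal (f n x powr p) \<partial>lborel) \<le> ennreal c" for p c
  proof -
    have "(\<integral>\<^sup>+x. ennreal (\<rho> x powr p) \<partial>lborel) = (\<integral>\<^sup>+x. liminf (\<lambda>i. ennreal (f (r i) x powr p)) \<partial>lborel)"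
    proof (intro nn_integral_cong_AE)
      show "AE x in lborel. ennreal (\<rho> x powr p) = liminf (\<lambda>i. ennreal (f (r i) x powr p))"
        using conv
      proof eventually_elim
        fix x assume "(\<lambda>i. f (r i) x) \<longlonglongrightarrow> \<rho> x"
        then have "(\<lambda>i. ennreal (f (r i) x powr p)) \<longlonglongrightarrow> ennreal (\<rho> x powr p)"
          using p by (intro tendsto_ennrealI tendsto_powr2[OF _ tendsto_const]) (auto simp: dens_nonneg[OF d])
        then show "ennreal (\<rho> x powr p) = liminf (\<lambda>i. ennreal (f (r i) x powr p))"
          by (rule lim_imp_Liminf[OF sequentially_bot, symmetric])
      qed
    qed
    also have "\<dots> \<le> liminf (\<lambda>i. \<integral>\<^sup>+x. ennreal (f (r i) x powr p) \<partial>lborel)"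
      by (rule nn_integral_liminf) measurable
    also have "\<dots> \<le> liminf (\<lambda>i. ennreal c)"
      by (rule Liminf_mono) (simp add: bound)
    finally show ?thesis by (simp add: Liminf_const)
  qed
  have m: "(\<integral>\<^sup>+x. ennreal (\<rho> x) \<partial>lborel) \<le> ennreal (real N)"
  proof -
    have "(\<integral>\<^sup>+x. ennreal (\<rho> x powr 1) \<partial>lborel) \<le> ennreal (real N)"
      by (rule fatou) (auto simp: dens_nonneg[OF d] nn_integral_dens[OF d] intro!: ennreal_leI adm_mass[OF f])
    then show ?thesis using nn by simp
  qed
  have l: "(\<integral>\<^sup>+x. ennreal (\<rho> x powr (1 + q)) \<partial>lborel) \<le> ennreal 1"
    using q_pos by (intro fatou) (auto simp: nn_integral_powr_dens[OF d] Lf simp flip: ennreal_1)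
  have dens: "dens \<rho>"
    unfolding dens_def using m l nn
    by (auto intro!: integrableI_nonneg simp: less_top[symmetric] top_unique)
  have "adm N \<rho>" using dens m by (simp add: adm_def nn_integral_dens)
  moreover have "L \<rho> \<le> 1" using dens l by (simp add: nn_integral_powr_dens L_nonneg flip: ennreal_1)
  ultimately show thesis using r conv by (intro that)
qed

lemma L_fatou:
  fixes f :: "nat \<Rightarrow> 'a \<Rightarrow> real"
  assumes f: "\<And>n. dens (f n)" and g: "dens g" and lim: "AE x in lborel. (\<lambda>n. f n x) \<longlonglongrightarrow> g x" and \<xi>: "0 < \<xi>"
  shows "\<forall>\<^sub>F n in sequentially. L g \<le> L (f n) + \<xi>"
proof (cases "L g < \<xi>")
  case True
  then show ?thesis using L_nonneg by (intro always_eventually allI) (simp add: add_increasing less_imp_le)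
next
  case False
  note [measurable] = dens_measurable[OF f]
  have "ennreal (L g) = (\<integral>\<^sup>+x. liminf (\<lambda>n. ennreal (f n x powr (1 + q))) \<partial>lborel)"
    unfolding nn_integral_powr_dens[OF g, symmetric]
  proof (intro nn_integral_cong_AE)
    show "AE x in lborel. ennreal (g x powr (1 + q)) = liminf (\<lambda>n. ennreal (f n x powr (1 + q)))"
      using lim
    proof eventually_elim
      fix x assume "(\<lambda>n. f n x) \<longlonglongrightarrow> g x"
      then have "(\<lambda>n. ennreal (f n x powr (1 + q))) \<longlonglongrightarrow> ennreal (g x powr (1 + q))"
        using q_pos by (intro tendsto_ennrealI tendsto_powr2[OF _ tendsto_const]) (auto simp: dens_nonneg[OF f])
      then show "ennreal (g x powr (1 + q)) = liminf (\<lambda>n. ennreal (f n x powr (1 + q)))"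
        by (rule lim_imp_Liminf[OF sequentially_bot, symmetric])
    qed
  qed
  also have "\<dots> \<le> liminf (\<lambda>n. \<integral>\<^sup>+x. ennreal (f n x powr (1 + q)) \<partial>lborel)"
    by (rule nn_integral_liminf) measurable
  finally have "ennreal (L g) \<le> liminf (\<lambda>n. ennreal (L (f n)))"
    by (simp add: nn_integral_powr_dens[OF f])
  moreover have "ennreal (L g - \<xi>) < ennreal (L g)" using False \<xi> by (intro ennreal_lessI) auto
  ultimately have "\<forall>\<^sub>F n in sequentially. ennreal (L g - \<xi>) < ennreal (L (f n))"
    by (auto simp: le_Liminf_iff)
  then show ?thesis by eventually_elim (use False in \<open>simp add: ennreal_less_iff\<close>)
qed

lemma L_trunc_le: "dens f \<Longrightarrow> L (trunc j f) \<le> L f"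
  by (intro L_mono dens_trunc trunc_le)

lemma trunc_tendsto: "(\<lambda>j. trunc j f x) \<longlonglongrightarrow> f x"
proof -
  obtain j0 :: nat where "norm x \<le> real j0" using real_arch_simple by blast
  then have "\<forall>\<^sub>F j in sequentially. f x = trunc j f x"
    unfolding eventually_sequentially by (intro exI[of _ j0]) (auto simp: trunc_def intro: order_trans)
  then show ?thesis by (rule Lim_transform_eventually[OF tendsto_const])
qed

lemma G_aff: "adm N f \<Longrightarrow> 0 < r \<Longrightarrow> r powr s * G N f \<le> G N (aff r v f)"
  using W_aff[of N f r v] by (simp add: G_def B_aff[OF adm_dens] right_diff_distrib)

text \<open>A dilation makes \<open>L\<close> equal to 1, and a translation moves the ball found by
  \<open>nonvanishing\<close> to the origin; neither lowers the quotient.\<close>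

lemma maximizing_sequence:
  assumes lam: "0 < lam N"
  obtains f A c where "\<And>n. adm N (f n)" "\<And>n. L (f n) = 1" "(\<lambda>n. defect N (f n)) \<longlonglongrightarrow> 0" "0 < c"
    "\<And>n::nat. ennreal c \<le> (\<integral>\<^sup>+y. ennreal (f n y) * indicator (ball 0 A) y \<partial>lborel)"
proof -
  obtain A c where A: "0 < A" and c: "0 < c" and nonvanish: "\<And>f. adm N f \<Longrightarrow> L f \<le> 1 \<Longrightarrow> lam N \<le> B f f \<Longrightarrow>
    \<exists>x. ennreal c \<le> (\<integral>\<^sup>+y. ennreal (f y) * indicator (ball x A) y \<partial>lborel)"
    using nonvanishing[OF lam] by metis
  have "\<exists>f. adm N f \<and> L f = 1 \<and> defect N f \<le> lam N / real (n + 2)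
      \<and> ennreal c \<le> (\<integral>\<^sup>+y. ennreal (f y) * indicator (ball 0 A) y \<partial>lborel)" for n :: nat
  proof -
    \<comment> \<open>With n + 2 in the denominator b is at least half of lam N. A value of
      \<open>G\<close> of at least b therefore forces a form of at least lam N, the lower bound
      passed to \<open>nonvanishing\<close>.\<close>
    define b where "b = lam N - lam N / real (n + 2)"
    have b: "b < lam N" "lam N \<le> 2 * b" using lam by (auto simp: b_def field_simps)
    obtain f where f: "adm N f" "b < G N f / L f" using lam_approx[OF b(1)] .
    have "L f \<noteq> 0" using f(2) b lam by auto
    then have L: "0 < L f" using L_nonneg[of f] by simp
    define r where "r = (1 / L f) powr (1 / s)"
    have r: "0 < r" using L by (simp add: r_def)
    have rs: "r powr s * L f = 1" using L s_pos by (simp add: r_def powr_powr)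
    have bG: "b * L f < G N f" using f(2) L by (simp add: field_simps)
    define g where "g = aff r 0 f"
    have g: "adm N g" unfolding g_def by (rule adm_aff[OF f(1) r])
    have Lg: "L g = 1" unfolding g_def using L_aff[OF adm_dens[OF f(1)] r] rs by simp
    have "r powr s * (b * L f) \<le> r powr s * G N f" using bG by (intro mult_left_mono) auto
    then have "b * (r powr s * L f) \<le> G N g"
      unfolding g_def using G_aff[OF f(1) r, of 0] by (simp only: mult_ac)
    then have Gg: "b \<le> G N g" by (simp add: rs)
    have "lam N \<le> B g g" using Gg b W_nonneg[OF g] by (simp add: G_def)
    then obtain x where x: "ennreal c \<le> (\<integral>\<^sup>+y. ennreal (g y) * indicator (ball x A) y \<partial>lborel)"
      using nonvanish[OF g] Lg by auto
    define h where "h = aff 1 x g"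
    have h: "adm N h" unfolding h_def by (rule adm_aff[OF g]) simp
    have Lh: "L h = 1" unfolding h_def using L_aff[OF adm_dens[OF g], of 1] Lg by simp
    have "b \<le> G N h" using G_aff[OF g, of 1 x] Gg by (simp add: h_def)
    then have "defect N h \<le> lam N / real (n + 2)" by (simp add: defect_def Lh b_def)
    moreover have "(\<integral>\<^sup>+y. ennreal (g y) * indicator (ball x A) y \<partial>lborel) = (\<integral>\<^sup>+y. ennreal (h y) * indicator (ball 0 A) y \<partial>lborel)"
    proof -
      note [measurable] = dens_measurable[OF adm_dens[OF g]]
      have "(\<integral>\<^sup>+y. ennreal (g y) * indicator (ball x A) y \<partial>lborel)
        = (\<integral>\<^sup>+y. ennreal (1 ^ DIM('a)) * (ennreal (g (x + 1 *\<^sub>R y)) * indicator (ball x A) (x + 1 *\<^sub>R y)) \<partial>lborel)"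
        by (rule nn_integral_affine) auto
      also have "\<dots> = (\<integral>\<^sup>+y. ennreal (h y) * indicator (ball 0 A) y \<partial>lborel)"
        by (intro nn_integral_cong) (auto simp: h_def aff_def indicator_def dist_norm)
      finally show ?thesis .
    qed
    ultimately show ?thesis using h Lh x by auto
  qed
  then obtain f where f: "\<And>n. adm N (f n)" "\<And>n. L (f n) = 1" "\<And>n::nat. defect N (f n) \<le> lam N / real (n + 2)"
      "\<And>n. ennreal c \<le> (\<integral>\<^sup>+y. ennreal (f n y) * indicator (ball 0 A) y \<partial>lborel)"
    by metis
  have "(\<lambda>n. defect N (f n)) \<longlonglongrightarrow> 0"
  proof (rule tendsto_sandwich[OF _ _ tendsto_const])
    show "(\<lambda>n. lam N / real (n + 2)) \<longlonglongrightarrow> 0"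
      using LIMSEQ_ignore_initial_segment[OF lim_const_over_n[of "lam N"], of 2] by simp
  qed (use f defect_nonneg in auto)
  with f c show thesis by (intro that)
qed

text \<open>The zero function has defect 0 as well, so positive mass is essential; it comes from the
  mass c kept near the origin. For the defect a radius j is fixed at which truncating the limit
  hardly changes \<open>W\<close> and \<open>L\<close> and at which the truncated sequence has small
  defect. For this j local convergence controls \<open>B\<close>, while \<open>W\<close> and
  \<open>L\<close> are lower semicontinuous.\<close>

theorem exists_optimizer:
  assumes lam: "0 < lam N"
  obtains \<rho> where "adm N \<rho>" "0 < mass \<rho>" "defect N \<rho> = 0"
proof -
  obtain f0 A c where f0: "\<And>n. adm N (f0 n)" "\<And>n. L (f0 n) = 1" "(\<lambda>n. defect N (f0 n)) \<longlonglongrightarrow> 0" and c: "0 < c"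
    and low0: "\<And>n::nat. ennreal c \<le> (\<integral>\<^sup>+y. ennreal (f0 n y) * indicator (ball 0 A) y \<partial>lborel)"
    by (rule maximizing_sequence[OF lam]) (rule that, assumption+)
  obtain r1 where r1: "strict_mono r1" "\<And>j. cauchy_trunc j (f0 \<circ> r1)"
    using exists_cauchy_trunc_all[of N f0, OF f0(1)] by blast
  define f where "f = f0 \<circ> r1"
  have f: "adm N (f n)" "L (f n) \<le> 1" for n using f0 by (auto simp: f_def)
  have df: "(\<lambda>n. defect N (f n)) \<longlonglongrightarrow> 0"
    using LIMSEQ_subseq_LIMSEQ[OF f0(3) r1(1)] by (simp add: f_def o_def)
  note cauchy = L1_cauchy[OF f df r1(2)[folded f_def] lam]
  obtain \<rho> r2 where r2: "strict_mono r2" and \<rho>: "adm N \<rho>" "L \<rho> \<le> 1"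
    and conv: "AE x in lborel. (\<lambda>n. f (r2 n) x) \<longlonglongrightarrow> \<rho> x"
    using exists_limit[OF f cauchy] by blast
  define u where "u n = f (r2 n)" for n
  have u: "adm N (u n)" "L (u n) \<le> 1" for n using f by (auto simp: u_def)
  have du: "(\<lambda>n. defect N (u n)) \<longlonglongrightarrow> 0"
    using LIMSEQ_subseq_LIMSEQ[OF df r2] by (simp add: u_def o_def)
  have cu: "cauchy_trunc j u" for j
    using cauchy_trunc_subseq[OF r1(2)[folded f_def] r2, of j] by (simp add: u_def[abs_def] o_def)
  note d\<rho> = adm_dens[OF \<rho>(1)] and d = adm_dens[OF u(1)]
  note [measurable] = dens_measurable[OF d\<rho>] dens_measurable[OF d]
  \<comment> \<open>Fatou's lemma in the second index of the Cauchy estimate.\<close>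
  have L1: "\<forall>\<^sub>F n in sequentially. (\<integral>\<^sup>+x. ennreal (\<bar>u n x - \<rho> x\<bar> * indicator (cball 0 (real i)) x) \<partial>lborel) \<le> ennreal e"
    if e: "0 < e" for e i
  proof -
    obtain n0 where n0: "\<And>m n. n0 \<le> m \<Longrightarrow> n0 \<le> n \<Longrightarrow> (LINT x|lborel. \<bar>f m x - f n x\<bar> * indicator (cball 0 (real i)) x) \<le> e"
      using cauchy[OF e, of i] by blast
    have "(\<integral>\<^sup>+x. ennreal (\<bar>u n x - \<rho> x\<bar> * indicator (cball 0 (real i)) x) \<partial>lborel) \<le> ennreal e" if n: "n0 \<le> n" for n
    proof -
      have "(\<integral>\<^sup>+x. ennreal (\<bar>u n x - \<rho> x\<bar> * indicator (cball 0 (real i)) x) \<partial>lborel)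
         = (\<integral>\<^sup>+x. liminf (\<lambda>m. ennreal (\<bar>u n x - u m x\<bar> * indicator (cball 0 (real i)) x)) \<partial>lborel)"
      proof (intro nn_integral_cong_AE)
        show "AE x in lborel. ennreal (\<bar>u n x - \<rho> x\<bar> * indicator (cball 0 (real i)) x)
            = liminf (\<lambda>m. ennreal (\<bar>u n x - u m x\<bar> * indicator (cball 0 (real i)) x))"
          using conv
        proof eventually_elim
          fix x assume "(\<lambda>n. f (r2 n) x) \<longlonglongrightarrow> \<rho> x"
          then have "(\<lambda>m. ennreal (\<bar>u n x - u m x\<bar> * indicator (cball 0 (real i)) x)) \<longlonglongrightarrow> ennreal (\<bar>u n x - \<rho> x\<bar> * indicator (cball 0 (real i)) x)"
            by (intro tendsto_ennrealI tendsto_intros) (simp add: u_def)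
          then show "ennreal (\<bar>u n x - \<rho> x\<bar> * indicator (cball 0 (real i)) x)
            = liminf (\<lambda>m. ennreal (\<bar>u n x - u m x\<bar> * indicator (cball 0 (real i)) x))"
            by (rule lim_imp_Liminf[OF sequentially_bot, symmetric])
        qed
      qed
      also have "\<dots> \<le> liminf (\<lambda>m. \<integral>\<^sup>+x. ennreal (\<bar>u n x - u m x\<bar> * indicator (cball 0 (real i)) x) \<partial>lborel)"
        by (rule nn_integral_liminf) measurable
      also have "\<dots> \<le> liminf (\<lambda>m. ennreal e)"
      proof (rule Liminf_mono)
        show "\<forall>\<^sub>F m in sequentially. (\<integral>\<^sup>+x. ennreal (\<bar>u n x - u m x\<bar> * indicator (cball 0 (real i)) x) \<partial>lborel) \<le> ennreal e"
          using eventually_ge_at_top[of n0]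
        proof eventually_elim
          case (elim m)
          have "n0 \<le> r2 n" "n0 \<le> r2 m" using n elim seq_suble[OF r2, of n] seq_suble[OF r2, of m] by linarith+
          from n0[OF this] show ?case
            using integrable_abs_diff_indicator[OF d d, of "cball 0 (real i)" n m]
            by (subst nn_integral_eq_integral) (auto simp: u_def intro!: ennreal_leI)
        qed
      qed
      finally show ?thesis by (simp add: Liminf_const)
    qed
    then show ?thesis unfolding eventually_sequentially by blast
  qed
  have "0 < mass \<rho>"
  proof -
    obtain i :: nat where i: "A \<le> real i" using real_arch_simple by blast
    obtain n where n: "(\<integral>\<^sup>+x. ennreal (\<bar>u n x - \<rho> x\<bar> * indicator (cball 0 (real i)) x) \<partial>lborel) \<le> ennreal (c / 2)"
      using eventually_happens'[OF sequentially_bot L1[of "c / 2" i]] c by auto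
    have "ennreal c \<le> (\<integral>\<^sup>+y. ennreal (u n y) * indicator (ball 0 A) y \<partial>lborel)"
      using low0 by (simp add: u_def f_def)
    also have "\<dots> \<le> (\<integral>\<^sup>+y. ennreal (\<rho> y) + ennreal (\<bar>u n y - \<rho> y\<bar> * indicator (cball 0 (real i)) y) \<partial>lborel)"
      using i dens_nonneg[OF d\<rho>] by (intro nn_integral_mono) (auto simp: indicator_def ennreal_plus[symmetric] simp del: ennreal_plus intro!: ennreal_leI)
    also have "\<dots> = ennreal (mass \<rho>) + (\<integral>\<^sup>+x. ennreal (\<bar>u n x - \<rho> x\<bar> * indicator (cball 0 (real i)) x) \<partial>lborel)"
      by (simp add: nn_integral_add nn_integral_dens[OF d\<rho>])
    also have "\<dots> \<le> ennreal (mass \<rho>) + ennreal (c / 2)" using n by (rule add_left_mono)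
    finally have "c \<le> mass \<rho> + c / 2" using c mass_nonneg[OF d\<rho>] by (simp add: ennreal_plus[symmetric] del: ennreal_plus)
    then show ?thesis using c by simp
  qed
  moreover have "defect N \<rho> \<le> \<kappa>" if \<kappa>: "0 < \<kappa>" for \<kappa>
  proof -
    \<comment> \<open>The errors will be 2 * lam N * \<xi> from \<open>L\<close>, 2 * \<xi> from
      \<open>W\<close>, \<xi> / 2 from \<open>B\<close>, and \<kappa> / 3 from the defect of the
      truncated sequence.\<close>
    define \<xi> where "\<xi> = \<kappa> / (3 * (lam N + 2))"
    have \<xi>: "0 < \<xi>" using \<kappa> lam by (simp add: \<xi>_def)
    have "(lam N + 2) * \<xi> = \<kappa> / 3" using lam by (simp add: \<xi>_def field_simps)
    then have \<xi>\<kappa>: "lam N * \<xi> + 2 * \<xi> = \<kappa> / 3" by (simp add: algebra_simps)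
    note a\<rho> = adm_trunc[OF \<rho>(1)]
    have "\<forall>\<^sub>F j in sequentially. W N \<rho> \<le> W N (trunc j \<rho>) + \<xi>"
      by (rule W_lower_semicontinuous[OF \<rho>(1) a\<rho> _ \<xi>]) (simp add: trunc_tendsto)
    moreover have "\<forall>\<^sub>F j in sequentially. L \<rho> \<le> L (trunc j \<rho>) + \<xi>"
      by (rule L_fatou[OF adm_dens[OF a\<rho>] d\<rho> _ \<xi>]) (simp add: trunc_tendsto)
    moreover have "\<forall>\<^sub>F j in sequentially. \<forall>\<^sub>F n in sequentially. defect N (trunc j (u n)) \<le> \<kappa> / 3"
      using \<kappa> by (intro defect_trunc_small[OF u du cu]) auto
    ultimately have "\<forall>\<^sub>F j in sequentially. W N \<rho> \<le> W N (trunc j \<rho>) + \<xi> \<and> L \<rho> \<le> L (trunc j \<rho>) + \<xi>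
      \<and> (\<forall>\<^sub>F n in sequentially. defect N (trunc j (u n)) \<le> \<kappa> / 3)"
      by eventually_elim auto
    then obtain j where j: "W N \<rho> \<le> W N (trunc j \<rho>) + \<xi>" "L \<rho> \<le> L (trunc j \<rho>) + \<xi>"
      and jn: "\<forall>\<^sub>F n in sequentially. defect N (trunc j (u n)) \<le> \<kappa> / 3"
      using eventually_happens'[OF sequentially_bot] by blast
    note au = adm_trunc[OF u(1)]
    have convj: "AE x in lborel. (\<lambda>n. trunc j (u n) x) \<longlonglongrightarrow> trunc j \<rho> x"
      using conv unfolding trunc_def u_def by eventually_elim (intro tendsto_mult tendsto_const)
    define K where "K = 12 * C1 * sqrt ((2 * real N) powr a)"
    have K: "0 \<le> K" using C1_pos by (simp add: K_def)
    obtain \<eta> where \<eta>: "0 < \<eta>" "\<And>x. 0 \<le> x \<Longrightarrow> x \<le> \<eta> \<Longrightarrow> sqrt (x powr a) \<le> \<xi> / (K + 1)"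
      using small_sqrt_powr[of "\<xi> / (K + 1)"] \<xi> K by auto
    have "\<forall>\<^sub>F n in sequentially. W N (trunc j \<rho>) \<le> W N (trunc j (u n)) + \<xi>"
      by (rule W_lower_semicontinuous[OF a\<rho> au convj \<xi>])
    moreover have "\<forall>\<^sub>F n in sequentially. L (trunc j \<rho>) \<le> L (trunc j (u n)) + \<xi>"
      by (rule L_fatou[OF adm_dens[OF au] adm_dens[OF a\<rho>] convj \<xi>])
    moreover note jn L1[OF \<eta>(1), of j]
    ultimately have "\<forall>\<^sub>F n in sequentially. W N (trunc j \<rho>) \<le> W N (trunc j (u n)) + \<xi> \<and> L (trunc j \<rho>) \<le> L (trunc j (u n)) + \<xi>
      \<and> defect N (trunc j (u n)) \<le> \<kappa> / 3
      \<and> (\<integral>\<^sup>+x. ennreal (\<bar>u n x - \<rho> x\<bar> * indicator (cball 0 (real j)) x) \<partial>lborel) \<le> ennreal \<eta>"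
      by eventually_elim auto
    then obtain n where n: "W N (trunc j \<rho>) \<le> W N (trunc j (u n)) + \<xi>" "L (trunc j \<rho>) \<le> L (trunc j (u n)) + \<xi>"
      "defect N (trunc j (u n)) \<le> \<kappa> / 3"
      and n\<eta>: "(\<integral>\<^sup>+x. ennreal (\<bar>u n x - \<rho> x\<bar> * indicator (cball 0 (real j)) x) \<partial>lborel) \<le> ennreal \<eta>"
      using eventually_happens'[OF sequentially_bot] by blast
    have le\<eta>: "mass (\<lambda>x. \<bar>trunc j (u n) x - trunc j \<rho> x\<bar>) \<le> \<eta>"
    proof -
      have eq: "(\<lambda>x. \<bar>trunc j (u n) x - trunc j \<rho> x\<bar>) = (\<lambda>x. \<bar>u n x - \<rho> x\<bar> * indicator (cball 0 (real j)) x)"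
        by (auto simp: trunc_def indicator_def)
      show ?thesis unfolding eq
        using n\<eta> \<eta>(1) integrable_abs_diff_indicator[OF d d\<rho>, of "cball 0 (real j)" n]
        by (subst (asm) nn_integral_eq_integral) auto
    qed
    have "B (trunc j (u n)) (trunc j (u n)) \<le> B (trunc j \<rho>) (trunc j \<rho>)
        + K * sqrt (mass (\<lambda>x. \<bar>trunc j (u n) x - trunc j \<rho> x\<bar>) powr a)"
      unfolding K_def
      by (intro B_continuous_L1 au a\<rho> order_trans[OF L_trunc_le] d d\<rho> u \<rho>)
    also have "K * sqrt (mass (\<lambda>x. \<bar>trunc j (u n) x - trunc j \<rho> x\<bar>) powr a) \<le> (K + 1) * (\<xi> / (K + 1))"
      using K \<xi> by (intro mult_mono \<eta>(2) le\<eta>) auto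
    also have "\<dots> = \<xi>" using K by simp
    finally have Bn: "B (trunc j (u n)) (trunc j (u n)) \<le> B (trunc j \<rho>) (trunc j \<rho>) + \<xi>" by simp
    have Bj: "B (trunc j \<rho>) (trunc j \<rho>) \<le> B \<rho> \<rho>"
      by (intro B_mono adm_dens[OF a\<rho>] d\<rho> trunc_le)
    have "lam N * L \<rho> \<le> lam N * (L (trunc j (u n)) + 2 * \<xi>)"
      using lam j n by (intro mult_left_mono) auto
    then have "lam N * L \<rho> \<le> lam N * L (trunc j (u n)) + 2 * (lam N * \<xi>)" by (simp add: algebra_simps)
    then show ?thesis
      using j(1) n(1,3) Bn Bj \<xi>\<kappa> \<xi> unfolding defect_def G_def by argo
  qed
  then have "defect N \<rho> \<le> 0" by (rule field_le_epsilon[of "defect N \<rho>" 0, simplified])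
  ultimately show thesis using that[OF \<rho>(1)] defect_nonneg[OF \<rho>(1)] by simp
qed


subsection \<open>Spread-out particles\<close>

text \<open>Below \<tau> by monotonicity, above it by t powr q = t powr (q - 1) * t. The free
  parameter is tuned in \<open>exists_spread\<close>, where the linear majorant reduces an integral
  of \<rho> powr q to masses.\<close>

lemma powr_le_tangent: "0 \<le> t \<Longrightarrow> 0 < \<tau> \<Longrightarrow> t powr q \<le> \<tau> powr (q - 1) * t + \<tau> powr q" for t \<tau> :: real
proof (cases "t \<le> \<tau>")
  case True
  assume "0 \<le> t" "0 < \<tau>"
  then have "t powr q \<le> \<tau> powr q" using True q_pos by (intro powr_mono2) auto
  moreover have "0 \<le> \<tau> powr (q - 1) * t" using \<open>0 \<le> t\<close> by simp
  ultimately show ?thesis by linarith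
next
  case False
  assume "0 \<le> t" "0 < \<tau>"
  then have "t powr q = t powr (q - 1) * t" using False by (simp add: powr_mult_base powr_diff)
  also have "\<dots> \<le> \<tau> powr (q - 1) * t"
    using False \<open>0 < \<tau>\<close> q_less by (intro mult_right_mono powr_mono2') auto
  finally show ?thesis by (simp add: add_increasing2)
qed

lemma powr_add_le: "0 \<le> x \<Longrightarrow> 0 \<le> y \<Longrightarrow> (x + y) powr q \<le> x powr q + y powr q" for x y :: real
proof (cases "x = 0 \<or> y = 0")
  case False
  assume "0 \<le> x" "0 \<le> y"
  with False have pos: "0 < x" "0 < y" by auto
  have e: "z powr q = z powr (q - 1) * z" if "0 < z" for z :: real using that by (simp add: powr_diff)
  have "(x + y) powr q = (x + y) powr (q - 1) * x + (x + y) powr (q - 1) * y"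
    using pos by (subst e) (auto simp: distrib_left)
  also have "\<dots> \<le> x powr (q - 1) * x + y powr (q - 1) * y"
    using pos q_less by (intro add_mono mult_right_mono powr_mono2') auto
  finally show ?thesis using pos by (simp add: e[symmetric])
qed auto

text \<open>In x * (x + y) powr q + y * (x + y) powr q, Bernoulli's inequality bounds the first
  product and subadditivity of the power q the second. The mixed term carries x powr q: it vanishes
  when the perturbation y lives off the support of x, so that \<open>L\<close> then changes only
  superlinearly.\<close>

lemma powr_Suc_add_le:
  fixes x y :: real
  assumes "0 \<le> x" "0 \<le> y"
  shows "(x + y) powr (1 + q) \<le> x powr (1 + q) + 2 * (y * x powr q) + y powr (1 + q)"
proof (cases "x = 0")
  case False
  then have x: "0 < x" using assms by simp
  have "(x + y) powr q \<le> x powr q + x powr q * (y / x)"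
  proof -
    have "(x + y) powr q = x powr q * (1 + y / x) powr q"
      using x assms by (simp add: powr_mult[symmetric] distrib_left)
    also have "\<dots> \<le> x powr q * (1 + y / x) powr 1"
      using x assms q_less by (intro mult_left_mono powr_mono) auto
    finally show ?thesis using x assms by (simp add: distrib_left)
  qed
  then have "x * (x + y) powr q \<le> x * (x powr q + x powr q * (y / x))" using x by (intro mult_left_mono) auto
  also have "\<dots> = x powr (1 + q) + y * x powr q" using x by (simp add: powr_add field_simps)
  finally have 1: "x * (x + y) powr q \<le> x powr (1 + q) + y * x powr q" .
  have "y * (x + y) powr q \<le> y * (x powr q + y powr q)"
    using assms by (intro mult_left_mono powr_add_le) auto
  also have "\<dots> = y * x powr q + y powr (1 + q)"
    using assms by (simp add: powr_mult_base distrib_left)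
  finally have 2: "y * (x + y) powr q \<le> y * x powr q + y powr (1 + q)" .
  have "(x + y) powr (1 + q) = x * (x + y) powr q + y * (x + y) powr q"
    using assms by (simp add: powr_mult_base[symmetric] distrib_right)
  then show ?thesis using 1 2 by linarith
qed (use assms in \<open>auto intro: add_increasing\<close>)

lemma integrable_mult_powr:
  assumes u: "dens u" and \<rho>: "dens \<rho>" shows "integrable lborel (\<lambda>x. u x * \<rho> x powr q)"
proof -
  note [measurable] = dens_measurable[OF u] dens_measurable[OF \<rho>]
  have "integrable lborel (\<lambda>x. u x powr (1 + q) + \<rho> x powr (1 + q))"
    using u \<rho> by (intro Bochner_Integration.integrable_add dens_integrable_powr)
  then show ?thesis
  proof (rule Bochner_Integration.integrable_bound)
    show "AE x in lborel. norm (u x * \<rho> x powr q) \<le> norm (u x powr (1 + q) + \<rho> x powr (1 + q))"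
    proof (rule AE_I2)
      fix x
      have nn: "0 \<le> u x" "0 \<le> \<rho> x" using u \<rho> by (auto intro: dens_nonneg)
      have "u x * \<rho> x powr q \<le> max (u x) (\<rho> x) * max (u x) (\<rho> x) powr q"
        using nn q_pos by (intro mult_mono powr_mono2) auto
      also have "\<dots> = max (u x) (\<rho> x) powr (1 + q)" using nn by (simp add: powr_mult_base)
      also have "\<dots> \<le> u x powr (1 + q) + \<rho> x powr (1 + q)" by (auto simp: max_def)
      finally show "norm (u x * \<rho> x powr q) \<le> norm (u x powr (1 + q) + \<rho> x powr (1 + q))"
        using nn by simp
    qed
  qed simp
qed

lemma L_add_le:
  assumes u: "dens u" and \<rho>: "dens \<rho>" and t: "0 \<le> t"
  shows "L (\<lambda>x. \<rho> x + t * u x) \<le> L \<rho> + 2 * t * (LINT x|lborel. u x * \<rho> x powr q) + t powr (1 + q) * L u"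
proof -
  have i: "integrable lborel (\<lambda>x. \<rho> x powr (1 + q))" "integrable lborel (\<lambda>x. 2 * t * (u x * \<rho> x powr q))"
    "integrable lborel (\<lambda>x. t powr (1 + q) * u x powr (1 + q))"
    using u \<rho> by (auto intro: dens_integrable_powr integrable_mult_powr)
  have "L (\<lambda>x. \<rho> x + t * u x) \<le> (LINT x|lborel. \<rho> x powr (1 + q) + 2 * t * (u x * \<rho> x powr q) + t powr (1 + q) * u x powr (1 + q))"
    unfolding L_def
  proof (rule integral_mono)
    show "integrable lborel (\<lambda>x. (\<rho> x + t * u x) powr (1 + q))"
      using u \<rho> t by (intro dens_integrable_powr dens_add dens_scale)
    show "integrable lborel (\<lambda>x. \<rho> x powr (1 + q) + 2 * t * (u x * \<rho> x powr q) + t powr (1 + q) * u x powr (1 + q))"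
      by (intro Bochner_Integration.integrable_add i)
    fix x
    show "(\<rho> x + t * u x) powr (1 + q) \<le> \<rho> x powr (1 + q) + 2 * t * (u x * \<rho> x powr q) + t powr (1 + q) * u x powr (1 + q)"
      using powr_Suc_add_le[of "\<rho> x" "t * u x"] dens_nonneg[OF u, of x] dens_nonneg[OF \<rho>, of x] t
      by (simp add: powr_mult mult.assoc)
  qed
  also have "\<dots> = L \<rho> + 2 * t * (LINT x|lborel. u x * \<rho> x powr q) + t powr (1 + q) * L u"
    unfolding L_def
    by (subst Bochner_Integration.integral_add Bochner_Integration.integral_add[OF i(1,2)],
        intro Bochner_Integration.integrable_add i, rule i,
        subst Bochner_Integration.integral_add[OF i(1,2)]) simp
  finally show ?thesis .
qed

lemma B_potential_le:
  assumes u: "dens u" and f: "dens f" and "0 \<le> c"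
    and le: "\<And>x. f x \<noteq> 0 \<Longrightarrow> (\<integral>\<^sup>+y. ennreal (u y) * k x y \<partial>lborel) \<le> ennreal c"
  shows "B u f \<le> c * mass f"
proof -
  note [measurable] = dens_measurable[OF u] dens_measurable[OF f]
  have "bform f u \<le> (\<integral>\<^sup>+x. ennreal (f x) * ennreal c \<partial>lborel)"
    unfolding bform_potential[OF f u]
  proof (rule nn_integral_mono)
    fix x show "ennreal (f x) * (\<integral>\<^sup>+y. ennreal (u y) * k x y \<partial>lborel) \<le> ennreal (f x) * ennreal c"
      using le[of x] by (cases "f x = 0") (auto intro: mult_left_mono)
  qed
  also have "\<dots> = ennreal (c * mass f)"
    using assms by (subst nn_integral_multc) (auto simp: nn_integral_dens ennreal_mult mass_nonneg mult.commute)
  finally have "B f u \<le> c * mass f"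
    using \<open>0 \<le> c\<close> mass_nonneg[OF f] by (simp add: bform_eq f u)
  then show ?thesis by (simp add: B_commute[OF u f])
qed

lemma B_bounded:
  assumes f: "dens f" and g: "dens g" and le: "\<And>x. f x \<le> t" and "0 \<le> t"
  shows "B f g \<le> C1 * t powr q * mass f powr a * mass g"
proof (rule B_potential_le[OF f g])
  note [measurable] = dens_measurable[OF f]
  show "(\<integral>\<^sup>+y. ennreal (f y) * k x y \<partial>lborel) \<le> ennreal (C1 * t powr q * mass f powr a)" for x
    using assms by (intro nn_integral_k_bounded) (auto simp: nn_integral_dens mass_nonneg intro: ennreal_leI)
qed (use C1_pos in simp)

lemma mass_outside:
  assumes f: "dens f" and e: "0 < e"
  obtains R where "0 < R" "mass (\<lambda>x. f x * indicator (- cball 0 R) x) < e"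
proof -
  have "(\<lambda>j. mass (trunc j f)) \<longlonglongrightarrow> mass f"
  proof (rule integral_dominated_convergence[where w = f])
    show "AE x in lborel. (\<lambda>j. trunc j f x) \<longlonglongrightarrow> f x" by (simp add: trunc_tendsto)
    show "AE x in lborel. norm (trunc j f x) \<le> f x" for j
      using trunc_le[OF f, of j] dens_nonneg[OF dens_trunc[OF f], of j] by simp
  qed (use f dens_trunc[OF f] in \<open>auto intro: dens_measurable dens_integrable\<close>)
  then have "\<forall>\<^sub>F j in sequentially. mass f - e < mass (trunc j f)" using e by (intro order_tendstoD(1)) auto
  then obtain j0 where j0: "\<And>j. j0 \<le> j \<Longrightarrow> mass f - e < mass (trunc j f)" unfolding eventually_sequentially by blast
  have "mass f = mass (trunc (Suc j0) f) + mass (\<lambda>x. f x * indicator (- cball 0 (real (Suc j0))) x)"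
    unfolding trunc_def by (rule mass_split[OF f]) simp
  then have "mass (\<lambda>x. f x * indicator (- cball 0 (real (Suc j0))) x) < e" using j0[of "Suc j0"] by simp
  then show thesis by (intro that[of "real (Suc j0)"]) auto
qed

section \<open>The potential of a uniform ball\<close>

definition ball_pot :: "real \<Rightarrow> 'a \<Rightarrow> ennreal" where
  "ball_pot K x = (\<integral>\<^sup>+y. indicator (ball 0 K) y * k x y \<partial>lborel)"

lemma ball_pot_shift: "ball_pot K x = (\<integral>\<^sup>+z. indicator (ball (- x) K) z * k 0 z \<partial>lborel)"
proof -
  have "ball_pot K x = (\<integral>\<^sup>+z. ennreal (1 ^ DIM('a)) * (indicator (ball 0 K) (x + 1 *\<^sub>R z) * k x (x + 1 *\<^sub>R z)) \<partial>lborel)"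
    unfolding ball_pot_def by (rule nn_integral_affine) auto
  also have "\<dots> = (\<integral>\<^sup>+z. indicator (ball (- x) K) z * k 0 z \<partial>lborel)"
  proof (intro nn_integral_cong)
    fix z
    have "k x (x + z) = k 0 z" using riesz_kernel_add[of s 0 x z] by (simp add: add.commute)
    moreover have "x + z \<in> ball 0 K \<longleftrightarrow> z \<in> ball (- x) K" by (simp add: dist_norm norm_minus_commute add.commute)
    ultimately show "ennreal (1 ^ DIM('a)) * (indicator (ball 0 K) (x + 1 *\<^sub>R z) * k x (x + 1 *\<^sub>R z)) = indicator (ball (- x) K) z * k 0 z"
      by (simp add: indicator_def)
  qed
  finally show ?thesis .
qed

text \<open>Both differences complement the same intersection in balls of equal finite volume; this
  is the exchange of volume in the bathtub argument.\<close>

lemma emeasure_ball_diff: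
  assumes "0 \<le> K" shows "emeasure lborel (ball x K - ball y K) = emeasure lborel (ball y K - ball (x::'a) K)"
proof -
  have fin: "emeasure lborel (ball x K \<inter> ball y K) \<noteq> \<infinity>"
    using emeasure_bounded_finite[of "ball x K \<inter> ball y K"] bounded_subset[OF bounded_ball[of x K], of "ball x K \<inter> ball y K"] by auto
  have eq: "emeasure lborel (ball x K) = emeasure lborel (ball y K)"
    using assms by (simp add: emeasure_ball)
  have "emeasure lborel (ball x K - ball y K) = emeasure lborel (ball x K) - emeasure lborel (ball x K \<inter> ball y K)"
    using fin by (subst emeasure_Diff[symmetric]) (auto simp: Diff_Int_distrib2 intro!: arg_cong[where f="emeasure lborel"])
  moreover have "emeasure lborel (ball y K - ball x K) = emeasure lborel (ball y K) - emeasure lborel (ball x K \<inter> ball y K)"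
    using fin by (subst emeasure_Diff[symmetric]) (auto intro!: arg_cong[where f="emeasure lborel"])
  ultimately show ?thesis using eq by simp
qed

text \<open>Bathtub principle.\<close>

lemma ball_pot_le:
  assumes K: "0 < K" shows "ball_pot K x \<le> ball_pot K 0"
proof -
  let ?E = "ball (- x) K" and ?F = "ball (0::'a) K"
  have "ball_pot K x = (\<integral>\<^sup>+z. indicator (?E \<inter> ?F) z * k 0 z + indicator (?E - ?F) z * k 0 z \<partial>lborel)"
    unfolding ball_pot_shift by (intro nn_integral_cong) (auto simp: indicator_def)
  also have "\<dots> = (\<integral>\<^sup>+z. indicator (?E \<inter> ?F) z * k 0 z \<partial>lborel) + (\<integral>\<^sup>+z. indicator (?E - ?F) z * k 0 z \<partial>lborel)"
    by (intro nn_integral_add) auto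
  \<comment> \<open>The kernel is at most K powr (- s) outside the central ball and at least that
    inside, so exchanging equal volumes can only increase the integral.\<close>
  also have "(\<integral>\<^sup>+z. indicator (?E - ?F) z * k 0 z \<partial>lborel) \<le> (\<integral>\<^sup>+z. ennreal (K powr - s) * indicator (?E - ?F) z \<partial>lborel)"
    using k_le[OF K, of 0] by (intro nn_integral_mono) (auto simp: indicator_def)
  also have "\<dots> = ennreal (K powr - s) * emeasure lborel (?F - ?E)"
    using K emeasure_ball_diff[of K "- x" 0] by (subst nn_integral_cmult_indicator) auto
  also have "\<dots> = (\<integral>\<^sup>+z. ennreal (K powr - s) * indicator (?F - ?E) z \<partial>lborel)"
    by (subst nn_integral_cmult_indicator) auto
  also have "\<dots> \<le> (\<integral>\<^sup>+z. indicator (?F - ?E) z * k 0 z \<partial>lborel)"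
    using k_ge[of 0 _ K] by (intro nn_integral_mono) (auto simp: indicator_def)
  also have "(\<integral>\<^sup>+z. indicator (?E \<inter> ?F) z * k 0 z \<partial>lborel) + (\<integral>\<^sup>+z. indicator (?F - ?E) z * k 0 z \<partial>lborel)
      = (\<integral>\<^sup>+z. indicator (?E \<inter> ?F) z * k 0 z + indicator (?F - ?E) z * k 0 z \<partial>lborel)"
    by (intro nn_integral_add[symmetric]) auto
  also have "\<dots> = ball_pot K 0"
    unfolding ball_pot_shift by (intro nn_integral_cong) (auto simp: indicator_def)
  finally show ?thesis by (simp add: add_left_mono)
qed

text \<open>Moving the centre by at most R loses only points of the shell between K - R and K, where
  the kernel is at most (K - R) powr (- s).\<close>

lemma ball_pot_ge:
  assumes "0 < R" "R < K" "norm x \<le> R"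
  shows "ball_pot K 0 \<le> ball_pot K x + ennreal ((K - R) powr - s * (unit_ball_vol (real DIM('a)) * (K ^ DIM('a) - (K - R) ^ DIM('a))))"
proof -
  let ?E = "ball (- x) K" and ?F = "ball (0::'a) K" and ?D = "ball (0::'a) (K - R)"
  have sub: "?D \<subseteq> ?E"
  proof
    fix z assume "z \<in> ?D"
    then have "norm z < K - R" by simp
    then have "norm (z + x) < K" using assms(3) norm_triangle_ineq[of z x] by linarith
    then show "z \<in> ?E" by (simp add: dist_norm norm_minus_commute add.commute)
  qed
  have "ball_pot K 0 = (\<integral>\<^sup>+z. indicator ?F z * k 0 z \<partial>lborel)" unfolding ball_pot_shift by simp
  also have "\<dots> \<le> (\<integral>\<^sup>+z. indicator ?E z * k 0 z + ennreal ((K - R) powr - s) * indicator (?F - ?D) z \<partial>lborel)"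
  proof (intro nn_integral_mono)
    fix z show "indicator ?F z * k 0 z \<le> indicator ?E z * k 0 z + ennreal ((K - R) powr - s) * indicator (?F - ?D) z"
      using sub k_le[of "K - R" 0 z] assms by (cases "z \<in> ?D") (auto simp: indicator_def intro: add_increasing)
  qed
  also have "\<dots> = ball_pot K x + ennreal ((K - R) powr - s) * emeasure lborel (?F - ?D)"
    unfolding ball_pot_shift[of K x] by (simp add: nn_integral_add nn_integral_cmult_indicator)
  also have "emeasure lborel (?F - ?D) = emeasure lborel ?F - emeasure lborel ?D"
    using assms emeasure_bounded_finite[of ?D] by (intro emeasure_Diff) (auto intro: subset_ball)
  also have "\<dots> = ennreal (unit_ball_vol (real DIM('a)) * (K ^ DIM('a) - (K - R) ^ DIM('a)))"
    using assms by (simp add: emeasure_ball ennreal_minus right_diff_distrib)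
  finally show ?thesis using assms by (simp add: ennreal_mult)
qed

text \<open>A particle spread uniformly over a large centred ball sees \<open>\<rho>\<close> as a point charge of size
  \<open>mass \<rho>\<close>, up to a relative error \<open>\<zeta>\<close>, and the corresponding change of \<open>L\<close> is of lower order.\<close>

lemma exists_spread:
  assumes \<rho>: "dens \<rho>" and \<zeta>: "0 < \<zeta>"
  obtains u U where "dens u" "mass u = 1" "0 < U" "\<And>x. (\<integral>\<^sup>+y. ennreal (u y) * k x y \<partial>lborel) \<le> ennreal U"
    "(mass \<rho> - \<zeta>) * U \<le> B u \<rho>" "(LINT x|lborel. u x * \<rho> x powr q) \<le> \<zeta> * U"
proof -
  note [measurable] = dens_measurable[OF \<rho>]
  define m where "m = mass \<rho>"
  have m: "0 \<le> m" using mass_nonneg[OF \<rho>] by (simp add: m_def)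
  define \<omega> where "\<omega> = unit_ball_vol (real DIM('a))"
  have \<omega>: "0 < \<omega>" by (simp add: \<omega>_def)
  define \<sigma> where "\<sigma> = (\<zeta> / 3) powr (1 / q)"
  have \<sigma>: "0 < \<sigma>" "\<sigma> powr q = \<zeta> / 3" using \<zeta> q_pos by (auto simp: \<sigma>_def powr_powr)
  define e where "e = min (\<zeta> / 2) (\<omega> * \<zeta> / (3 * \<sigma> powr (q - 1)))"
  have e: "0 < e" using \<zeta> \<omega> \<sigma> by (simp add: e_def)
  obtain R where R: "0 < R" and Rout: "mass (\<lambda>x. \<rho> x * indicator (- cball 0 R) x) < e"
    using mass_outside[OF \<rho> e] .
  define \<rho>1 where "\<rho>1 = (\<lambda>x. \<rho> x * indicator (cball 0 R) x)"
  define \<rho>2 where "\<rho>2 = (\<lambda>x. \<rho> x * indicator (- cball 0 R) x)"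
  have d12: "dens \<rho>1" "dens \<rho>2" unfolding \<rho>1_def \<rho>2_def by (auto intro: dens_restrict \<rho>)
  note [measurable] = d12[THEN dens_measurable]
  have m12: "m = mass \<rho>1 + mass \<rho>2" unfolding m_def \<rho>1_def \<rho>2_def by (rule mass_split[OF \<rho>]) simp
  have m2: "0 \<le> mass \<rho>2" "mass \<rho>2 \<le> \<zeta> / 2" "\<sigma> powr (q - 1) * mass \<rho>2 / \<omega> \<le> \<zeta> / 3"
  proof -
    show "0 \<le> mass \<rho>2" by (rule mass_nonneg[OF d12(2)])
    show "mass \<rho>2 \<le> \<zeta> / 2" using Rout by (simp add: \<rho>2_def e_def)
    have "mass \<rho>2 \<le> \<omega> * \<zeta> / (3 * \<sigma> powr (q - 1))" using Rout by (simp add: \<rho>2_def e_def)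
    then show "\<sigma> powr (q - 1) * mass \<rho>2 / \<omega> \<le> \<zeta> / 3" using \<omega> \<sigma> by (simp add: field_simps)
  qed
  define VR where "VR = measure lborel (cball (0::'a) R)"
  \<comment> \<open>Loss of the potential of u at points within R of the centre, in units of K powr
    (- s); it tends to 0 as K grows with R fixed.\<close>
  define \<theta> where "\<theta> K = ((K - R) / K) powr - s * (1 - ((K - R) / K) ^ DIM('a))" for K
  have dpos: "0 < real DIM('a)" by simp
  have lim1: "((\<lambda>K. (K - R) / K) \<longlongrightarrow> 1) at_top"
  proof -
    have "((\<lambda>K. 1 - R * inverse K) \<longlongrightarrow> 1 - R * 0) at_top"
      by (intro tendsto_intros tendsto_inverse_0_at_top filterlim_ident)
    moreover have "\<forall>\<^sub>F K in at_top. 1 - R * inverse K = (K - R) / K"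
      using eventually_gt_at_top[of 0] by eventually_elim (simp add: field_simps)
    ultimately show ?thesis using Lim_transform_eventually by fastforce
  qed
  have "(\<theta> \<longlongrightarrow> 1 powr - s * (1 - 1 ^ DIM('a))) at_top"
    unfolding \<theta>_def by (intro tendsto_intros lim1) auto
  then have "\<forall>\<^sub>F K in at_top. \<theta> K < \<zeta> / (2 * (m + 1))"
    using \<zeta> m by (intro order_tendstoD(2)) auto
  moreover have "((\<lambda>K. (VR + m) / \<omega> * K powr - (real DIM('a) - s)) \<longlongrightarrow> (VR + m) / \<omega> * 0) at_top"
    using s_less by (intro tendsto_mult tendsto_const tendsto_neg_powr filterlim_ident) auto
  then have "\<forall>\<^sub>F K in at_top. (VR + m) / \<omega> * K powr - (real DIM('a) - s) < \<zeta> / 3"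
    using \<zeta> by (intro order_tendstoD(2)) auto
  moreover have "\<forall>\<^sub>F K in at_top. R < K" by (rule eventually_gt_at_top)
  ultimately have "\<forall>\<^sub>F K in at_top. \<theta> K < \<zeta> / (2 * (m + 1)) \<and> (VR + m) / \<omega> * K powr - (real DIM('a) - s) < \<zeta> / 3 \<and> R < K"
    by eventually_elim auto
  then obtain K where K\<theta>: "\<theta> K < \<zeta> / (2 * (m + 1))" and Kd: "(VR + m) / \<omega> * K powr - (real DIM('a) - s) < \<zeta> / 3" and KR: "R < K"
    using eventually_happens'[OF trivial_limit_at_top_linorder] by blast
  have K: "0 < K" using R KR by simp
  define V where "V = \<omega> * K ^ DIM('a)"
  have V: "0 < V" using \<omega> K by (simp add: V_def)
  have emV: "emeasure lborel (ball (0::'a) K) = ennreal V" using K by (simp add: emeasure_ball V_def \<omega>_def)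
  have V_powr: "V = \<omega> * K powr real DIM('a)" using K by (simp add: V_def powr_realpow)
  define u where "u = (\<lambda>x::'a. (1 / V) * indicator (ball 0 K) x)"
  have u_meas [measurable]: "u \<in> borel_measurable borel" unfolding u_def by measurable
  have u_nn: "0 \<le> u x" for x using V by (simp add: u_def)
  have u_powr: "u x powr (1 + q) = (1 / V) powr (1 + q) * indicator (ball 0 K) x" for x
    by (auto simp: u_def indicator_def)
  have int_ball: "integrable lborel (indicator (ball 0 K) :: 'a \<Rightarrow> real)"
    using emV by (simp add: integrable_indicator_iff)
  have du: "dens u"
    unfolding dens_def u_powr using int_ball u_nn by (auto simp: u_def)
  have mu: "mass u = 1"
    using emV V by (simp add: u_def measure_def)
  have fin: "ball_pot K 0 < \<infinity>"
    unfolding ball_pot_def using nn_integral_k_ball[OF K, of 0] by (auto simp: mult.commute top_unique less_top[symmetric])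
  \<comment> \<open>Potential of u at the centre, the largest one by \<open>ball_pot_le\<close>. It
    is at least K powr (- s), so errors that are small multiples of K powr (- s) are small multiples
    of U.\<close>
  define U where "U = enn2real (ball_pot K 0) / V"
  have UV: "ennreal (U * V) = ball_pot K 0" using V fin by (simp add: U_def)
  have Kge: "K powr - s * V \<le> U * V"
  proof -
    have "ennreal (K powr - s * V) = (\<integral>\<^sup>+y. ennreal (K powr - s) * indicator (ball 0 K) y \<partial>(lborel :: 'a measure))"
      using V by (simp add: nn_integral_cmult_indicator emV ennreal_mult)
    also have "\<dots> \<le> ball_pot K 0"
      unfolding ball_pot_def using k_ge[of 0 _ K] by (intro nn_integral_mono) (auto simp: indicator_def)
    finally have "ennreal (K powr - s * V) \<le> ennreal (U * V)" by (simp add: UV)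
    moreover have "0 \<le> U" using V by (simp add: U_def)
    ultimately show ?thesis using V by (subst (asm) ennreal_le_iff) auto
  qed
  then have UK: "K powr - s \<le> U" using V by simp
  have "0 < K powr - s" using K by simp
  then have U: "0 < U" using UK by linarith
  have u_pot: "(\<integral>\<^sup>+y. ennreal (u y) * k x y \<partial>lborel) = ennreal (1 / V) * ball_pot K x" for x
    unfolding ball_pot_def u_def using V
    by (subst nn_integral_cmult[symmetric]) (auto simp: ennreal_mult mult.assoc intro!: nn_integral_cong simp: indicator_def)
  have pot_le: "(\<integral>\<^sup>+y. ennreal (u y) * k x y \<partial>lborel) \<le> ennreal U" for x
  proof -
    have "ennreal (1 / V) * ball_pot K x \<le> ennreal (1 / V) * ennreal (U * V)"
      unfolding UV by (intro mult_left_mono ball_pot_le K) auto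
    also have "\<dots> = ennreal U" using V U by (simp add: ennreal_mult[symmetric])
    finally show ?thesis by (simp add: u_pot)
  qed
  have \<theta>0: "0 \<le> \<theta> K"
    unfolding \<theta>_def using R KR by (intro mult_nonneg_nonneg) (auto simp: power_le_one_iff)
  have pot_ge: "ennreal ((1 - \<theta> K) * U) \<le> (\<integral>\<^sup>+y. ennreal (u y) * k x y \<partial>lborel)" if "norm x \<le> R" for x
  proof -
    let ?E = "(K - R) powr - s * (\<omega> * (K ^ DIM('a) - (K - R) ^ DIM('a)))"
    have E: "?E = K powr - s * \<theta> K * V"
    proof -
      have "(K - R) powr - s = K powr - s * ((K - R) / K) powr - s"
        using K KR by (simp add: powr_divide)
      moreover have "\<omega> * (K ^ DIM('a) - (K - R) ^ DIM('a)) = V * (1 - ((K - R) / K) ^ DIM('a))"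
        using K by (simp add: V_def power_divide field_simps)
      ultimately show ?thesis by (simp add: \<theta>_def mult_ac)
    qed
    have "ball_pot K 0 \<le> ball_pot K x + ennreal ?E" unfolding \<omega>_def by (rule ball_pot_ge[OF R KR that])
    also have "?E \<le> U * \<theta> K * V" unfolding E using UK \<theta>0 V by (intro mult_right_mono) auto
    finally have *: "ennreal (U * V) \<le> ball_pot K x + ennreal (U * \<theta> K * V)"
      unfolding UV[symmetric] by (simp add: add_left_mono ennreal_leI)
    have finx: "ball_pot K x < \<infinity>" using ball_pot_le[OF K, of x] fin by (rule le_less_trans)
    then obtain z where z: "ball_pot K x = ennreal z" "0 \<le> z" by (cases "ball_pot K x") auto
    have "U * V \<le> z + U * \<theta> K * V"
      using * z U V \<theta>0 by (simp add: ennreal_plus[symmetric] del: ennreal_plus)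
    then have "(1 - \<theta> K) * U \<le> (1 / V) * z" using V by (simp add: field_simps)
    then have "ennreal ((1 - \<theta> K) * U) \<le> ennreal ((1 / V) * z)" by (rule ennreal_leI)
    also have "\<dots> = ennreal (1 / V) * ball_pot K x" using z V by (simp add: ennreal_mult[symmetric])
    finally show ?thesis by (simp add: u_pot)
  qed
  have Bge: "(m - \<zeta>) * U \<le> B u \<rho>"
  proof (cases "1 - \<theta> K \<le> 0")
    case True
    have "m * \<theta> K \<le> m * (\<zeta> / (2 * (m + 1)))" using K\<theta> m by (intro mult_left_mono) auto
    also have "\<dots> \<le> \<zeta> / 2" using m \<zeta> by (simp add: field_simps)
    finally have "m * 1 \<le> \<zeta> / 2" using True m mult_left_mono[of 1 "\<theta> K" m] by linarith
    then have "(m - \<zeta>) * U \<le> 0" using \<zeta> U by (intro mult_nonpos_nonneg) auto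
    then show ?thesis using B_nonneg[of u \<rho>] by linarith
  next
    case False
    have "ennreal ((1 - \<theta> K) * U * mass \<rho>1) = (\<integral>\<^sup>+x. ennreal ((1 - \<theta> K) * U) * ennreal (\<rho>1 x) \<partial>lborel)"
      using False U by (simp add: nn_integral_cmult nn_integral_dens d12 ennreal_mult mass_nonneg)
    also have "\<dots> \<le> (\<integral>\<^sup>+x. ennreal (\<rho> x) * (\<integral>\<^sup>+y. ennreal (u y) * k x y \<partial>lborel) \<partial>lborel)"
    proof (intro nn_integral_mono)
      fix x
      show "ennreal ((1 - \<theta> K) * U) * ennreal (\<rho>1 x) \<le> ennreal (\<rho> x) * (\<integral>\<^sup>+y. ennreal (u y) * k x y \<partial>lborel)"
        using pot_ge[of x] by (cases "norm x \<le> R") (auto simp: \<rho>1_def mult.commute intro!: mult_left_mono)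
    qed
    also have "\<dots> = ennreal (B u \<rho>)"
      using bform_potential[OF \<rho> du] by (simp add: bform_eq \<rho> du B_commute[OF du \<rho>])
    finally have 1: "(1 - \<theta> K) * U * mass \<rho>1 \<le> B u \<rho>" using B_nonneg by simp
    have "\<theta> K * mass \<rho>1 \<le> \<zeta> / (2 * (m + 1)) * m"
      using K\<theta> \<theta>0 m12 m2 mass_nonneg[OF d12(1)] by (intro mult_mono) auto
    also have "\<dots> \<le> \<zeta> / 2" using m \<zeta> by (simp add: field_simps)
    finally have "m - \<zeta> \<le> (1 - \<theta> K) * mass \<rho>1" using m12 m2 by (simp add: left_diff_distrib)
    then have "(m - \<zeta>) * U \<le> (1 - \<theta> K) * mass \<rho>1 * U" using U by (intro mult_right_mono) auto
    then show ?thesis using 1 by (simp add: mult_ac)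
  qed
  \<comment> \<open>A height of the order K^(-d) of the spread density. Then \<tau> powr q is
    \<zeta> / 3 * K powr (- s), while the large slope \<tau> powr (q - 1) only meets the small mass
    of \<rho>2, outside radius R.\<close>
  define \<tau> where "\<tau> = \<sigma> * K powr - real DIM('a)"
  have \<tau>: "0 < \<tau>" using \<sigma> K by (simp add: \<tau>_def)
  have dq: "real DIM('a) * q = s" by (simp add: q_eq)
  have \<tau>q: "\<tau> powr q = \<zeta> / 3 * K powr - s"
  proof -
    have "(K powr - real DIM('a)) powr q = K powr - s" by (simp add: powr_powr dq)
    then show ?thesis using \<sigma> K by (simp add: \<tau>_def powr_mult)
  qed
  have \<tau>q1: "\<tau> powr (q - 1) = \<sigma> powr (q - 1) * (K powr - s * K powr real DIM('a))"
  proof -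
    have "(K powr - real DIM('a)) powr (q - 1) = K powr (- s + real DIM('a))"
      using dq by (simp add: powr_powr algebra_simps)
    also have "\<dots> = K powr - s * K powr real DIM('a)" by (rule powr_add)
    finally show ?thesis using \<sigma> K by (simp add: \<tau>_def powr_mult)
  qed
  have int_R: "integrable lborel (indicator (cball 0 R) :: 'a \<Rightarrow> real)"
    using emeasure_bounded_finite[of "cball (0::'a) R"] by (simp add: integrable_indicator_iff)
  have "(LINT x|lborel. u x * \<rho> x powr q)
      \<le> (LINT x|lborel. (1 / V) * (indicator (cball 0 R) x + \<rho> x + \<tau> powr (q - 1) * \<rho>2 x) + \<tau> powr q * u x)"
  proof (rule integral_mono)
    show "integrable lborel (\<lambda>x. u x * \<rho> x powr q)" by (rule integrable_mult_powr[OF du \<rho>])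
    show "integrable lborel (\<lambda>x. (1 / V) * (indicator (cball 0 R) x + \<rho> x + \<tau> powr (q - 1) * \<rho>2 x) + \<tau> powr q * u x)"
      by (intro Bochner_Integration.integrable_add integrable_mult_right int_R dens_integrable[OF \<rho>] dens_integrable[OF d12(2)] dens_integrable[OF du])
    fix x
    have \<rho>0: "0 \<le> \<rho> x" by (rule dens_nonneg[OF \<rho>])
    have uV: "u x \<le> 1 / V" using V by (simp add: u_def indicator_def)
    show "u x * \<rho> x powr q \<le> (1 / V) * (indicator (cball 0 R) x + \<rho> x + \<tau> powr (q - 1) * \<rho>2 x) + \<tau> powr q * u x"
    proof (cases "norm x \<le> R")
      case True
      have "u x * \<rho> x powr q \<le> (1 / V) * (1 + \<rho> x)"
        using powr_le_tangent[OF \<rho>0, of 1] uV u_nn V by (intro mult_mono) auto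
      moreover have "0 \<le> \<tau> powr q * u x" using u_nn by simp
      ultimately show ?thesis using True by (simp add: \<rho>2_def)
    next
      case False
      have "u x * \<rho> x powr q \<le> u x * (\<tau> powr (q - 1) * \<rho> x + \<tau> powr q)"
        using powr_le_tangent[OF \<rho>0 \<tau>] u_nn by (intro mult_left_mono) auto
      also have "\<dots> = u x * (\<tau> powr (q - 1) * \<rho> x) + \<tau> powr q * u x" by (simp add: algebra_simps)
      also have "u x * (\<tau> powr (q - 1) * \<rho> x) \<le> (1 / V) * (\<rho> x + \<tau> powr (q - 1) * \<rho> x)"
        using uV u_nn \<rho>0 V by (intro mult_mono) auto
      finally show ?thesis using False by (simp add: \<rho>2_def)
    qed
  qed
  also have "\<dots> = (1 / V) * (VR + m + \<tau> powr (q - 1) * mass \<rho>2) + \<tau> powr q"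
  proof -
    have "(LINT x|lborel. indicator (cball 0 R) x + \<rho> x + \<tau> powr (q - 1) * \<rho>2 x) = VR + m + \<tau> powr (q - 1) * mass \<rho>2"
      using int_R dens_integrable[OF \<rho>] dens_integrable[OF d12(2)] by (simp add: VR_def m_def)
    moreover have "integrable lborel (\<lambda>x. indicator (cball 0 R) x + \<rho> x + \<tau> powr (q - 1) * \<rho>2 x)"
      by (intro Bochner_Integration.integrable_add integrable_mult_right int_R dens_integrable[OF \<rho>] dens_integrable[OF d12(2)])
    ultimately show ?thesis
      using Bochner_Integration.integral_add[OF integrable_mult_right integrable_mult_right[OF dens_integrable[OF du]],
          of "1 / V" "\<lambda>x. indicator (cball 0 R) x + \<rho> x + \<tau> powr (q - 1) * \<rho>2 x" "\<tau> powr q"] mu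
      by (simp only: integral_mult_right_zero mult_1_right)
  qed
  also have "\<dots> = K powr - s * ((VR + m) / \<omega> * K powr - (real DIM('a) - s) + \<sigma> powr (q - 1) * mass \<rho>2 / \<omega> + \<zeta> / 3)"
  proof -
    have "K powr - s * K powr - (real DIM('a) - s) = K powr (- s + - (real DIM('a) - s))"
      by (rule powr_add[symmetric])
    also have "- s + - (real DIM('a) - s) = - real DIM('a)" by simp
    also have "K powr - real DIM('a) = 1 / K powr real DIM('a)" by (rule powr_minus_divide)
    finally have "1 / V = 1 / \<omega> * (K powr - s * K powr - (real DIM('a) - s))"
      by (simp only: V_powr times_divide_times_eq mult_1)
    then have A: "(1 / V) * (VR + m) = K powr - s * ((VR + m) / \<omega> * K powr - (real DIM('a) - s))"
      by simp
    have "(1 / V) * (\<tau> powr (q - 1) * mass \<rho>2) = K powr - s * (\<sigma> powr (q - 1) * mass \<rho>2 / \<omega>)"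
      using K \<omega> by (simp add: V_powr \<tau>q1)
    with A show ?thesis by (simp add: \<tau>q distrib_left)
  qed
  also have "\<dots> \<le> K powr - s * \<zeta>"
  proof (rule mult_left_mono)
    show "(VR + m) / \<omega> * K powr - (real DIM('a) - s) + \<sigma> powr (q - 1) * mass \<rho>2 / \<omega> + \<zeta> / 3 \<le> \<zeta>"
      using Kd m2(3) by argo
  qed simp
  also have "\<dots> \<le> \<zeta> * U" using UK \<zeta> by (simp add: mult.commute)
  finally show thesis
    using that[OF du mu U pot_le] Bge by (simp add: m_def)
qed

lemma ach_single: assumes "dens u" "mass u = 1" shows "ach 1 u 0"
proof -
  have "ach (Suc 0) (\<lambda>x. 0 + u x) (0 + B (\<lambda>_. 0) u)"
    by (rule ach_insert[OF ach_empty dens_zero assms])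
  moreover have "B (\<lambda>_. 0) u = 0" by (simp add: B_def bform_def)
  ultimately show ?thesis by simp
qed

text \<open>A single particle has no repulsion, so a density of mass 1 with positive form suffices.
  Its part in a ball of radius R has positive mass and mutual distances at most 2 * R.\<close>

lemma lam_one_pos: "0 < lam 1"
proof -
  obtain u where u: "dens u" "mass u = 1"
    by (rule exists_spread[OF dens_zero zero_less_one]) blast
  obtain R where R: "0 < R" "mass (\<lambda>x. u x * indicator (- cball 0 R) x) < 1"
    using mass_outside[OF u(1), of 1] by auto
  define v where "v = (\<lambda>x. u x * indicator (cball 0 R) x)"
  have v: "dens v" unfolding v_def by (rule dens_restrict[OF u(1)]) simp
  note [measurable] = dens_measurable[OF v]
  have "mass u = mass v + mass (\<lambda>x. u x * indicator (- cball 0 R) x)"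
    unfolding v_def by (rule mass_split[OF u(1)]) simp
  then have mv: "0 < mass v" using R u by simp
  have "ennreal ((2 * R) powr - s * (mass v * mass v)) = (\<integral>\<^sup>+x. \<integral>\<^sup>+y. ennreal (v x) * ennreal (v y) * ennreal ((2 * R) powr - s) \<partial>lborel \<partial>lborel)"
    using mv by (simp add: nn_integral_cmult nn_integral_multc nn_integral_dens[OF v] ennreal_mult mult_ac)
  also have "\<dots> \<le> bform v v"
    unfolding bform_def
  proof (intro nn_integral_mono)
    fix x y
    show "ennreal (v x) * ennreal (v y) * ennreal ((2 * R) powr - s) \<le> ennreal (v x) * ennreal (v y) * k x y"
    proof (cases "norm x \<le> R \<and> norm y \<le> R")
      case True
      then have "dist x y \<le> 2 * R" using dist_triangle[of x y 0] by (simp add: dist_norm)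
      then show ?thesis by (intro mult_left_mono k_ge) auto
    qed (auto simp: v_def)
  qed
  finally have "ennreal ((2 * R) powr - s * (mass v * mass v)) \<le> ennreal (B v v)" by (simp add: bform_eq v)
  then have "(2 * R) powr - s * (mass v * mass v) \<le> B v v" using B_nonneg by simp
  moreover have "0 < (2 * R) powr - s * (mass v * mass v)" using R mv by simp
  ultimately have Bv: "0 < B v v" by linarith
  have "B v v \<le> B u u" using u v by (intro B_mono) (auto simp: v_def indicator_def dens_nonneg)
  moreover have "adm 1 u" using u by (simp add: adm_def)
  moreover have "W 1 u \<le> 0" by (rule W_le[OF ach_single[OF u(1,2)]])
  ultimately have "0 < G 1 u" "G 1 u \<le> lam 1 * L u" using Bv G_le_lam[of 1 u] by (auto simp: G_def)
  then have "0 < lam 1 * L u" by linarith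
  then show ?thesis using L_nonneg[of u] by (simp add: zero_less_mult_iff)
qed

end

subsection \<open>The mass of maximizers\<close>

text \<open>Off G all flags are cleared, which can only lower the cost; on G the count is at most
  \<open>N'\<close> by assumption. In this way a part of a state for N + 1 particles becomes a state
  for N.\<close>

lemma state_restrict_event:
  assumes P: "state N P \<rho>" and [measurable]: "G \<in> sets slots"
    and count: "\<And>\<omega>. \<omega> \<in> G \<Longrightarrow> psum (\<lambda>_. 1) \<omega> \<le> of_nat N'"
    and rest: "\<And>f. f \<in> borel_measurable borel \<Longrightarrow>
      (\<integral>\<^sup>+\<omega>. psum f \<omega> * indicator G \<omega> \<partial>P) = (\<integral>\<^sup>+x. f x * ennreal (\<rho>' x) \<partial>lborel)"
  shows "\<exists>R. state N' R \<rho>' \<and> cost s R \<le> cost s P"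
proof -
  note [measurable_cong] = state_sets[OF P]
  let ?h = "\<lambda>\<omega> i. (fst (\<omega> i), snd (\<omega> i) \<and> \<omega> \<in> G)"
  have h: "?h \<in> measurable P slots" by (rule measurable_slots) measurable
  have psum_h: "psum f (?h \<omega>) = psum f \<omega> * indicator G \<omega>" for f \<omega>
    by (auto simp: psum_def indicator_def cong: if_cong)
  have "pcost s (?h \<omega>) \<le> pcost s \<omega>" for \<omega>
    unfolding pcost_def by (intro suminf_le sum_mono) auto
  then have "cost s (distr P slots ?h) \<le> cost s P"
    using cost_distr[OF h, of s] unfolding cost_def by (simp add: nn_integral_mono)
  moreover have "state N' (distr P slots ?h) \<rho>'"
  proof (rule state_distr[OF state_prob[OF P] h])
    show "AE \<omega> in P. psum (\<lambda>_. 1) (?h \<omega>) \<le> of_nat N'"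
      unfolding psum_h using count by (auto simp: indicator_def)
    show "(\<integral>\<^sup>+\<omega>. psum f (?h \<omega>) \<partial>P) = (\<integral>\<^sup>+x. f x * ennreal (\<rho>' x) \<partial>lborel)"
      if "f \<in> borel_measurable borel" for f
      unfolding psum_h by (rule rest[OF that])
  qed
  ultimately show ?thesis by blast
qed

text \<open>The event on which a particle can still be inserted without exceeding N; its complement
  consists of the full configurations.\<close>

definition few :: "nat \<Rightarrow> (nat \<Rightarrow> 'a::euclidean_space \<times> bool) set" where
  "few N = {\<omega> \<in> space slots. psum (\<lambda>_. 1) \<omega> < (of_nat N :: ennreal)}"

lemma sets_few [measurable]: "few N \<in> sets slots"
  unfolding few_def by measurable

context riesz_exponent begin

lemma small_powr_q:
  assumes "0 < b" obtains \<epsilon> where "0 < \<epsilon>" "\<epsilon> \<le> 1" "\<And>x. 0 \<le> x \<Longrightarrow> x \<le> \<epsilon> \<Longrightarrow> x powr q \<le> b"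
proof
  define \<epsilon> where "\<epsilon> = min 1 (b powr (1 / q))"
  show "0 < \<epsilon>" "\<epsilon> \<le> 1" using assms by (auto simp: \<epsilon>_def)
  fix x assume "0 \<le> x" "x \<le> \<epsilon>"
  then have "x powr q \<le> (b powr (1 / q)) powr q" using q_pos by (intro powr_mono2) (auto simp: \<epsilon>_def)
  then show "x powr q \<le> b" using assms q_pos by (simp add: powr_powr)
qed

lemma state_mass:
  assumes P: "state N P \<rho>" and \<rho>: "dens \<rho>" shows "mass \<rho> \<le> real N"
proof -
  interpret P: prob_space P using state_prob[OF P] .
  have "ennreal (mass \<rho>) = (\<integral>\<^sup>+\<omega>. psum (\<lambda>_. 1) \<omega> \<partial>P)"
    by (simp add: state_density[OF P] nn_integral_dens[OF \<rho>])
  also have "\<dots> \<le> (\<integral>\<^sup>+\<omega>. of_nat N \<partial>P)" by (rule nn_integral_mono_AE) (rule state_count[OF P])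
  also have "\<dots> = ennreal (real N)" by (simp add: P.emeasure_space_1 ennreal_of_nat_eq_real_of_nat)
  finally show ?thesis by simp
qed

text \<open>Configurations outside \<open>few N\<close> hold exactly N particles almost surely, so
  they account for the mass N * (1 - measure P (few N)), and the rest of the mass sits on
  \<open>few N\<close>.\<close>

lemma few_mass:
  assumes P: "state N P \<rho>" and \<rho>: "dens \<rho>"
  shows "(\<integral>\<^sup>+\<omega>. psum (\<lambda>_. 1) \<omega> * indicator (few N) \<omega> \<partial>P) = ennreal (mass \<rho> - real N * (1 - measure P (few N)))"
    and "real N * (1 - measure P (few N)) \<le> mass \<rho>"
proof -
  interpret P: prob_space P using state_prob[OF P] .
  note [measurable_cong] = state_sets[OF P]
  have sp: "space P = space slots" using state_sets[OF P] by (rule sets_eq_imp_space_eq)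
  have few[measurable]: "few N \<in> sets P" using sets_few state_sets[OF P] by simp
  let ?I = "\<integral>\<^sup>+\<omega>. psum (\<lambda>_. 1) \<omega> * indicator (few N) \<omega> \<partial>P"
  have "ennreal (mass \<rho>) = (\<integral>\<^sup>+\<omega>. psum (\<lambda>_. 1) \<omega> \<partial>P)"
    by (simp add: state_density[OF P] nn_integral_dens[OF \<rho>])
  also have "\<dots> = (\<integral>\<^sup>+\<omega>. psum (\<lambda>_. 1) \<omega> * indicator (few N) \<omega> + of_nat N * indicator (space P - few N) \<omega> \<partial>P)"
  proof (rule nn_integral_cong_AE)
    show "AE \<omega> in P. psum (\<lambda>_. 1) \<omega> = psum (\<lambda>_. 1) \<omega> * indicator (few N) \<omega> + of_nat N * indicator (space P - few N) \<omega>"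
      using state_count[OF P] AE_space
      by eventually_elim (auto simp: few_def sp indicator_def not_less)
  qed
  also have "\<dots> = ?I + of_nat N * emeasure P (space P - few N)"
    by (subst nn_integral_add) (auto simp: nn_integral_cmult_indicator)
  also have "of_nat N * emeasure P (space P - few N) = ennreal (real N * (1 - P.prob (few N)))"
    by (simp add: P.emeasure_eq_measure P.prob_compl[OF few] ennreal_mult ennreal_of_nat_eq_real_of_nat)
  finally have eq: "ennreal (mass \<rho>) = ?I + ennreal (real N * (1 - P.prob (few N)))" .
  then obtain z where z: "?I = ennreal z" "0 \<le> z" by (cases ?I) auto
  have nn: "0 \<le> real N * (1 - P.prob (few N))" by simp
  have "mass \<rho> = z + real N * (1 - P.prob (few N))"
    using eq z nn mass_nonneg[OF \<rho>] by (simp add: ennreal_plus[symmetric] del: ennreal_plus)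
  then show "?I = ennreal (mass \<rho> - real N * (1 - P.prob (few N)))" "real N * (1 - P.prob (few N)) \<le> mass \<rho>"
    using z by auto
qed

text \<open>The part of \<open>\<rho>\<close> carried by \<open>few (Suc N)\<close> comes from at most \<open>N\<close> particles, hence only competes
  with the smaller constant \<open>lam N\<close>.\<close>

lemma optimizer_count:
  assumes \<rho>: "adm (Suc N) \<rho>" "0 < mass \<rho>" "defect (Suc N) \<rho> = 0" and lam: "lam N < lam (Suc N)"
  obtains c \<xi> where "0 < c" "0 < \<xi>" "\<And>P. state (Suc N) P \<rho> \<Longrightarrow> cost s P \<le> ennreal (W (Suc N) \<rho> + \<xi>)
    \<Longrightarrow> c \<le> 1 - measure P (few (Suc N))"
proof -
  note d = adm_dens[OF \<rho>(1)]
  have L: "0 < L \<rho>" using L_zero_iff[OF d] \<rho>(2) L_nonneg[of \<rho>] by simp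
  \<comment> \<open>The strict gap of the constants in units of energy; the errors below add up to
    at most 5 * g / 8.\<close>
  define g where "g = (lam (Suc N) - lam N) * L \<rho>"
  have g: "0 < g" using lam L by (simp add: g_def)
  define K where "K = 2 * C1 * sqrt (mass \<rho> powr a * L \<rho>) * sqrt (L \<rho>)"
  have K: "0 \<le> K" using C1_pos by (simp add: K_def L_nonneg)
  obtain \<eta> where \<eta>: "0 < \<eta>" "\<And>x. 0 \<le> x \<Longrightarrow> x \<le> \<eta> \<Longrightarrow> sqrt (x powr a) \<le> g / (4 * (K + 1))"
    using small_sqrt_powr[of "g / (4 * (K + 1))"] g K by auto
  show thesis
  proof (rule that)
    show "0 < \<eta> / real (Suc N)" "0 < g / 4" using \<eta> g by auto
    fix P assume P: "state (Suc N) P \<rho>" "cost s P \<le> ennreal (W (Suc N) \<rho> + g / 4)"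
    let ?\<tau> = "1 - measure P (few (Suc N))"
    interpret P: prob_space P using state_prob[OF P(1)] .
    show "\<eta> / real (Suc N) \<le> ?\<tau>"
    proof (rule ccontr)
      assume "\<not> ?thesis"
      then have \<tau>: "real (Suc N) * ?\<tau> \<le> \<eta>" by (simp add: field_simps)
      obtain \<rho>2 where \<rho>2m: "\<rho>2 \<in> borel_measurable borel" and \<rho>2: "\<And>x. 0 \<le> \<rho>2 x" "\<And>x. \<rho>2 x \<le> \<rho> x"
        and rest: "\<And>f. f \<in> borel_measurable borel \<Longrightarrow>
          (\<integral>\<^sup>+\<omega>. psum f \<omega> * indicator (few (Suc N)) \<omega> \<partial>P) = (\<integral>\<^sup>+x. f x * ennreal (\<rho>2 x) \<partial>lborel)"
        using state_restrict_density[OF P(1) dens_measurable[OF d] sets_few _ dens_integrable[OF d]] dens_nonneg[OF d] by blast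
      note [measurable] = \<rho>2m dens_measurable[OF d]
      have d2: "dens \<rho>2" using \<rho>2 by (intro dens_mono[OF d \<rho>2m]) auto
      have "ennreal (mass \<rho>2) = ennreal (mass \<rho> - real (Suc N) * ?\<tau>)"
        using rest[of "\<lambda>_. 1"] few_mass(1)[OF P(1) d] by (simp add: nn_integral_dens[OF d2])
      then have m2: "mass \<rho>2 = mass \<rho> - real (Suc N) * ?\<tau>"
        using few_mass(2)[OF P(1) d] mass_nonneg[OF d2] by (subst (asm) ennreal_inj) auto
      have "psum (\<lambda>_. 1) \<omega> \<le> of_nat N" if "\<omega> \<in> few (Suc N)" for \<omega> :: "nat \<Rightarrow> 'a \<times> bool"
        using that psum_one_cases[of \<omega>] by (force simp: few_def simp flip: of_nat_Suc simp del: of_nat_Suc)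
      then obtain R where R: "state N R \<rho>2" "cost s R \<le> cost s P"
        using state_restrict_event[OF P(1) sets_few _ rest, of N s] by auto
      have adm2: "adm N \<rho>2" using d2 state_mass[OF R(1) d2] by (simp add: adm_def)
      have Wnn: "0 \<le> W (Suc N) \<rho>" by (rule W_nonneg[OF \<rho>(1)])
      have W2: "W N \<rho>2 \<le> W (Suc N) \<rho> + g / 4"
        using R P(2) Wnn g by (intro W_le) (auto simp: ach_def intro: order_trans)
      \<comment> \<open>Density of the full configurations, whose mass is N + 1 times their
        probability. It is small if the claim fails.\<close>
      define e where "e = (\<lambda>x. \<rho> x - \<rho>2 x)"
      have e: "dens e" "e x \<le> \<rho> x" for x
        using \<rho>2 by (auto simp: e_def intro!: dens_mono[OF d])
      have me: "mass e = real (Suc N) * ?\<tau>"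
        unfolding e_def using d d2 m2 by (simp add: dens_integrable)
      have Be: "B \<rho> e \<le> g / 4"
      proof -
        have "B \<rho> e \<le> K * sqrt (mass e powr a)"
          unfolding K_def using e d by (intro B_le_mass L_mono) auto
        also have "\<dots> \<le> (K + 1) * (g / (4 * (K + 1)))"
          using K g \<tau> mass_nonneg[OF e(1)] by (intro mult_mono \<eta>) (auto simp: me)
        also have "\<dots> = g / 4" using K by (simp add: field_simps)
        finally show ?thesis .
      qed
      have "\<rho> = (\<lambda>x. \<rho>2 x + e x)" by (auto simp: e_def)
      then have "B \<rho> \<rho> = B (\<lambda>x. \<rho>2 x + e x) (\<lambda>x. \<rho>2 x + e x)" by simp
      also have "\<dots> = B \<rho>2 \<rho>2 + 2 * B \<rho>2 e + B e e"
        using d2 e by (simp add: B_add_left B_add_right dens_add B_commute[of e \<rho>2])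
      also have "B \<rho>2 e \<le> B \<rho> e" using d d2 e \<rho>2 by (intro B_mono) auto
      also have "B e e \<le> B \<rho> e" using d e by (intro B_mono) auto
      finally have BB: "B \<rho> \<rho> \<le> B \<rho>2 \<rho>2 + 3 * B \<rho> e" by simp
      have "G N \<rho>2 \<le> lam N * L \<rho>2" by (rule G_le_lam[OF adm2])
      also have "\<dots> \<le> lam N * L \<rho>" using lam_nonneg d d2 \<rho>2 by (intro mult_left_mono L_mono) auto
      finally have "B \<rho>2 \<rho>2 / 2 - W N \<rho>2 \<le> lam N * L \<rho>" by (simp add: G_def)
      moreover have "lam (Suc N) * L \<rho> = B \<rho> \<rho> / 2 - W (Suc N) \<rho>"
        using \<rho>(3) by (simp add: defect_def G_def)
      moreover have "g = lam (Suc N) * L \<rho> - lam N * L \<rho>" by (simp add: g_def left_diff_distrib)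
      ultimately show False using BB Be W2 g by argo
    qed
  qed
qed

lemma B_perturb_ge:
  assumes \<rho>: "dens \<rho>" and u: "dens u" and t: "0 \<le> t"
  shows "B \<rho> \<rho> + 2 * t * B u \<rho> \<le> B (\<lambda>x. \<rho> x + t * u x) (\<lambda>x. \<rho> x + t * u x)"
proof -
  note dtu = dens_scale[OF u t]
  have "B (\<lambda>x. \<rho> x + t * u x) (\<lambda>x. \<rho> x + t * u x)
      = B \<rho> \<rho> + 2 * t * B u \<rho> + B (\<lambda>x. t * u x) (\<lambda>x. t * u x)"
    using \<rho> u dtu t
    by (simp add: B_add_left B_add_right dens_add B_scale_left[OF u \<rho> t] B_scale_right[OF u \<rho> t] B_commute[OF \<rho> u])
  then show ?thesis using B_nonneg[of "\<lambda>x. t * u x" "\<lambda>x. t * u x"] by simp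
qed

text \<open>The potential of u never exceeds U, so the repulsion paid is at most U times the mean
  number of particles present on \<open>few N\<close>, which is the mass computed in
  \<open>few_mass\<close>.\<close>

lemma ach_insert_few:
  assumes P: "state N P \<rho>" "cost s P \<le> ennreal c" and "0 \<le> c" and \<rho>: "dens \<rho>" and u: "dens u" "mass u = 1"
    and U: "0 \<le> U" "\<And>x. (\<integral>\<^sup>+y. ennreal (u y) * k x y \<partial>lborel) \<le> ennreal U"
  shows "ach N (\<lambda>x. \<rho> x + measure P (few N) * u x) (c + U * (mass \<rho> - real N * (1 - measure P (few N))))"
proof -
  note [measurable] = dens_measurable[OF \<rho>] dens_measurable[OF u(1)]
  note [measurable_cong] = state_sets[OF P(1)]
  let ?U = "\<lambda>x. \<integral>\<^sup>+y. ennreal (u y) * k x y \<partial>lborel"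
  have "AE \<omega> in P. psum (\<lambda>_. 1) \<omega> + indicator (few N) \<omega> \<le> of_nat N"
    using state_count[OF P(1)]
    by eventually_elim (auto simp: few_def indicator_def intro: psum_one_less)
  then obtain R where R: "state N R (\<lambda>x. \<rho> x + measure P (few N) * u x)"
      "cost s R = cost s P + (\<integral>\<^sup>+\<omega>. psum ?U \<omega> * indicator (few N) \<omega> \<partial>P)"
    using state_insert[OF P(1) dens_measurable[OF u(1)] dens_measurable[OF \<rho>] sets_few, of N N s] u
    by (auto simp: nn_integral_dens dens_nonneg \<rho>)
  have "(\<integral>\<^sup>+\<omega>. psum ?U \<omega> * indicator (few N) \<omega> \<partial>P)
      \<le> (\<integral>\<^sup>+\<omega>. ennreal U * (psum (\<lambda>_. 1) \<omega> * indicator (few N) \<omega>) \<partial>P)"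
  proof (intro nn_integral_mono)
    fix \<omega>
    have "psum ?U \<omega> \<le> psum (\<lambda>x. ennreal U * 1) \<omega>" using U by (intro psum_mono) simp
    also have "\<dots> = ennreal U * psum (\<lambda>_. 1) \<omega>" by (rule psum_cmult)
    finally show "psum ?U \<omega> * indicator (few N) \<omega> \<le> ennreal U * (psum (\<lambda>_. 1) \<omega> * indicator (few N) \<omega>)"
      by (simp add: indicator_def)
  qed
  also have "\<dots> = ennreal U * ennreal (mass \<rho> - real N * (1 - measure P (few N)))"
    by (simp add: nn_integral_cmult few_mass(1)[OF P(1) \<rho>])
  finally have "cost s R \<le> ennreal c + ennreal U * ennreal (mass \<rho> - real N * (1 - measure P (few N)))"
    unfolding R(2) by (intro add_mono P)
  also have "\<dots> = ennreal (c + U * (mass \<rho> - real N * (1 - measure P (few N))))"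
    using \<open>0 \<le> c\<close> U few_mass(2)[OF P(1) \<rho>] by (simp add: ennreal_mult)
  finally show ?thesis
    using R(1) \<open>0 \<le> c\<close> U few_mass(2)[OF P(1) \<rho>] by (auto simp: ach_def)
qed

lemma ach_adm: "ach N \<rho> c \<Longrightarrow> dens \<rho> \<Longrightarrow> adm N \<rho>"
  using state_mass by (auto simp: ach_def adm_def)

text \<open>Inserting u into the configurations that are not full, of probability \<delta>, gains
  about \<delta> * mass \<rho> * U in attraction and pays at most (mass \<rho> - M * (1 - \<delta>))
  * U in repulsion. The difference is (M - mass \<rho>) * (1 - \<delta>) * U, and
  \<open>optimizer_count\<close> bounds 1 - \<delta> from below uniformly over almost optimal
  states.\<close>

theorem optimizer_mass:
  assumes \<rho>: "adm (Suc N) \<rho>" "0 < mass \<rho>" "defect (Suc N) \<rho> = 0" and lam: "lam N < lam (Suc N)"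
  shows "mass \<rho> = real (Suc N)"
proof (rule ccontr)
  assume "mass \<rho> \<noteq> real (Suc N)"
  then have m: "mass \<rho> < real (Suc N)" using adm_mass[OF \<rho>(1)] by simp
  note d = adm_dens[OF \<rho>(1)]
  define M where "M = real (Suc N)"
  define \<Lambda> where "\<Lambda> = lam (Suc N)"
  have \<Lambda>: "0 \<le> \<Lambda>" by (simp add: \<Lambda>_def lam_nonneg)
  obtain c \<xi>0 where c: "0 < c" "0 < \<xi>0" and count: "\<And>P. state (Suc N) P \<rho> \<Longrightarrow> cost s P \<le> ennreal (W (Suc N) \<rho> + \<xi>0)
    \<Longrightarrow> c \<le> 1 - measure P (few (Suc N))"
    using optimizer_count[OF \<rho> lam] by blast
  \<comment> \<open>Half of the guaranteed gain per \<epsilon> * U; in the same units the errors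
    amount to at most 3 * \<beta> / 2.\<close>
  define \<beta> where "\<beta> = (M - mass \<rho>) * c / 2"
  have \<beta>: "0 < \<beta>" using m c by (simp add: \<beta>_def M_def)
  define \<zeta> where "\<zeta> = \<beta> / (1 + 2 * \<Lambda>)"
  have \<zeta>: "0 < \<zeta>" "\<zeta> * (1 + 2 * \<Lambda>) = \<beta>" using \<beta> \<Lambda> by (auto simp: \<zeta>_def)
  obtain u U where u: "dens u" "mass u = 1" and U: "0 < U" "\<And>x. (\<integral>\<^sup>+y. ennreal (u y) * k x y \<partial>lborel) \<le> ennreal U"
    and Bu: "(mass \<rho> - \<zeta>) * U \<le> B u \<rho>" and Lu: "(LINT x|lborel. u x * \<rho> x powr q) \<le> \<zeta> * U"
    by (rule exists_spread[OF d \<zeta>(1)]) blast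
  obtain \<epsilon> where \<epsilon>: "0 < \<epsilon>" "\<epsilon> \<le> 1" and \<epsilon>q: "\<And>x. 0 \<le> x \<Longrightarrow> x \<le> \<epsilon> \<Longrightarrow> x powr q \<le> U * \<beta> / (4 * (\<Lambda> * L u + 1))"
    using small_powr_q[of "U * \<beta> / (4 * (\<Lambda> * L u + 1))"] U \<beta> \<Lambda> L_nonneg[of u] by (auto simp: add_nonneg_pos)
  \<comment> \<open>The gain is of order \<epsilon> * U * \<beta> with \<epsilon>, U and \<beta>
    fixed before P, so P can be taken optimal up to a quarter of this.\<close>
  define \<xi> where "\<xi> = min \<xi>0 (\<epsilon> * U * \<beta> / 4)"
  have \<xi>: "0 < \<xi>" "\<xi> \<le> \<xi>0" "\<xi> \<le> \<epsilon> * U * \<beta> / 4" using c \<epsilon> U \<beta> by (auto simp: \<xi>_def)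
  obtain P where P: "state (Suc N) P \<rho>" "cost s P \<le> ennreal (W (Suc N) \<rho> + \<xi>)"
    using W_approx_state[OF \<rho>(1) \<xi>(1)] .
  interpret P: prob_space P using state_prob[OF P(1)] .
  have Wnn: "0 \<le> W (Suc N) \<rho>" by (rule W_nonneg[OF \<rho>(1)])
  define \<delta> where "\<delta> = P.prob (few (Suc N))"
  have \<delta>: "0 \<le> \<delta>" "\<delta> \<le> 1" by (auto simp: \<delta>_def)
  have "cost s P \<le> ennreal (W (Suc N) \<rho> + \<xi>0)" using \<xi> by (intro order_trans[OF P(2)] ennreal_leI) auto
  from count[OF P(1) this] have \<tau>: "c \<le> 1 - \<delta>" by (simp add: \<delta>_def)
  \<comment> \<open>The insertion is carried out only with weight \<epsilon>. The gain is linear in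
    \<epsilon>, whereas t powr (1 + q) is of higher order.\<close>
  define t where "t = \<epsilon> * \<delta>"
  have t: "0 \<le> t" "t \<le> \<epsilon>" using \<epsilon> \<delta> by (auto simp: t_def mult_left_le)
  have "ach (Suc N) (\<lambda>x. (1 - \<epsilon>) * \<rho> x + \<epsilon> * (\<rho> x + \<delta> * u x))
      ((1 - \<epsilon>) * (W (Suc N) \<rho> + \<xi>) + \<epsilon> * (W (Suc N) \<rho> + \<xi> + U * (mass \<rho> - M * (1 - \<delta>))))"
    unfolding \<delta>_def M_def using P \<xi> Wnn U \<epsilon> u d
    by (intro ach_mix ach_insert_few) (auto simp: ach_def intro!: dens_add dens_scale)
  also have "(\<lambda>x. (1 - \<epsilon>) * \<rho> x + \<epsilon> * (\<rho> x + \<delta> * u x)) = (\<lambda>x. \<rho> x + t * u x)"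
    by (auto simp: t_def algebra_simps)
  also have "(1 - \<epsilon>) * (W (Suc N) \<rho> + \<xi>) + \<epsilon> * (W (Suc N) \<rho> + \<xi> + U * (mass \<rho> - M * (1 - \<delta>)))
      = W (Suc N) \<rho> + \<xi> + \<epsilon> * U * (mass \<rho> - M * (1 - \<delta>))" by (simp add: algebra_simps)
  finally have ach: "ach (Suc N) (\<lambda>x. \<rho> x + t * u x) (W (Suc N) \<rho> + \<xi> + \<epsilon> * U * (mass \<rho> - M * (1 - \<delta>)))" .
  have dn: "dens (\<lambda>x. \<rho> x + t * u x)" using d u t by (intro dens_add dens_scale) auto
  have "G (Suc N) (\<lambda>x. \<rho> x + t * u x) \<le> \<Lambda> * L (\<lambda>x. \<rho> x + t * u x)"
    unfolding \<Lambda>_def by (rule G_le_lam[OF ach_adm[OF ach dn]])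
  also have "\<dots> \<le> \<Lambda> * (L \<rho> + 2 * t * (\<zeta> * U) + \<epsilon> * (U * \<beta> / (4 * (\<Lambda> * L u + 1)) * L u))"
  proof (intro mult_left_mono \<Lambda>)
    have "t powr (1 + q) = t * t powr q" using t by (simp add: powr_mult_base)
    also have "\<dots> \<le> \<epsilon> * (U * \<beta> / (4 * (\<Lambda> * L u + 1)))" using t \<epsilon>q[OF t] \<epsilon> by (intro mult_mono) auto
    finally have "t powr (1 + q) * L u \<le> \<epsilon> * (U * \<beta> / (4 * (\<Lambda> * L u + 1))) * L u" by (intro mult_right_mono L_nonneg)
    moreover have "2 * t * (LINT x|lborel. u x * \<rho> x powr q) \<le> 2 * t * (\<zeta> * U)" using t Lu by (intro mult_left_mono) auto
    ultimately show "L (\<lambda>x. \<rho> x + t * u x) \<le> L \<rho> + 2 * t * (\<zeta> * U) + \<epsilon> * (U * \<beta> / (4 * (\<Lambda> * L u + 1)) * L u)"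
      using L_add_le[OF u(1) d t(1)] by (simp only: mult.assoc)
  qed
  also have "\<dots> = \<Lambda> * L \<rho> + 2 * \<Lambda> * \<zeta> * t * U + \<epsilon> * (U * \<beta> / 4) * (\<Lambda> * L u / (\<Lambda> * L u + 1))"
    by (simp add: distrib_left mult_ac)
  also have "\<dots> \<le> \<Lambda> * L \<rho> + 2 * \<Lambda> * \<zeta> * t * U + \<epsilon> * (U * \<beta> / 4) * 1"
  proof -
    have "\<Lambda> * L u / (\<Lambda> * L u + 1) \<le> 1"
      using \<Lambda> L_nonneg[of u] by (simp add: divide_le_eq add_nonneg_pos)
    then show ?thesis using \<epsilon> U \<beta> by (intro add_left_mono mult_left_mono) auto
  qed
  finally have up: "G (Suc N) (\<lambda>x. \<rho> x + t * u x) \<le> \<Lambda> * L \<rho> + 2 * \<Lambda> * \<zeta> * t * U + \<epsilon> * U * \<beta> / 4" by simp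
  have "t * ((mass \<rho> - \<zeta>) * U) \<le> t * B u \<rho>" using t Bu by (intro mult_left_mono) auto
  then have "B \<rho> \<rho> / 2 + t * ((mass \<rho> - \<zeta>) * U) - (W (Suc N) \<rho> + \<xi> + \<epsilon> * U * (mass \<rho> - M * (1 - \<delta>)))
      \<le> G (Suc N) (\<lambda>x. \<rho> x + t * u x)"
    using B_perturb_ge[OF d u(1) t(1)] W_le[OF ach] by (simp add: G_def)
  moreover have "\<Lambda> * L \<rho> = B \<rho> \<rho> / 2 - W (Suc N) \<rho>" using \<rho>(3) by (simp add: defect_def G_def \<Lambda>_def)
  ultimately have "t * ((mass \<rho> - \<zeta>) * U) - \<epsilon> * U * (mass \<rho> - M * (1 - \<delta>)) - 2 * \<Lambda> * \<zeta> * t * U \<le> \<epsilon> * U * \<beta> / 2"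
    using up \<xi>(3) by linarith
  moreover have "t * ((mass \<rho> - \<zeta>) * U) - \<epsilon> * U * (mass \<rho> - M * (1 - \<delta>)) - 2 * \<Lambda> * \<zeta> * t * U
      = \<epsilon> * U * ((M - mass \<rho>) * (1 - \<delta>) - \<delta> * (\<zeta> * (1 + 2 * \<Lambda>)))"
    by (simp add: t_def algebra_simps)
  ultimately have "\<epsilon> * U * ((M - mass \<rho>) * (1 - \<delta>) - \<delta> * \<beta>) \<le> \<epsilon> * U * (\<beta> / 2)"
    unfolding \<zeta>(2) by simp
  then have le: "(M - mass \<rho>) * (1 - \<delta>) - \<delta> * \<beta> \<le> \<beta> / 2" using \<epsilon> U by simp
  have "(M - mass \<rho>) * c \<le> (M - mass \<rho>) * (1 - \<delta>)" using m \<tau> by (intro mult_left_mono) (auto simp: M_def)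
  moreover have "\<delta> * \<beta> \<le> \<beta>" using \<delta> \<beta> by simp
  moreover have "2 * \<beta> = (M - mass \<rho>) * c" by (simp add: \<beta>_def)
  ultimately show False using le \<beta> by linarith
qed

end

subsection \<open>Boundedness and compact support\<close>

lemma psum_eq_0_iff: "psum f \<omega> = 0 \<longleftrightarrow> (\<forall>i. snd (\<omega> i) \<longrightarrow> f (fst (\<omega> i)) = 0)"
  unfolding psum_def by (subst suminf_eq_zero_iff) auto

lemma psum_ge: "snd (\<omega> i) \<Longrightarrow> f (fst (\<omega> i)) \<le> psum f \<omega>"
proof -
  assume "snd (\<omega> i)"
  then have "f (fst (\<omega> i)) = (\<Sum>j\<in>{i}. if snd (\<omega> j) then f (fst (\<omega> j)) else 0)" by simp
  also have "\<dots> \<le> psum f \<omega>" unfolding psum_def by (rule sum_le_suminf) auto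
  finally show ?thesis .
qed

context riesz_exponent begin

lemma B_bounded_AE:
  assumes f: "dens f" and g: "dens g" and le: "AE x in lborel. f x \<le> t" and "0 \<le> t"
  shows "B f g \<le> C1 * t powr q * mass f powr a * mass g"
proof (rule B_potential_le[OF f g])
  note [measurable] = dens_measurable[OF f]
  fix x
  have "(\<integral>\<^sup>+y. ennreal (f y) * k x y \<partial>lborel) = (\<integral>\<^sup>+y. ennreal (min (f y) t) * k x y \<partial>lborel)"
    using le by (intro nn_integral_cong_AE) (auto elim!: eventually_mono simp: min_def)
  also have "\<dots> \<le> ennreal (C1 * t powr q * mass f powr a)"
  proof (rule nn_integral_k_bounded)
    have "(\<integral>\<^sup>+y. ennreal (min (f y) t) \<partial>lborel) \<le> (\<integral>\<^sup>+y. ennreal (f y) \<partial>lborel)"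
      by (intro nn_integral_mono ennreal_leI) auto
    then show "(\<integral>\<^sup>+y. ennreal (min (f y) t) \<partial>lborel) \<le> ennreal (mass f)" by (simp add: nn_integral_dens f)
  qed (use assms in \<open>auto simp: mass_nonneg intro: ennreal_leI\<close>)
  finally show "(\<integral>\<^sup>+y. ennreal (f y) * k x y \<partial>lborel) \<le> ennreal (C1 * t powr q * mass f powr a)" .
qed (use C1_pos in simp)

text \<open>Removing the particles in \<open>E\<close> from a maximizer must not increase the functional.\<close>

lemma optimizer_delete:
  assumes \<rho>: "adm N \<rho>" "defect N \<rho> = 0" and E: "E \<in> sets borel"
  shows "lam N * L (\<lambda>x. \<rho> x * indicator E x) \<le> B \<rho> (\<lambda>x. \<rho> x * indicator E x)"
proof -
  note d = adm_dens[OF \<rho>(1)]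
  define f1 where "f1 = (\<lambda>x. \<rho> x * indicator E x)"
  define f2 where "f2 = (\<lambda>x. \<rho> x * indicator (- E) x)"
  note s = restrict_split[OF d E, folded f1_def f2_def]
  have a2: "adm N f2" unfolding f2_def using E by (intro adm_restrict[OF \<rho>(1)]) auto
  have d1: "dens f1" unfolding f1_def by (rule dens_restrict[OF d E])
  note d2 = adm_dens[OF a2]
  have "W N f2 \<le> W N \<rho>" unfolding f2_def using E by (intro W_restrict_le[OF \<rho>(1)]) auto
  moreover have "lam N * L \<rho> = lam N * L f1 + lam N * L f2" by (simp add: s(2) distrib_left)
  moreover have "B \<rho> f1 = B f1 f1 + B f2 f1" by (rule s(3)[OF d1])
  moreover have "B f2 f1 = B f1 f2" by (rule B_commute[OF d2 d1])
  moreover have "0 \<le> B f1 f1" by (rule B_nonneg)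
  ultimately have "lam N * L f1 \<le> B \<rho> f1"
    using defect_nonneg[OF a2] \<rho>(2) s(4) unfolding defect_def G_def by argo
  then show ?thesis by (simp add: f1_def)
qed

lemma superlevel_mass:
  assumes f: "dens f" and T: "0 < T"
  shows "T powr q * mass (\<lambda>x. f x * indicator {x. T < f x} x) \<le> L (\<lambda>x. f x * indicator {x. T < f x} x)"
proof -
  note [measurable] = dens_measurable[OF f]
  have d: "dens (\<lambda>x. f x * indicator {x. T < f x} x)" by (rule dens_restrict[OF f]) measurable
  have "(LINT x|lborel. T powr q * (f x * indicator {x. T < f x} x)) \<le> L (\<lambda>x. f x * indicator {x. T < f x} x)"
    unfolding L_def
  proof (rule integral_mono)
    fix x
    show "T powr q * (f x * indicator {x. T < f x} x) \<le> (f x * indicator {x. T < f x} x) powr (1 + q)"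
    proof (cases "T < f x")
      case True
      then have "T powr q * f x \<le> f x powr q * f x" using T q_pos by (intro mult_right_mono powr_mono2) auto
      also have "\<dots> = f x powr (1 + q)" using True T by (simp add: powr_mult_base mult.commute)
      finally show ?thesis using True by simp
    qed simp
  qed (use d in \<open>auto intro: dens_integrable_powr integrable_mult_right dens_integrable\<close>)
  then show ?thesis by simp
qed

text \<open>Deleting \<eta>, the part of \<rho> above T, gives lam N * \<open>L \<eta>\<close> \<le>
  \<open>B \<rho> \<eta>\<close>. An intermediate level T' cuts \<rho> into three layers: the mass
  above T' is so small that the two upper layers contribute little, and T is so much larger than T'
  that the potential of the lower layer, of order T' powr q, is small against T powr q. Hence
  \<open>L \<eta>\<close> vanishes.\<close>

theorem optimizer_bounded:
  assumes \<rho>: "adm N \<rho>" "defect N \<rho> = 0" and lam: "0 < lam N"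
  obtains T where "0 < T" "AE x in lborel. \<rho> x \<le> T"
proof -
  note d = adm_dens[OF \<rho>(1)]
  note [measurable] = dens_measurable[OF d]
  define \<Lambda> where "\<Lambda> = lam N"
  have \<Lambda>: "0 < \<Lambda>" using lam by (simp add: \<Lambda>_def)
  define up where "up T = (\<lambda>x. \<rho> x * indicator {x. T < \<rho> x} x)" for T
  have dup: "dens (up T)" for T unfolding up_def by (rule dens_restrict[OF d]) measurable
  define \<eta>0 where "\<eta>0 = (\<Lambda> / (12 * C1)) powr (1 / a)"
  have \<eta>0: "0 < \<eta>0" "C1 * \<eta>0 powr a = \<Lambda> / 12"
    using \<Lambda> C1_pos q_less by (auto simp: \<eta>0_def powr_powr)
  define T' where "T' = (L \<rho> / \<eta>0 + 1) powr (1 / q)"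
  have p1: "0 < L \<rho> / \<eta>0 + 1" using \<eta>0 L_nonneg[of \<rho>] by (simp add: add_nonneg_pos)
  have T': "0 < T'" "T' powr q = L \<rho> / \<eta>0 + 1" using p1 q_pos by (auto simp: T'_def powr_powr)
  have mT': "mass (up T') \<le> \<eta>0"
  proof -
    have "T' powr q * mass (up T') \<le> L (up T')" unfolding up_def by (rule superlevel_mass[OF d T'(1)])
    also have "\<dots> \<le> L \<rho>" using dens_nonneg[OF d] by (intro L_mono d dup) (auto simp: up_def indicator_def)
    also have "\<dots> \<le> T' powr q * \<eta>0" unfolding T'(2) using \<eta>0 by (simp add: field_simps)
    finally show ?thesis using T'(1) by simp
  qed
  \<comment> \<open>Q is the ratio (T / T') powr q; it is chosen to beat the potential of the lower
    layer.\<close>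
  define Q where "Q = 4 * C1 * real N powr a / \<Lambda> + 1"
  have Q: "1 \<le> Q" using C1_pos \<Lambda> by (simp add: Q_def)
  define T where "T = T' * Q powr (1 / q)"
  have T: "T' \<le> T" "0 < T"
    using T' Q q_pos ge_one_powr_ge_zero[of Q "1 / q"] by (auto simp: T_def)
  have Tq: "T powr q = T' powr q * Q" using T' Q q_pos by (simp add: T_def powr_mult powr_powr)
  define \<eta> where "\<eta> = up T"
  define lo where "lo = (\<lambda>x. \<rho> x * indicator {x. \<rho> x \<le> T'} x)"
  define band where "band = (\<lambda>x. \<rho> x * indicator {x. T' < \<rho> x \<and> \<rho> x \<le> T} x)"
  have dd: "dens \<eta>" "dens lo" "dens band"
    unfolding lo_def band_def \<eta>_def by (auto intro!: dup dens_restrict[OF d])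
  have eq: "\<rho> = (\<lambda>x. lo x + (band x + \<eta> x))"
    using T by (auto simp: lo_def band_def \<eta>_def up_def indicator_def)
  have B\<eta>: "B \<rho> \<eta> = B lo \<eta> + (B band \<eta> + B \<eta> \<eta>)"
    by (subst eq) (use dd in \<open>simp add: B_add_left dens_add\<close>)
  have L\<eta>: "T powr q * mass \<eta> \<le> L \<eta>" unfolding \<eta>_def up_def by (rule superlevel_mass[OF d T(2)])
  have m\<eta>: "mass \<eta> \<le> \<eta>0" "mass band \<le> \<eta>0"
  proof -
    have "mass \<eta> \<le> mass (up T')" using T dens_nonneg[OF d] dd dup
      by (intro mass_mono) (auto simp: \<eta>_def up_def indicator_def)
    then show "mass \<eta> \<le> \<eta>0" using mT' by simp
    have "mass band \<le> mass (up T')" using dens_nonneg[OF d] dd dup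
      by (intro mass_mono) (auto simp: band_def up_def indicator_def)
    then show "mass band \<le> \<eta>0" using mT' by simp
  qed
  have mlo: "mass lo \<le> real N"
    using mass_mono[OF d dd(2)] dens_nonneg[OF d] adm_mass[OF \<rho>(1)] by (force simp: lo_def indicator_def)
  have nn: "0 \<le> mass \<eta>" "0 \<le> mass lo" "0 \<le> mass band" using dd by (auto intro: mass_nonneg)
  have b1: "B lo \<eta> \<le> \<Lambda> / 4 * L \<eta>"
  proof -
    have "B lo \<eta> \<le> C1 * T' powr q * mass lo powr a * mass \<eta>"
      using T' by (intro B_bounded dd) (auto simp: lo_def indicator_def)
    also have "\<dots> \<le> C1 * T' powr q * real N powr a * mass \<eta>"
      using C1_pos q_less nn mlo by (intro mult_right_mono mult_left_mono powr_mono2) auto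
    also have "\<dots> = (\<Lambda> / 4 * (Q - 1)) * (T' powr q * mass \<eta>)"
      using \<Lambda> by (simp add: Q_def field_simps)
    also have "\<dots> \<le> (\<Lambda> / 4 * Q) * (T' powr q * mass \<eta>)"
      using \<Lambda> nn by (intro mult_right_mono mult_left_mono) auto
    also have "\<dots> = \<Lambda> / 4 * (T powr q * mass \<eta>)" by (simp add: Tq mult_ac)
    also have "\<dots> \<le> \<Lambda> / 4 * L \<eta>" using \<Lambda> L\<eta> by (intro mult_left_mono) auto
    finally show ?thesis .
  qed
  have b2: "B band \<eta> \<le> \<Lambda> / 12 * L \<eta>"
  proof -
    have "B band \<eta> \<le> C1 * T powr q * mass band powr a * mass \<eta>"
      using T by (intro B_bounded dd) (auto simp: band_def indicator_def)
    also have "\<dots> \<le> C1 * T powr q * \<eta>0 powr a * mass \<eta>"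
      using C1_pos q_less nn m\<eta> by (intro mult_right_mono mult_left_mono powr_mono2) auto
    also have "\<dots> = (C1 * \<eta>0 powr a) * (T powr q * mass \<eta>)" by (simp add: mult_ac)
    also have "\<dots> \<le> \<Lambda> / 12 * L \<eta>" unfolding \<eta>0(2) using \<Lambda> L\<eta> by (intro mult_left_mono) auto
    finally show ?thesis .
  qed
  have b3: "B \<eta> \<eta> \<le> \<Lambda> / 6 * L \<eta>"
  proof -
    have "B \<eta> \<eta> \<le> C1 * (mass \<eta> powr a * L \<eta> + mass \<eta> powr a * L \<eta>)" by (rule B_le[OF dd(1) dd(1)])
    also have "\<dots> = 2 * (C1 * mass \<eta> powr a) * L \<eta>" by (simp add: algebra_simps)
    also have "\<dots> \<le> 2 * (C1 * \<eta>0 powr a) * L \<eta>"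
      using C1_pos q_less nn m\<eta> L_nonneg by (intro mult_right_mono mult_left_mono powr_mono2) auto
    finally show ?thesis by (simp add: \<eta>0(2))
  qed
  have "\<Lambda> * L \<eta> \<le> B \<rho> \<eta>"
    unfolding \<Lambda>_def \<eta>_def up_def by (rule optimizer_delete[OF \<rho>]) measurable
  \<comment> \<open>The three layers contribute the fractions 1/4, 1/12 and 1/6 of \<Lambda> *
    \<open>L \<eta>\<close>.\<close>
  then have "\<Lambda> * L \<eta> \<le> \<Lambda> / 2 * L \<eta>" using B\<eta> b1 b2 b3 by argo
  then have "L \<eta> \<le> 0" using \<Lambda> by (simp add: field_simps)
  then have "L \<eta> = 0" using L_nonneg[of \<eta>] by simp
  then have "AE x in lborel. \<eta> x = 0" using L_zero_iff[OF dd(1)] mass_zero_AE[OF dd(1)] by simp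
  then have "AE x in lborel. \<rho> x \<le> T"
    by eventually_elim (use T in \<open>auto simp: \<eta>_def up_def indicator_def split: if_splits\<close>)
  with T show thesis by (intro that)
qed

lemma few_mass_le:
  assumes P: "state (Suc N) P \<rho>" and \<rho>: "dens \<rho>"
  shows "mass \<rho> - real (Suc N) * (1 - measure P (few (Suc N))) \<le> real N * measure P (few (Suc N))"
proof -
  interpret P: prob_space P using state_prob[OF P] .
  have few[measurable]: "few (Suc N) \<in> sets P" using sets_few state_sets[OF P] by simp
  have le: "psum (\<lambda>_. 1) \<omega> \<le> of_nat N" if "\<omega> \<in> few (Suc N)" for \<omega> :: "nat \<Rightarrow> 'a \<times> bool"
    using that psum_one_cases[of \<omega>] by (force simp: few_def simp flip: of_nat_Suc simp del: of_nat_Suc)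
  have "ennreal (mass \<rho> - real (Suc N) * (1 - measure P (few (Suc N)))) \<le> (\<integral>\<^sup>+\<omega>. of_nat N * indicator (few (Suc N)) \<omega> \<partial>P)"
    unfolding few_mass(1)[OF P \<rho>, symmetric] using le by (intro nn_integral_mono) (auto simp: indicator_def)
  also have "\<dots> = ennreal (real N * P.prob (few (Suc N)))"
    by (simp add: nn_integral_cmult_indicator P.emeasure_eq_measure ennreal_mult ennreal_of_nat_eq_real_of_nat)
  finally show ?thesis by (subst (asm) ennreal_le_iff) auto
qed

text \<open>Deleting \<eta>, the part outside radius 2 * R, loses at most
  \<open>B \<rho> \<eta>\<close>, a small multiple of mass \<eta>, but creates free places with a
  probability \<delta> between mass \<eta> / M and mass \<eta>. A configuration with a free place
  holds at most M - 1 particles, whereas the mean field has mass close to M, so a spread-out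
  particle put there gains a fixed fraction of \<delta> * U. For R large this exceeds the loss
  unless mass \<eta> = 0.\<close>

theorem optimizer_support:
  assumes \<rho>: "adm (Suc N) \<rho>" "mass \<rho> = real (Suc N)" "defect (Suc N) \<rho> = 0" and lam: "0 < lam (Suc N)"
    and T: "0 < T" "AE x in lborel. \<rho> x \<le> T"
  obtains R where "AE x in lborel. x \<notin> cball 0 R \<longrightarrow> \<rho> x = 0"
proof -
  note d = adm_dens[OF \<rho>(1)]
  note [measurable] = dens_measurable[OF d]
  define M where "M = real (Suc N)"
  have M: "1 \<le> M" by (simp add: M_def)
  define \<Lambda> where "\<Lambda> = lam (Suc N)"
  have \<Lambda>: "0 < \<Lambda>" using lam by (simp add: \<Lambda>_def)
  define \<zeta> where "\<zeta> = 1 / (4 * (1 + 2 * \<Lambda>))"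
  have \<zeta>: "0 < \<zeta>" "\<zeta> * (1 + 2 * \<Lambda>) = 1 / 4" using \<Lambda> by (auto simp: \<zeta>_def field_simps)
  obtain u U where u: "dens u" "mass u = 1" and U: "0 < U" "\<And>x. (\<integral>\<^sup>+y. ennreal (u y) * k x y \<partial>lborel) \<le> ennreal U"
    and Bu: "(mass \<rho> - \<zeta>) * U \<le> B u \<rho>" and Lu: "(LINT x|lborel. u x * \<rho> x powr q) \<le> \<zeta> * U"
    by (rule exists_spread[OF d \<zeta>(1)]) blast
  \<comment> \<open>The gain is at least \<delta> * U / 4, and mass \<eta> \<le> M * \<delta> turns
    this into \<theta> * mass \<eta>.\<close>
  define \<theta> where "\<theta> = U / (4 * M)"
  have \<theta>: "0 < \<theta>" using U M by (simp add: \<theta>_def)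
  obtain \<epsilon> where \<epsilon>: "0 < \<epsilon>" and \<epsilon>q: "\<And>x. 0 \<le> x \<Longrightarrow> x \<le> \<epsilon> \<Longrightarrow> x powr q \<le> U / (4 * (\<Lambda> * L u + 1))"
  proof -
    have "0 < U / (4 * (\<Lambda> * L u + 1))" using U(1) \<Lambda> L_nonneg[of u] by (simp add: add_nonneg_pos)
    then show thesis by (rule small_powr_q) (rule that)
  qed
  define \<eta>a where "\<eta>a = (\<theta> / (4 * C1 * T powr q)) powr (1 / a)"
  have \<eta>a: "0 < \<eta>a" "C1 * T powr q * \<eta>a powr a = \<theta> / 4"
    using \<theta> C1_pos T q_less by (auto simp: \<eta>a_def powr_powr)
  obtain R0 where R0: "0 < R0" "mass (\<lambda>x. \<rho> x * indicator (- cball 0 R0) x) < min \<epsilon> (min \<eta>a (1/4))"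
    using mass_outside[OF d, of "min \<epsilon> (min \<eta>a (1/4))"] \<epsilon> \<eta>a by auto
  \<comment> \<open>R0 makes the outer mass small; the second bound makes the kernel at distance R,
    multiplied by the total mass M, at most \<theta> / 4.\<close>
  define R where "R = max R0 ((4 * M / \<theta>) powr (1 / s))"
  have R: "0 < R" "R0 \<le> R" using R0 by (auto simp: R_def)
  have Rs: "R powr - s * M \<le> \<theta> / 4"
  proof -
    have "R powr - s \<le> ((4 * M / \<theta>) powr (1 / s)) powr - s"
      using s_pos M \<theta> by (intro powr_mono2') (auto simp: R_def)
    also have "\<dots> = \<theta> / (4 * M)" using s_pos M \<theta> by (simp add: powr_powr powr_minus_divide)
    finally show ?thesis using M by (simp add: field_simps)
  qed
  define \<rho>a where "\<rho>a = (\<lambda>x. \<rho> x * indicator (cball 0 R) x)"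
  define \<rho>b where "\<rho>b = (\<lambda>x. \<rho> x * indicator (- cball 0 R) x)"
  have dab: "dens \<rho>a" "dens \<rho>b" unfolding \<rho>a_def \<rho>b_def by (auto intro: dens_restrict[OF d])
  have mb: "mass \<rho>b \<le> \<epsilon>" "mass \<rho>b \<le> \<eta>a" "mass \<rho>b \<le> 1/4"
  proof -
    have "mass \<rho>b \<le> mass (\<lambda>x. \<rho> x * indicator (- cball 0 R0) x)"
      using dens_nonneg[OF d] R by (intro mass_mono dab dens_restrict[OF d]) (auto simp: \<rho>b_def indicator_def)
    then show "mass \<rho>b \<le> \<epsilon>" "mass \<rho>b \<le> \<eta>a" "mass \<rho>b \<le> 1/4" using R0 by auto
  qed
  define E where "E = cball (0::'a) (2 * R)"
  define \<rho>' where "\<rho>' = (\<lambda>x. \<rho> x * indicator E x)"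
  define \<eta> where "\<eta> = (\<lambda>x. \<rho> x * indicator (- E) x)"
  have E: "E \<in> sets borel" by (simp add: E_def)
  have a': "adm (Suc N) \<rho>'" unfolding \<rho>'_def by (rule adm_restrict[OF \<rho>(1) E])
  have d': "dens \<rho>'" "dens \<eta>" unfolding \<rho>'_def \<eta>_def using E by (auto intro: dens_restrict[OF d])
  note sp = restrict_split[OF d E, folded \<rho>'_def \<eta>_def]
  have m\<eta>b: "mass \<eta> \<le> mass \<rho>b"
    using dens_nonneg[OF d] R by (intro mass_mono dab d') (auto simp: \<rho>b_def \<eta>_def E_def indicator_def)
  have m\<eta>: "0 \<le> mass \<eta>" by (rule mass_nonneg[OF d'(2)])
  have B\<rho>\<eta>: "B \<rho> \<eta> \<le> \<theta> / 2 * mass \<eta>"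
  proof -
    have "B \<rho> \<eta> = B \<rho>a \<eta> + B \<rho>b \<eta>"
      unfolding \<rho>a_def \<rho>b_def by (rule B_split[OF d _ d'(2)]) simp
    moreover have "B \<rho>a \<eta> \<le> R powr - s * mass \<rho>a * mass \<eta>"
    proof (rule B_far[OF dab(1) d'(2) R(1)])
      fix x y assume "\<rho>a x \<noteq> 0" "\<eta> y \<noteq> 0"
      then have "norm x \<le> R" "2 * R < norm y"
        by (auto simp: \<rho>a_def \<eta>_def E_def indicator_def split: if_splits)
      then show "R \<le> dist x y" using norm_triangle_ineq2[of y x] by (simp add: dist_norm norm_minus_commute)
    qed
    moreover have "R powr - s * mass \<rho>a * mass \<eta> \<le> \<theta> / 4 * mass \<eta>"
    proof (rule mult_right_mono[OF _ m\<eta>])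
      have "mass \<rho>a \<le> M" unfolding M_def \<rho>(2)[symmetric]
        using dens_nonneg[OF d] by (intro mass_mono d dab) (auto simp: \<rho>a_def indicator_def)
      then have "R powr - s * mass \<rho>a \<le> R powr - s * M" by (intro mult_left_mono) auto
      then show "R powr - s * mass \<rho>a \<le> \<theta> / 4" using Rs by simp
    qed
    moreover have "B \<rho>b \<eta> \<le> C1 * T powr q * mass \<rho>b powr a * mass \<eta>"
    proof (rule B_bounded_AE[OF dab(2) d'(2)])
      show "AE x in lborel. \<rho>b x \<le> T"
        using T(2) by eventually_elim (use T in \<open>auto simp: \<rho>b_def indicator_def\<close>)
    qed (use T in simp)
    moreover have "C1 * T powr q * mass \<rho>b powr a * mass \<eta> \<le> \<theta> / 4 * mass \<eta>"
      unfolding \<eta>a(2)[symmetric] using mb C1_pos q_less mass_nonneg[OF dab(2)] m\<eta>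
      by (intro mult_right_mono mult_left_mono powr_mono2) auto
    ultimately show ?thesis by argo
  qed
  have key: "mass \<eta> * \<theta> \<le> B \<rho> \<eta> + \<xi>" if \<xi>: "0 < \<xi>" for \<xi>
  proof -
    obtain P where P: "state (Suc N) P \<rho>'" "cost s P \<le> ennreal (W (Suc N) \<rho>' + \<xi>)"
      using W_approx_state[OF a' \<xi>] .
    interpret P: prob_space P using state_prob[OF P(1)] .
    define \<delta> where "\<delta> = P.prob (few (Suc N))"
    have m': "mass \<rho>' = M - mass \<eta>" using sp(1) \<rho>(2) by (simp add: M_def)
    have f1: "M * (1 - \<delta>) \<le> mass \<rho>'" using few_mass(2)[OF P(1) d'(1)] by (simp add: M_def \<delta>_def)
    have f2: "mass \<rho>' - M * (1 - \<delta>) \<le> (M - 1) * \<delta>"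
      using few_mass_le[OF P(1) d'(1)] unfolding M_def \<delta>_def by simp
    have \<delta>lo: "mass \<eta> \<le> M * \<delta>" using f1 by (simp add: m' algebra_simps)
    have \<delta>up: "\<delta> \<le> mass \<eta>" using f2 by (simp add: m' algebra_simps)
    have \<delta>0: "0 \<le> \<delta>" by (simp add: \<delta>_def)
    have W'nn: "0 \<le> W (Suc N) \<rho>'" by (rule W_nonneg[OF a'])
    have ach: "ach (Suc N) (\<lambda>x. \<rho>' x + \<delta> * u x) (W (Suc N) \<rho>' + \<xi> + U * (mass \<rho>' - M * (1 - \<delta>)))"
      unfolding \<delta>_def M_def using P W'nn \<xi> u U d'(1) by (intro ach_insert_few) auto
    have dn: "dens (\<lambda>x. \<rho>' x + \<delta> * u x)" using d'(1) u \<delta>0 by (intro dens_add dens_scale) auto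
    have up: "G (Suc N) (\<lambda>x. \<rho>' x + \<delta> * u x) \<le> \<Lambda> * L \<rho> + 2 * \<Lambda> * \<zeta> * \<delta> * U + \<delta> * U / 4"
    proof -
      have "G (Suc N) (\<lambda>x. \<rho>' x + \<delta> * u x) \<le> \<Lambda> * L (\<lambda>x. \<rho>' x + \<delta> * u x)"
        unfolding \<Lambda>_def by (rule G_le_lam[OF ach_adm[OF ach dn]])
      also have "\<dots> \<le> \<Lambda> * (L \<rho> + 2 * \<delta> * (\<zeta> * U) + \<delta> * (U / (4 * (\<Lambda> * L u + 1))) * L u)"
      proof (intro mult_left_mono)
        have 1: "L \<rho>' \<le> L \<rho>" using dens_nonneg[OF d] by (intro L_mono d d') (auto simp: \<rho>'_def indicator_def)
        have "(LINT x|lborel. u x * \<rho>' x powr q) \<le> (LINT x|lborel. u x * \<rho> x powr q)"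
          using dens_nonneg[OF d] dens_nonneg[OF u(1)] q_pos
          by (intro integral_mono integrable_mult_powr u d d' mult_left_mono powr_mono2) (auto simp: \<rho>'_def indicator_def)
        then have 2: "2 * \<delta> * (LINT x|lborel. u x * \<rho>' x powr q) \<le> 2 * \<delta> * (\<zeta> * U)"
          using Lu \<delta>0 by (intro mult_left_mono) auto
        have "\<delta> powr (1 + q) = \<delta> * \<delta> powr q" using \<delta>0 by (simp add: powr_mult_base)
        also have "\<dots> \<le> \<delta> * (U / (4 * (\<Lambda> * L u + 1)))"
          using \<delta>0 \<delta>up m\<eta>b mb by (intro mult_left_mono \<epsilon>q) auto
        finally have "\<delta> powr (1 + q) * L u \<le> \<delta> * (U / (4 * (\<Lambda> * L u + 1))) * L u"
          by (intro mult_right_mono L_nonneg)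
        then show "L (\<lambda>x. \<rho>' x + \<delta> * u x) \<le> L \<rho> + 2 * \<delta> * (\<zeta> * U) + \<delta> * (U / (4 * (\<Lambda> * L u + 1))) * L u"
          using L_add_le[OF u(1) d'(1) \<delta>0] 1 2 by linarith
      qed (use \<Lambda> in simp)
      also have "\<dots> = \<Lambda> * L \<rho> + 2 * \<Lambda> * \<zeta> * \<delta> * U + \<delta> * U / 4 * (\<Lambda> * L u / (\<Lambda> * L u + 1))"
        by (simp add: distrib_left mult_ac)
      also have "\<dots> \<le> \<Lambda> * L \<rho> + 2 * \<Lambda> * \<zeta> * \<delta> * U + \<delta> * U / 4 * 1"
      proof -
        have "\<Lambda> * L u / (\<Lambda> * L u + 1) \<le> 1"
          using \<Lambda> L_nonneg[of u] by (simp add: divide_le_eq add_nonneg_pos)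
        then show ?thesis using \<delta>0 U by (intro add_left_mono mult_left_mono) auto
      qed
      finally show ?thesis by simp
    qed
    have Bu': "(M - \<zeta> - mass \<eta>) * U \<le> B u \<rho>'"
    proof -
      have "B \<rho> u = B \<rho>' u + B \<eta> u" by (rule sp(3)[OF u(1)])
      then have "B u \<rho> = B u \<rho>' + B u \<eta>" using u d d' by (simp add: B_commute[of u])
      moreover have "B u \<eta> \<le> U * mass \<eta>" using U by (intro B_potential_le u d') auto
      ultimately show ?thesis using Bu \<rho>(2) by (simp add: M_def algebra_simps)
    qed
    have "\<delta> * ((M - \<zeta> - mass \<eta>) * U) \<le> \<delta> * B u \<rho>'" using Bu' \<delta>0 by (intro mult_left_mono)
    then have lo: "B \<rho>' \<rho>' / 2 + \<delta> * ((M - \<zeta> - mass \<eta>) * U) - (W (Suc N) \<rho>' + \<xi> + U * (mass \<rho>' - M * (1 - \<delta>)))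
        \<le> G (Suc N) (\<lambda>x. \<rho>' x + \<delta> * u x)"
      using B_perturb_ge[OF d'(1) u(1) \<delta>0] W_le[OF ach] by (simp add: G_def)
    have "W (Suc N) \<rho>' \<le> W (Suc N) \<rho>" unfolding \<rho>'_def by (rule W_restrict_le[OF \<rho>(1) E])
    moreover have "B \<rho> \<rho> \<le> B \<rho>' \<rho>' + 2 * B \<rho> \<eta>"
      using sp(4) sp(3)[OF d'(2)] B_nonneg[of \<eta> \<eta>] by simp
    moreover have "\<Lambda> * L \<rho> = B \<rho> \<rho> / 2 - W (Suc N) \<rho>" using \<rho>(3) by (simp add: defect_def G_def \<Lambda>_def)
    moreover have "U * (mass \<rho>' - M * (1 - \<delta>)) \<le> U * ((M - 1) * \<delta>)" using f2 U by (intro mult_left_mono) auto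
    ultimately have "\<delta> * ((M - \<zeta> - mass \<eta>) * U) - U * ((M - 1) * \<delta>) - 2 * \<Lambda> * \<zeta> * \<delta> * U - \<delta> * U / 4 \<le> B \<rho> \<eta> + \<xi>"
      using lo up by argo
    moreover have "\<delta> * ((M - \<zeta> - mass \<eta>) * U) - U * ((M - 1) * \<delta>) - 2 * \<Lambda> * \<zeta> * \<delta> * U - \<delta> * U / 4
        = \<delta> * U * (3 / 4 - \<zeta> * (1 + 2 * \<Lambda>) - mass \<eta>)" by (simp add: algebra_simps)
    moreover have "\<delta> * U * (1 / 4) \<le> \<delta> * U * (3 / 4 - \<zeta> * (1 + 2 * \<Lambda>) - mass \<eta>)"
      unfolding \<zeta>(2) using \<delta>0 U m\<eta>b mb by (intro mult_left_mono) auto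
    moreover have "mass \<eta> * \<theta> \<le> \<delta> * U * (1 / 4)"
    proof -
      have "mass \<eta> * \<theta> \<le> M * \<delta> * \<theta>" using \<delta>lo \<theta> by (intro mult_right_mono) auto
      also have "\<dots> = \<delta> * U * (1 / 4)" using M by (simp add: \<theta>_def)
      finally show ?thesis .
    qed
    ultimately show ?thesis by linarith
  qed
  have "mass \<eta> * \<theta> \<le> B \<rho> \<eta>" by (rule field_le_epsilon) (rule key)
  then have "mass \<eta> * \<theta> \<le> mass \<eta> * \<theta> / 2" using B\<rho>\<eta> by (simp add: mult.commute)
  then have "mass \<eta> = 0" using \<theta> m\<eta> by (simp add: mult_le_0_iff)
  then have "AE x in lborel. \<eta> x = 0" using mass_zero_AE[OF d'(2)] by simp
  then have "AE x in lborel. x \<notin> cball 0 (2 * R) \<longrightarrow> \<rho> x = 0"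
    by eventually_elim (auto simp: \<eta>_def E_def indicator_def)
  then show thesis by (rule that)
qed

end

subsection \<open>Strict monotonicity\<close>

text \<open>The essential support S is the complement of all balls on which \<rho> vanishes almost
  everywhere. By Lindelof countably many of them cover their union, so \<rho> vanishes almost
  everywhere off S. S is compact and nonempty, and a coordinate attains its maximum on it at
  y.\<close>

lemma extreme_support_point:
  fixes \<rho> :: "'a::euclidean_space \<Rightarrow> real"
  assumes [measurable]: "\<rho> \<in> borel_measurable borel" and nz: "\<not> (AE x in lborel. \<rho> x = 0)"
    and bdd: "AE x in lborel. x \<notin> cball 0 R \<longrightarrow> \<rho> x = 0"
  obtains y e where "e \<in> Basis" "\<And>\<tau>. 0 < \<tau> \<Longrightarrow> \<not> (AE x in lborel. x \<in> ball y \<tau> \<longrightarrow> \<rho> x = 0)"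
    "AE x in lborel. y \<bullet> e < x \<bullet> e \<longrightarrow> \<rho> x = 0"
proof -
  define \<F> where "\<F> = {ball y \<tau> | y \<tau>. AE x in lborel. x \<in> ball y \<tau> \<longrightarrow> \<rho> x = 0}"
  define S where "S = - \<Union>\<F>"
  have op: "open B" if "B \<in> \<F>" for B using that by (auto simp: \<F>_def)
  obtain \<F>' where \<F>': "\<F>' \<subseteq> \<F>" "countable \<F>'" "\<Union>\<F>' = \<Union>\<F>"
    using Lindelof[OF op] by blast
  have "AE x in lborel. \<forall>B\<in>\<F>'. x \<in> B \<longrightarrow> \<rho> x = 0"
    using \<F>'(1) by (intro AE_ball_countable'[OF _ \<F>'(2)]) (auto simp: \<F>_def)
  then have outside: "AE x in lborel. x \<notin> S \<longrightarrow> \<rho> x = 0"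
    by eventually_elim (use \<F>'(3) in \<open>auto simp: S_def\<close>)
  have supp: "\<not> (AE x in lborel. x \<in> ball y \<tau> \<longrightarrow> \<rho> x = 0)" if y: "y \<in> S" and "0 < \<tau>" for y \<tau>
  proof
    assume "AE x in lborel. x \<in> ball y \<tau> \<longrightarrow> \<rho> x = 0"
    then have "ball y \<tau> \<in> \<F>" unfolding \<F>_def by blast
    moreover have "y \<in> ball y \<tau>" using that by simp
    ultimately show False using y by (auto simp: S_def)
  qed
  have "S \<noteq> {}" using outside nz by auto
  have "closed S" unfolding S_def using op by (simp add: closed_Compl open_Union)
  moreover have "S \<subseteq> cball 0 R"
  proof
    fix y assume y: "y \<in> S"
    show "y \<in> cball 0 R"
    proof (rule ccontr)
      assume "y \<notin> cball 0 R"
      then obtain \<tau> where \<tau>: "0 < \<tau>" "ball y \<tau> \<subseteq> - cball 0 R"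
        using openE[of "- cball (0::'a) R" y] by (auto simp: open_Compl)
      have "AE x in lborel. x \<in> ball y \<tau> \<longrightarrow> \<rho> x = 0"
        using bdd by eventually_elim (use \<tau> in auto)
      then show False using supp[OF y \<tau>(1)] by simp
    qed
  qed
  ultimately have "compact S" using compact_cball compact_Int_closed[of "cball 0 R" S] by (simp add: Int_absorb1)
  obtain e :: 'a where e: "e \<in> Basis" using nonempty_Basis by blast
  have "continuous_on S (\<lambda>x. x \<bullet> e)" by (intro continuous_intros)
  then obtain y where y: "y \<in> S" "\<And>x. x \<in> S \<Longrightarrow> x \<bullet> e \<le> y \<bullet> e"
    using continuous_attains_sup[OF \<open>compact S\<close> \<open>S \<noteq> {}\<close>] by blast
  have "AE x in lborel. y \<bullet> e < x \<bullet> e \<longrightarrow> \<rho> x = 0"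
    using outside by eventually_elim (use y in force)
  with e supp[OF y(1)] show thesis by (intro that)
qed

text \<open>Since m - f has mean 0, the mean of its positive part is half the mean of |m - f|.
  Depending on the side of (a1 + a2) / 2 on which m lies, one of the two events keeps f at distance
  at least 1/2 from m.\<close>

lemma expectation_below_mean_ge:
  fixes f :: "'b \<Rightarrow> real"
  assumes "prob_space P" and f: "integrable P f" and A: "A1 \<in> sets P" "A2 \<in> sets P"
    and a1: "AE x in P. x \<in> A1 \<longrightarrow> f x \<le> a1" and a2: "AE x in P. x \<in> A2 \<longrightarrow> a2 \<le> f x" and gap: "a1 + 1 \<le> a2"
    and b: "b \<le> measure P A1" "b \<le> measure P A2"
  shows "b / 4 \<le> (LINT x|P. max 0 (integral\<^sup>L P f - f x))"
proof -
  interpret prob_space P by fact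
  define m where "m = expectation f"
  have int: "integrable P (\<lambda>x. \<bar>m - f x\<bar>)" "integrable P (\<lambda>x. m - f x)" using f by auto
  have "(LINT x|P. max 0 (m - f x)) = (LINT x|P. (\<bar>m - f x\<bar> + (m - f x)) / 2)"
    by (intro Bochner_Integration.integral_cong) (auto simp: max_def)
  also have "\<dots> = (LINT x|P. \<bar>m - f x\<bar>) / 2"
    using int f by (simp add: m_def prob_space)
  finally have eq: "(LINT x|P. max 0 (m - f x)) = (LINT x|P. \<bar>m - f x\<bar>) / 2" .
  have ge: "b / 2 \<le> (LINT x|P. \<bar>m - f x\<bar>)" if "A \<in> sets P" "b \<le> prob A" "AE x in P. x \<in> A \<longrightarrow> 1 / 2 \<le> \<bar>m - f x\<bar>" for A
  proof -
    have "b / 2 \<le> (LINT x|P. 1 / 2 * indicator A x)" using that by simp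
    also have "\<dots> \<le> (LINT x|P. \<bar>m - f x\<bar>)"
    proof (rule integral_mono_AE)
      show "AE x in P. 1 / 2 * indicator A x \<le> \<bar>m - f x\<bar>"
        using that(3) by eventually_elim (auto simp: indicator_def)
      show "integrable P (\<lambda>x. 1 / 2 * indicator A x :: real)"
        using that(1) by (intro integrable_mult_right) (simp add: less_top[symmetric])
    qed (rule int)
    finally show ?thesis .
  qed
  have "b / 2 \<le> (LINT x|P. \<bar>m - f x\<bar>)"
  proof (cases "(a1 + a2) / 2 \<le> m")
    case True
    have "AE x in P. x \<in> A1 \<longrightarrow> 1 / 2 \<le> \<bar>m - f x\<bar>" using a1 by eventually_elim (use True gap in auto)
    then show ?thesis using ge[OF A(1) b(1)] by blast
  next
    case False
    have "AE x in P. x \<in> A2 \<longrightarrow> 1 / 2 \<le> \<bar>m - f x\<bar>" using a2 by eventually_elim (use False gap in auto)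
    then show ?thesis using ge[OF A(2) b(2)] by blast
  qed
  then show ?thesis using eq by (simp add: m_def)
qed

context riesz_exponent begin

text \<open>Near an extreme point \<open>y0\<close> of the support, the potential generated by a random configuration
  fluctuates: it is large if some particle is very close to \<open>y0\<close> and bounded otherwise. An additional
  particle just outside the support that is present only when this potential is below its mean
  gains energy to first order, at the price of a term of higher order in \<open>L\<close>.\<close>

theorem lam_strict:
  assumes \<rho>: "adm N \<rho>" "mass \<rho> = real N" "0 < N" "defect N \<rho> = 0"
    and T: "0 < T" "AE x in lborel. \<rho> x \<le> T"
    and R: "AE x in lborel. x \<notin> cball 0 R \<longrightarrow> \<rho> x = 0"
  shows "lam N < lam (Suc N)"
proof (rule ccontr)
  assume "\<not> ?thesis"
  \<comment> \<open>With equal constants the enlarged density, realised by N + 1 particles, has to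
    respect the bound for N.\<close>
  then have lameq: "lam (Suc N) = lam N" using lam_mono[of N "Suc N"] by simp
  define \<Lambda> where "\<Lambda> = lam N"
  have \<Lambda>: "0 \<le> \<Lambda>" by (simp add: \<Lambda>_def lam_nonneg)
  note d = adm_dens[OF \<rho>(1)]
  note \<rho>_meas [measurable] = dens_measurable[OF d]
  have "\<not> (AE x in lborel. \<rho> x = 0)" using \<rho>(2,3) mass_zero_AE[OF d] by simp
  then obtain y0 e where e: "e \<in> Basis"
    and supp: "\<And>\<tau>. 0 < \<tau> \<Longrightarrow> \<not> (AE x in lborel. x \<in> ball y0 \<tau> \<longrightarrow> \<rho> x = 0)"
    and beyond: "AE x in lborel. y0 \<bullet> e < x \<bullet> e \<longrightarrow> \<rho> x = 0"
    by (rule extreme_support_point[OF \<rho>_meas _ R]) blast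
  define mb where "mb r = mass (\<lambda>x. \<rho> x * indicator (ball y0 r) x)" for r
  have db: "dens (\<lambda>x. \<rho> x * indicator (ball y0 r) x)" for r by (rule dens_restrict[OF d]) simp
  have mbpos: "0 < mb r" if "0 < r" for r
  proof -
    have "mb r \<noteq> 0"
    proof
      assume "mb r = 0"
      then have "AE x in lborel. \<rho> x * indicator (ball y0 r) x = 0" using mass_zero_AE[OF db] by (simp add: mb_def)
      then have "AE x in lborel. x \<in> ball y0 r \<longrightarrow> \<rho> x = 0"
        by (rule eventually_mono) auto
      then show False using supp[OF that] by simp
    qed
    then show ?thesis using mass_nonneg[OF db, of r] by (simp add: mb_def)
  qed
  have mb_int: "(\<integral>\<^sup>+x. indicator (ball y0 r) x * ennreal (\<rho> x) \<partial>lborel) = ennreal (mb r)" for r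
    unfolding mb_def nn_integral_dens[OF db, symmetric]
    by (intro nn_integral_cong) (auto simp: indicator_def)
  \<comment> \<open>With mass at most 1/2 in the ball of radius r, every state of \<rho> leaves this
    ball empty with probability at least 1/2.\<close>
  obtain r where r: "0 < r" "mb r \<le> 1 / 2"
  proof -
    define V where "V = unit_ball_vol (real DIM('a))"
    have V: "0 < V" by (simp add: V_def)
    define r where "r = min 1 (1 / (2 * T * V))"
    have r: "0 < r" "r \<le> 1" using T V by (auto simp: r_def)
    have "mb r \<le> (LINT x|lborel. T * indicator (ball y0 r) x)"
      unfolding mb_def
    proof (rule integral_mono_AE)
      show "integrable lborel (\<lambda>x. T * indicator (ball y0 r) x)"
        using r by (intro integrable_mult_right) (simp add: integrable_indicator_iff emeasure_ball)
      show "AE x in lborel. \<rho> x * indicator (ball y0 r) x \<le> T * indicator (ball y0 r) x"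
        using T(2) by eventually_elim (auto simp: indicator_def)
    qed (rule dens_integrable[OF db])
    also have "\<dots> = T * (V * r ^ DIM('a))" using r by (simp add: content_ball V_def)
    also have "\<dots> \<le> T * (V * r)"
      using r T V power_decreasing[of 1 "DIM('a)" r] by (intro mult_left_mono) (auto simp: Suc_leI)
    also have "\<dots> \<le> T * (V * (1 / (2 * T * V)))" using T V by (intro mult_left_mono) (auto simp: r_def)
    also have "\<dots> = 1 / 2" using T V by simp
    finally show thesis using that r by blast
  qed
  define a1 where "a1 = real N * (r / 2) powr - s"
  have a1: "0 \<le> a1" by (simp add: a1_def)
  \<comment> \<open>A single particle within \<tau> of y0 creates a potential of at least a2 \<ge>
    a1 + 1, while a1 bounds the potential of N particles that all stay outside the ball of radius
    r.\<close>
  define \<tau> where "\<tau> = min (r / 2) ((a1 + 1) powr (- 1 / s) / 2)"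
  have \<tau>: "0 < \<tau>" "\<tau> \<le> r / 2" using r a1 by (auto simp: \<tau>_def)
  define a2 where "a2 = (2 * \<tau>) powr - s"
  have gap: "a1 + 1 \<le> a2"
  proof -
    have "((a1 + 1) powr (- 1 / s)) powr - s \<le> a2"
      unfolding a2_def using \<tau> s_pos by (intro powr_mono2') (auto simp: \<tau>_def)
    then show ?thesis using s_pos a1 by (simp add: powr_powr)
  qed
  \<comment> \<open>Half ball beyond the supporting hyperplane: open, nonempty, and \<rho> vanishes
    almost everywhere on it, so the linear part in \<open>L_add_le\<close> disappears.\<close>
  define A where "A = ball y0 \<tau> \<inter> {x. y0 \<bullet> e < x \<bullet> e}"
  have opA: "open A" unfolding A_def by (intro open_Int open_ball open_Collect_less continuous_intros)
  have A_meas [measurable]: "A \<in> sets borel" using opA by simp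
  have "y0 + (\<tau> / 2) *\<^sub>R e \<in> A"
    using \<tau> e by (simp add: A_def dist_norm inner_add_left)
  then obtain x1 \<tau>1 where x1: "0 < \<tau>1" "ball x1 \<tau>1 \<subseteq> A" using opA open_contains_ball by blast
  have finA: "emeasure lborel A < \<infinity>"
    using bounded_subset[OF bounded_ball[of y0 \<tau>], of A] by (intro emeasure_bounded_finite) (auto simp: A_def)
  define V where "V = measure lborel A"
  have emA: "emeasure lborel A = ennreal V" using finA by (simp add: V_def emeasure_eq_ennreal_measure less_top)
  have "emeasure lborel (ball x1 \<tau>1) \<le> emeasure lborel A" using x1 by (intro emeasure_mono) auto
  moreover have "0 < emeasure lborel (ball x1 \<tau>1)" using x1 by (simp add: emeasure_ball)
  ultimately have V: "0 < V" unfolding emA by (meson ennreal_less_zero_iff less_le_trans)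
  define u where "u = (\<lambda>x. (1 / V) * indicator A x)"
  have u_meas [measurable]: "u \<in> borel_measurable borel" unfolding u_def by measurable
  have u_nn: "0 \<le> u x" for x using V by (simp add: u_def)
  have u_powr: "u x powr (1 + q) = (1 / V) powr (1 + q) * indicator A x" for x
    by (auto simp: u_def indicator_def)
  have intA: "integrable lborel (indicator A :: 'a \<Rightarrow> real)" using finA by (simp add: integrable_indicator_iff)
  have du: "dens u" unfolding dens_def u_powr using intA u_nn by (auto simp: u_def)
  have mu: "mass u = 1" using V by (simp add: u_def V_def)
  have u\<rho>: "(LINT x|lborel. u x * \<rho> x powr q) = 0"
  proof -
    have "AE x in lborel. u x * \<rho> x powr q = 0"
      using beyond by eventually_elim (auto simp: u_def A_def indicator_def)
    then show ?thesis by (rule integral_eq_zero_AE)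
  qed
  define Upot where "Upot x = (\<integral>\<^sup>+y. ennreal (u y) * k x y \<partial>lborel)" for x
  have Upot_meas [measurable]: "Upot \<in> borel_measurable borel" unfolding Upot_def by measurable
  define Umax where "Umax = C1 * (1 / V) powr q * 1 powr a"
  have Umax: "0 \<le> Umax" "\<And>x. Upot x \<le> ennreal Umax"
  proof -
    show "0 \<le> Umax" using C1_pos by (simp add: Umax_def)
    show "Upot x \<le> ennreal Umax" for x
      unfolding Upot_def Umax_def using V mu nn_integral_dens[OF du]
      by (intro nn_integral_k_bounded) (auto simp: u_def indicator_def intro!: ennreal_leI)
  qed
  have u_int: "(\<integral>\<^sup>+y. ennreal (u y) \<partial>lborel) = 1" using nn_integral_dens[OF du] mu by simp
  have Upot_far: "Upot x \<le> ennreal ((r / 2) powr - s)" if "x \<notin> ball y0 r" for x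
  proof -
    have "Upot x \<le> (\<integral>\<^sup>+y. ennreal (u y) * ennreal ((r / 2) powr - s) \<partial>lborel)"
      unfolding Upot_def
    proof (rule nn_integral_mono)
      fix y
      show "ennreal (u y) * k x y \<le> ennreal (u y) * ennreal ((r / 2) powr - s)"
      proof (cases "y \<in> A")
        case True
        then have "r / 2 \<le> dist x y"
          using that \<tau> dist_triangle[of x y0 y] by (auto simp: A_def dist_commute)
        then show ?thesis using r by (intro mult_left_mono k_le) auto
      qed (simp add: u_def)
    qed
    also have "\<dots> = ennreal ((r / 2) powr - s)" using u_int by (simp add: nn_integral_multc)
    finally show ?thesis .
  qed
  have Upot_near: "ennreal a2 \<le> Upot x" if "x \<in> ball y0 \<tau>" for x
  proof -
    have "ennreal a2 = (\<integral>\<^sup>+y. ennreal (u y) * ennreal a2 \<partial>lborel)" using u_int by (simp add: nn_integral_multc)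
    also have "\<dots> \<le> Upot x"
      unfolding Upot_def
    proof (rule nn_integral_mono)
      fix y
      show "ennreal (u y) * ennreal a2 \<le> ennreal (u y) * k x y"
      proof (cases "y \<in> A")
        case True
        then have "dist x y \<le> 2 * \<tau>"
          using that dist_triangle[of x y y0] by (auto simp: A_def dist_commute)
        then show ?thesis unfolding a2_def by (intro mult_left_mono k_ge) auto
      qed (simp add: u_def)
    qed
    finally show ?thesis .
  qed
  \<comment> \<open>Lower bound for the probabilities of both events under every state of \<rho>, so
    that \<epsilon> and \<xi> can be chosen before P. As at most N particles are present, the mass
    \<open>mb \<tau>\<close> near y0 is met with probability at least \<open>mb \<tau>\<close> /
    N.\<close>
  define b where "b = min (1 / 2) (mb \<tau> / real N)"
  have b: "0 < b" using mbpos[OF \<tau>(1)] \<rho>(3) by (simp add: b_def)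
  define \<beta> where "\<beta> = b / 4"
  have \<beta>: "0 < \<beta>" using b by (simp add: \<beta>_def)
  obtain \<epsilon> where \<epsilon>: "0 < \<epsilon>" "\<epsilon> \<le> 1" and \<epsilon>q: "\<And>x. 0 \<le> x \<Longrightarrow> x \<le> \<epsilon> \<Longrightarrow> x powr q \<le> \<beta> / (4 * (\<Lambda> * L u + 1))"
  proof -
    have "0 < \<beta> / (4 * (\<Lambda> * L u + 1))" using \<beta> \<Lambda> L_nonneg[of u] by (simp add: add_nonneg_pos)
    then show thesis by (rule small_powr_q) (rule that)
  qed
  define \<xi> where "\<xi> = \<epsilon> * \<beta> / 4"
  have \<xi>: "0 < \<xi>" using \<epsilon> \<beta> by (simp add: \<xi>_def)
  obtain P where P: "state N P \<rho>" "cost s P \<le> ennreal (W N \<rho> + \<xi>)"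
    using W_approx_state[OF \<rho>(1) \<xi>] .
  interpret P: prob_space P using state_prob[OF P(1)] .
  note [measurable_cong] = state_sets[OF P(1)]
  have sp: "space P = space slots" using state_sets[OF P(1)] by (rule sets_eq_imp_space_eq)
  define f where "f \<omega> = enn2real (psum Upot \<omega>)" for \<omega>
  have f_AE: "AE \<omega> in P. psum Upot \<omega> = ennreal (f \<omega>) \<and> f \<omega> \<le> Umax * real N"
    using state_count[OF P(1)]
  proof eventually_elim
    fix \<omega> :: "nat \<Rightarrow> 'a \<times> bool" assume c: "psum (\<lambda>_. 1) \<omega> \<le> of_nat N"
    have "psum Upot \<omega> \<le> psum (\<lambda>x. ennreal Umax * 1) \<omega>" using Umax by (intro psum_mono) simp
    also have "\<dots> = ennreal Umax * psum (\<lambda>_. 1) \<omega>" by (rule psum_cmult)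
    also have "\<dots> \<le> ennreal Umax * of_nat N" using c by (intro mult_left_mono) auto
    also have "\<dots> = ennreal (Umax * real N)" using Umax by (simp add: ennreal_mult ennreal_of_nat_eq_real_of_nat)
    finally have le: "psum Upot \<omega> \<le> ennreal (Umax * real N)" .
    then have "psum Upot \<omega> < \<infinity>" by (auto simp: less_top[symmetric] top_unique)
    moreover have "f \<omega> \<le> Umax * real N" unfolding f_def using le Umax by (intro enn2real_leI) auto
    ultimately show "psum Upot \<omega> = ennreal (f \<omega>) \<and> f \<omega> \<le> Umax * real N" by (simp add: f_def)
  qed
  have f_meas [measurable]: "f \<in> borel_measurable P" unfolding f_def by measurable
  have f_int: "integrable P f"
    by (rule P.integrable_const_bound[where B = "Umax * real N"])
      (use f_AE in \<open>auto elim!: eventually_mono simp: f_def\<close>)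
  define m where "m = P.expectation f"
  have m: "m = B u \<rho>"
  proof -
    have "ennreal m = (\<integral>\<^sup>+\<omega>. ennreal (f \<omega>) \<partial>P)"
      unfolding m_def using f_int by (subst nn_integral_eq_integral) (auto simp: f_def)
    also have "\<dots> = (\<integral>\<^sup>+\<omega>. psum Upot \<omega> \<partial>P)"
      using f_AE by (intro nn_integral_cong_AE) (auto elim!: eventually_mono)
    also have "\<dots> = bform \<rho> u"
      by (subst state_density[OF P(1)]) (auto simp: bform_potential d du Upot_def mult.commute)
    finally have "ennreal m = ennreal (B \<rho> u)" by (simp add: bform_eq d du)
    moreover have "0 \<le> m" unfolding m_def by (intro Bochner_Integration.integral_nonneg) (simp add: f_def)
    ultimately show ?thesis using B_nonneg by (simp add: B_commute[OF du d])
  qed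
  define X1 where "X1 = {\<omega> \<in> space P. psum (indicator (ball y0 r)) \<omega> = 0}"
  define X2 where "X2 = {\<omega> \<in> space P. psum (indicator (ball y0 \<tau>)) \<omega> \<noteq> 0}"
  have X_meas [measurable]: "X1 \<in> sets P" "X2 \<in> sets P" unfolding X1_def X2_def by measurable
  have ind_ge: "1 \<le> psum (indicator (ball y0 r)) \<omega>" if nz: "psum (indicator (ball y0 r)) \<omega> \<noteq> 0" for \<omega> :: "nat \<Rightarrow> 'a \<times> bool" and r
  proof -
    obtain i where "snd (\<omega> i)" "fst (\<omega> i) \<in> ball y0 r"
      using nz unfolding psum_eq_0_iff by (auto simp: indicator_def split: if_splits)
    then show ?thesis using psum_ge[of \<omega> i "indicator (ball y0 r)"] by simp
  qed
  have PX1: "1 / 2 \<le> P.prob X1"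
  proof -
    have "ennreal (P.prob (space P - X1)) = (\<integral>\<^sup>+\<omega>. indicator (space P - X1) \<omega> \<partial>P)"
      by (simp add: P.emeasure_eq_measure)
    also have "\<dots> \<le> (\<integral>\<^sup>+\<omega>. psum (indicator (ball y0 r)) \<omega> \<partial>P)"
      by (intro nn_integral_mono) (auto simp: X1_def indicator_def intro: ind_ge)
    also have "\<dots> = ennreal (mb r)" by (subst state_density[OF P(1)]) (auto simp: mb_int)
    finally have "P.prob (space P - X1) \<le> mb r" using mbpos[OF r(1)] by simp
    then show ?thesis using P.prob_compl[OF X_meas(1)] r(2) by simp
  qed
  have PX2: "mb \<tau> / real N \<le> P.prob X2"
  proof -
    have "ennreal (mb \<tau>) = (\<integral>\<^sup>+\<omega>. psum (indicator (ball y0 \<tau>)) \<omega> \<partial>P)"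
      by (subst state_density[OF P(1)]) (auto simp: mb_int)
    also have "\<dots> \<le> (\<integral>\<^sup>+\<omega>. of_nat N * indicator X2 \<omega> \<partial>P)"
    proof (rule nn_integral_mono_AE)
      show "AE \<omega> in P. psum (indicator (ball y0 \<tau>)) \<omega> \<le> of_nat N * indicator X2 \<omega>"
        using state_count[OF P(1)] AE_space
      proof eventually_elim
        fix \<omega> assume c: "psum (\<lambda>_. 1) \<omega> \<le> of_nat N" and "\<omega> \<in> space P"
        have "psum (indicator (ball y0 \<tau>)) \<omega> \<le> psum (\<lambda>_. 1) \<omega>" by (intro psum_mono) (simp add: indicator_def)
        also note c
        finally show "psum (indicator (ball y0 \<tau>)) \<omega> \<le> of_nat N * indicator X2 \<omega>"
          using \<open>\<omega> \<in> space P\<close> by (cases "psum (indicator (ball y0 \<tau>)) \<omega> = 0") (auto simp: X2_def)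
      qed
    qed
    also have "\<dots> = ennreal (real N * P.prob X2)"
      by (simp add: nn_integral_cmult_indicator P.emeasure_eq_measure ennreal_mult ennreal_of_nat_eq_real_of_nat)
    finally have "mb \<tau> \<le> real N * P.prob X2" by (subst (asm) ennreal_le_iff) auto
    then show ?thesis using \<rho>(3) by (simp add: field_simps)
  qed
  have J: "\<beta> \<le> (LINT \<omega>|P. max 0 (m - f \<omega>))"
    unfolding m_def \<beta>_def
  proof (rule expectation_below_mean_ge[OF P.prob_space_axioms f_int X_meas _ _ gap])
    show "AE \<omega> in P. \<omega> \<in> X1 \<longrightarrow> f \<omega> \<le> a1"
      using state_count[OF P(1)]
    proof eventually_elim
      fix \<omega> :: "nat \<Rightarrow> 'a \<times> bool" assume c: "psum (\<lambda>_. 1) \<omega> \<le> of_nat N"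
      show "\<omega> \<in> X1 \<longrightarrow> f \<omega> \<le> a1"
      proof
        assume "\<omega> \<in> X1"
        then have out: "snd (\<omega> i) \<Longrightarrow> fst (\<omega> i) \<notin> ball y0 r" for i
          unfolding X1_def psum_eq_0_iff by (auto simp: indicator_def split: if_splits)
        have "psum Upot \<omega> \<le> psum (\<lambda>x. ennreal ((r / 2) powr - s) * 1) \<omega>"
          unfolding psum_def using Upot_far[OF out] by (intro suminf_le) auto
        also have "\<dots> = ennreal ((r / 2) powr - s) * psum (\<lambda>_. 1) \<omega>" by (rule psum_cmult)
        also have "\<dots> \<le> ennreal ((r / 2) powr - s) * of_nat N" using c by (intro mult_left_mono) auto
        also have "\<dots> = ennreal a1" by (simp add: a1_def ennreal_mult ennreal_of_nat_eq_real_of_nat mult.commute)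
        finally show "f \<omega> \<le> a1" unfolding f_def using a1 by (intro enn2real_leI)
      qed
    qed
    show "AE \<omega> in P. \<omega> \<in> X2 \<longrightarrow> a2 \<le> f \<omega>"
      using f_AE
    proof eventually_elim
      fix \<omega> assume fin: "psum Upot \<omega> = ennreal (f \<omega>) \<and> f \<omega> \<le> Umax * real N"
      show "\<omega> \<in> X2 \<longrightarrow> a2 \<le> f \<omega>"
      proof
        assume "\<omega> \<in> X2"
        then obtain i where i: "snd (\<omega> i)" "fst (\<omega> i) \<in> ball y0 \<tau>"
          unfolding X2_def psum_eq_0_iff by (auto simp: indicator_def split: if_splits)
        have "ennreal a2 \<le> ennreal (f \<omega>)"
          using Upot_near[OF i(2)] psum_ge[of \<omega> i Upot, OF i(1)] fin by (auto intro: order_trans)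
        then show "a2 \<le> f \<omega>" by (subst (asm) ennreal_le_iff) (auto simp: f_def)
      qed
    qed
    show "b \<le> P.prob X1" "b \<le> P.prob X2" using PX1 PX2 by (auto simp: b_def)
  qed
  \<comment> \<open>On this event the potential is below its mean, so the gain
    \<open>\<gamma> * m - F\<close> equals the mean of the whole positive part of m - f.\<close>
  define Gset where "Gset = {\<omega> \<in> space P. f \<omega> < m}"
  have Gset [measurable]: "Gset \<in> sets P" unfolding Gset_def by measurable
  then have Gset' [measurable]: "Gset \<in> sets slots" using state_sets[OF P(1)] by simp
  define \<gamma> where "\<gamma> = P.prob Gset"
  have \<gamma>: "0 \<le> \<gamma>" "\<gamma> \<le> 1" by (auto simp: \<gamma>_def)
  define F where "F = (LINT \<omega>|P. f \<omega> * indicator Gset \<omega>)"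
  have intF: "integrable P (\<lambda>\<omega>. f \<omega> * indicator Gset \<omega>)" by (intro integrable_real_mult_indicator Gset f_int)
  have F0: "0 \<le> F" unfolding F_def by (intro Bochner_Integration.integral_nonneg) (simp add: f_def)
  have JF: "\<gamma> * m - F = (LINT \<omega>|P. max 0 (m - f \<omega>))"
  proof -
    have "(LINT \<omega>|P. max 0 (m - f \<omega>)) = (LINT \<omega>|P. m * indicator Gset \<omega> - f \<omega> * indicator Gset \<omega>)"
      by (intro Bochner_Integration.integral_cong) (auto simp: Gset_def indicator_def max_def)
    also have "\<dots> = \<gamma> * m - F" unfolding F_def \<gamma>_def
      using intF Gset by (subst Bochner_Integration.integral_diff) (auto simp: less_top[symmetric])
    finally show ?thesis by simp
  qed
  have ach1: "ach (Suc N) (\<lambda>x. \<rho> x + \<gamma> * u x) (W N \<rho> + \<xi> + F)"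
  proof -
    have "AE \<omega> in P. psum (\<lambda>_. 1) \<omega> + indicator Gset \<omega> \<le> of_nat (Suc N)"
      using state_count[OF P(1)]
      by eventually_elim (auto simp: indicator_def add.commute intro: add_left_mono order_trans)
    then obtain Q where Q: "state (Suc N) Q (\<lambda>x. \<rho> x + \<gamma> * u x)"
      "cost s Q = cost s P + (\<integral>\<^sup>+\<omega>. psum Upot \<omega> * indicator Gset \<omega> \<partial>P)"
      using state_insert[OF P(1) u_meas \<rho>_meas Gset', of "Suc N" s] u_nn u_int dens_nonneg[OF d]
      by (auto simp: \<gamma>_def Upot_def[abs_def])
    have "(\<integral>\<^sup>+\<omega>. psum Upot \<omega> * indicator Gset \<omega> \<partial>P) = (\<integral>\<^sup>+\<omega>. ennreal (f \<omega> * indicator Gset \<omega>) \<partial>P)"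
      using f_AE by (intro nn_integral_cong_AE) (auto elim!: eventually_mono simp: indicator_def)
    also have "\<dots> = ennreal F"
      unfolding F_def using intF by (intro nn_integral_eq_integral) (auto simp: f_def)
    finally have "cost s Q \<le> ennreal (W N \<rho> + \<xi>) + ennreal F"
      unfolding Q(2) using P(2) by (simp add: add_right_mono)
    also have "\<dots> = ennreal (W N \<rho> + \<xi> + F)" using W_nonneg[OF \<rho>(1)] \<xi> F0 by simp
    finally show ?thesis using Q(1) W_nonneg[OF \<rho>(1)] \<xi> F0 by (auto simp: ach_def)
  qed
  have ach0: "ach (Suc N) \<rho> (W N \<rho> + \<xi>)"
    using P W_nonneg[OF \<rho>(1)] \<xi> state_le[of N P \<rho> "Suc N"] by (auto simp: ach_def)
  define t where "t = \<epsilon> * \<gamma>"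
  have t: "0 \<le> t" "t \<le> \<epsilon>" using \<epsilon> \<gamma> by (auto simp: t_def mult_left_le)
  have "ach (Suc N) (\<lambda>x. (1 - \<epsilon>) * \<rho> x + \<epsilon> * (\<rho> x + \<gamma> * u x)) ((1 - \<epsilon>) * (W N \<rho> + \<xi>) + \<epsilon> * (W N \<rho> + \<xi> + F))"
    using \<epsilon> d du \<gamma> by (intro ach_mix ach0 ach1) (auto intro!: dens_add dens_scale)
  also have "(\<lambda>x. (1 - \<epsilon>) * \<rho> x + \<epsilon> * (\<rho> x + \<gamma> * u x)) = (\<lambda>x. \<rho> x + t * u x)"
    by (auto simp: t_def algebra_simps)
  also have "(1 - \<epsilon>) * (W N \<rho> + \<xi>) + \<epsilon> * (W N \<rho> + \<xi> + F) = W N \<rho> + \<xi> + \<epsilon> * F" by (simp add: algebra_simps)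
  finally have ach: "ach (Suc N) (\<lambda>x. \<rho> x + t * u x) (W N \<rho> + \<xi> + \<epsilon> * F)" .
  have dn: "dens (\<lambda>x. \<rho> x + t * u x)" using d du t by (intro dens_add dens_scale) auto
  have "G (Suc N) (\<lambda>x. \<rho> x + t * u x) \<le> \<Lambda> * L (\<lambda>x. \<rho> x + t * u x)"
    unfolding \<Lambda>_def lameq[symmetric] by (rule G_le_lam[OF ach_adm[OF ach dn]])
  also have "\<dots> \<le> \<Lambda> * (L \<rho> + \<epsilon> * (\<beta> / (4 * (\<Lambda> * L u + 1))) * L u)"
  proof (intro mult_left_mono \<Lambda>)
    have "t powr (1 + q) = t * t powr q" using t by (simp add: powr_mult_base)
    also have "\<dots> \<le> \<epsilon> * (\<beta> / (4 * (\<Lambda> * L u + 1)))" using t \<epsilon>q[OF t] \<epsilon> by (intro mult_mono) auto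
    finally have "t powr (1 + q) * L u \<le> \<epsilon> * (\<beta> / (4 * (\<Lambda> * L u + 1))) * L u" by (intro mult_right_mono L_nonneg)
    then show "L (\<lambda>x. \<rho> x + t * u x) \<le> L \<rho> + \<epsilon> * (\<beta> / (4 * (\<Lambda> * L u + 1))) * L u"
      using L_add_le[OF du d t(1)] u\<rho> by simp
  qed
  also have "\<dots> = \<Lambda> * L \<rho> + \<epsilon> * \<beta> / 4 * (\<Lambda> * L u / (\<Lambda> * L u + 1))"
    by (simp add: distrib_left mult_ac)
  also have "\<dots> \<le> \<Lambda> * L \<rho> + \<epsilon> * \<beta> / 4 * 1"
  proof -
    have "\<Lambda> * L u / (\<Lambda> * L u + 1) \<le> 1"
      using \<Lambda> L_nonneg[of u] by (simp add: divide_le_eq add_nonneg_pos)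
    then show ?thesis using \<epsilon> \<beta> by (intro add_left_mono mult_left_mono) auto
  qed
  finally have up: "G (Suc N) (\<lambda>x. \<rho> x + t * u x) \<le> \<Lambda> * L \<rho> + \<epsilon> * \<beta> / 4" by simp
  have "B \<rho> \<rho> / 2 + t * m - (W N \<rho> + \<xi> + \<epsilon> * F) \<le> G (Suc N) (\<lambda>x. \<rho> x + t * u x)"
    using B_perturb_ge[OF d du t(1)] W_le[OF ach] by (simp add: G_def m)
  moreover have "\<Lambda> * L \<rho> = B \<rho> \<rho> / 2 - W N \<rho>" using \<rho>(4) by (simp add: defect_def G_def \<Lambda>_def)
  moreover have "t * m - \<epsilon> * F = \<epsilon> * (\<gamma> * m - F)" by (simp add: t_def algebra_simps)
  moreover have "\<epsilon> * \<beta> \<le> \<epsilon> * (\<gamma> * m - F)" using J \<epsilon> unfolding JF by (intro mult_left_mono) auto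
  moreover have "0 < \<epsilon> * \<beta>" using \<epsilon> \<beta> by simp
  ultimately show False using up unfolding \<xi>_def by linarith
qed

end

subsection \<open>Comparison with symmetric probability measures\<close>

lemma pair_sum_double:
  fixes g :: "nat \<Rightarrow> nat \<Rightarrow> ennreal"
  assumes "finite A" and sym: "\<And>i j. g i j = g j i"
  shows "(\<Sum>j\<in>A. \<Sum>i\<in>A - {j}. g i j) = 2 * (\<Sum>j\<in>A. \<Sum>i\<in>{i\<in>A. i < j}. g i j)"
proof -
  have "(\<Sum>j\<in>A. \<Sum>i\<in>A - {j}. g i j) = (\<Sum>j\<in>A. (\<Sum>i\<in>{i\<in>A. i < j}. g i j) + (\<Sum>i\<in>{i\<in>A. j < i}. g i j))"
    using assms(1) by (intro sum.cong refl, subst sum.union_disjoint[symmetric]) (auto intro!: sum.cong)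
  also have "\<dots> = (\<Sum>j\<in>A. \<Sum>i\<in>{i\<in>A. i < j}. g i j) + (\<Sum>j\<in>A. \<Sum>i\<in>{i\<in>A. j < i}. g i j)"
    by (rule sum.distrib)
  also have "(\<Sum>j\<in>A. \<Sum>i\<in>{i\<in>A. j < i}. g i j) = (\<Sum>i\<in>A. \<Sum>j\<in>{j\<in>A. j < i}. g i j)"
    by (rule sum.swap_restrict) (use assms(1) in auto)
  also have "\<dots> = (\<Sum>j\<in>A. \<Sum>i\<in>{i\<in>A. i < j}. g i j)"
    by (simp only: sym)
  finally show ?thesis by (simp add: mult_2)
qed

text \<open>The bijection need not respect the order of indices, so the sum over i < j is doubled to
  one over all ordered pairs of distinct indices, which every bijection preserves.\<close>

lemma pair_sum_reindex:
  fixes g :: "nat \<Rightarrow> nat \<Rightarrow> ennreal" and A B :: "nat set"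
  assumes A: "finite A" and f: "bij_betw f A B" and sym: "\<And>i j. g i j = g j i"
  shows "(\<Sum>j\<in>A. \<Sum>i\<in>{i\<in>A. i < j}. g (f i) (f j)) = (\<Sum>j\<in>B. \<Sum>i\<in>{i\<in>B. i < j}. g i j)"
proof -
  have "2 * (\<Sum>j\<in>A. \<Sum>i\<in>{i\<in>A. i < j}. g (f i) (f j)) = (\<Sum>j\<in>A. \<Sum>i\<in>A - {j}. g (f i) (f j))"
    by (rule pair_sum_double[symmetric, OF A]) (rule sym)
  also have "\<dots> = (\<Sum>j\<in>A. \<Sum>i\<in>B - {f j}. g i (f j))"
  proof (rule sum.cong[OF refl])
    fix j assume j: "j \<in> A"
    have "bij_betw f (A - {j}) (B - {f j})"
      using f j by (intro bij_betw_DiffI) (auto simp: bij_betw_def)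
    then show "(\<Sum>i\<in>A - {j}. g (f i) (f j)) = (\<Sum>i\<in>B - {f j}. g i (f j))"
      by (rule sum.reindex_bij_betw)
  qed
  also have "\<dots> = (\<Sum>j\<in>B. \<Sum>i\<in>B - {j}. g i j)"
    using sum.reindex_bij_betw[OF f, of "\<lambda>j. \<Sum>i\<in>B - {j}. g i j"] .
  also have "\<dots> = 2 * (\<Sum>j\<in>B. \<Sum>i\<in>{i\<in>B. i < j}. g i j)"
    using A f bij_betw_finite by (intro pair_sum_double sym) auto
  finally show ?thesis by (simp add: ennreal_mult_cancel_left)
qed

lemma lessThan_less: "j < N \<Longrightarrow> {i \<in> {..<N}. i < j} = {..<j::nat}"
  by auto

definition penergy :: "real \<Rightarrow> nat \<Rightarrow> (nat \<Rightarrow> 'a::euclidean_space) \<Rightarrow> ennreal" where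
  "penergy s N x = (\<Sum>j<N. \<Sum>i<j. riesz_kernel s (x i) (x j))"

lemma penergy_eq: "penergy s N x = (\<Sum>j\<in>{..<N}. \<Sum>i\<in>{i\<in>{..<N}. i < j}. riesz_kernel s (x i) (x j))"
  unfolding penergy_def by (intro sum.cong refl) (auto simp: lessThan_less)

lemma penergy_reindex:
  fixes A :: "nat set" and x :: "nat \<Rightarrow> 'a::euclidean_space"
  assumes "bij_betw f {..<N} A"
  shows "penergy s N (\<lambda>i. x (f i)) = (\<Sum>j\<in>A. \<Sum>i\<in>{i\<in>A. i < j}. riesz_kernel s (x i) (x j))"
  unfolding penergy_eq
  by (rule pair_sum_reindex[of _ f A "\<lambda>i j. riesz_kernel s (x i) (x j)"])
    (use assms in \<open>auto simp: riesz_kernel_commute\<close>)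

lemma psum_finite:
  "finite {i. snd (\<omega> i)} \<Longrightarrow> psum f \<omega> = (\<Sum>i\<in>{i. snd (\<omega> i)}. f (fst (\<omega> i)))"
  unfolding psum_def by (subst suminf_finite[of "{i. snd (\<omega> i)}"]) (auto intro!: sum.cong)

lemma pcost_finite:
  assumes fin: "finite {i. snd (\<omega> i)}"
  shows "pcost s \<omega> = (\<Sum>j\<in>{i. snd (\<omega> i)}. \<Sum>i\<in>{i\<in>{i. snd (\<omega> i)}. i < j}.
    riesz_kernel s (fst (\<omega> i)) (fst (\<omega> j)))"
proof -
  have "(\<Sum>i<j. if snd (\<omega> i) \<and> snd (\<omega> j) then riesz_kernel s (fst (\<omega> i)) (fst (\<omega> j)) else 0)
     = (\<Sum>i\<in>{i\<in>{i. snd (\<omega> i)}. i < j}. riesz_kernel s (fst (\<omega> i)) (fst (\<omega> j)))" if "snd (\<omega> j)" for j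
    using that by (intro sum.mono_neutral_cong_right) auto
  moreover have "pcost s \<omega> = (\<Sum>j\<in>{i. snd (\<omega> i)}. \<Sum>i<j.
      if snd (\<omega> i) \<and> snd (\<omega> j) then riesz_kernel s (fst (\<omega> i)) (fst (\<omega> j)) else 0)"
    unfolding pcost_def by (rule suminf_finite[OF fin]) auto
  ultimately show ?thesis by simp
qed

lemma measurable_component_config:
  assumes "sets P = sets (config_space N)" "i < N" shows "(\<lambda>x. x i) \<in> borel_measurable P"
  using measurable_component_singleton[of i "{..<N}" "\<lambda>_. borel"] assms
  by (simp cong: measurable_cong_sets)

lemma penergy_measurable:
  assumes P: "sets P = sets (config_space N)"
  shows "penergy s N \<in> borel_measurable P"
  unfolding penergy_def
  by (intro borel_measurable_sum riesz_kernel_measurable measurable_component_config[OF P]) auto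

lemma interaction_energy_eq: "interaction_energy s N P = (\<integral>\<^sup>+x. penergy s N x \<partial>P)"
  by (simp add: interaction_energy_def penergy_def)

lemma emeasure_one_body':
  assumes P: "sets P = sets (config_space N)" and A: "A \<in> sets borel"
  shows "emeasure (one_body N P) A = (\<Sum>i<N. \<integral>\<^sup>+x. indicator A (x i) \<partial>P)"
proof -
  have "emeasure (distr P borel (\<lambda>x. x i)) A = (\<integral>\<^sup>+x. indicator A (x i) \<partial>P)" if "i < N" for i
    using A nn_integral_distr[OF measurable_component_config[OF P that], of "indicator A"]
    by simp
  then show ?thesis using A by (simp add: emeasure_one_body)
qed

text \<open>The one-body measure is the image of counting measure on the labels times P under the
  evaluation (i, x) to x i; the formula for integrands is then a change of variables followed by
  Fubini.\<close>

lemma nn_integral_one_body: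
  fixes P :: "(nat \<Rightarrow> 'a::euclidean_space) measure"
  assumes P: "prob_space P" "sets P = sets (config_space N)" and f: "f \<in> borel_measurable borel"
  shows "(\<integral>\<^sup>+y. f y \<partial>one_body N P) = (\<integral>\<^sup>+x. (\<Sum>i<N. f (x i)) \<partial>P)"
proof -
  interpret prob_space P by fact
  note m = measurable_component_config[OF P(2)]
  let ?M = "count_space {..<N} \<Otimes>\<^sub>M P"
  have g: "(\<lambda>(i, x). x i) \<in> borel_measurable ?M"
    by (rule measurable_pair_measure_countable1) (auto intro: m)
  have int: "(\<integral>\<^sup>+y. f y \<partial>distr ?M borel (\<lambda>(i, x). x i)) = (\<Sum>i<N. \<integral>\<^sup>+x. f (x i) \<partial>P)"
    if f: "f \<in> borel_measurable borel" for f :: "'a \<Rightarrow> ennreal"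
  proof -
    have "(\<integral>\<^sup>+y. f y \<partial>distr ?M borel (\<lambda>(i, x). x i)) = (\<integral>\<^sup>+z. f (case z of (i, x) \<Rightarrow> x i) \<partial>?M)"
      by (rule nn_integral_distr[OF g]) (use f in simp)
    also have "\<dots> = (\<integral>\<^sup>+i. \<integral>\<^sup>+x. f (x i) \<partial>P \<partial>count_space {..<N})"
      by (subst nn_integral_fst[symmetric]) (use measurable_compose[OF g f] in auto)
    finally show ?thesis by (simp add: nn_integral_count_space_finite)
  qed
  have "one_body N P = distr ?M borel (\<lambda>(i, x). x i)"
  proof (rule measure_eqI)
    fix A assume "A \<in> sets (one_body N P)"
    then have A: "A \<in> sets borel" by simp
    have "emeasure (distr ?M borel (\<lambda>(i, x). x i)) A = (\<integral>\<^sup>+y. indicator A y \<partial>distr ?M borel (\<lambda>(i, x). x i))"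
      using A by simp
    also have "\<dots> = emeasure (one_body N P) A"
      using A emeasure_one_body'[OF P(2) A] by (subst int) auto
    finally show "emeasure (one_body N P) A = emeasure (distr ?M borel (\<lambda>(i, x). x i)) A" ..
  qed simp
  then show ?thesis using f measurable_compose[OF m f]
    by (subst nn_integral_sum) (auto simp: int)
qed

lemma state_of_symmetric_prob:
  assumes P: "symmetric_prob N P" "one_body N P = density lborel (\<lambda>x. ennreal (\<rho> x))"
    and [measurable]: "\<rho> \<in> borel_measurable borel"
  obtains Q where "state N Q \<rho>" "cost s Q = interaction_energy s N P"
proof -
  have pr: "prob_space P" and se: "sets P = sets (config_space N)" using P(1) by (auto simp: symmetric_prob_def)
  interpret prob_space P by fact
  \<comment> \<open>The N particles occupy the first N slots; (0, False) is a dummy entry for an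
    empty slot.\<close>
  define h :: "(nat \<Rightarrow> 'a) \<Rightarrow> nat \<Rightarrow> 'a \<times> bool" where "h x = (\<lambda>i. if i < N then (x i, True) else (0, False))" for x
  have h: "h \<in> measurable P slots"
  proof (rule measurable_slots)
    fix i
    have "(\<lambda>x. (x i, True)) \<in> measurable P (borel \<Otimes>\<^sub>M count_space UNIV)" if "i < N"
      by (intro measurable_Pair measurable_component_config[OF se that]) auto
    moreover have "(\<lambda>x. (0, False)) \<in> measurable P (borel \<Otimes>\<^sub>M count_space UNIV)" by (simp add: space_pair_measure)
    ultimately show "(\<lambda>x. h x i) \<in> measurable P (borel \<Otimes>\<^sub>M count_space UNIV)"
      by (cases "i < N") (simp_all add: h_def)
  qed
  have alive: "{i. snd (h x i)} = {..<N}" for x by (auto simp: h_def)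
  have ps: "psum f (h x) = (\<Sum>i<N. f (x i))" for f x
    by (subst psum_finite) (auto simp: alive, auto simp: h_def)
  have pc: "pcost s (h x) = penergy s N x" for x
    unfolding penergy_eq by (subst pcost_finite) (auto simp: alive lessThan_less h_def intro!: sum.cong)
  have "state N (distr P slots h) \<rho>"
  proof (rule state_distr[OF pr h])
    show "AE x in P. psum (\<lambda>_. 1) (h x) \<le> of_nat N" by (simp add: ps)
    fix f :: "'a \<Rightarrow> ennreal" assume [measurable]: "f \<in> borel_measurable borel"
    have "(\<integral>\<^sup>+x. psum f (h x) \<partial>P) = (\<integral>\<^sup>+y. f y \<partial>one_body N P)"
      by (simp add: ps nn_integral_one_body[OF pr se])
    also have "\<dots> = (\<integral>\<^sup>+x. ennreal (\<rho> x) * f x \<partial>lborel)"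
      unfolding P(2) by (rule nn_integral_density) auto
    finally show "(\<integral>\<^sup>+x. psum f (h x) \<partial>P) = (\<integral>\<^sup>+x. f x * ennreal (\<rho> x) \<partial>lborel)"
      by (simp add: mult.commute)
  qed
  moreover have "cost s (distr P slots h) = interaction_energy s N P"
    by (simp add: cost_distr[OF h] pc interaction_energy_eq)
  ultimately show thesis by (rule that)
qed

text \<open>Relabelling by an independent, uniformly distributed permutation: one-body measure and
  pair energy do not depend on the labels, and composing with a fixed permutation only reorders the
  average.\<close>

lemma symmetrize:
  fixes P :: "(nat \<Rightarrow> 'a::euclidean_space) measure"
  assumes P: "prob_space P" "sets P = sets (config_space N)"
  obtains Q where "symmetric_prob N Q" "one_body N Q = one_body N P" "interaction_energy s N Q = interaction_energy s N P"
proof -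
  let ?S = "{\<sigma>. \<sigma> permutes {..<N}}"
  define p where "p = uniform_count_measure ?S"
  have S: "finite ?S" "?S \<noteq> {}" using permutes_id[of "{..<N}"] by (blast intro: finite_permutations)+
  have sets_p: "sets p = sets (count_space ?S)" by (simp add: p_def sets_uniform_count_measure)
  define c :: ennreal where "c = of_nat (card ?S)"
  have c: "c \<noteq> 0" "c \<noteq> \<infinity>" using S by (auto simp: c_def)
  interpret P: prob_space P by fact
  interpret pp: prob_space p unfolding p_def using S by (rule prob_space_uniform_count_measure)
  interpret PP: pair_prob_space p P ..
  define R where "R \<sigma> x = (\<lambda>i\<in>{..<N}. x (\<sigma> i))" for \<sigma> :: "nat \<Rightarrow> nat" and x :: "nat \<Rightarrow> 'a"
  have Rm: "R \<sigma> \<in> measurable M (config_space N)" if "\<sigma> permutes {..<N}" "sets M = sets (config_space N)" for \<sigma> M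
    unfolding R_def
    by (rule measurable_restrict) (use that permutes_in_image[OF that(1)] in \<open>auto intro: measurable_component_config\<close>)
  define H where "H = (\<lambda>(\<sigma>, x). R \<sigma> x)"
  have Hm: "H \<in> measurable (p \<Otimes>\<^sub>M P) (config_space N)"
  proof -
    have "H \<in> measurable (count_space ?S \<Otimes>\<^sub>M P) (config_space N)"
      unfolding H_def using S(1) Rm[OF _ P(2)]
      by (intro measurable_pair_measure_countable1) (auto intro: countable_finite)
    then show ?thesis
      by (simp only: measurable_cong_sets[OF sets_pair_measure_cong[OF sets_p refl] refl])
  qed
  define Q where "Q = distr (p \<Otimes>\<^sub>M P) (config_space N) H"
  have Qs: "sets Q = sets (config_space N)" by (simp add: Q_def)
  have Qp: "prob_space Q" unfolding Q_def by (rule PP.prob_space_distr[OF Hm])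
  have int: "(\<integral>\<^sup>+x. f x \<partial>Q) = (\<Sum>\<sigma>\<in>?S. \<integral>\<^sup>+x. f (R \<sigma> x) \<partial>P) / c" if f: "f \<in> borel_measurable (config_space N)" for f
  proof -
    have "(\<integral>\<^sup>+x. f x \<partial>Q) = (\<integral>\<^sup>+z. f (H z) \<partial>(p \<Otimes>\<^sub>M P))"
      unfolding Q_def by (rule nn_integral_distr[OF Hm]) (use f in simp)
    also have "\<dots> = (\<integral>\<^sup>+\<sigma>. \<integral>\<^sup>+x. f (H (\<sigma>, x)) \<partial>P \<partial>p)"
      by (rule P.nn_integral_fst[symmetric]) (rule measurable_compose[OF Hm f])
    also have "\<dots> = (\<Sum>\<sigma>\<in>?S. \<integral>\<^sup>+x. f (H (\<sigma>, x)) \<partial>P) / c"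
      unfolding p_def c_def uniform_count_measure_def using S
      by (subst nn_integral_point_measure_finite)
        (auto simp: sum_distrib_left mult.commute divide_ennreal_def ennreal_of_nat_eq_real_of_nat inverse_ennreal
          card_gt_0_iff inverse_eq_divide[symmetric])
    finally show ?thesis by (simp add: H_def)
  qed
  have comp: "(\<lambda>i\<in>{..<N}. R \<sigma> x (\<tau> i)) = R (\<sigma> \<circ> \<tau>) x" if "\<tau> permutes {..<N}" for \<sigma> \<tau> x
    unfolding R_def by (rule restrict_ext) (simp add: permutes_in_image[OF that] del: lessThan_iff)
  have "distr Q (config_space N) (R \<tau>) = Q" if \<tau>: "\<tau> permutes {..<N}" for \<tau>
  proof (rule measure_eqI)
    fix A assume "A \<in> sets (distr Q (config_space N) (R \<tau>))"
    then have A: "A \<in> sets (config_space N)" by simp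
    have "emeasure (distr Q (config_space N) (R \<tau>)) A = (\<integral>\<^sup>+x. indicator A x \<partial>distr Q (config_space N) (R \<tau>))"
      using A by simp
    also have "\<dots> = (\<integral>\<^sup>+x. indicator A (R \<tau> x) \<partial>Q)"
      using A by (intro nn_integral_distr Rm[OF \<tau> Qs]) simp
    also have "\<dots> = (\<Sum>\<sigma>\<in>?S. \<integral>\<^sup>+x. indicator A (R \<tau> (R \<sigma> x)) \<partial>P) / c"
      using A measurable_compose[OF Rm[OF \<tau> refl], of "indicator A" borel] by (intro int) simp
    also have "\<dots> = (\<Sum>\<sigma>\<in>?S. \<integral>\<^sup>+x. indicator A (R (\<sigma> \<circ> \<tau>) x) \<partial>P) / c"
      by (simp add: R_def[of \<tau>] comp[OF \<tau>])
    also have "\<dots> = (\<Sum>\<sigma>\<in>?S. \<integral>\<^sup>+x. indicator A (R \<sigma> x) \<partial>P) / c"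
      by (subst sum_permutations_compose_right[OF \<tau>, of "\<lambda>\<sigma>. \<integral>\<^sup>+x. indicator A (R \<sigma> x) \<partial>P"]) (rule refl)
    also have "\<dots> = (\<integral>\<^sup>+x. indicator A x \<partial>Q)" using A by (subst int) auto
    also have "\<dots> = emeasure Q A" using A Qs by simp
    finally show "emeasure (distr Q (config_space N) (R \<tau>)) A = emeasure Q A" .
  qed (simp add: Qs)
  then have "symmetric_prob N Q" using Qp Qs by (simp add: symmetric_prob_def R_def[abs_def])
  moreover have cancel: "(\<Sum>\<sigma>\<in>?S. y) / c = y" for y :: ennreal
    using ennreal_mult_divide_eq[of c y] c by (simp add: c_def[symmetric] mult.commute[of c])
  have "one_body N Q = one_body N P"
  proof (rule measure_eqI)
    fix A assume "A \<in> sets (one_body N Q)"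
    then have A: "A \<in> sets borel" by simp
    have mi: "(\<lambda>x. indicator A (x i) :: ennreal) \<in> borel_measurable M" if "i < N" "sets M = sets (config_space N)" for i and M :: "(nat \<Rightarrow> 'a) measure"
      by (rule measurable_compose[OF measurable_component_config[OF that(2,1)] borel_measurable_indicator[OF A]])
    have "emeasure (one_body N Q) A = (\<integral>\<^sup>+x. (\<Sum>i<N. indicator A (x i)) \<partial>Q)"
      by (subst nn_integral_sum) (auto simp: emeasure_one_body'[OF Qs A] intro!: mi Qs)
    also have "\<dots> = (\<Sum>\<sigma>\<in>?S. \<integral>\<^sup>+x. (\<Sum>i<N. indicator A (R \<sigma> x i)) \<partial>P) / c"
      by (intro int borel_measurable_sum mi) auto
    also have "\<dots> = (\<Sum>\<sigma>\<in>?S. \<integral>\<^sup>+x. (\<Sum>i<N. indicator A (x i)) \<partial>P) / c"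
    proof (rule arg_cong2[where f = "(/)", OF sum.cong[OF refl nn_integral_cong] refl])
      fix \<sigma> and x :: "nat \<Rightarrow> 'a" assume "\<sigma> \<in> ?S"
      then have "(\<Sum>i<N. indicator A (x i)) = (\<Sum>i<N. indicator A (x (\<sigma> i)) :: ennreal)"
        using sum.permute[of \<sigma> "{..<N}" "\<lambda>i. indicator A (x i) :: ennreal"] by (simp add: comp_def)
      then show "(\<Sum>i<N. indicator A (R \<sigma> x i)) = (\<Sum>i<N. indicator A (x i) :: ennreal)"
        by (simp add: R_def)
    qed
    also have "\<dots> = emeasure (one_body N P) A"
      unfolding cancel by (subst nn_integral_sum) (auto simp: emeasure_one_body'[OF P(2) A] intro!: mi P(2))
    finally show "emeasure (one_body N Q) A = emeasure (one_body N P) A" .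
  qed simp
  moreover have "interaction_energy s N Q = interaction_energy s N P"
  proof -
    have "interaction_energy s N Q = (\<Sum>\<sigma>\<in>?S. \<integral>\<^sup>+x. penergy s N (R \<sigma> x) \<partial>P) / c"
      unfolding interaction_energy_eq by (intro int penergy_measurable) simp
    also have "\<dots> = (\<Sum>\<sigma>\<in>?S. \<integral>\<^sup>+x. penergy s N x \<partial>P) / c"
    proof (rule arg_cong2[where f = "(/)", OF sum.cong[OF refl nn_integral_cong] refl])
      fix \<sigma> and x :: "nat \<Rightarrow> 'a" assume "\<sigma> \<in> ?S"
      then have "bij_betw \<sigma> {..<N} {..<N}" by (auto intro: permutes_imp_bij)
      from penergy_reindex[OF this, of s x] have "penergy s N (\<lambda>i. x (\<sigma> i)) = penergy s N x"
        by (simp add: penergy_eq)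
      moreover have "penergy s N (R \<sigma> x) = penergy s N (\<lambda>i. x (\<sigma> i))"
        unfolding penergy_def R_def by (intro sum.cong refl) auto
      ultimately show "penergy s N (R \<sigma> x) = penergy s N x" by simp
    qed
    finally show ?thesis by (simp only: cancel interaction_energy_eq)
  qed
  ultimately show thesis by (rule that)
qed

text \<open>Used to read off the occupied slots of a random configuration in increasing order. The
  induction over n varies the set, from which the least element is removed at each step.\<close>

lemma measurable_enumerate:
  fixes A :: "'b \<Rightarrow> nat set"
  assumes "\<And>i. Measurable.pred M (\<lambda>\<omega>. i \<in> A \<omega>)"
  shows "(\<lambda>\<omega>. enumerate (A \<omega>) n) \<in> measurable M (count_space UNIV)"
  using assms
proof (induction n arbitrary: A)
  case 0
  note [measurable] = 0
  show ?case unfolding enumerate_0 by measurable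
next
  case (Suc n)
  note [measurable] = Suc.prems
  have "Measurable.pred M (\<lambda>\<omega>. i \<in> A \<omega> \<and> i \<noteq> (LEAST j. j \<in> A \<omega>))" for i by measurable
  then have "Measurable.pred M (\<lambda>\<omega>. i \<in> A \<omega> - {LEAST j. j \<in> A \<omega>})" for i by simp
  from Suc.IH[OF this] show ?case by (simp add: enumerate_Suc)
qed

text \<open>Full mass together with at most N particles forces exactly N of them almost surely.
  Their positions, listed in the order of the slots, form an N-tuple with the same one-body measure
  and energy, which is then symmetrized.\<close>

lemma symmetric_prob_of_state:
  fixes \<rho> :: "'a::euclidean_space \<Rightarrow> real"
  assumes P: "state N P \<rho>" and full: "(\<integral>\<^sup>+x. ennreal (\<rho> x) \<partial>lborel) = of_nat N"
    and \<rho>[measurable]: "\<rho> \<in> borel_measurable borel"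
  obtains Q where "symmetric_prob N Q" "one_body N Q = density lborel (\<lambda>x. ennreal (\<rho> x))"
    "interaction_energy s N Q = cost s P"
proof -
  interpret P: prob_space P by (rule state_prob[OF P])
  note [measurable_cong] = state_sets[OF P]
  have id: "(\<lambda>\<omega>. \<omega>) \<in> measurable P slots" by measurable
  have "(\<integral>\<^sup>+\<omega>. of_nat N - psum (\<lambda>_. 1) \<omega> \<partial>P) = 0"
    using state_count[OF P] state_density[OF P, of "\<lambda>_. 1"] full
    by (subst nn_integral_diff) (auto simp: P.emeasure_space_1)
  then have "AE \<omega> in P. of_nat N - psum (\<lambda>_. 1) \<omega> = 0"
    by (subst (asm) nn_integral_0_iff_AE) auto
  then have "AE \<omega> in P. psum (\<lambda>_. 1) \<omega> = of_nat N"
    using state_count[OF P]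
    by eventually_elim (auto simp: ennreal_minus_eq_0 intro: antisym)
  then have alive: "AE \<omega> in P. finite {i. snd (\<omega> i)} \<and> card {i. snd (\<omega> i)} = N"
  proof eventually_elim
    fix \<omega> :: "nat \<Rightarrow> 'a \<times> bool"
    assume "psum (\<lambda>_. 1) \<omega> = of_nat N"
    then show "finite {i. snd (\<omega> i)} \<and> card {i. snd (\<omega> i)} = N"
      unfolding psum_one emeasure_count_space[OF subset_UNIV] by (auto split: if_splits)
  qed
  define pos where "pos n \<omega> = fst (\<omega> (enumerate {i. snd (\<omega> i)} n))" for n and \<omega> :: "nat \<Rightarrow> 'a \<times> bool"
  have pos [measurable]: "pos n \<in> borel_measurable P" for n
    unfolding pos_def
    by (rule measurable_compose_countable[where f = "\<lambda>i \<omega>. fst (\<omega> i)"]; (rule measurable_enumerate)?) (auto intro: measurable_fst_slot[OF id] measurable_snd_slot[OF id])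
  define X where "X \<omega> = (\<lambda>n\<in>{..<N}. pos n \<omega>)" for \<omega>
  have X: "X \<in> measurable P (config_space N)" unfolding X_def by (rule measurable_restrict) simp
  define Q0 where "Q0 = distr P (config_space N) X"
  have Q0: "prob_space Q0" "sets Q0 = sets (config_space N)"
    unfolding Q0_def using P.prob_space_distr[OF X] by auto
  have bij: "bij_betw (enumerate {i. snd (\<omega> i)}) {..<N} {i. snd (\<omega> i)}"
    if "finite {i. snd (\<omega> i)} \<and> card {i. snd (\<omega> i)} = N" for \<omega> :: "nat \<Rightarrow> 'a \<times> bool"
    using finite_bij_enumerate[of "{i. snd (\<omega> i)}"] that by auto
  have ps: "AE \<omega> in P. (\<Sum>i<N. f (X \<omega> i)) = psum f \<omega>" for f :: "'a \<Rightarrow> ennreal"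
    using alive
  proof eventually_elim
    fix \<omega> :: "nat \<Rightarrow> 'a \<times> bool" assume fc: "finite {i. snd (\<omega> i)} \<and> card {i. snd (\<omega> i)} = N"
    show "(\<Sum>i<N. f (X \<omega> i)) = psum f \<omega>"
      using fc sum.reindex_bij_betw[OF bij[OF fc], of "\<lambda>i. f (fst (\<omega> i))"]
      by (simp add: psum_finite X_def pos_def)
  qed
  have pc: "AE \<omega> in P. penergy s N (X \<omega>) = pcost s \<omega>"
    using alive
  proof eventually_elim
    fix \<omega> :: "nat \<Rightarrow> 'a \<times> bool" assume fc: "finite {i. snd (\<omega> i)} \<and> card {i. snd (\<omega> i)} = N"
    have "penergy s N (X \<omega>) = penergy s N (\<lambda>n. fst (\<omega> (enumerate {i. snd (\<omega> i)} n)))"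
      unfolding penergy_def X_def pos_def by (intro sum.cong refl) auto
    then show "penergy s N (X \<omega>) = pcost s \<omega>"
      using fc penergy_reindex[OF bij[OF fc], of s "\<lambda>i. fst (\<omega> i)"] by (simp add: pcost_finite)
  qed
  have "one_body N Q0 = density lborel (\<lambda>x. ennreal (\<rho> x))"
  proof (rule measure_eqI)
    fix A assume "A \<in> sets (one_body N Q0)"
    then have A: "A \<in> sets borel" by simp
    have "emeasure (one_body N Q0) A = (\<integral>\<^sup>+y. indicator A y \<partial>one_body N Q0)" using A by simp
    also have "\<dots> = (\<integral>\<^sup>+x. (\<Sum>i<N. indicator A (x i)) \<partial>Q0)"
      using A by (intro nn_integral_one_body Q0) simp
    also have "\<dots> = (\<integral>\<^sup>+\<omega>. (\<Sum>i<N. indicator A (X \<omega> i)) \<partial>P)"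
      unfolding Q0_def
      by (intro nn_integral_distr X borel_measurable_sum
          measurable_compose[OF measurable_component_config borel_measurable_indicator[OF A]]) auto
    also have "\<dots> = (\<integral>\<^sup>+\<omega>. psum (indicator A) \<omega> \<partial>P)"
      by (intro nn_integral_cong_AE ps)
    also have "\<dots> = (\<integral>\<^sup>+x. indicator A x * ennreal (\<rho> x) \<partial>lborel)"
      using A by (intro state_density[OF P]) simp
    also have "\<dots> = emeasure (density lborel (\<lambda>x. ennreal (\<rho> x))) A"
      using A by (subst emeasure_density) (auto simp: mult.commute)
    finally show "emeasure (one_body N Q0) A = emeasure (density lborel (\<lambda>x. ennreal (\<rho> x))) A" .
  qed simp
  moreover have "interaction_energy s N Q0 = cost s P"
    unfolding interaction_energy_eq Q0_def cost_def
    by (subst nn_integral_distr[OF X]) (auto intro!: nn_integral_cong_AE pc penergy_measurable)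
  moreover obtain Q where "symmetric_prob N Q" "one_body N Q = one_body N Q0" "interaction_energy s N Q = interaction_energy s N Q0"
    using symmetrize[OF Q0, of s] .
  ultimately show thesis using that[of Q] by simp
qed

section \<open>Identification with the original constants and the induction on N\<close>

context riesz_exponent begin

text \<open>At full mass the translations between states and symmetric measures keep the cost in
  both directions, so the relaxation of the particle number changes nothing there.\<close>

lemma W_fun_eq:
  assumes \<rho>: "dens \<rho>" "mass \<rho> = real N"
  shows "W_fun s N \<rho> = ennreal (W N \<rho>)"
proof -
  have adm: "adm N \<rho>" using \<rho> by (simp add: adm_def)
  have full: "(\<integral>\<^sup>+x. ennreal (\<rho> x) \<partial>lborel) = of_nat N"
    by (simp add: nn_integral_dens \<rho> ennreal_of_nat_eq_real_of_nat)
  show ?thesis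
  proof (rule antisym)
    show "W_fun s N \<rho> \<le> ennreal (W N \<rho>)"
    proof (rule ennreal_le_epsilon)
      fix \<xi> :: real assume "0 < \<xi>"
      obtain P where P: "state N P \<rho>" "cost s P \<le> ennreal (W N \<rho> + \<xi>)"
        by (rule W_approx_state[OF adm \<open>0 < \<xi>\<close>])
      obtain Q where Q: "symmetric_prob N Q" "one_body N Q = density lborel (\<lambda>x. ennreal (\<rho> x))"
        "interaction_energy s N Q = cost s P"
        using symmetric_prob_of_state[OF P(1) full dens_measurable[OF \<rho>(1)], of s] .
      have "W_fun s N \<rho> \<le> interaction_energy s N Q"
        unfolding W_fun_def by (rule INF_lower) (use Q in simp)
      also have "\<dots> \<le> ennreal (W N \<rho> + \<xi>)" using Q(3) P(2) by simp
      also have "\<dots> = ennreal (W N \<rho>) + ennreal \<xi>" using W_nonneg[OF adm] \<open>0 < \<xi>\<close> by simp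
      finally show "W_fun s N \<rho> \<le> ennreal (W N \<rho>) + ennreal \<xi>" .
    qed
    show "ennreal (W N \<rho>) \<le> W_fun s N \<rho>"
      unfolding W_fun_def
    proof (rule INF_greatest)
      fix P :: "(nat \<Rightarrow> 'a) measure"
      assume "P \<in> {P. symmetric_prob N P \<and> one_body N P = density lborel (\<lambda>x. ennreal (\<rho> x))}"
      then have P: "symmetric_prob N P" "one_body N P = density lborel (\<lambda>x. ennreal (\<rho> x))" by auto
      obtain Q where Q: "state N Q \<rho>" "cost s Q = interaction_energy s N P"
        using state_of_symmetric_prob[OF P dens_measurable[OF \<rho>(1)], of s] .
      show "ennreal (W N \<rho>) \<le> interaction_energy s N P"
      proof (cases "interaction_energy s N P")
        case (real c)
        then have "ach N \<rho> c" using Q by (auto simp: ach_def)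
        then show ?thesis using W_le real by (simp add: ennreal_leI)
      qed simp
    qed
  qed
qed

lemma exponent_eq: "LO_exponent TYPE('a) s = 1 + q"
  by (simp add: LO_exponent_def q_eq)

text \<open>The positive part is the representative that is nonnegative everywhere; it agrees with
  \<rho> almost everywhere, so all integrals coincide.\<close>

lemma admissible_iff:
  "\<rho> \<in> admissible s N \<longleftrightarrow> integrable lborel \<rho> \<and> (AE x in lborel. 0 \<le> \<rho> x)
    \<and> dens (\<lambda>x. max 0 (\<rho> x)) \<and> mass (\<lambda>x. max 0 (\<rho> x)) = real N"
proof (cases "integrable lborel \<rho> \<and> (AE x in lborel. 0 \<le> \<rho> x)")
  case True
  then have i: "integrable lborel \<rho>" and nn: "AE x in lborel. 0 \<le> \<rho> x" by auto
  have [measurable]: "\<rho> \<in> borel_measurable borel" using borel_measurable_integrable[OF i] by simp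
  have "integrable lborel (\<lambda>x. \<bar>\<rho> x\<bar> powr (1 + q)) \<longleftrightarrow> integrable lborel (\<lambda>x. max 0 (\<rho> x) powr (1 + q))"
    by (rule integrable_cong_AE) (use nn in \<open>auto elim!: eventually_mono simp: max_def\<close>)
  moreover have "mass (\<lambda>x. max 0 (\<rho> x)) = mass \<rho>"
    by (rule integral_cong_AE) (use nn in \<open>auto elim!: eventually_mono simp: max_def\<close>)
  ultimately show ?thesis
    using i nn by (auto simp: admissible_def dens_def exponent_eq)
qed (auto simp: admissible_def)

text \<open>For N > 0 the mass is positive and therefore \<open>L f\<close> is, so the quotient in
  \<open>ereal\<close> is an honest real quotient.\<close>

lemma quotient_eq:
  assumes "\<rho> \<in> admissible s N" "0 < N"
  defines "f \<equiv> \<lambda>x. max 0 (\<rho> x)"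
  shows "G_fun s N \<rho> / ereal (L_fun s \<rho>) = ereal (G N f / L f)" and "0 < L f"
proof -
  have i: "integrable lborel \<rho>" and nn: "AE x in lborel. 0 \<le> \<rho> x" and f: "dens f" "mass f = real N"
    using assms(1) by (auto simp: admissible_iff f_def)
  have [measurable]: "\<rho> \<in> borel_measurable borel" using borel_measurable_integrable[OF i] by simp
  have e: "ennreal (f x) = ennreal (\<rho> x)" for x by (simp add: f_def)
  have adm: "adm N f" using f by (simp add: adm_def)
  have "D_fun s \<rho> = ennreal (B f f)"
    using bform_eq[OF f(1) f(1)] by (simp add: D_fun_def bform_def e)
  moreover have "W_fun s N \<rho> = ennreal (W N f)"
    using W_fun_eq[OF f] by (simp add: W_fun_def e)
  ultimately have "G_fun s N \<rho> = ereal (G N f)"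
    using W_nonneg[OF adm] B_nonneg by (simp add: G_fun_def G_def)
  moreover have "L_fun s \<rho> = L f"
    unfolding L_fun_def L_def exponent_eq
    by (rule integral_cong_AE) (use nn in \<open>auto elim!: eventually_mono simp: max_def f_def\<close>)
  ultimately have GL: "G_fun s N \<rho> = ereal (G N f)" "L_fun s \<rho> = L f" by auto
  show "0 < L f" using L_zero_iff[OF f(1)] L_nonneg[of f] f(2) assms(2) by linarith
  then show "G_fun s N \<rho> / ereal (L_fun s \<rho>) = ereal (G N f / L f)" by (simp add: GL)
qed

text \<open>Mass 0 forces \<open>L f\<close> = 0, and division by 0 gives 0. With this value,
  positivity of the first constant is the strict increase from 0 to 1.\<close>

lemma lam_zero: "lam 0 = 0"
proof -
  have "G 0 f / L f = 0" if "adm 0 f" for f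
    using that mass_nonneg[of f] L_zero_iff[of f] by (simp add: adm_def)
  then have "{G 0 f / L f | f. adm 0 f} = {0}" using adm_zero[of 0] by fastforce
  then show ?thesis by (simp add: lam_def)
qed

lemma full_optimizer:
  assumes "lam N < lam (Suc N)"
  obtains \<rho> where "adm (Suc N) \<rho>" "mass \<rho> = real (Suc N)" "defect (Suc N) \<rho> = 0"
proof -
  have "0 < lam (Suc N)" using assms lam_nonneg[of N] by simp
  then obtain \<rho> where \<rho>: "adm (Suc N) \<rho>" "0 < mass \<rho>" "defect (Suc N) \<rho> = 0" by (rule exists_optimizer)
  then show thesis using that optimizer_mass[OF \<rho> assms] by blast
qed

text \<open>\<open>lam_strict\<close> perturbs a compactly supported maximizer of mass exactly N,
  and \<open>optimizer_support\<close> starts from full mass, which in turn follows from the strict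
  increase one step earlier. Both assertions are therefore carried through the induction
  together.\<close>

lemma lam_less_Suc:
  "lam N < lam (Suc N) \<and> (\<exists>\<rho>. adm (Suc N) \<rho> \<and> mass \<rho> = real (Suc N) \<and> defect (Suc N) \<rho> = 0)"
proof (induction N)
  case 0
  have "lam 0 < lam (Suc 0)" using lam_zero lam_one_pos by simp
  then show ?case by (blast elim: full_optimizer)
next
  case (Suc N)
  then obtain \<rho> where \<rho>: "adm (Suc N) \<rho>" "mass \<rho> = real (Suc N)" "defect (Suc N) \<rho> = 0" by blast
  have pos: "0 < lam (Suc N)" using Suc lam_nonneg[of N] by simp
  obtain T where T: "0 < T" "AE x in lborel. \<rho> x \<le> T" by (rule optimizer_bounded[OF \<rho>(1,3) pos])
  obtain R where R: "AE x in lborel. x \<notin> cball 0 R \<longrightarrow> \<rho> x = 0" by (rule optimizer_support[OF \<rho> pos T])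
  have "lam (Suc N) < lam (Suc (Suc N))" by (rule lam_strict[OF \<rho>(1,2) _ \<rho>(3) T R]) simp
  then show ?case by (blast elim: full_optimizer)
qed

lemma optimizer_iff:
  assumes "0 < N" "\<rho> \<in> admissible s N"
  shows "G_fun s N \<rho> / ereal (L_fun s \<rho>) = ereal (lam N) \<longleftrightarrow> defect N (\<lambda>x. max 0 (\<rho> x)) = 0"
  using quotient_eq[OF assms(2,1)] by (auto simp: defect_def field_simps)

lemma exists_full_optimizer:
  assumes "0 < N"
  obtains \<rho> :: "'a \<Rightarrow> real" where "\<rho> \<in> admissible s N" "G_fun s N \<rho> / ereal (L_fun s \<rho>) = ereal (lam N)"
proof -
  obtain n where n: "N = Suc n" using assms gr0_implies_Suc by blast
  obtain \<rho> where \<rho>: "adm N \<rho>" "mass \<rho> = real N" "defect N \<rho> = 0" using lam_less_Suc[of n] n by blast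
  have m: "(\<lambda>x. max 0 (\<rho> x)) = \<rho>" using dens_nonneg[OF adm_dens[OF \<rho>(1)]] by (simp add: max_def)
  have ad: "\<rho> \<in> admissible s N"
    using \<rho> dens_integrable[OF adm_dens[OF \<rho>(1)]] dens_nonneg[OF adm_dens[OF \<rho>(1)]] adm_dens[OF \<rho>(1)]
    by (simp add: admissible_iff m)
  moreover have "G_fun s N \<rho> / ereal (L_fun s \<rho>) = ereal (lam N)"
    using optimizer_iff[OF assms ad] \<rho>(3) by (simp only: m)
  ultimately show thesis by (rule that)
qed

text \<open>The relaxed supremum runs over more densities, which gives one inequality; a relaxed
  maximizer of full mass gives the other.\<close>

lemma LO_constant_eq:
  assumes "0 < N" shows "LO_constant TYPE('a) s N = ereal (lam N)"
proof (rule antisym)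
  show "LO_constant TYPE('a) s N \<le> ereal (lam N)"
    unfolding LO_constant_def
  proof (rule SUP_least)
    fix \<rho> :: "'a \<Rightarrow> real" assume \<rho>: "\<rho> \<in> admissible s N"
    note eq = quotient_eq[OF \<rho> assms]
    have "adm N (\<lambda>x. max 0 (\<rho> x))" using \<rho> by (simp add: admissible_iff adm_def)
    from G_le_lam[OF this] show "G_fun s N \<rho> / ereal (L_fun s \<rho>) \<le> ereal (lam N)"
      unfolding eq(1) using eq(2) by (simp add: divide_le_eq)
  qed
  obtain \<rho> :: "'a \<Rightarrow> real" where \<rho>: "\<rho> \<in> admissible s N" "G_fun s N \<rho> / ereal (L_fun s \<rho>) = ereal (lam N)"
    by (rule exists_full_optimizer[OF assms])
  show "ereal (lam N) \<le> LO_constant TYPE('a) s N"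
    unfolding LO_constant_def \<rho>(2)[symmetric] by (rule SUP_upper[OF \<rho>(1)])
qed

text \<open>Equality of the constants makes the positive part of every optimizer a relaxed maximizer
  of full mass, so the boundedness and support theorems apply to it and not just to the maximizer
  constructed before.\<close>

lemma optimizer_compactly_supported:
  assumes "0 < N" "LO_optimizer s N (\<rho> :: 'a \<Rightarrow> real)"
  shows "compactly_supported \<rho>"
proof -
  obtain n where n: "N = Suc n" using assms gr0_implies_Suc by blast
  have \<rho>: "\<rho> \<in> admissible s N" using assms by (simp add: LO_optimizer_def)
  let ?f = "\<lambda>x. max 0 (\<rho> x)"
  have f: "adm (Suc n) ?f" "mass ?f = real (Suc n)" using \<rho> n by (auto simp: admissible_iff adm_def)
  have "defect (Suc n) ?f = 0"
    using optimizer_iff[OF assms(1) \<rho>] assms(2) n by (simp add: LO_optimizer_def LO_constant_eq)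
  note f = f this
  have pos: "0 < lam (Suc n)" using lam_less_Suc[of n] lam_nonneg[of n] by simp
  obtain T where T: "0 < T" "AE x in lborel. ?f x \<le> T" by (rule optimizer_bounded[OF f(1,3) pos])
  obtain R where "AE x in lborel. x \<notin> cball 0 R \<longrightarrow> ?f x = 0" by (rule optimizer_support[OF f pos T])
  moreover have "AE x in lborel. 0 \<le> \<rho> x" using \<rho> by (simp add: admissible_iff)
  ultimately have "AE x in lborel. x \<notin> cball 0 R \<longrightarrow> \<rho> x = 0"
    by eventually_elim (auto simp: max_def split: if_splits)
  then show ?thesis unfolding compactly_supported_def using compact_cball by blast
qed

end

theorem theorem1p1:
  fixes s :: real
  assumes "0 < s" and "s < real DIM('a::euclidean_space)"
  shows "(\<forall>N\<ge>1. \<exists>\<rho> :: 'a \<Rightarrow> real. LO_optimizer s N \<rho>)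
    \<and> 0 < LO_constant TYPE('a) s 1
    \<and> (\<forall>N\<ge>1. LO_constant TYPE('a) s N < LO_constant TYPE('a) s (N + 1))
    \<and> (\<forall>N\<ge>1. \<forall>\<rho> :: 'a \<Rightarrow> real. LO_optimizer s N \<rho> \<longrightarrow> compactly_supported \<rho>)"
proof -
  interpret riesz_exponent s "TYPE('a)" by unfold_locales (use assms in auto)
  have "\<exists>\<rho> :: 'a \<Rightarrow> real. LO_optimizer s N \<rho>" if "1 \<le> N" for N
  proof -
    have N: "0 < N" using that by simp
    obtain \<rho> :: "'a \<Rightarrow> real" where "\<rho> \<in> admissible s N" "G_fun s N \<rho> / ereal (L_fun s \<rho>) = ereal (lam N)"
      by (rule exists_full_optimizer[OF N])
    then show ?thesis using LO_constant_eq[OF N] by (auto simp: LO_optimizer_def)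
  qed
  moreover have "0 < LO_constant TYPE('a) s 1"
    using lam_one_pos by (simp add: LO_constant_eq)
  moreover have "LO_constant TYPE('a) s N < LO_constant TYPE('a) s (N + 1)" if "1 \<le> N" for N
    using that lam_less_Suc[of N] by (simp add: LO_constant_eq)
  moreover have "compactly_supported \<rho>" if "1 \<le> N" "LO_optimizer s N \<rho>" for N and \<rho> :: "'a \<Rightarrow> real"
    using that by (intro optimizer_compactly_supported[of N]) auto
  ultimately show ?thesis by auto
qed

end
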